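(* Let $N\geq 2$, let $p=4+\frac{4}{N}$, and let $g:\mathbb{R}\to\mathbb{R}$ satisfy: (g1) $g\in C(\mathbb{R},\mathbb{R})$; (g2) $\lim_{s\to 0} g(s)/s=0$; (g3) $\lim_{|s|\to\infty}|g(s)|/|s|^{p-1}=0$; (g4) there exists $s_0>0$ with $G(s_0)>0$, where $G(s)=\int_0^s g(t)\,dt$. Then: (1) There exists $m_1\geq 0$ such that for every $m>m_1$ the problem $(P_{\mu,m})$ has at least one ground state (least energy) normalized solution. (2) If in addition (g6) holds, namely $\liminf_{s\to 0}\frac{g(s)}{|s|^{q-2}s}=+\infty$ with $q=2+\frac{4}{N}$, then for every $m>0$ the problem $(P_{\mu,m})$ has at least one ground state (least energy) normalized solution.
   Context: For $m>0$, problem $(P_{\mu,m})$ asks for $\mu\in\mathbb{R}$ and $u\in H^1(\mathbb{R}^N)$ with $\int_{\mathbb{R}^N}u^2|\nabla u|^2dx<\infty$ and $\int_{\mathbb{R}^N}|u|^2dx=m$ such that $-\Delta u+\mu u-\Delta(u^2)u=g(u)$ in $\mathbb{R}^N$ in the weak sense, i.e. $\int_{\mathbb{R}^N}\big[(1+2u^2)\nabla u\cdot\nabla\varphi+2u|\nabla u|^2\varphi+\mu u\varphi-g(u)\varphi\big]dx=0$ for all $\varphi\in C_0^\infty(\mathbb{R}^N)$. Let $S(m)=\{u\in H^1(\mathbb{R}^N):\int u^2|\nabla u|^2<\infty,\ \int|u|^2=m\}$ and $E(u)=\frac12\int_{\mathbb{R}^N}(1+2u^2)|\nabla u|^2dx-\int_{\mathbb{R}^N}G(u)dx$.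 A ground state (least energy) normalized solution is a $u\in S(m)$ such that $(\mu,u)$ solves $(P_{\mu,m})$ for some $\mu\in\mathbb{R}$ and $E(u)=\min\{E(w): w\in S(m),\ (\nu,w)\text{ solves }(P_{\nu,m})\text{ for some }\nu\in\mathbb{R}\}$. *)

theory Defs
  imports "HOL-Analysis.Analysis"
begin

definition pderiv_i :: "(real^'n \<Rightarrow> real) \<Rightarrow> 'n \<Rightarrow> real^'n \<Rightarrow> real" where
  "pderiv_i f i x = frechet_derivative f (at x) (axis i 1)"

coinductive smooth_fun :: "(real^'n \<Rightarrow> real) \<Rightarrow> bool" where
  "(\<forall>x. f differentiable (at x)) \<Longrightarrow> (\<forall>i. smooth_fun (pderiv_i f i)) \<Longrightarrow> smooth_fun f"

definition test_fun :: "(real^'n \<Rightarrow> real) \<Rightarrow> bool" where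
  "test_fun \<phi> \<longleftrightarrow> smooth_fun \<phi> \<and> compact (closure {x. \<phi> x \<noteq> 0})"

text \<open>Du is a weak gradient of u in L^2, i.e. (u, Du) represents an element of H^1(R^N).\<close>
definition H1_weak :: "(real^'n \<Rightarrow> real) \<Rightarrow> (real^'n \<Rightarrow> real^'n) \<Rightarrow> bool" where
  "H1_weak u Du \<longleftrightarrow>
     u \<in> borel_measurable lebesgue \<and> integrable lebesgue (\<lambda>x. (u x)\<^sup>2) \<and>
     Du \<in> borel_measurable lebesgue \<and> integrable lebesgue (\<lambda>x. (norm (Du x))\<^sup>2) \<and>
     (\<forall>\<phi> i. test_fun \<phi> \<longrightarrow>
        integral\<^sup>L lebesgue (\<lambda>x. u x * pderiv_i \<phi> i x) = - integral\<^sup>L lebesgue (\<lambda>x. Du x $ i * \<phi> x))"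

definition prim :: "(real \<Rightarrow> real) \<Rightarrow> real \<Rightarrow> real" where
  "prim g s = (LBINT t=0..s. g t)"

definition Sm :: "real \<Rightarrow> ((real^'n \<Rightarrow> real) \<times> (real^'n \<Rightarrow> real^'n)) set" where
  "Sm m = {(u, Du). H1_weak u Du \<and> integrable lebesgue (\<lambda>x. (u x)\<^sup>2 * (norm (Du x))\<^sup>2)
                  \<and> integral\<^sup>L lebesgue (\<lambda>x. (u x)\<^sup>2) = m}"

text \<open>Weak form of  -Lap u + mu u - Lap(u^2) u = g(u).\<close>
definition weak_sol :: "(real \<Rightarrow> real) \<Rightarrow> real \<Rightarrow> (real^'n \<Rightarrow> real) \<Rightarrow> (real^'n \<Rightarrow> real^'n) \<Rightarrow> bool" where
  "weak_sol g \<mu> u Du \<longleftrightarrow>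
     (\<forall>\<phi>. test_fun \<phi> \<longrightarrow>
        (let F = (\<lambda>x. (1 + 2 * (u x)\<^sup>2) * (Du x \<bullet> (\<chi> i. pderiv_i \<phi> i x))
                   + 2 * u x * (norm (Du x))\<^sup>2 * \<phi> x + \<mu> * u x * \<phi> x - g (u x) * \<phi> x)
         in integrable lebesgue F \<and> integral\<^sup>L lebesgue F = 0))"

definition solves_P :: "(real \<Rightarrow> real) \<Rightarrow> real \<Rightarrow> real \<Rightarrow> (real^'n \<Rightarrow> real) \<Rightarrow> (real^'n \<Rightarrow> real^'n) \<Rightarrow> bool" where
  "solves_P g \<mu> m u Du \<longleftrightarrow> (u, Du) \<in> Sm m \<and> weak_sol g \<mu> u Du"

definition energy :: "(real \<Rightarrow> real) \<Rightarrow> (real^'n \<Rightarrow> real) \<Rightarrow> (real^'n \<Rightarrow> real^'n) \<Rightarrow> real" where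
  "energy g u Du = 1/2 * integral\<^sup>L lebesgue (\<lambda>x. (1 + 2 * (u x)\<^sup>2) * (norm (Du x))\<^sup>2)
                   - integral\<^sup>L lebesgue (\<lambda>x. prim g (u x))"

definition ground_state :: "(real \<Rightarrow> real) \<Rightarrow> real \<Rightarrow> (real^'n \<Rightarrow> real) \<Rightarrow> (real^'n \<Rightarrow> real^'n) \<Rightarrow> bool" where
  "ground_state g m u Du \<longleftrightarrow>
     (u, Du) \<in> Sm m \<and> (\<exists>\<mu>. solves_P g \<mu> m u Du) \<and>
     (\<forall>(w :: real^'n \<Rightarrow> real) Dw. (w, Dw) \<in> Sm m \<and> (\<exists>\<nu>. solves_P g \<nu> m w Dw) \<longrightarrow> energy g u Du \<le> energy g w Dw)"

end

theory Submission
  imports Defs "HOL-Library.Diagonal_Subsequence"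
begin

text \<open>A ground state is obtained as a global minimiser of the energy on the sphere of mass \<open>m\<close>, which exists as
soon as the infimum \<open>e0\<close> is negative. With \<open>p = 4 + 4/N\<close> the growth of \<open>g\<close> is subcritical for the quasilinear term:
the Gagliardo--Nirenberg inequality applied to \<open>u\<^sup>2\<close> bounds the \<open>L\<^sup>p\<close> norm of \<open>u\<close> by the mass and the integral of
\<open>u\<^sup>2 |Du|\<^sup>2\<close>, so the energy is coercive on the sphere. A minimising sequence with negative energy cannot vanish; after
translation it converges locally to some \<open>v \<noteq> 0\<close>. Dilating a function of mass \<open>M \<le> m\<close> to mass \<open>m\<close> shows that
its energy is at least \<open>(M/m) e0\<close>, strictly so if \<open>M < m\<close>. Applying this to the part of the sequence outside a large
cube gives \<open>E(v) \<le> (M/m) e0\<close> with \<open>M\<close> the mass of \<open>v\<close>, hence \<open>M = m\<close> and \<open>v\<close> is a minimiser. Its Euler--Lagrange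
equation follows by comparing \<open>v\<close> with the dilations of \<open>v + t\<phi>\<close> back to mass \<open>m\<close>. Negativity of \<open>e0\<close> comes from
dilating a bump of positive potential energy, or, under the superlinearity assumption at zero, from flat and small bumps.

Sobolev spaces are replaced by the bound \<open>\<integral>|f(x+h) - f(x)|\<^sup>2 dx \<le> K |h|\<^sup>2\<close>, from which the Nash and
Gagliardo--Nirenberg inequalities and local compactness follow by averaging over small cubes.\<close>

section \<open>Smooth functions and test functions\<close>

text \<open>The exponent comes from scaling. The mass bounds u^2 in L^1, and the integral of u^2
  |Du|^2 bounds the gradient of u^2 in L^2. The inequality in L^(2 + 2/N) between these two is
  linear in the Dirichlet integral, so the part of G that is o(|s|^p) at infinity costs only a small
  multiple of the kinetic energy. Three obstacles shape the argument. The terms |Du|^2 and u^2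
  |Du|^2 scale differently when u is multiplied by a constant, but alike when space is dilated;
  hence masses are always adjusted by dilations, in the comparison of masses and in the first
  variation. The integrand (1 + 2 u^2) |Du|^2 is not jointly convex in (u, Du); it is convex in the
  triple (u, Du, u Du), whose limit is taken as one vector in L^2 and whose third component is
  identified afterwards. The potential has no sign and critical growth; Fatou's lemma is applied to
  Ce s^2 + ep |s|^p - G(s), which is nonnegative, and ep tends to 0 last. The analysis uses Borel
  functions and \<open>lborel\<close>; Lebesgue measurable functions enter only at the end.\<close>

lemma pderiv_i_eq: "(f has_derivative f') (at x) \<Longrightarrow> pderiv_i f i x = f' (axis i 1)"
  unfolding pderiv_i_def by (simp add: frechet_derivative_at[symmetric])

lemma smooth_fun_differentiable: "smooth_fun f \<Longrightarrow> f differentiable (at x)"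
  by (erule smooth_fun.cases) auto

lemma smooth_fun_pderiv_i: "smooth_fun f \<Longrightarrow> smooth_fun (pderiv_i f i)"
  by (erule smooth_fun.cases) auto

lemma smooth_fun_continuous: "smooth_fun f \<Longrightarrow> continuous_on UNIV f"
  using smooth_fun_differentiable differentiable_imp_continuous_within[of f _ UNIV]
  by (auto intro!: continuous_at_imp_continuous_on)

lemma has_derivative_pderiv_i:
  assumes "f differentiable (at x)"
  shows "(f has_derivative (\<lambda>h. \<Sum>i\<in>UNIV. h $ i * pderiv_i f i x)) (at x)"
proof -
  have D: "(f has_derivative frechet_derivative f (at x)) (at x)"
    using assms frechet_derivative_works by blast
  then have L: "linear (frechet_derivative f (at x))"
    using has_derivative_linear by blast
  have "frechet_derivative f (at x) h = (\<Sum>i\<in>UNIV. h $ i * pderiv_i f i x)" for h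
  proof -
    have "frechet_derivative f (at x) h = frechet_derivative f (at x) (\<Sum>i\<in>UNIV. h $ i *\<^sub>R axis i 1)"
      by (simp add: basis_expansion scalar_mult_eq_scaleR[symmetric])
    also have "\<dots> = (\<Sum>i\<in>UNIV. h $ i * pderiv_i f i x)"
      by (simp add: linear_sum[OF L] linear_cmul[OF L] pderiv_i_def)
    finally show ?thesis .
  qed
  then have "frechet_derivative f (at x) = (\<lambda>h. \<Sum>i\<in>UNIV. h $ i * pderiv_i f i x)" by (rule ext)
  then show ?thesis using D by simp
qed

lemma pderiv_i_add:
  "f differentiable (at x) \<Longrightarrow> g differentiable (at x) \<Longrightarrow>
    pderiv_i (\<lambda>x. f x + g x) i x = pderiv_i f i x + pderiv_i g i x"
  using pderiv_i_eq[OF has_derivative_add[of f "frechet_derivative f (at x)" "at x" g "frechet_derivative g (at x)"], of i]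
  unfolding frechet_derivative_works by (simp add: pderiv_i_def)

lemma pderiv_i_mult:
  "f differentiable (at x) \<Longrightarrow> g differentiable (at x) \<Longrightarrow>
    pderiv_i (\<lambda>x. f x * g x) i x = pderiv_i f i x * g x + f x * pderiv_i g i x"
  using pderiv_i_eq[OF has_derivative_mult[of f "frechet_derivative f (at x)" x UNIV g "frechet_derivative g (at x)"], of i]
  unfolding frechet_derivative_works by (simp add: pderiv_i_def)

lemma pderiv_i_const [simp]: "pderiv_i (\<lambda>x. c) i x = 0"
  by (rule pderiv_i_eq[OF has_derivative_const, THEN trans]) simp

lemma pderiv_i_affine:
  assumes "f differentiable (at (c *\<^sub>R x + d))"
  shows "pderiv_i (\<lambda>x. f (c *\<^sub>R x + d)) i x = c * pderiv_i f i (c *\<^sub>R x + d)"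
proof -
  let ?f = "frechet_derivative f (at (c *\<^sub>R x + d))"
  have D: "(f has_derivative ?f) (at (c *\<^sub>R x + d))"
    using assms frechet_derivative_works by blast
  have "((\<lambda>x. f (c *\<^sub>R x + d)) has_derivative (\<lambda>h. ?f (c *\<^sub>R h))) (at x)"
    by (rule has_derivative_compose[of "\<lambda>x. c *\<^sub>R x + d", OF _ D]) (auto intro!: derivative_eq_intros)
  from pderiv_i_eq[OF this, of i] show ?thesis
    using linear_cmul[OF has_derivative_linear[OF D]] by (simp add: pderiv_i_def)
qed

lemma differentiable_affine:
  "(\<And>y. f differentiable (at y)) \<Longrightarrow> (\<lambda>x::real^'n. f (c *\<^sub>R x + d)) differentiable (at x)"
  by (rule differentiable_compose[of f "\<lambda>x. c *\<^sub>R x + d"]) (auto intro!: derivative_intros simp: differentiable_at_withinI)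

text \<open>Each differentiation brings out a factor \<open>c\<close>, so the coinductive invariant
  admits an arbitrary scalar \<open>k\<close> in front of the composite.\<close>

lemma smooth_fun_affine:
  assumes "smooth_fun f" shows "smooth_fun (\<lambda>x. k * f (c *\<^sub>R x + d))"
proof (rule smooth_fun.coinduct[where X="\<lambda>g. \<exists>f k. smooth_fun f \<and> g = (\<lambda>x. k * f (c *\<^sub>R x + d))"])
  show "\<exists>f' k'. smooth_fun f' \<and> (\<lambda>x. k * f (c *\<^sub>R x + d)) = (\<lambda>x. k' * f' (c *\<^sub>R x + d))"
    using assms by blast
next
  fix g assume "\<exists>f k. smooth_fun f \<and> g = (\<lambda>x. k * f (c *\<^sub>R x + d))"
  then obtain f k where s: "smooth_fun f" and e: "g = (\<lambda>x. k * f (c *\<^sub>R x + d))" by blast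
  have d: "\<forall>x. g differentiable (at x)"
    using differentiable_affine[OF smooth_fun_differentiable[OF s], of c d] unfolding e by simp
  have "pderiv_i g i = (\<lambda>x. (k * c) * pderiv_i f i (c *\<^sub>R x + d))" for i
    using differentiable_affine[OF smooth_fun_differentiable[OF s]] unfolding e
    by (auto simp: fun_eq_iff pderiv_i_mult pderiv_i_affine smooth_fun_differentiable[OF s])
  then have "\<exists>f k. smooth_fun f \<and> pderiv_i g i = (\<lambda>x. k * f (c *\<^sub>R x + d))" for i
    using smooth_fun_pderiv_i[OF s] by blast
  then show "\<exists>f. g = f \<and> (\<forall>x. f differentiable at x) \<and>
    (\<forall>i. (\<exists>fa k. smooth_fun fa \<and> pderiv_i f i = (\<lambda>x. k * fa (c *\<^sub>R x + d))) \<or> smooth_fun (pderiv_i f i))"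
    using d by blast
qed

lemma differentiable_sum_mult:
  assumes "\<forall>(a,b)\<in>set ps. smooth_fun a \<and> smooth_fun b"
  shows "(\<lambda>x. \<Sum>(a,b)\<leftarrow>ps. a x * b x) differentiable (at x)"
  using assms
  by (induction ps) (auto intro!: differentiable_add differentiable_mult simp: smooth_fun_differentiable)

lemma pderiv_i_sum_mult:
  assumes "\<forall>(a,b)\<in>set ps. smooth_fun a \<and> smooth_fun b"
  shows "pderiv_i (\<lambda>x. \<Sum>(a,b)\<leftarrow>ps. a x * b x) i x =
    (\<Sum>(a,b)\<leftarrow>concat (map (\<lambda>(a,b). [(pderiv_i a i, b), (a, pderiv_i b i)]) ps). a x * b x)"
  using assms
proof (induction ps)
  case (Cons q qs)
  obtain a b where q: "q = (a,b)" by fastforce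
  have s: "smooth_fun a" "smooth_fun b" and qs: "\<forall>(a,b)\<in>set qs. smooth_fun a \<and> smooth_fun b"
    using Cons.prems by (auto simp: q)
  have "pderiv_i (\<lambda>x. a x * b x + (\<Sum>(a,b)\<leftarrow>qs. a x * b x)) i x =
      pderiv_i (\<lambda>x. a x * b x) i x + pderiv_i (\<lambda>x. \<Sum>(a,b)\<leftarrow>qs. a x * b x) i x"
    by (intro pderiv_i_add differentiable_sum_mult[OF qs] differentiable_mult smooth_fun_differentiable s)
  then show ?case 
    using Cons.IH[OF qs] by (simp add: q pderiv_i_mult smooth_fun_differentiable[OF s(1)] smooth_fun_differentiable[OF s(2)])
qed simp

text \<open>Products are not closed under the derivative, so the coinduction runs over finite sums of products.\<close>

lemma smooth_fun_sum_mult: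
  assumes "\<forall>(a,b)\<in>set ps. smooth_fun a \<and> smooth_fun b"
  shows "smooth_fun (\<lambda>x. \<Sum>(a,b)\<leftarrow>ps. a x * b x)"
proof (rule smooth_fun.coinduct[where
    X="\<lambda>f. \<exists>ps. (\<forall>(a,b)\<in>set ps. smooth_fun a \<and> smooth_fun b) \<and> f = (\<lambda>x. \<Sum>(a,b)\<leftarrow>ps. a x * b x)"])
  show "\<exists>qs. (\<forall>(a,b)\<in>set qs. smooth_fun a \<and> smooth_fun b) \<and>
    (\<lambda>x. \<Sum>(a,b)\<leftarrow>ps. a x * b x) = (\<lambda>x. \<Sum>(a,b)\<leftarrow>qs. a x * b x)"
    using assms by blast
next
  fix f :: "real^'n \<Rightarrow> real"
  assume "\<exists>ps. (\<forall>(a,b)\<in>set ps. smooth_fun a \<and> smooth_fun b) \<and> f = (\<lambda>x. \<Sum>(a,b)\<leftarrow>ps. a x * b x)"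
  then obtain ps where ps: "\<forall>(a,b)\<in>set ps. smooth_fun a \<and> smooth_fun b"
    and f: "f = (\<lambda>x. \<Sum>(a,b)\<leftarrow>ps. a x * b x)" by blast
  have "\<exists>ps. (\<forall>(a,b)\<in>set ps. smooth_fun a \<and> smooth_fun b) \<and> pderiv_i f i = (\<lambda>x. \<Sum>(a,b)\<leftarrow>ps. a x * b x)" for i
  proof (intro exI conjI)
    show "pderiv_i f i = (\<lambda>x. \<Sum>(a,b)\<leftarrow>concat (map (\<lambda>(a,b). [(pderiv_i a i, b), (a, pderiv_i b i)]) ps). a x * b x)"
      unfolding f by (rule ext) (rule pderiv_i_sum_mult[OF ps])
    show "\<forall>(a,b)\<in>set (concat (map (\<lambda>(a,b). [(pderiv_i a i, b), (a, pderiv_i b i)]) ps)). smooth_fun a \<and> smooth_fun b"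
      using ps by (auto simp: smooth_fun_pderiv_i)
  qed
  moreover have "\<forall>x. f differentiable at x" unfolding f using differentiable_sum_mult[OF ps] by blast
  ultimately show "\<exists>h. f = h \<and> (\<forall>x. h differentiable at x) \<and>
    (\<forall>i. (\<exists>ps. (\<forall>(a,b)\<in>set ps. smooth_fun a \<and> smooth_fun b) \<and> pderiv_i h i = (\<lambda>x. \<Sum>(a,b)\<leftarrow>ps. a x * b x)) \<or> smooth_fun (pderiv_i h i))"
    by blast
qed

lemma smooth_fun_mult: "smooth_fun f \<Longrightarrow> smooth_fun g \<Longrightarrow> smooth_fun (\<lambda>x. f x * g x)"
  using smooth_fun_sum_mult[of "[(f,g)]"] by simp

lemma smooth_fun_const: "smooth_fun (\<lambda>x. c)"
proof (coinduction arbitrary: c rule: smooth_fun.coinduct)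
  case smooth_fun
  have "pderiv_i (\<lambda>x. c) i = (\<lambda>x. 0)" for i by (simp add: fun_eq_iff)
  then show ?case by auto
qed

lemma smooth_fun_add: "smooth_fun f \<Longrightarrow> smooth_fun g \<Longrightarrow> smooth_fun (\<lambda>x. f x + g x)"
  using smooth_fun_sum_mult[of "[(f,\<lambda>x. 1),(g,\<lambda>x. 1)]"] by (simp add: smooth_fun_const)

lemma smooth_fun_prod: "finite I \<Longrightarrow> (\<And>i. i \<in> I \<Longrightarrow> smooth_fun (f i)) \<Longrightarrow> smooth_fun (\<lambda>x. \<Prod>i\<in>I. f i x)"
  by (induction I rule: finite_induct) (auto simp: smooth_fun_const intro: smooth_fun_mult)

text \<open>The functions \<open>P(1/x) exp(-1/x)\<close> are closed under differentiation, which makes them smooth by coinduction.\<close>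

definition flat :: "real poly \<Rightarrow> real \<Rightarrow> real" where
  "flat p x = (if x > 0 then poly p (1/x) * exp (- (1/x)) else 0)"

text \<open>With y = 1/x every monomial contributes a multiple of y^i / exp y. All polynomials are
  covered at once because the difference quotient at 0 raises the degree by one.\<close>

lemma flat_tendsto_0: "(flat p \<longlongrightarrow> 0) (at 0)"
proof -
  have "((\<lambda>y. \<Sum>i\<le>degree p. coeff p i * (y ^ i / exp y)) \<longlongrightarrow> (\<Sum>i\<le>degree p. coeff p i * 0)) at_top"
    by (intro tendsto_intros tendsto_power_div_exp_0)
  moreover have "(\<lambda>y. \<Sum>i\<le>degree p. coeff p i * (y ^ i / exp y)) = (\<lambda>y. poly p y * exp (- y))"
    by (simp add: fun_eq_iff poly_altdef sum_distrib_right exp_minus divide_inverse mult.assoc)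
  ultimately have "((\<lambda>y. poly p y * exp (- y)) \<longlongrightarrow> 0) at_top" by simp
  moreover have "filterlim (\<lambda>x::real. 1 / x) at_top (at_right 0)"
    using filterlim_inverse_at_top_right by (simp add: inverse_eq_divide)
  ultimately have "((\<lambda>x. poly p (1/x) * exp (- (1/x))) \<longlongrightarrow> 0) (at_right 0)"
    by (rule filterlim_compose)
  then have "(flat p \<longlongrightarrow> 0) (at_right 0)"
    by (rule Lim_transform_eventually) (auto simp: flat_def eventually_at_filter)
  moreover have "(flat p \<longlongrightarrow> 0) (at_left 0)"
    by (rule Lim_transform_eventually[OF tendsto_const]) (auto simp: flat_def eventually_at_filter)
  ultimately show ?thesis by (simp add: filterlim_at_split)
qed

text \<open>For x > 0 the derivative of P(1/x) exp(-1/x) is (1/x)^2 (P - P')(1/x) exp(-1/x), the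
  origin of the polynomial X^2 (P - P'). At 0 the difference quotient of \<open>flat p\<close> is
  the function \<open>flat\<close> of X p, which tends to 0.\<close>

lemma flat_has_derivative:
  "(flat p has_real_derivative flat ([:0,0,1:] * (p - pderiv p)) x) (at x)"
proof -
  consider "x > 0" | "x < 0" | "x = 0" by linarith
  then show ?thesis
  proof cases
    case 1
    have "((\<lambda>x. poly p (1/x) * exp (- (1/x))) has_real_derivative
      poly ([:0,0,1:] * (p - pderiv p)) (1/x) * exp (- (1/x))) (at x)"
      using 1 by (auto intro!: derivative_eq_intros simp: field_simps power2_eq_square)
    moreover have "\<forall>\<^sub>F y in nhds x. flat p y = poly p (1/y) * exp (- (1/y))"
      using eventually_nhds_in_open[of "{0<..}" x] 1 by (auto simp: flat_def elim!: eventually_mono)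
    ultimately have "(flat p has_real_derivative poly ([:0,0,1:] * (p - pderiv p)) (1/x) * exp (- (1/x))) (at x)"
      by (subst DERIV_cong_ev[OF refl _ refl])
    then show ?thesis using 1 by (simp add: flat_def)
  next
    case 2
    moreover have "\<forall>\<^sub>F y in nhds x. flat p y = 0"
      using eventually_nhds_in_open[of "{..<0}" x] 2 by (auto simp: flat_def elim!: eventually_mono)
    ultimately show ?thesis using DERIV_cong_ev[of x x "flat p" "\<lambda>_. 0" 0 0] by (auto simp: flat_def)
  next
    case 3
    have "((\<lambda>h. (flat p (0 + h) - flat p 0) / h) \<longlongrightarrow> 0) (at 0)"
      by (rule Lim_transform_eventually[OF flat_tendsto_0[of "[:0,1:] * p"]])
         (auto simp: flat_def eventually_at_filter)
    then show ?thesis using 3 by (simp add: DERIV_def flat_def)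
  qed
qed

lemma has_derivative_coord_compose:
  fixes f :: "real \<Rightarrow> real"
  assumes "(f has_real_derivative D) (at (c * x $ i + d))"
  shows "((\<lambda>x. f (c * x $ i + d)) has_derivative (\<lambda>h. D * c * h $ i)) (at (x::real^'n))"
proof -
  have "((\<lambda>x::real^'n. c * x $ i + d) has_derivative (\<lambda>h. c * h $ i + 0)) (at x)"
    by (intro has_derivative_add has_derivative_mult_right has_derivative_const
        bounded_linear_imp_has_derivative bounded_linear_vec_nth)
  from has_derivative_compose[OF this assms[unfolded has_field_derivative_def]]
  show ?thesis by (simp add: mult.assoc)
qed

lemma smooth_fun_coord:
  assumes D: "\<And>s. (f has_real_derivative f' s) (at s)"
    and s: "smooth_fun (\<lambda>x::real^'n. f' (c * x $ i + d))"
  shows "smooth_fun (\<lambda>x::real^'n. f (c * x $ i + d))"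
proof (rule smooth_fun.intros)
  note * = has_derivative_coord_compose[OF D]
  show "\<forall>x. (\<lambda>x::real^'n. f (c * x $ i + d)) differentiable at x"
    using * differentiable_def by blast
  have "pderiv_i (\<lambda>x::real^'n. f (c * x $ i + d)) j = (\<lambda>x. (if j = i then c else 0) * f' (c * x $ i + d))" for j
  proof
    fix x :: "real^'n"
    have "pderiv_i (\<lambda>x::real^'n. f (c * x $ i + d)) j x = f' (c * x $ i + d) * c * (axis j 1 :: real^'n) $ i"
      by (rule pderiv_i_eq[OF *])
    then show "pderiv_i (\<lambda>x::real^'n. f (c * x $ i + d)) j x = (if j = i then c else 0) * f' (c * x $ i + d)"
      by (simp add: axis_def)
  qed
  then show "\<forall>j. smooth_fun (pderiv_i (\<lambda>x::real^'n. f (c * x $ i + d)) j)"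
    using smooth_fun_mult[OF smooth_fun_const s] by simp
qed

lemma smooth_fun_flat: "smooth_fun (\<lambda>x::real^'n. flat p (c * x $ i + d))"
proof -
  \<comment> \<open>The factor 1 is hidden behind an unspecified \<open>k\<close>, so that the
    coinduction generalises over the scalar together with the polynomial.\<close>
  have "\<exists>k. (\<lambda>x::real^'n. flat p (c * x $ i + d)) = (\<lambda>x::real^'n. k * flat p (c * x $ i + d))"
    by (rule exI[of _ 1]) simp
  then obtain k where "(\<lambda>x::real^'n. flat p (c * x $ i + d)) = (\<lambda>x::real^'n. k * flat p (c * x $ i + d))" by blast
  moreover have "smooth_fun (\<lambda>x::real^'n. k * flat p (c * x $ i + d))"
  proof (coinduction arbitrary: k p rule: smooth_fun.coinduct)
    case smooth_fun
    note * = has_derivative_coord_compose[OF flat_has_derivative]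
    have d: "(\<lambda>x::real^'n. k * flat p (c * x $ i + d)) differentiable at x" for x
      by (intro derivative_intros) (use * differentiable_def in blast)
    have "pderiv_i (\<lambda>x::real^'n. k * flat p (c * x $ i + d)) j =
      (\<lambda>x. (if j = i then k * c else 0) * flat ([:0,0,1:] * (p - pderiv p)) (c * x $ i + d))" for j
    proof
      fix x :: "real^'n"
      have "((\<lambda>x::real^'n. k * flat p (c * x $ i + d)) has_derivative
         (\<lambda>h. k * (flat ([:0,0,1:] * (p - pderiv p)) (c * x $ i + d) * c * h $ i))) (at x)"
        by (intro has_derivative_mult_right *)
      from pderiv_i_eq[OF this, of j]
      show "pderiv_i (\<lambda>x::real^'n. k * flat p (c * x $ i + d)) j x =
        (if j = i then k * c else 0) * flat ([:0,0,1:] * (p - pderiv p)) (c * x $ i + d)"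
        by (simp add: axis_def)
    qed
    then show ?case using d by blast
  qed
  ultimately show ?thesis by simp
qed

text \<open>\<open>\<sigma>\<close> is the normalised primitive of the bump
  \<open>flat 1 t * flat 1 (1 - t)\<close>, which lives on [0, 1]. Smoothness is stated after
  composition with an affine function of one coordinate, since \<open>smooth_fun\<close> concerns
  functions on the whole space.\<close>

lemma ex_smooth_step:
  obtains \<sigma> :: "real \<Rightarrow> real" where "\<And>c d (i::'n::finite). smooth_fun (\<lambda>x::real^'n. \<sigma> (c * x $ i + d))"
    "\<And>s. s \<le> 0 \<Longrightarrow> \<sigma> s = 0" "\<And>s. 1 \<le> s \<Longrightarrow> \<sigma> s = 1" "\<And>s. 0 \<le> \<sigma> s" "\<And>s. \<sigma> s \<le> 1"
proof -
  define b where "b t = flat 1 t * flat 1 (1 - t)" for t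
  have cf: "isCont (flat p) x" for p x using flat_has_derivative DERIV_isCont by blast
  have b0: "b t \<ge> 0" for t by (simp add: b_def flat_def)
  have bz: "b t = 0" if "t \<le> 0 \<or> 1 \<le> t" for t using that by (auto simp: b_def flat_def)
  have bp: "b t > 0" if "0 < t" "t < 1" for t using that by (auto simp: b_def flat_def)
  have cb: "continuous_on (einterval (-\<infinity>) \<infinity>) b"
    unfolding b_def
    by (intro continuous_at_imp_continuous_on ballI isCont_mult cf isCont_o2[of _ "\<lambda>t. 1 - t" "flat 1"]) auto
  obtain S where S: "\<And>x. (S has_vector_derivative b x) (at x)"
    using einterval_antiderivative[of "-\<infinity>" \<infinity> b] cb
    by (auto simp: einterval_def continuous_on_eq_continuous_at)
  then have S': "(S has_real_derivative b x) (at x)" for x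
    by (simp add: has_real_derivative_iff_has_vector_derivative)
  have mono: "S x \<le> S y" if "x \<le> y" for x y
    using DERIV_nonneg_imp_nondecreasing[OF that] S' b0 by blast
  have cS: "continuous_on A S" for A
    using S' DERIV_isCont continuous_at_imp_continuous_on by blast
  have neg: "S s = S 0" if "s \<le> 0" for s
  proof (cases "s = 0")
    case False
    have "S 0 = S s"
    proof (rule DERIV_isconst_end[OF _ cS])
      show "s < 0" using that False by simp
      show "DERIV S x :> 0" if "s < x" "x < 0" for x using S'[of x] bz[of x] that by simp
    qed
    then show ?thesis by simp
  qed simp
  have pos: "S s = S 1" if "1 \<le> s" for s
  proof (cases "s = 1")
    case False
    show "S s = S 1"
    proof (rule DERIV_isconst_end[OF _ cS])
      show "1 < s" using that False by simp
      show "DERIV S x :> 0" if "1 < x" "x < s" for x using S'[of x] bz[of x] that by simp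
    qed
  qed simp
  have lt: "S 0 < S 1"
    by (rule DERIV_pos_imp_increasing_open[OF _ _ cS]) (use S' bp in auto)
  define \<sigma> where "\<sigma> s = (S s - S 0) / (S 1 - S 0)" for s
  have D: "(\<sigma> has_real_derivative b s / (S 1 - S 0)) (at s)" for s
    unfolding \<sigma>_def using lt by (auto intro!: derivative_eq_intros S')
  have "smooth_fun (\<lambda>x::real^'n. \<sigma> (c * x $ i + d))" for c d i
  proof (rule smooth_fun_coord[OF D])
    have "b (c * x $ i + d) / (S 1 - S 0) = 1 / (S 1 - S 0) * (flat 1 (c * x $ i + d) * flat 1 ((- c) * x $ i + (1 - d)))" for x :: "real^'n"
      by (simp add: b_def algebra_simps)
    then show "smooth_fun (\<lambda>x::real^'n. b (c * x $ i + d) / (S 1 - S 0))"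
      by (simp only:) (intro smooth_fun_mult smooth_fun_const smooth_fun_flat)
  qed
  moreover have "0 \<le> \<sigma> s \<and> \<sigma> s \<le> 1" for s
  proof -
    have "S 0 \<le> S s" using mono[of 0 s] neg[of s] by (cases "s \<le> 0") simp_all
    moreover have "S s \<le> S 1" using mono[of s 1] pos[of s] by (cases "1 \<le> s") simp_all
    ultimately have "S 0 \<le> S s" "S s \<le> S 1" by simp_all
    then show ?thesis using lt by (simp add: \<sigma>_def divide_simps)
  qed
  moreover have "\<sigma> s = 0" if "s \<le> 0" for s using neg[OF that] by (simp add: \<sigma>_def)
  moreover have "\<sigma> s = 1" if "1 \<le> s" for s using pos[OF that] lt by (simp add: \<sigma>_def)
  ultimately show ?thesis by (intro that[of \<sigma>]) simp_all
qed

section \<open>Test functions, cubes and cut-offs\<close>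

lemma test_funI:
  assumes "smooth_fun \<phi>" "\<And>x. \<phi> x \<noteq> 0 \<Longrightarrow> norm x \<le> R"
  shows "test_fun \<phi>"
  unfolding test_fun_def using assms
  by (auto simp: compact_closure bounded_iff)

lemma test_fun_smooth: "test_fun \<phi> \<Longrightarrow> smooth_fun \<phi>" by (simp add: test_fun_def)

lemma test_fun_mult: "test_fun \<phi> \<Longrightarrow> smooth_fun \<eta> \<Longrightarrow> test_fun (\<lambda>x. \<phi> x * \<eta> x)"
  unfolding test_fun_def
  by (auto intro!: smooth_fun_mult simp: compact_closure elim!: bounded_subset)

text \<open>Off the closed support the function vanishes in a neighbourhood, hence so does its
  derivative.\<close>

lemma test_fun_pderiv: assumes "test_fun \<phi>" shows "test_fun (pderiv_i \<phi> i)"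
proof -
  have "pderiv_i \<phi> i x = 0" if "x \<notin> closure {x. \<phi> x \<noteq> 0}" for x
  proof -
    let ?S = "{x. \<phi> x \<noteq> 0}"
    have z: "0 = \<phi> y" if "y \<in> - closure ?S" for y
    proof -
      have "y \<notin> ?S" using that closure_subset[of ?S] by blast
      then show ?thesis by simp
    qed
    have o: "open (- closure ?S)" by (rule open_Compl[OF closed_closure])
    have xin: "x \<in> - closure ?S" using that by simp
    have "(\<phi> has_derivative (\<lambda>_. 0)) (at x)"
      by (rule has_derivative_transform_within_open[OF has_derivative_const o xin z])
    from pderiv_i_eq[OF this] show ?thesis by simp
  qed
  then have "{x. pderiv_i \<phi> i x \<noteq> 0} \<subseteq> closure {x. \<phi> x \<noteq> 0}" by auto
  then have "bounded {x. pderiv_i \<phi> i x \<noteq> 0}"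
    using assms unfolding test_fun_def by (meson bounded_subset compact_imp_bounded)
  then show ?thesis using assms unfolding test_fun_def by (simp add: smooth_fun_pderiv_i compact_closure)
qed

lemma test_fun_bound:
  assumes "test_fun \<phi>"
  obtains R B where "R > 0" "B > 0" "\<And>x. \<bar>\<phi> x\<bar> \<le> B * indicator (cball 0 R) x"
proof -
  have c: "compact (closure {x. \<phi> x \<noteq> 0})" using assms by (simp add: test_fun_def)
  then obtain R where R: "R > 0" "closure {x. \<phi> x \<noteq> 0} \<subseteq> cball 0 R"
    using compact_imp_bounded[OF c] unfolding bounded_pos by (auto simp: subset_iff)
  have "compact (\<phi> ` cball 0 R)"
    using smooth_fun_continuous[OF test_fun_smooth[OF assms]] 
    by (intro compact_continuous_image) (auto intro: continuous_on_subset)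
  then obtain B where B: "B > 0" "\<And>y. y \<in> \<phi> ` cball 0 R \<Longrightarrow> norm y \<le> B"
    using compact_imp_bounded bounded_pos by metis
  have "\<bar>\<phi> x\<bar> \<le> B * indicator (cball 0 R) x" for x
  proof (cases "x \<in> cball 0 R")
    case True then show ?thesis using B(2)[of "\<phi> x"] by (simp add: image_eqI)
  next
    case False
    then have "x \<notin> closure {x. \<phi> x \<noteq> 0}" using R(2) by blast
    then have "\<phi> x = 0" by (metis (mono_tags, lifting) closure_subset mem_Collect_eq subsetD)
    then show ?thesis using B by simp
  qed
  then show ?thesis using that R B by blast
qed

lemma test_fun_affine: assumes "test_fun \<phi>" "c \<noteq> 0" shows "test_fun (\<lambda>x. k * \<phi> (c *\<^sub>R x + d))"
proof -
  obtain R B where R: "R > 0" "\<And>x. \<bar>\<phi> x\<bar> \<le> B * indicator (cball 0 R) x"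
    using test_fun_bound[OF assms(1)] by metis
  have "norm x \<le> (R + norm d) / \<bar>c\<bar>" if "k * \<phi> (c *\<^sub>R x + d) \<noteq> 0" for x
  proof -
    have "norm (c *\<^sub>R x + d) \<le> R" 
      using R(2)[of "c *\<^sub>R x + d"] that by (cases "norm (c *\<^sub>R x + d) \<le> R") auto
    then have "norm (c *\<^sub>R x) \<le> R + norm d"
      using norm_triangle_ineq4[of "c *\<^sub>R x + d" d] by simp
    then show ?thesis using assms(2) by (simp add: field_simps)
  qed
  then show ?thesis by (rule test_funI[OF smooth_fun_affine[OF test_fun_smooth[OF assms(1)]]])
qed

definition grad :: "(real^'n \<Rightarrow> real) \<Rightarrow> real^'n \<Rightarrow> real^'n" where
  "grad f x = (\<chi> i. pderiv_i f i x)"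

lemma test_fun_grad_bound:
  fixes \<phi> :: "real^'n \<Rightarrow> real"
  assumes "test_fun \<phi>"
  obtains R B where "R > 0" "B > 0" "\<And>x. \<bar>\<phi> x\<bar> \<le> B * indicator (cball 0 R) x"
    "\<And>x i. \<bar>pderiv_i \<phi> i x\<bar> \<le> B * indicator (cball 0 R) x"
    "\<And>x. norm (grad \<phi> x) \<le> B * indicator (cball 0 R) x"
proof -
  obtain R0 B0 where 0: "R0 > 0" "B0 > 0" "\<And>x. \<bar>\<phi> x\<bar> \<le> B0 * indicator (cball 0 R0) x"
    using test_fun_bound[OF assms] by metis
  have "\<forall>i. \<exists>R B. R > 0 \<and> B > 0 \<and> (\<forall>x. \<bar>pderiv_i \<phi> i x\<bar> \<le> B * indicator (cball 0 R) x)"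
    using test_fun_bound[OF test_fun_pderiv[OF assms]] by metis
  then obtain R1 B1 where 1: "\<And>i. R1 i > 0" "\<And>i. B1 i > 0" 
    "\<And>i x. \<bar>pderiv_i \<phi> i x\<bar> \<le> B1 i * indicator (cball 0 (R1 i)) x" by metis
  define R where "R = R0 + (\<Sum>i\<in>UNIV. R1 i)"
  define B where "B = B0 + (\<Sum>i\<in>UNIV. B1 i)"
  have s: "R1 i \<le> (\<Sum>i\<in>UNIV. R1 i)" "B1 i \<le> (\<Sum>i\<in>UNIV. B1 i)" for i
    using 1 by (auto intro!: member_le_sum simp: less_imp_le)
  have n: "(\<Sum>i\<in>UNIV. R1 i) \<ge> 0" "(\<Sum>i\<in>UNIV. B1 i) \<ge> 0" using 1 by (auto intro!: sum_nonneg simp: less_imp_le)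
  have R: "R0 \<le> R" "\<And>i. R1 i \<le> R" "B0 \<le> B" "\<And>i. B1 i \<le> B" "R > 0" "B > 0"
    unfolding R_def B_def using s n 0 
    by (auto simp: add_pos_nonneg intro: order_trans[OF s(1)] order_trans[OF s(2)])
  have mono: "b * indicator (cball 0 r) x \<le> b' * indicator (cball 0 r') x"
    if "0 \<le> b" "b \<le> b'" "r \<le> r'" for b b' r r' :: real and x :: "real^'n"
    using that by (auto simp: indicator_def)
  have a: "\<bar>\<phi> x\<bar> \<le> B * indicator (cball 0 R) x" for x
    using order_trans[OF 0(3) mono] 0 R by fastforce
  have b: "\<bar>pderiv_i \<phi> i x\<bar> \<le> B1 i * indicator (cball 0 R) x" for x i
    using order_trans[OF 1(3) mono] 1 R by (meson less_imp_le order_refl)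
  have c: "norm (grad \<phi> x) \<le> B * indicator (cball 0 R) x" for x
  proof -
    have "norm (grad \<phi> x) \<le> (\<Sum>i\<in>UNIV. \<bar>grad \<phi> x $ i\<bar>)" by (rule norm_le_l1_cart)
    also have "\<dots> \<le> (\<Sum>i\<in>UNIV. B1 i * indicator (cball 0 R) x)" by (intro sum_mono) (simp add: grad_def b)
    also have "\<dots> = (\<Sum>i\<in>UNIV. B1 i) * indicator (cball 0 R) x" by (simp add: sum_distrib_right)
    also have "\<dots> \<le> B * indicator (cball 0 R) x" using 0 by (intro mult_right_mono) (auto simp: B_def)
    finally show ?thesis .
  qed
  have "\<bar>pderiv_i \<phi> i x\<bar> \<le> B * indicator (cball 0 R) x" for x i
    using component_le_norm_cart[of "grad \<phi> x" i] c[of x] by (simp add: grad_def)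
  then show ?thesis using that a c R by blast
qed

text \<open>Closed ball of the maximum norm. Cubes have the exact volume (2R)^N, and two points of
  one grid cell differ by an element of such a cube.\<close>

definition Q :: "real \<Rightarrow> (real^'n) set" where "Q R = {x. \<forall>i. \<bar>x $ i\<bar> \<le> R}"

lemma Q_cbox: "Q R = cbox (\<chi> i. - R) (\<chi> i. R)"
  unfolding set_eq_iff by (simp add: Q_def mem_box_cart abs_le_iff) (metis minus_le_iff)

lemma Q_borel [measurable]: "Q R \<in> sets borel" by (simp add: Q_cbox)

text \<open>A product over the coordinates s of \<sigma>(2 - s) \<sigma>(2 + s), which is 1 for |s|
  \<le> 1 and 0 for |s| > 2.\<close>

lemma ex_cutoff:
  obtains \<theta> :: "real^'n::finite \<Rightarrow> real" where "test_fun \<theta>" "\<And>x. 0 \<le> \<theta> x" "\<And>x. \<theta> x \<le> 1"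
    "\<And>x. x \<in> Q 1 \<Longrightarrow> \<theta> x = 1" "\<And>x. x \<notin> Q 2 \<Longrightarrow> \<theta> x = 0"
proof -
  obtain \<sigma> :: "real \<Rightarrow> real" where s: "\<And>c d (i::'n::finite). smooth_fun (\<lambda>x::real^'n. \<sigma> (c * x $ i + d))"
    "\<And>s. s \<le> 0 \<Longrightarrow> \<sigma> s = 0" "\<And>s. 1 \<le> s \<Longrightarrow> \<sigma> s = 1" "\<And>s. 0 \<le> \<sigma> s" "\<And>s. \<sigma> s \<le> 1"
    using ex_smooth_step by metis
  define \<theta> where "\<theta> x = (\<Prod>i\<in>UNIV. \<sigma> (-1 * x $ i + 2) * \<sigma> (1 * x $ i + 2))" for x :: "real^'n"
  have sm: "smooth_fun \<theta>" unfolding \<theta>_def by (intro smooth_fun_prod smooth_fun_mult s) auto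
  have out: "\<theta> x = 0" if x2: "x \<notin> Q 2" for x
  proof -
    obtain i where "\<bar>x $ i\<bar> > 2" using x2 by (auto simp: Q_def not_le)
    then have "\<sigma> (-1 * x $ i + 2) * \<sigma> (1 * x $ i + 2) = 0" using s(2) by (cases "x $ i > 0") auto
    then show ?thesis unfolding \<theta>_def by (intro prod_zero) auto
  qed
  have "bounded (Q 2 :: (real^'n) set)" by (simp add: Q_cbox bounded_cbox)
  then obtain R where "\<And>x::real^'n. x \<in> Q 2 \<Longrightarrow> norm x \<le> R" unfolding bounded_iff by blast
  then have "test_fun \<theta>" using test_funI[OF sm] out by metis
  moreover have "0 \<le> \<theta> x" "\<theta> x \<le> 1" for x
    unfolding \<theta>_def by (auto intro!: prod_nonneg prod_le_1 mult_le_one mult_nonneg_nonneg s)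
  moreover have "\<theta> x = 1" if "x \<in> Q 1" for x
  proof -
    have "\<sigma> (-1 * x $ i + 2) * \<sigma> (1 * x $ i + 2) = 1" for i
    proof -
      have "\<bar>x $ i\<bar> \<le> 1" using that by (simp add: Q_def)
      then have "1 \<le> -1 * x $ i + 2" "1 \<le> 1 * x $ i + 2" by linarith+
      then show ?thesis using s(3) by simp
    qed
    then show ?thesis by (simp add: \<theta>_def)
  qed
  ultimately show ?thesis using that out by blast
qed

text \<open>There is one factor exp(-1/(k s)) for each of the 2 N faces of the box, s being the
  signed distance to that face. Inside the box every factor tends to 1 as k grows; outside some
  factor is 0. Box indicators are thus limits from below of test functions.\<close>

lemma ex_bump_seq:
  fixes a b :: "real^'n"
  obtains \<phi> :: "nat \<Rightarrow> real^'n \<Rightarrow> real" where "\<And>k. test_fun (\<phi> k)" "\<And>k x. 0 \<le> \<phi> k x" "\<And>k x. \<phi> k x \<le> indicator (box a b) x"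
    "\<And>x. (\<lambda>k. \<phi> k x) \<longlonglongrightarrow> indicator (box a b) x"
proof -
  define e where "e = flat 1"
  define \<phi> where "\<phi> k x = (\<Prod>i\<in>UNIV. e (real (Suc k) * x $ i + - real (Suc k) * a $ i) * e (- real (Suc k) * x $ i + real (Suc k) * b $ i))" for k and x :: "real^'n"
  have e: "0 \<le> e s" "e s \<le> 1" "s \<le> 0 \<Longrightarrow> e s = 0" for s by (auto simp: e_def flat_def)
  have bx: "x \<in> box a b \<longleftrightarrow> (\<forall>i. a $ i < x $ i \<and> x $ i < b $ i)" for x
    by (simp add: mem_box_cart)
  have 0: "\<phi> k x = 0" if out: "x \<notin> box a b" for k x
  proof -
    obtain i where "x $ i \<le> a $ i \<or> b $ i \<le> x $ i" using out unfolding bx by (auto simp: not_less)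
    then have "real (Suc k) * (x $ i - a $ i) \<le> 0 \<or> real (Suc k) * (b $ i - x $ i) \<le> 0"
      by (auto simp: mult_le_0_iff)
    then have "e (real (Suc k) * x $ i + - real (Suc k) * a $ i) * e (- real (Suc k) * x $ i + real (Suc k) * b $ i) = 0"
      using e(3) by (auto simp: algebra_simps)
    then show ?thesis unfolding \<phi>_def by (intro prod_zero) auto
  qed
  have 1: "0 \<le> \<phi> k x" "\<phi> k x \<le> 1" for k x
    unfolding \<phi>_def by (auto intro!: prod_nonneg prod_le_1 mult_le_one mult_nonneg_nonneg e)
  have sm: "smooth_fun (\<phi> k)" for k
    unfolding \<phi>_def e_def by (intro smooth_fun_prod smooth_fun_mult smooth_fun_flat) auto
  obtain R where "\<And>x. x \<in> box a b \<Longrightarrow> norm x \<le> R" using bounded_box[of a b] unfolding bounded_iff by blast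
  then have "test_fun (\<phi> k)" for k using test_funI[OF sm] 0 by metis
  moreover have "(\<lambda>k. \<phi> k x) \<longlonglongrightarrow> indicator (box a b) x" for x
  proof (cases "x \<in> box a b")
    case True
    have lim: "(\<lambda>k. e (real (Suc k) * s)) \<longlonglongrightarrow> 1" if "s > 0" for s
    proof -
      have "(\<lambda>k. exp (- (inverse (real (Suc k)) * (1 / s)))) \<longlonglongrightarrow> exp (- (0 * (1/s)))"
        by (intro tendsto_intros LIMSEQ_inverse_real_of_nat)
      moreover have "e (real (Suc k) * s) = exp (- (inverse (real (Suc k)) * (1 / s)))" for k
        using that by (simp add: e_def flat_def zero_less_mult_iff inverse_eq_divide)
      ultimately show ?thesis by simp
    qed
    have "(\<lambda>k. \<phi> k x) \<longlonglongrightarrow> (\<Prod>i\<in>(UNIV::'n set). 1 * 1)"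
      unfolding \<phi>_def
    proof (intro tendsto_intros)
      fix i
      have "a $ i < x $ i" "x $ i < b $ i" using True bx by auto
      then show "(\<lambda>k. e (real (Suc k) * x $ i + - real (Suc k) * a $ i)) \<longlonglongrightarrow> 1"
         "(\<lambda>k. e (- real (Suc k) * x $ i + real (Suc k) * b $ i)) \<longlonglongrightarrow> 1"
        using lim[of "x $ i - a $ i"] lim[of "b $ i - x $ i"] by (auto simp: algebra_simps)
    qed
    then show ?thesis using True by simp
  qed (simp add: 0)
  ultimately show ?thesis using that[of \<phi>] 0 1 by (auto simp: indicator_def)
qed

section \<open>Weak gradients along lines\<close>

lemma borel_measurable_vec_nth [measurable (raw)]:
  fixes f :: "'a \<Rightarrow> real^'n"
  assumes [measurable]: "f \<in> borel_measurable M"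
  shows "(\<lambda>x. f x $ i) \<in> borel_measurable M"
proof -
  have "(\<lambda>x. f x $ i) = (\<lambda>x. f x \<bullet> axis i 1)" by (simp add: inner_axis)
  then show ?thesis by simp
qed

section \<open>Translations and dilations of Lebesgue integrals\<close>

lemma nn_integral_lborel_affine:
  fixes f :: "'a::euclidean_space \<Rightarrow> ennreal"
  assumes [measurable]: "f \<in> borel_measurable borel" and c: "c \<noteq> 0"
  shows "(\<integral>\<^sup>+x. f x \<partial>lborel) = ennreal (\<bar>c\<bar> ^ DIM('a)) * (\<integral>\<^sup>+x. f (t + c *\<^sub>R x) \<partial>lborel)"
  apply (subst lborel_affine[OF c, of t])
  apply (subst nn_integral_density)
    apply (auto simp: nn_integral_distr nn_integral_cmult ennreal_power)
  done

lemma nn_integral_lborel_shift: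
  fixes f :: "'a::euclidean_space \<Rightarrow> ennreal"
  assumes "f \<in> borel_measurable borel"
  shows "(\<integral>\<^sup>+x. f (x + t) \<partial>lborel) = (\<integral>\<^sup>+x. f x \<partial>lborel)"
  using nn_integral_lborel_affine[OF assms, of 1 t] by (simp add: add.commute)

lemma integrable_lborel_affine:
  fixes f :: "'a::euclidean_space \<Rightarrow> real"
  assumes [measurable]: "f \<in> borel_measurable borel" and c: "c \<noteq> 0"
  shows "integrable lborel (\<lambda>x. f (t + c *\<^sub>R x)) \<longleftrightarrow> integrable lborel f"
proof -
  have "integrable lborel f \<longleftrightarrow> integrable (density (distr lborel borel (\<lambda>x. t + c *\<^sub>R x)) (\<lambda>_. \<bar>c\<bar> ^ DIM('a))) f"
    using lborel_affine[OF c, of t] by simp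
  also have "\<dots> \<longleftrightarrow> integrable lborel (\<lambda>x. f (t + c *\<^sub>R x))"
    using c by (simp add: integrable_density integrable_distr_eq)
  finally show ?thesis by simp
qed

lemma integral_lborel_affine:
  fixes f :: "'a::euclidean_space \<Rightarrow> real"
  assumes [measurable]: "f \<in> borel_measurable borel" and c: "c \<noteq> 0"
  shows "(\<integral>x. f x \<partial>lborel) = \<bar>c\<bar> ^ DIM('a) * (\<integral>x. f (t + c *\<^sub>R x) \<partial>lborel)"
proof -
  have "(\<integral>x. f x \<partial>lborel) = (\<integral>x. f x \<partial>(density (distr lborel borel (\<lambda>x. t + c *\<^sub>R x)) (\<lambda>_. \<bar>c\<bar> ^ DIM('a))))"
    using lborel_affine[OF c, of t] by simp
  also have "\<dots> = \<bar>c\<bar> ^ DIM('a) * (\<integral>x. f (t + c *\<^sub>R x) \<partial>lborel)"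
    using c by (simp add: integral_density integral_distr)
  finally show ?thesis .
qed

lemma integrable_lborel_shift:
  fixes f :: "'a::euclidean_space \<Rightarrow> real"
  assumes "f \<in> borel_measurable borel"
  shows "integrable lborel (\<lambda>x. f (x + t)) \<longleftrightarrow> integrable lborel f"
  using integrable_lborel_affine[OF assms, of 1 t] by (simp add: add.commute)

lemma integral_lborel_shift:
  fixes f :: "'a::euclidean_space \<Rightarrow> real"
  assumes "f \<in> borel_measurable borel"
  shows "(\<integral>x. f (x + t) \<partial>lborel) = (\<integral>x. f x \<partial>lborel)"
  using integral_lborel_affine[OF assms, of 1 t] by (simp add: add.commute)

lemma integrable_mult_of_squares:
  fixes f g :: "'a \<Rightarrow> real"
  assumes [measurable]: "f \<in> borel_measurable M" "g \<in> borel_measurable M"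
    and "integrable M (\<lambda>x. (f x)\<^sup>2)" "integrable M (\<lambda>x. (g x)\<^sup>2)"
  shows "integrable M (\<lambda>x. f x * g x)"
proof (rule Bochner_Integration.integrable_bound)
  show "integrable M (\<lambda>x. (f x)\<^sup>2 + (g x)\<^sup>2)" using assms by auto
  show "AE x in M. norm (f x * g x) \<le> norm ((f x)\<^sup>2 + (g x)\<^sup>2)"
  proof (rule AE_I2)
    fix x
    have "2 * (\<bar>f x\<bar> * \<bar>g x\<bar>) \<le> \<bar>f x\<bar>\<^sup>2 + \<bar>g x\<bar>\<^sup>2" by (rule sum_squares_bound[of "\<bar>f x\<bar>" "\<bar>g x\<bar>", simplified mult.assoc])
    moreover have "0 \<le> \<bar>f x\<bar> * \<bar>g x\<bar>" by simp
    ultimately have "\<bar>f x\<bar> * \<bar>g x\<bar> \<le> (f x)\<^sup>2 + (g x)\<^sup>2" unfolding power2_abs by linarith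
    then show "norm (f x * g x) \<le> norm ((f x)\<^sup>2 + (g x)\<^sup>2)" by (simp add: abs_mult)
  qed
qed measurable

section \<open>The fundamental lemma of the calculus of variations\<close>

text \<open>Boxes form an intersection-stable generator of the Borel sets, so vanishing integrals
  extend from boxes to all Borel sets by Dynkin induction. The complement step needs the integral
  over the whole space, which is obtained beforehand by exhaustion with growing boxes. Uniqueness of
  densities concludes.\<close>

lemma integral_box_zero_AE:
  fixes F :: "'a::euclidean_space \<Rightarrow> real"
  assumes F: "integrable lborel F"
    and z: "\<And>a b. (\<integral>x. indicator (box a b) x * F x \<partial>lborel) = 0"
  shows "AE x in lborel. F x = 0"
proof -
  have [measurable]: "F \<in> borel_measurable borel" using F by simp
  have ii: "integrable lborel (\<lambda>x. indicator A x * F x)" if "A \<in> sets borel" for A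
    using integrable_mult_indicator[OF _ F, of A] that by simp
  have tot: "(\<integral>x. F x \<partial>lborel) = 0"
  proof -
    have "(\<lambda>n::nat. \<integral>x. indicator (box (- (real n *\<^sub>R One)) (real n *\<^sub>R One)) x * F x \<partial>lborel) \<longlonglongrightarrow> (\<integral>x. F x \<partial>lborel)"
    proof (rule integral_dominated_convergence[where w="\<lambda>x. norm (F x)"])
      show "AE x in lborel. (\<lambda>n::nat. indicator (box (- (real n *\<^sub>R One)) (real n *\<^sub>R One)) x * F x) \<longlonglongrightarrow> F x"
      proof (rule AE_I2)
        fix x :: 'a
        obtain n :: nat where "x \<in> box (- (real n *\<^sub>R One)) (real n *\<^sub>R One)"
          using UN_box_eq_UNIV by blast
        moreover have "box (- (real n *\<^sub>R One)) (real n *\<^sub>R One) \<subseteq> box (- (real k *\<^sub>R One)) (real k *\<^sub>R One :: 'a)" if "n \<le> k" for k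
          using that by (auto simp: mem_box intro: order_le_less_trans less_le_trans) (metis le_less_trans neg_le_iff_le of_nat_mono less_le_trans)+
        ultimately have "x \<in> box (- (real k *\<^sub>R One)) (real k *\<^sub>R One)" if "n \<le> k" for k
          using that by blast
        then have "\<forall>\<^sub>F k in sequentially. indicator (box (- (real k *\<^sub>R One)) (real k *\<^sub>R One)) x * F x = F x"
          by (auto simp: eventually_sequentially intro!: exI[of _ n])
        then show "(\<lambda>n::nat. indicator (box (- (real n *\<^sub>R One)) (real n *\<^sub>R One)) x * F x) \<longlonglongrightarrow> F x"
          by (rule tendsto_eventually)
      qed
    qed (use F in \<open>auto simp: indicator_def\<close>)
    then show ?thesis using z by (simp add: LIMSEQ_const_iff)
  qed
  have all: "(\<integral>x. indicator A x * F x \<partial>lborel) = 0" if A: "A \<in> sets borel" for A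
  proof -
    let ?G = "range (\<lambda>(a, b). box a b :: 'a set)"
    have "Int_stable ?G" by (auto simp: Int_stable_def box_Int_box)
    moreover have "?G \<subseteq> Pow UNIV" by simp
    moreover have s: "sigma_sets UNIV ?G = sets borel" by (simp add: borel_eq_box)
    then have "A \<in> sigma_sets UNIV ?G" using A by simp
    ultimately show ?thesis
    proof (induction rule: sigma_sets_induct_disjoint)
      case (basic A) then show ?case using z by auto
    next
      case empty then show ?case by simp
    next
      case (compl A)
      then have [measurable]: "A \<in> sets borel" using s by simp
      have "(\<integral>x. indicator (UNIV - A) x * F x \<partial>lborel) = (\<integral>x. F x - indicator A x * F x \<partial>lborel)"
        by (intro Bochner_Integration.integral_cong) (auto simp: indicator_def)
      also have "\<dots> = 0" using F ii[of A] tot compl by simp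
      finally show ?case .
    next
      case (union B)
      then have B: "B i \<in> sets lborel" for i using s by auto
      have "(\<integral>x\<in>(\<Union>i. B i). F x \<partial>lborel) = (\<Sum>i. \<integral>x\<in>B i. F x \<partial>lborel)"
      proof (rule lebesgue_integral_countable_add)
        show "set_integrable lborel (\<Union>i. B i) F" using ii[of "\<Union>i. B i"] B by (auto simp: set_integrable_def)
      qed (use union B in \<open>auto simp: disjoint_family_on_def\<close>)
      then show ?case using union by (simp add: set_lebesgue_integral_def)
    qed
  qed
  show ?thesis
  proof (rule density_unique_real[OF F, of "\<lambda>_. 0"])
    show "(\<integral>x\<in>A. F x \<partial>lborel) = (\<integral>x\<in>A. 0 \<partial>lborel)" if "A \<in> sets lborel" for A
      using all[of A] that by (simp add: set_lebesgue_integral_def)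
  qed simp
qed

text \<open>Bumps converging to a box indicator show that the integral of \<open>F\<close> over
  every box vanishes. As \<open>F\<close> is only locally integrable, the preceding lemma is applied
  to its restriction to a growing box; boxes intersect in boxes, so the hypothesis survives the
  restriction.\<close>

lemma fundamental_lemma:
  fixes F :: "real^'n \<Rightarrow> real"
  assumes [measurable]: "F \<in> borel_measurable borel"
    and loc: "\<And>R. integrable lborel (\<lambda>x. indicator (cball 0 R) x * F x)"
    and z: "\<And>\<phi>. test_fun \<phi> \<Longrightarrow> (\<integral>x. F x * \<phi> x \<partial>lborel) = 0"
  shows "AE x in lborel. F x = 0"
proof -
  have box0: "(\<integral>x. indicator (box a b) x * F x \<partial>lborel) = 0" for a b
  proof -
    obtain \<phi> :: "nat \<Rightarrow> real^'n \<Rightarrow> real" where f: "\<And>k. test_fun (\<phi> k)" "\<And>k x. 0 \<le> \<phi> k x"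
      "\<And>k x. \<phi> k x \<le> indicator (box a b) x" "\<And>x. (\<lambda>k. \<phi> k x) \<longlonglongrightarrow> indicator (box a b) x"
      using ex_bump_seq by metis
    have [measurable]: "\<phi> k \<in> borel_measurable borel" for k
      using smooth_fun_continuous[OF test_fun_smooth[OF f(1)]] by (rule borel_measurable_continuous_onI)
    obtain R where R: "box a b \<subseteq> cball 0 R"
      using bounded_box[of a b] unfolding bounded_iff by (auto simp: subset_iff)
    have "(\<lambda>k. \<integral>x. F x * \<phi> k x \<partial>lborel) \<longlonglongrightarrow> (\<integral>x. F x * indicator (box a b) x \<partial>lborel)"
    proof (rule integral_dominated_convergence[where w="\<lambda>x. norm (indicator (cball 0 R) x * F x)"])
      show "AE x in lborel. norm (F x * \<phi> k x) \<le> norm (indicator (cball 0 R) x * F x)" for k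
      proof (rule AE_I2)
        fix x
        have "\<phi> k x \<le> indicator (cball 0 R) x"
          using f(3)[of k x] R by (cases "x \<in> box a b") (auto intro: order_trans[OF _ indicator_pos_le])
        then have "\<bar>F x\<bar> * \<bar>\<phi> k x\<bar> \<le> \<bar>F x\<bar> * indicator (cball 0 R) x"
          using f(2)[of k x] by (intro mult_left_mono) auto
        then show "norm (F x * \<phi> k x) \<le> norm (indicator (cball 0 R) x * F x)"
          by (simp add: abs_mult mult.commute)
      qed
      show "integrable lborel (\<lambda>x. norm (indicator (cball 0 R) x * F x))"
        using loc by (rule integrable_norm)
      show "AE x in lborel. (\<lambda>k. F x * \<phi> k x) \<longlonglongrightarrow> F x * indicator (box a b) x"
        by (intro AE_I2 tendsto_intros f)
    qed measurable
    then show ?thesis using z[OF f(1)] by (simp add: LIMSEQ_const_iff mult.commute)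
  qed
  have "AE x in lborel. indicator (box (- (real n *\<^sub>R One)) (real n *\<^sub>R One)) x * F x = 0" for n
  proof (rule integral_box_zero_AE)
    let ?B = "box (- (real n *\<^sub>R One)) (real n *\<^sub>R One) :: (real^'n) set"
    obtain R where R: "?B \<subseteq> cball 0 R"
      using bounded_box[of "- (real n *\<^sub>R One)" "real n *\<^sub>R One :: real^'n"] unfolding bounded_iff by (auto simp: subset_iff)
    have "indicator ?B x * F x = indicator ?B x *\<^sub>R (indicator (cball 0 R) x * F x)" for x
      using R by (auto simp: indicator_def)
    then have e: "(\<lambda>x. indicator ?B x * F x) = (\<lambda>x. indicator ?B x *\<^sub>R (indicator (cball 0 R) x * F x))" by (rule ext)
    show "integrable lborel (\<lambda>x. indicator ?B x * F x)"
      unfolding e by (rule integrable_mult_indicator[OF _ loc[of R]]) simp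
    show "(\<integral>x. indicator (box a b) x * (indicator ?B x * F x) \<partial>lborel) = 0" for a b
    proof -
      obtain c d where cd: "box a b \<inter> ?B = box c d" unfolding box_Int_box by blast
      have "indicator (box a b) x * (indicator ?B x * F x) = indicator (box c d) x * F x" for x
        unfolding cd[symmetric] by (auto simp: indicator_def)
      then show ?thesis by (simp only: box0)
    qed
  qed
  then have "AE x in lborel. \<forall>n. indicator (box (- (real n *\<^sub>R One)) (real n *\<^sub>R One)) x * F x = 0"
    unfolding AE_all_countable by (rule allI)
  then show ?thesis
  proof eventually_elim
    case (elim x)
    obtain n :: nat where "x \<in> box (- (real n *\<^sub>R One)) (real n *\<^sub>R One)"
      using UN_box_eq_UNIV by blast
    then show ?case using elim[rule_format, of n] by simp
  qed
qed

section \<open>Integration of a weak gradient along segments\<close>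

text \<open>The integration-by-parts clause of \<open>H1_weak\<close> over \<open>lborel\<close>,
  separated from the measurability and integrability clauses so that it can be transported through
  products, translations and limits on its own.\<close>

definition weak_grad :: "(real^'n \<Rightarrow> real) \<Rightarrow> (real^'n \<Rightarrow> real^'n) \<Rightarrow> bool" where
  "weak_grad u Du \<longleftrightarrow> (\<forall>\<phi> i. test_fun \<phi> \<longrightarrow>
     (\<integral>x. u x * pderiv_i \<phi> i x \<partial>lborel) = - (\<integral>x. Du x $ i * \<phi> x \<partial>lborel))"

lemma test_fun_borel [measurable_dest]: "test_fun \<phi> \<Longrightarrow> \<phi> \<in> borel_measurable borel"
  by (intro borel_measurable_continuous_onI smooth_fun_continuous test_fun_smooth)

lemma test_fun_square_integrable:
  fixes \<phi> :: "real^'n \<Rightarrow> real"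
  assumes t: "test_fun \<phi>" shows "integrable lborel (\<lambda>x. (\<phi> x)\<^sup>2)"
proof -
  obtain R B where B: "B > 0" "\<And>x. \<bar>\<phi> x\<bar> \<le> B * indicator (cball 0 R) x"
    using test_fun_bound[OF t] by metis
  have [measurable]: "\<phi> \<in> borel_measurable borel" using t by (rule test_fun_borel)
  show ?thesis
  proof (rule Bochner_Integration.integrable_bound)
    show "integrable lborel (\<lambda>x::real^'n. B\<^sup>2 * indicator (cball 0 R) x)"
      using emeasure_bounded_finite[OF bounded_cball, of "0::real^'n" R] by simp
    show "AE x in lborel. norm ((\<phi> x)\<^sup>2) \<le> norm (B\<^sup>2 * indicator (cball 0 R) x)"
    proof (rule AE_I2)
      fix x show "norm ((\<phi> x)\<^sup>2) \<le> norm (B\<^sup>2 * indicator (cball 0 R) x)"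
        using power_mono[OF B(2)[of x] abs_ge_zero, of 2] by (auto simp: power_mult_distrib indicator_def split: if_splits)
    qed
  qed simp
qed

lemma weak_grad_directional:
  fixes u :: "real^'n \<Rightarrow> real"
  assumes w: "weak_grad u Du"
    and [measurable]: "u \<in> borel_measurable borel" "Du \<in> borel_measurable borel"
    and u2: "integrable lborel (\<lambda>x. (u x)\<^sup>2)" and D2: "integrable lborel (\<lambda>x. (norm (Du x))\<^sup>2)"
    and t: "test_fun \<phi>"
  shows "(\<integral>x. u x * (h \<bullet> grad \<phi> x) \<partial>lborel) = - (\<integral>x. (Du x \<bullet> h) * \<phi> x \<partial>lborel)"
proof -
  have [measurable]: "\<phi> \<in> borel_measurable borel" using t by (rule test_fun_borel)
  have [measurable]: "pderiv_i \<phi> i \<in> borel_measurable borel" for i using test_fun_pderiv[OF t] by (rule test_fun_borel)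
  have Di: "integrable lborel (\<lambda>x. (Du x $ i)\<^sup>2)" for i
    by (rule Bochner_Integration.integrable_bound[OF D2]) 
       (auto intro!: AE_I2 simp: abs_le_square_iff[symmetric] component_le_norm_cart)
  have i1: "integrable lborel (\<lambda>x. u x * pderiv_i \<phi> i x)" for i
    by (intro integrable_mult_of_squares u2 test_fun_square_integrable test_fun_pderiv t) measurable
  have i2: "integrable lborel (\<lambda>x. Du x $ i * \<phi> x)" for i
    by (intro integrable_mult_of_squares Di test_fun_square_integrable t) measurable
  have "(\<integral>x. u x * (h \<bullet> grad \<phi> x) \<partial>lborel) = (\<integral>x. (\<Sum>i\<in>UNIV. h $ i * (u x * pderiv_i \<phi> i x)) \<partial>lborel)"
    by (simp add: inner_vec_def grad_def sum_distrib_left mult_ac)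
  also have "\<dots> = (\<Sum>i\<in>UNIV. h $ i * (\<integral>x. u x * pderiv_i \<phi> i x \<partial>lborel))"
    using i1 by (simp add: Bochner_Integration.integral_sum)
  also have "\<dots> = (\<Sum>i\<in>UNIV. h $ i * (- (\<integral>x. Du x $ i * \<phi> x \<partial>lborel)))"
    using w t unfolding weak_grad_def by simp
  also have "\<dots> = - (\<integral>x. (\<Sum>i\<in>UNIV. h $ i * (Du x $ i * \<phi> x)) \<partial>lborel)"
    using i2 by (simp add: Bochner_Integration.integral_sum sum_negf)
  also have "\<dots> = - (\<integral>x. (Du x \<bullet> h) * \<phi> x \<partial>lborel)"
    by (simp add: inner_vec_def sum_distrib_left mult_ac)
  finally show ?thesis .
qed

text \<open>The input for Fubini along segments: 2 |V \<psi>| \<le> V^2 + \<psi>^2 and translation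
  invariance bound the integral over x uniformly in t.\<close>

lemma integrable_line_product:
  fixes V \<psi> :: "real^'n \<Rightarrow> real"
  assumes [measurable]: "V \<in> borel_measurable borel" "\<psi> \<in> borel_measurable borel"
    and V2: "integrable lborel (\<lambda>x. (V x)\<^sup>2)" and p2: "integrable lborel (\<lambda>x. (\<psi> x)\<^sup>2)"
  shows "integrable (lborel \<Otimes>\<^sub>M lborel) (\<lambda>(t::real, x). indicator {0..1} t * V (x + t *\<^sub>R h) * \<psi> x)"
proof (rule lborel_pair.Fubini_integrable)
  show "(\<lambda>(t::real, x). indicator {0..1} t * V (x + t *\<^sub>R h) * \<psi> x) \<in> borel_measurable (lborel \<Otimes>\<^sub>M lborel)"
    by measurable
  have Vt: "integrable lborel (\<lambda>x. (V (x + t *\<^sub>R h))\<^sup>2)" for t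
    using V2 integrable_lborel_shift[of "\<lambda>x. (V x)\<^sup>2" "t *\<^sub>R h"] by simp
  have It: "integrable lborel (\<lambda>x. V (x + t *\<^sub>R h) * \<psi> x)" for t
    by (intro integrable_mult_of_squares Vt p2; measurable)
  have bnd: "(\<integral>x. norm (V (x + t *\<^sub>R h) * \<psi> x) \<partial>lborel) \<le> (\<integral>x. (V x)\<^sup>2 \<partial>lborel) + (\<integral>x. (\<psi> x)\<^sup>2 \<partial>lborel)" for t
  proof -
    have "(\<integral>x. norm (V (x + t *\<^sub>R h) * \<psi> x) \<partial>lborel) \<le> (\<integral>x. (V (x + t *\<^sub>R h))\<^sup>2 + (\<psi> x)\<^sup>2 \<partial>lborel)"
    proof (rule integral_mono)
      fix x
      have "2 * (\<bar>V (x + t *\<^sub>R h)\<bar> * \<bar>\<psi> x\<bar>) \<le> \<bar>V (x + t *\<^sub>R h)\<bar>\<^sup>2 + \<bar>\<psi> x\<bar>\<^sup>2" 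
        by (rule sum_squares_bound[of "\<bar>V (x + t *\<^sub>R h)\<bar>" "\<bar>\<psi> x\<bar>", simplified mult.assoc])
      moreover have "0 \<le> \<bar>V (x + t *\<^sub>R h)\<bar> * \<bar>\<psi> x\<bar>" by simp
      ultimately show "norm (V (x + t *\<^sub>R h) * \<psi> x) \<le> (V (x + t *\<^sub>R h))\<^sup>2 + (\<psi> x)\<^sup>2" unfolding real_norm_def abs_mult power2_abs by linarith
    qed (use It Vt p2 in auto)
    also have "\<dots> = (\<integral>x. (V x)\<^sup>2 \<partial>lborel) + (\<integral>x. (\<psi> x)\<^sup>2 \<partial>lborel)"
      using Vt p2 integral_lborel_shift[of "\<lambda>x. (V x)\<^sup>2" "t *\<^sub>R h"] by simp
    finally show ?thesis .
  qed
  let ?C = "(\<integral>x. (V x)\<^sup>2 \<partial>lborel) + (\<integral>x. (\<psi> x)\<^sup>2 \<partial>lborel)"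
  have m: "(\<lambda>t::real. (\<integral>x. norm (indicator {0..1} t * V (x + t *\<^sub>R h) * \<psi> x) \<partial>lborel)) \<in> borel_measurable lborel"
    by measurable
  have e: "(\<integral>x. norm (indicator {0..1} t * V (x + t *\<^sub>R h) * \<psi> x) \<partial>lborel) = 
      indicator {0..1} t * (\<integral>x. norm (V (x + t *\<^sub>R h) * \<psi> x) \<partial>lborel)" for t :: real
    by (simp add: abs_mult mult.assoc)
  show "integrable lborel (\<lambda>t::real. \<integral>x. norm (case (t, x) of (t, x) \<Rightarrow> indicator {0..1} t * V (x + t *\<^sub>R h) * \<psi> x) \<partial>lborel)"
    unfolding prod.case
  proof (rule Bochner_Integration.integrable_bound)
    show "integrable lborel (\<lambda>t::real. ?C * indicator {0..1} t)" by simp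
    show "AE t in lborel. norm (\<integral>x. norm (indicator {0..1} t * V (x + t *\<^sub>R h) * \<psi> x) \<partial>lborel) \<le> norm (?C * indicator {0..1} t)"
      unfolding e using bnd by (auto intro!: AE_I2 simp: indicator_def integral_nonneg_AE)
  qed (rule m)
  show "AE t::real in lborel. integrable lborel (\<lambda>x. case (t, x) of (t, x) \<Rightarrow> indicator {0..1} t * V (x + t *\<^sub>R h) * \<psi> x)"
    using It by (auto intro!: AE_I2 simp: mult.assoc)
qed

lemma grad_translate:
  assumes "smooth_fun \<phi>" shows "grad (\<lambda>x. \<phi> (x + d)) x = grad \<phi> (x + d)"
  using pderiv_i_affine[of \<phi> 1 x d] smooth_fun_differentiable[OF assms] by (simp add: grad_def)

lemma test_fun_translate: "test_fun \<phi> \<Longrightarrow> test_fun (\<lambda>x. \<phi> (x + d))"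
  using test_fun_affine[of \<phi> 1 1 d] by simp

lemma grad_line_derivative:
  assumes "smooth_fun \<phi>"
  shows "((\<lambda>t. \<phi> (x + t *\<^sub>R h)) has_real_derivative (h \<bullet> grad \<phi> (x + t *\<^sub>R h))) (at t)"
proof -
  have "((\<lambda>t. \<phi> (x + t *\<^sub>R h)) has_derivative (\<lambda>s. \<Sum>i\<in>UNIV. (s *\<^sub>R h) $ i * pderiv_i \<phi> i (x + t *\<^sub>R h))) (at t)"
    by (rule has_derivative_compose[OF _ has_derivative_pderiv_i[OF smooth_fun_differentiable[OF assms]]])
       (auto intro!: derivative_eq_intros)
  moreover have "(\<lambda>s. \<Sum>i\<in>UNIV. (s *\<^sub>R h) $ i * pderiv_i \<phi> i (x + t *\<^sub>R h)) = (*) (h \<bullet> grad \<phi> (x + t *\<^sub>R h))"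
    by (auto simp: fun_eq_iff inner_vec_def grad_def sum_distrib_right sum_distrib_left mult_ac)
  ultimately show ?thesis by (simp add: has_field_derivative_def)
qed

lemma grad_continuous: assumes "smooth_fun \<phi>" shows "continuous_on UNIV (grad \<phi>)"
  unfolding grad_def
  by (intro continuous_on_vec_lambda smooth_fun_continuous smooth_fun_pderiv_i assms)

lemma grad_borel [measurable_dest]: "smooth_fun \<phi> \<Longrightarrow> grad \<phi> \<in> borel_measurable borel"
  by (intro borel_measurable_continuous_onI grad_continuous)

lemma test_fun_grad_square_integrable:
  assumes t: "test_fun \<phi>" shows "integrable lborel (\<lambda>x. (h \<bullet> grad \<phi> x)\<^sup>2)"
proof -
  have [measurable]: "grad \<phi> \<in> borel_measurable borel" using grad_borel test_fun_smooth t by blast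
  obtain R B where RB: "B > 0" "\<And>x. norm (grad \<phi> x) \<le> B * indicator (cball 0 R) x"
    using test_fun_grad_bound[OF t] by metis
  show ?thesis
  proof (rule Bochner_Integration.integrable_bound)
    show "integrable lborel (\<lambda>x. (norm h * B)\<^sup>2 * indicator (cball (0::real^'n) R) x)"
      using emeasure_bounded_finite[OF bounded_cball, of "0::real^'n" R] by simp
    show "AE x in lborel. norm ((h \<bullet> grad \<phi> x)\<^sup>2) \<le> norm ((norm h * B)\<^sup>2 * indicator (cball 0 R) x)"
    proof (rule AE_I2)
      fix x
      have "\<bar>h \<bullet> grad \<phi> x\<bar> \<le> norm h * (B * indicator (cball 0 R) x)"
        by (rule order_trans[OF Cauchy_Schwarz_ineq2]) (intro mult_left_mono RB norm_ge_zero)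
      then have "\<bar>h \<bullet> grad \<phi> x\<bar>\<^sup>2 \<le> (norm h * (B * indicator (cball 0 R) x))\<^sup>2"
        by (rule power_mono) simp
      then show "norm ((h \<bullet> grad \<phi> x)\<^sup>2) \<le> norm ((norm h * B)\<^sup>2 * indicator (cball 0 R) x)"
        by (auto simp: power_mult_distrib indicator_def split: if_splits)
    qed
  qed measurable
qed

text \<open>The fundamental theorem of calculus along \<open>h\<close> is clear for test functions
  and reaches \<open>u\<close> by duality. Tested against \<phi>, the right-hand side becomes, by
  Fubini, a translation and the definition of the weak gradient, an integral of u against
  directional derivatives of \<phi>; integrating these in t gives \<phi>(x - h) - \<phi>(x), and
  shifting back moves the difference onto u.\<close>

lemma weak_grad_line:
  fixes u :: "real^'n \<Rightarrow> real"
  assumes w: "weak_grad u Du"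
    and [measurable]: "u \<in> borel_measurable borel" "Du \<in> borel_measurable borel"
    and u2: "integrable lborel (\<lambda>x. (u x)\<^sup>2)" and D2: "integrable lborel (\<lambda>x. (norm (Du x))\<^sup>2)"
  shows "AE x in lborel. u (x + h) - u x = (\<integral>t. indicator {0..1} t * (Du (x + t *\<^sub>R h) \<bullet> h) \<partial>lborel)"
proof -
  define V where "V x = Du x \<bullet> h" for x
  have [measurable]: "V \<in> borel_measurable borel" unfolding V_def by measurable
  define I where "I x = (\<integral>t. indicator {0..1} t * V (x + t *\<^sub>R h) \<partial>lborel)" for x
  have [measurable]: "I \<in> borel_measurable borel" unfolding I_def by measurable
  have V2: "integrable lborel (\<lambda>x. (V x)\<^sup>2)"
  proof (rule Bochner_Integration.integrable_bound)
    show "integrable lborel (\<lambda>x. (norm (Du x))\<^sup>2 * (norm h)\<^sup>2)" using D2 by simp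
    show "AE x in lborel. norm ((V x)\<^sup>2) \<le> norm ((norm (Du x))\<^sup>2 * (norm h)\<^sup>2)"
      unfolding V_def power_mult_distrib[symmetric]
      by (auto intro!: AE_I2 simp: abs_le_square_iff[symmetric] abs_mult Cauchy_Schwarz_ineq2)
  qed measurable
  have int_I: "integrable lborel (\<lambda>x. I x * \<psi> x)"
    and Fub: "(\<integral>x. I x * \<psi> x \<partial>lborel) = (\<integral>t. indicator {0..1} t * (\<integral>x. V (x + t *\<^sub>R h) * \<psi> x \<partial>lborel) \<partial>lborel)"
    if [measurable]: "\<psi> \<in> borel_measurable borel" and p2: "integrable lborel (\<lambda>x. (\<psi> x)\<^sup>2)" for \<psi>
  proof -
    note ip = integrable_line_product[OF \<open>V \<in> _\<close> that(1) V2 p2, of h]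
    have e: "I x * \<psi> x = (\<integral>t. indicator {0..1} t * V (x + t *\<^sub>R h) * \<psi> x \<partial>lborel)" for x
      unfolding I_def by simp
    show "integrable lborel (\<lambda>x. I x * \<psi> x)" unfolding e by (rule lborel_pair.integrable_snd[OF ip])
    have "(\<integral>x. I x * \<psi> x \<partial>lborel) = (\<integral>t. (\<integral>x. indicator {0..1} t * V (x + t *\<^sub>R h) * \<psi> x \<partial>lborel) \<partial>lborel)"
      unfolding e by (rule lborel_pair.Fubini_integral[OF ip])
    then show "(\<integral>x. I x * \<psi> x \<partial>lborel) = (\<integral>t. indicator {0..1} t * (\<integral>x. V (x + t *\<^sub>R h) * \<psi> x \<partial>lborel) \<partial>lborel)"
      by (simp add: mult.assoc)
  qed
  have uh2: "integrable lborel (\<lambda>x. (u (x + h))\<^sup>2)"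
    using u2 integrable_lborel_shift[of "\<lambda>x. (u x)\<^sup>2" h] by simp
  have "AE x in lborel. u (x + h) - u x - I x = 0"
  proof (rule fundamental_lemma)
    fix R
    let ?i = "indicator (cball (0::real^'n) R) :: _ \<Rightarrow> real"
    have i2: "integrable lborel (\<lambda>x. (?i x)\<^sup>2)"
      using emeasure_bounded_finite[OF bounded_cball, of "0::real^'n" R] by (simp add: power2_eq_square indicator_inter_arith[symmetric])
    have [measurable]: "?i \<in> borel_measurable borel" by (rule borel_measurable_indicator) simp
    have "integrable lborel (\<lambda>x. u (x + h) * ?i x)" "integrable lborel (\<lambda>x. u x * ?i x)"
      by (rule integrable_mult_of_squares[OF _ _ uh2 i2] integrable_mult_of_squares[OF _ _ u2 i2]; measurable)+
    moreover have "integrable lborel (\<lambda>x. I x * ?i x)"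
      by (rule int_I[OF _ i2]) measurable
    ultimately have "integrable lborel (\<lambda>x. u (x + h) * ?i x - u x * ?i x - I x * ?i x)"
      by simp
    then show "integrable lborel (\<lambda>x. ?i x * (u (x + h) - u x - I x))" by (simp add: algebra_simps)
  next
    fix \<phi> :: "real^'n \<Rightarrow> real" assume t: "test_fun \<phi>"
    have [measurable]: "\<phi> \<in> borel_measurable borel" "grad \<phi> \<in> borel_measurable borel"
      using t by (auto intro: test_fun_borel grad_borel test_fun_smooth)
    note p2 = test_fun_square_integrable[OF t]
    have i1: "integrable lborel (\<lambda>x. u (x + h) * \<phi> x)" "integrable lborel (\<lambda>x. u x * \<phi> x)"
      by (intro integrable_mult_of_squares uh2 u2 p2; measurable)+
    have "(\<integral>x. I x * \<phi> x \<partial>lborel) = (\<integral>t. indicator {0..1} t * (\<integral>x. V (x + t *\<^sub>R h) * \<phi> x \<partial>lborel) \<partial>lborel)"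
      by (rule Fub[OF _ p2]) measurable
    \<comment> \<open>For fixed t the translation by t h moves onto \<phi>, and the translated
      \<phi> is a legitimate test function for the weak gradient.\<close>
    also have "\<dots> = (\<integral>t. (\<integral>x. indicator {0..1} t * - (h \<bullet> grad \<phi> (x + t *\<^sub>R (- h))) * u x \<partial>lborel) \<partial>lborel)"
    proof (rule Bochner_Integration.integral_cong[OF refl])
      fix t :: real
      have "(\<integral>x. V (x + t *\<^sub>R h) * \<phi> x \<partial>lborel) = (\<integral>x. V x * \<phi> (x + - (t *\<^sub>R h)) \<partial>lborel)"
        using integral_lborel_shift[of "\<lambda>x. V x * \<phi> (x + - (t *\<^sub>R h))" "t *\<^sub>R h"] by simp
      also have "\<dots> = - (\<integral>x. u x * (h \<bullet> grad (\<lambda>x. \<phi> (x + - (t *\<^sub>R h))) x) \<partial>lborel)"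
        using weak_grad_directional[OF w _ _ u2 D2 test_fun_translate[OF t, of "- (t *\<^sub>R h)"], of h] by (simp add: V_def)
      also have "\<dots> = - (\<integral>x. (h \<bullet> grad \<phi> (x + t *\<^sub>R (- h))) * u x \<partial>lborel)"
        by (simp only: grad_translate[OF test_fun_smooth[OF t]]) (simp add: mult.commute)
      finally show "indicator {0..1} t * (\<integral>x. V (x + t *\<^sub>R h) * \<phi> x \<partial>lborel) =
          (\<integral>x. indicator {0..1} t * - (h \<bullet> grad \<phi> (x + t *\<^sub>R (- h))) * u x \<partial>lborel)"
        by (simp add: mult.assoc)
    qed
    also have "\<dots> = (\<integral>x. (\<integral>t. indicator {0..1} t * - (h \<bullet> grad \<phi> (x + t *\<^sub>R (- h))) * u x \<partial>lborel) \<partial>lborel)"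
    proof (rule lborel_pair.Fubini_integral[symmetric])
      show "integrable (lborel \<Otimes>\<^sub>M lborel) (\<lambda>(t::real, x). indicator {0..1} t * - (h \<bullet> grad \<phi> (x + t *\<^sub>R (- h))) * u x)"
        using integrable_line_product[of "\<lambda>x. - (h \<bullet> grad \<phi> x)" u "- h"] test_fun_grad_square_integrable[OF t, of h] u2 by simp
    qed
    \<comment> \<open>For fixed x the integrand in t is the derivative of \<phi> along the segment
      from x to x - h.\<close>
    also have "\<dots> = (\<integral>x. (\<phi> (x - h) - \<phi> x) * u x \<partial>lborel)"
    proof (rule Bochner_Integration.integral_cong[OF refl])
      fix x
      have d: "((\<lambda>t. \<phi> (x + t *\<^sub>R (- h))) has_real_derivative (- (h \<bullet> grad \<phi> (x + t *\<^sub>R (- h))))) (at t)" for t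
        using grad_line_derivative[OF test_fun_smooth[OF t], of x "- h"] by simp
      have c: "isCont (\<lambda>t. - (h \<bullet> grad \<phi> (x + t *\<^sub>R (- h)))) t" for t
        using grad_continuous[OF test_fun_smooth[OF t]]
        by (intro continuous_intros isCont_o2[of t "\<lambda>t. x + t *\<^sub>R (- h)" "grad \<phi>"]) (auto simp: continuous_on_eq_continuous_at)
      have "(\<integral>t. - (h \<bullet> grad \<phi> (x + t *\<^sub>R (- h))) * indicator {0..1} t \<partial>lborel) = \<phi> (x + 1 *\<^sub>R (- h)) - \<phi> (x + 0 *\<^sub>R (- h))"
        by (rule integral_FTC_Icc_real) (use d c in auto)
      then have F: "(\<integral>t. - (h \<bullet> grad \<phi> (x + t *\<^sub>R (- h))) * indicator {0..1} t \<partial>lborel) = \<phi> (x - h) - \<phi> x" by simp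
      have "(\<integral>t. indicator {0..1} t * - (h \<bullet> grad \<phi> (x + t *\<^sub>R (- h))) * u x \<partial>lborel)
        = (\<integral>t. - (h \<bullet> grad \<phi> (x + t *\<^sub>R (- h))) * indicator {0..1} t * u x \<partial>lborel)"
        by (simp only: mult.commute[of "indicator {0..1} _"])
      also have "\<dots> = (\<integral>t. - (h \<bullet> grad \<phi> (x + t *\<^sub>R (- h))) * indicator {0..1} t \<partial>lborel) * u x"
        by (rule integral_mult_left_zero)
      finally show "(\<integral>t. indicator {0..1} t * - (h \<bullet> grad \<phi> (x + t *\<^sub>R (- h))) * u x \<partial>lborel) = (\<phi> (x - h) - \<phi> x) * u x"
        unfolding F .
    qed
    also have "\<dots> = (\<integral>x. u x * \<phi> (x - h) \<partial>lborel) - (\<integral>x. u x * \<phi> x \<partial>lborel)"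
    proof -
      have "integrable lborel (\<lambda>x. u x * \<phi> (x - h))"
        using i1(1) integrable_lborel_shift[of "\<lambda>x. u x * \<phi> (x - h)" h] by simp
      then show ?thesis using i1(2) by (simp add: algebra_simps)
    qed
    also have "(\<integral>x. u x * \<phi> (x - h) \<partial>lborel) = (\<integral>x. u (x + h) * \<phi> x \<partial>lborel)"
      using integral_lborel_shift[of "\<lambda>x. u x * \<phi> (x - h)" h] by simp
    finally show "(\<integral>x. (u (x + h) - u x - I x) * \<phi> x \<partial>lborel) = 0"
      using i1 int_I[OF _ p2] by (simp add: left_diff_distrib)
  qed measurable
  then show ?thesis by (rule AE_mp) (auto simp: I_def V_def)
qed

text \<open>Cauchy-Schwarz on the unit interval. If the integrand is not integrable, its integral is
  0 by convention and the bound is trivial.\<close>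

lemma segment_square_le:
  fixes z :: "real \<Rightarrow> real"
  assumes [measurable]: "z \<in> borel_measurable borel"
  shows "ennreal ((\<integral>t. indicator {0..1} t * z t \<partial>lborel)\<^sup>2) \<le> (\<integral>\<^sup>+t. indicator {0..1} t * ennreal ((z t)\<^sup>2) \<partial>lborel)"
proof (cases "integrable lborel (\<lambda>t. indicator {0..1} t * z t)")
  case True
  have "ennreal ((\<integral>t. indicator {0..1} t * z t \<partial>lborel)\<^sup>2) = (ennreal (norm (\<integral>t. indicator {0..1} t * z t \<partial>lborel)))\<^sup>2"
    by (simp add: ennreal_power)
  also have "\<dots> \<le> (\<integral>\<^sup>+t. norm (indicator {0..1} t * z t) \<partial>lborel)\<^sup>2"
    by (intro power_mono integral_norm_bound_ennreal True) simp
  also have "(\<integral>\<^sup>+t. norm (indicator {0..1} t * z t) \<partial>lborel) = (\<integral>\<^sup>+t. indicator {0..1} t * (indicator {0..1} t * ennreal \<bar>z t\<bar>) \<partial>lborel)"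
    by (intro nn_integral_cong) (auto simp: indicator_def)
  also have "\<dots>\<^sup>2 \<le> (\<integral>\<^sup>+t. (indicator {0..1::real} t)\<^sup>2 \<partial>lborel) * (\<integral>\<^sup>+t. (indicator {0..1} t * ennreal \<bar>z t\<bar>)\<^sup>2 \<partial>lborel)"
    by (rule Cauchy_Schwarz_nn_integral) measurable
  also have "(\<integral>\<^sup>+t. (indicator {0..1::real} t)\<^sup>2 \<partial>lborel) = (\<integral>\<^sup>+t. (indicator {0..1::real} t) \<partial>lborel)"
    by (intro nn_integral_cong) (auto simp: indicator_def)
  also have "\<dots> = 1" by simp
  also have "(\<integral>\<^sup>+t. (indicator {0..1} t * ennreal \<bar>z t\<bar>)\<^sup>2 \<partial>lborel) = (\<integral>\<^sup>+t. indicator {0..1} t * ennreal ((z t)\<^sup>2) \<partial>lborel)"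
    by (intro nn_integral_cong) (auto simp: indicator_def ennreal_power)
  finally show ?thesis by simp
qed (simp add: not_integrable_integral_eq)

text \<open>Cauchy-Schwarz in t, then Fubini: all translates of \<open>Z\<close> have the same L^2
  norm, so averaging over a segment of unit parameter length costs nothing.\<close>

lemma line_square_le:
  fixes f Z :: "real^'n \<Rightarrow> real"
  assumes [measurable]: "Z \<in> borel_measurable borel"
    and l: "AE x in lborel. f (x + h) - f x = (\<integral>t. indicator {0..1} t * Z (x + t *\<^sub>R h) \<partial>lborel)"
  shows "(\<integral>\<^sup>+x. ennreal ((f (x + h) - f x)\<^sup>2) \<partial>lborel) \<le> (\<integral>\<^sup>+x. ennreal ((Z x)\<^sup>2) \<partial>lborel)"
proof -
  have "(\<integral>\<^sup>+x. ennreal ((f (x + h) - f x)\<^sup>2) \<partial>lborel) \<le>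
     (\<integral>\<^sup>+x. (\<integral>\<^sup>+t. indicator {0..1} t * ennreal ((Z (x + t *\<^sub>R h))\<^sup>2) \<partial>lborel) \<partial>lborel)"
    using l by (intro nn_integral_mono_AE, eventually_elim) (simp add: segment_square_le)
  also have "\<dots> = (\<integral>\<^sup>+t. (\<integral>\<^sup>+x. indicator {0..1} t * ennreal ((Z (x + t *\<^sub>R h))\<^sup>2) \<partial>lborel) \<partial>lborel)"
    by (rule lborel_pair.Fubini') measurable
  also have "\<dots> = (\<integral>\<^sup>+t. indicator {0..1::real} t * (\<integral>\<^sup>+x. ennreal ((Z x)\<^sup>2) \<partial>lborel) \<partial>lborel)"
  proof (rule nn_integral_cong)
    fix t :: real
    have "(\<integral>\<^sup>+x. indicator {0..1} t * ennreal ((Z (x + t *\<^sub>R h))\<^sup>2) \<partial>lborel) =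
       indicator {0..1} t * (\<integral>\<^sup>+x. ennreal ((Z (x + t *\<^sub>R h))\<^sup>2) \<partial>lborel)"
      by (rule nn_integral_cmult) measurable
    then show "(\<integral>\<^sup>+x. indicator {0..1} t * ennreal ((Z (x + t *\<^sub>R h))\<^sup>2) \<partial>lborel) =
      indicator {0..1} t * (\<integral>\<^sup>+x. ennreal ((Z x)\<^sup>2) \<partial>lborel)"
      using nn_integral_lborel_shift[of "\<lambda>x. ennreal ((Z x)\<^sup>2)" "t *\<^sub>R h"] by simp
  qed
  also have "\<dots> = (\<integral>\<^sup>+x. ennreal ((Z x)\<^sup>2) \<partial>lborel)" by (simp add: nn_integral_multc)
  finally show ?thesis .
qed

section \<open>Difference quotients\<close>

text \<open>If V(s) denotes the integral of w up to s, this is the integral of (V^2)' = 2 w V, in a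
  form that makes sense for merely integrable w. The square is an integral over the plane; the
  triangles t \<le> s and s < t contribute equally by symmetry, the diagonal being null.\<close>

lemma square_of_primitive:
  fixes w :: "real \<Rightarrow> real"
  assumes w: "integrable lborel w"
  shows "(\<integral>x. w x \<partial>lborel)\<^sup>2 = 2 * (\<integral>s. w s * (\<integral>t. (if t \<le> s then w t else 0) \<partial>lborel) \<partial>lborel)"
proof -
  have [measurable]: "w \<in> borel_measurable borel" using w by simp
  have int: "integrable (lborel \<Otimes>\<^sub>M lborel) (\<lambda>(s, t). w s * (if P s t then w t else 0))"
    if m: "\<And>s. Measurable.pred borel (P s)"
      and meas: "(\<lambda>(s, t). w s * (if P s t then w t else 0)) \<in> borel_measurable (lborel \<Otimes>\<^sub>M lborel)"
    for P :: "real \<Rightarrow> real \<Rightarrow> bool"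
  proof (rule lborel_pair.Fubini_integrable)
    have i: "integrable lborel (\<lambda>t. if P s t then w t else 0)" for s
      by (rule Bochner_Integration.integrable_bound[OF w]) (use m[of s] in auto)
    show "(\<lambda>(s, t). w s * (if P s t then w t else 0)) \<in> borel_measurable (lborel \<Otimes>\<^sub>M lborel)" by (rule meas)
    show "AE s in lborel. integrable lborel (\<lambda>t. case (s, t) of (s, t) \<Rightarrow> w s * (if P s t then w t else 0))"
      using i by simp
    show "integrable lborel (\<lambda>s. \<integral>t. norm (case (s, t) of (s, t) \<Rightarrow> w s * (if P s t then w t else 0)) \<partial>lborel)"
    proof (rule Bochner_Integration.integrable_bound)
      show "integrable lborel (\<lambda>s. w s * (\<integral>t. \<bar>w t\<bar> \<partial>lborel))" using w by simp
      show "(\<lambda>s. \<integral>t. norm (case (s, t) of (s, t) \<Rightarrow> w s * (if P s t then w t else 0)) \<partial>lborel) \<in> borel_measurable lborel"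
      proof -
        have m2: "(\<lambda>(s, t). norm (w s * (if P s t then w t else 0))) \<in> borel_measurable (lborel \<Otimes>\<^sub>M lborel)"
          using measurable_compose[OF meas borel_measurable_norm] by (simp add: split_beta')
        show ?thesis unfolding prod.case by (rule lborel.borel_measurable_lebesgue_integral[OF m2])
      qed
      show "AE s in lborel. norm (\<integral>t. norm (case (s, t) of (s, t) \<Rightarrow> w s * (if P s t then w t else 0)) \<partial>lborel)
          \<le> norm (w s * (\<integral>t. \<bar>w t\<bar> \<partial>lborel))"
      proof (rule AE_I2)
        fix s
        have "(\<integral>t. \<bar>if P s t then w t else 0\<bar> \<partial>lborel) \<le> (\<integral>t. \<bar>w t\<bar> \<partial>lborel)"
          by (rule integral_mono) (use i[of s] w in auto)
        then show "norm (\<integral>t. norm (case (s, t) of (s, t) \<Rightarrow> w s * (if P s t then w t else 0)) \<partial>lborel)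
          \<le> norm (w s * (\<integral>t. \<bar>w t\<bar> \<partial>lborel))"
          by (simp add: abs_mult mult_left_mono integral_nonneg_AE)
      qed
    qed
  qed
  let ?A = "\<integral>s. w s * (\<integral>t. (if t \<le> s then w t else 0) \<partial>lborel) \<partial>lborel"
  have i1: "integrable (lborel \<Otimes>\<^sub>M lborel) (\<lambda>(s, t). w s * (if t \<le> s then w t else 0))"
    and i2: "integrable (lborel \<Otimes>\<^sub>M lborel) (\<lambda>(s, t). w s * (if s < t then w t else 0))"
    by (rule int; measurable)+
  have B: "(\<integral>s. w s * (\<integral>t. (if s < t then w t else 0) \<partial>lborel) \<partial>lborel) = ?A"
  proof -
    have "(\<integral>s. w s * (\<integral>t. (if s < t then w t else 0) \<partial>lborel) \<partial>lborel) = (\<integral>s. (\<integral>t. w s * (if s < t then w t else 0) \<partial>lborel) \<partial>lborel)"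
      by simp
    also have "\<dots> = (\<integral>t. (\<integral>s. w s * (if s < t then w t else 0) \<partial>lborel) \<partial>lborel)"
      by (rule lborel_pair.Fubini_integral[OF i2, symmetric])
    also have "\<dots> = (\<integral>t. w t * (\<integral>s. (if s \<le> t then w s else 0) \<partial>lborel) \<partial>lborel)"
    proof (rule Bochner_Integration.integral_cong[OF refl])
      fix t
      have "(\<integral>s. w s * (if s < t then w t else 0) \<partial>lborel) = (\<integral>s. w t * (if s \<le> t then w s else 0) \<partial>lborel)"
      proof (rule integral_cong_AE)
        show "AE s in lborel. w s * (if s < t then w t else 0) = w t * (if s \<le> t then w s else 0)"
          using AE_lborel_singleton[of t] by eventually_elim auto
      qed measurable
      then show "(\<integral>s. w s * (if s < t then w t else 0) \<partial>lborel) = w t * (\<integral>s. (if s \<le> t then w s else 0) \<partial>lborel)"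
        by simp
    qed
    finally show ?thesis .
  qed
  have int1: "integrable lborel (\<lambda>s. w s * (\<integral>t. (if t \<le> s then w t else 0) \<partial>lborel))"
    using lborel_pair.integrable_fst[OF i1] by simp
  have int2: "integrable lborel (\<lambda>s. w s * (\<integral>t. (if s < t then w t else 0) \<partial>lborel))"
    using lborel_pair.integrable_fst[OF i2] by simp
  have sp: "(\<integral>t. w t \<partial>lborel) = (\<integral>t. (if t \<le> s then w t else 0) \<partial>lborel) + (\<integral>t. (if s < t then w t else 0) \<partial>lborel)" for s
  proof -
    have "integrable lborel (\<lambda>t. if t \<le> s then w t else 0)" "integrable lborel (\<lambda>t. if s < t then w t else 0)"
      by (rule Bochner_Integration.integrable_bound[OF w]; auto)+
    then have "(\<integral>t. (if t \<le> s then w t else 0) \<partial>lborel) + (\<integral>t. (if s < t then w t else 0) \<partial>lborel) =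
      (\<integral>t. (if t \<le> s then w t else 0) + (if s < t then w t else 0) \<partial>lborel)" by simp
    also have "\<dots> = (\<integral>t. w t \<partial>lborel)" by (rule Bochner_Integration.integral_cong) auto
    finally show ?thesis by simp
  qed
  have "(\<integral>x. w x \<partial>lborel)\<^sup>2 = (\<integral>s. w s * (\<integral>x. w x \<partial>lborel) \<partial>lborel)" by (simp add: power2_eq_square)
  also have "\<dots> = (\<integral>s. w s * (\<integral>t. (if t \<le> s then w t else 0) \<partial>lborel) + w s * (\<integral>t. (if s < t then w t else 0) \<partial>lborel) \<partial>lborel)"
    by (intro Bochner_Integration.integral_cong refl) (subst sp, simp add: distrib_left)
  also have "\<dots> = ?A + ?A" using int1 int2 B by simp
  finally show ?thesis by simp
qed

text \<open>The chain rule D(u^2) = 2 u Du, proved on lines: along almost every line in direction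
  \<open>h\<close> the function u is an indefinite integral, and \<open>square_of_primitive\<close>
  squares it.\<close>

lemma weak_grad_square_line:
  fixes u :: "real^'n \<Rightarrow> real"
  assumes w: "weak_grad u Du"
    and [measurable]: "u \<in> borel_measurable borel" "Du \<in> borel_measurable borel"
    and u2: "integrable lborel (\<lambda>x. (u x)\<^sup>2)" and D2: "integrable lborel (\<lambda>x. (norm (Du x))\<^sup>2)"
  shows "AE x in lborel. (u (x + h))\<^sup>2 - (u x)\<^sup>2 =
    (\<integral>t. indicator {0..1} t * (2 * u (x + t *\<^sub>R h) * (Du (x + t *\<^sub>R h) \<bullet> h)) \<partial>lborel)"
proof -
  define V where "V x = Du x \<bullet> h" for x
  have [measurable]: "V \<in> borel_measurable borel" unfolding V_def by measurable
  have V2: "integrable lborel (\<lambda>x. (V x)\<^sup>2)"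
  proof (rule Bochner_Integration.integrable_bound)
    show "integrable lborel (\<lambda>x. (norm (Du x))\<^sup>2 * (norm h)\<^sup>2)" using D2 by simp
    show "AE x in lborel. norm ((V x)\<^sup>2) \<le> norm ((norm (Du x))\<^sup>2 * (norm h)\<^sup>2)"
      unfolding V_def power_mult_distrib[symmetric]
      by (auto intro!: AE_I2 simp: abs_le_square_iff[symmetric] abs_mult Cauchy_Schwarz_ineq2)
  qed measurable
  have P3: "AE x in lborel. integrable lborel (\<lambda>t::real. indicator {0..1} t * V (x + t *\<^sub>R h))"
  proof -
    \<comment> \<open>Integrability over the product space is available only after multiplication
      with a square-integrable function of x; indicators of balls of radius n serve, and they
      exhaust the space.\<close>
    have "AE x in lborel. integrable lborel (\<lambda>t::real. indicator {0..1} t * V (x + t *\<^sub>R h) * indicator (cball 0 (real n)) x)" for n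
    proof (rule lborel_pair.AE_integrable_snd, rule integrable_line_product[OF _ _ V2])
      show "integrable lborel (\<lambda>x::real^'n. (indicator (cball 0 (real n)) x :: real)\<^sup>2)"
        using emeasure_bounded_finite[OF bounded_cball, of "0::real^'n" "real n"]
        by (simp add: power2_eq_square indicator_inter_arith[symmetric])
    qed (auto intro: borel_measurable_indicator)
    then have "AE x in lborel. \<forall>n. integrable lborel (\<lambda>t::real. indicator {0..1} t * V (x + t *\<^sub>R h) * indicator (cball 0 (real n)) x)"
      unfolding AE_all_countable by (rule allI)
    then show ?thesis
    proof eventually_elim
      case (elim x)
      obtain n :: nat where "norm x \<le> real n" using real_arch_simple by blast
      then show ?case using elim[rule_format, of n] by simp
    qed
  qed
  have "AE x in lborel. u (x + s *\<^sub>R h) = u x + (\<integral>t. (if t \<le> s then indicator {0..1} t * V (x + t *\<^sub>R h) else 0) \<partial>lborel)"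
    if s: "s \<in> {0..1}" for s
    using weak_grad_line[OF w assms(2,3) u2 D2, of "s *\<^sub>R h"]
  proof eventually_elim
    case (elim x)
    have "(\<integral>t. indicator {0..1} t * (Du (x + t *\<^sub>R (s *\<^sub>R h)) \<bullet> (s *\<^sub>R h)) \<partial>lborel) =
       (\<integral>t. (if t \<le> s then indicator {0..1} t * V (x + t *\<^sub>R h) else 0) \<partial>lborel)"
    proof (cases "s = 0")
      case True
      have "(\<integral>t. (if t \<le> 0 then indicator {0..1} t * V (x + t *\<^sub>R h) else 0) \<partial>lborel) = (\<integral>(t::real). 0 \<partial>lborel)"
      proof (rule integral_cong_AE)
        show "AE t in lborel. (if t \<le> 0 then indicator {0..1} t * V (x + t *\<^sub>R h) else 0) = 0"
          using AE_lborel_singleton[of "0::real"] by eventually_elim (auto simp: indicator_def)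
      qed measurable
      then show ?thesis using True by simp
    next
      case False
      then have "s > 0" using s by simp
      have "(\<integral>t. (if t \<le> s then indicator {0..1} t * V (x + t *\<^sub>R h) else 0) \<partial>lborel) =
        \<bar>s\<bar> ^ DIM(real) * (\<integral>t. (if 0 + s *\<^sub>R t \<le> s then indicator {0..1} (0 + s *\<^sub>R t) * V (x + (0 + s *\<^sub>R t) *\<^sub>R h) else 0) \<partial>lborel)"
        by (rule integral_lborel_affine) (use False in simp_all)
      also have "\<dots> = (\<integral>t. s * (if s * t \<le> s then indicator {0..1} (s * t) * V (x + (s * t) *\<^sub>R h) else 0) \<partial>lborel)"
        using \<open>s > 0\<close> by (simp cong: if_cong)
      also have "\<dots> = (\<integral>t. indicator {0..1} t * (Du (x + t *\<^sub>R (s *\<^sub>R h)) \<bullet> (s *\<^sub>R h)) \<partial>lborel)"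
        using \<open>s > 0\<close> s by (intro Bochner_Integration.integral_cong refl)
          (auto simp: V_def indicator_def mult_le_cancel_left1 mult.commute zero_le_mult_iff mult_le_one)
      finally show ?thesis by simp
    qed
    then show ?case using elim by simp
  qed
  then have "AE s in lborel. AE x in lborel. s \<in> {0..1} \<longrightarrow>
     u (x + s *\<^sub>R h) = u x + (\<integral>t. (if t \<le> s then indicator {0..1} t * V (x + t *\<^sub>R h) else 0) \<partial>lborel)"
    by (auto intro!: AE_I2)
  \<comment> \<open>The exceptional set of starting points depends on s. Exchanging the two
    quantifiers by Fubini gives the formula on almost every line for almost every s at once.\<close>
  then have P2: "AE x in lborel. AE s in lborel. s \<in> {0..1} \<longrightarrow>
     u (x + s *\<^sub>R h) = u x + (\<integral>t. (if t \<le> s then indicator {0..1} t * V (x + t *\<^sub>R h) else 0) \<partial>lborel)"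
    by (subst lborel_pair.AE_commute) measurable
  show ?thesis
    using P2 P3 weak_grad_line[OF w assms(2,3) u2 D2, of h]
  proof eventually_elim
    case (elim x)
    define v where "v t = indicator {0..1} t * V (x + t *\<^sub>R h)" for t :: real
    have [measurable]: "v \<in> borel_measurable borel" unfolding v_def by measurable
    have iv: "integrable lborel v" using elim(2) by (simp add: v_def[abs_def])
    have e3: "u (x + h) = u x + (\<integral>t. v t \<partial>lborel)" using elim(3) by (simp add: v_def V_def)
    have "(\<integral>t. indicator {0..1} t * (2 * u (x + t *\<^sub>R h) * (Du (x + t *\<^sub>R h) \<bullet> h)) \<partial>lborel) =
      (\<integral>s. 2 * u x * v s + 2 * (v s * (\<integral>t. (if t \<le> s then v t else 0) \<partial>lborel)) \<partial>lborel)"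
    proof (rule integral_cong_AE)
      show "AE t in lborel. indicator {0..1} t * (2 * u (x + t *\<^sub>R h) * (Du (x + t *\<^sub>R h) \<bullet> h)) =
        2 * u x * v t + 2 * (v t * (\<integral>s. (if s \<le> t then v s else 0) \<partial>lborel))"
        using elim(1)
      proof eventually_elim
        case (elim t)
        then have "t \<in> {0..1} \<Longrightarrow> u (x + t *\<^sub>R h) = u x + (\<integral>s. (if s \<le> t then v s else 0) \<partial>lborel)"
          by (simp only: v_def)
        moreover have "v t = indicator {0..1} t * (Du (x + t *\<^sub>R h) \<bullet> h)" by (simp add: v_def V_def)
        ultimately show ?case by (cases "t \<in> {0..1}") (simp_all add: algebra_simps)
      qed
    qed measurable
    also have "\<dots> = (\<integral>s. 2 * u x * v s \<partial>lborel) + (\<integral>s. 2 * (v s * (\<integral>t. (if t \<le> s then v t else 0) \<partial>lborel)) \<partial>lborel)"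
    proof (rule Bochner_Integration.integral_add)
      show "integrable lborel (\<lambda>s. 2 * (v s * (\<integral>t. (if t \<le> s then v t else 0) \<partial>lborel)))"
      proof (rule Bochner_Integration.integrable_bound)
        show "integrable lborel (\<lambda>s. 2 * (v s * (\<integral>t. \<bar>v t\<bar> \<partial>lborel)))" using iv by simp
        show "AE s in lborel. norm (2 * (v s * (\<integral>t. (if t \<le> s then v t else 0) \<partial>lborel))) \<le> norm (2 * (v s * (\<integral>t. \<bar>v t\<bar> \<partial>lborel)))"
        proof (rule AE_I2)
          fix s
          have "\<bar>\<integral>t. (if t \<le> s then v t else 0) \<partial>lborel\<bar> \<le> (\<integral>t. norm (if t \<le> s then v t else 0) \<partial>lborel)"
            using integral_norm_bound[of lborel "\<lambda>t. if t \<le> s then v t else 0"] by simp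
          also have "\<dots> \<le> (\<integral>t. \<bar>v t\<bar> \<partial>lborel)"
          proof (rule integral_mono)
            show "integrable lborel (\<lambda>t. norm (if t \<le> s then v t else 0))"
              by (rule Bochner_Integration.integrable_bound[OF iv]) auto
          qed (use iv in auto)
          finally show "norm (2 * (v s * (\<integral>t. (if t \<le> s then v t else 0) \<partial>lborel))) \<le> norm (2 * (v s * (\<integral>t. \<bar>v t\<bar> \<partial>lborel)))"
            by (simp add: abs_mult mult_left_mono)
        qed
      qed measurable
    qed (use iv in simp)
    also have "\<dots> = 2 * u x * (\<integral>t. v t \<partial>lborel) + (\<integral>t. v t \<partial>lborel)\<^sup>2"
      using square_of_primitive[OF iv] by simp
    also have "\<dots> = (u (x + h))\<^sup>2 - (u x)\<^sup>2" unfolding e3 by (simp add: power2_eq_square algebra_simps)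
    finally show ?case by simp
  qed
qed

text \<open>\<open>K\<close> stands for a bound on the Dirichlet integral of \<open>f\<close>. The
  form by differences applies directly to u^2, whose increments are controlled by
  \<open>weak_grad_square_line\<close>.\<close>

definition diff_bound :: "real \<Rightarrow> ('a::euclidean_space \<Rightarrow> real) \<Rightarrow> bool" where
  "diff_bound K f \<longleftrightarrow> (\<forall>h. (\<integral>\<^sup>+x. ennreal ((f (x + h) - f x)\<^sup>2) \<partial>lborel) \<le> ennreal ((norm h)\<^sup>2 * K))"

lemma diff_bound_weak_grad:
  fixes u :: "real^'n \<Rightarrow> real"
  assumes w: "weak_grad u Du"
    and [measurable]: "u \<in> borel_measurable borel" "Du \<in> borel_measurable borel"
    and u2: "integrable lborel (\<lambda>x. (u x)\<^sup>2)" and D2: "integrable lborel (\<lambda>x. (norm (Du x))\<^sup>2)"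
  shows "diff_bound (\<integral>x. (norm (Du x))\<^sup>2 \<partial>lborel) u"
  unfolding diff_bound_def
proof
  fix h
  have "(\<integral>\<^sup>+x. ennreal ((u (x + h) - u x)\<^sup>2) \<partial>lborel) \<le> (\<integral>\<^sup>+x. ennreal ((Du x \<bullet> h)\<^sup>2) \<partial>lborel)"
    by (rule line_square_le[OF _ weak_grad_line[OF w _ _ u2 D2]]) measurable
  also have "\<dots> \<le> (\<integral>\<^sup>+x. ennreal ((norm h)\<^sup>2 * (norm (Du x))\<^sup>2) \<partial>lborel)"
    unfolding power_mult_distrib[symmetric]
    by (intro nn_integral_mono ennreal_leI) (simp add: abs_le_square_iff[symmetric] abs_mult Cauchy_Schwarz_ineq2 mult.commute[of "norm h"])
  also have "\<dots> = ennreal (\<integral>x. (norm h)\<^sup>2 * (norm (Du x))\<^sup>2 \<partial>lborel)"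
    by (rule nn_integral_eq_integral) (use D2 in auto)
  finally show "(\<integral>\<^sup>+x. ennreal ((u (x + h) - u x)\<^sup>2) \<partial>lborel) \<le> ennreal ((norm h)\<^sup>2 * (\<integral>x. (norm (Du x))\<^sup>2 \<partial>lborel))"
    by simp
qed

text \<open>The factor 4 is that of |D(u^2)|^2 = 4 u^2 |Du|^2.\<close>

lemma diff_bound_weak_grad_square:
  fixes u :: "real^'n \<Rightarrow> real"
  assumes w: "weak_grad u Du"
    and [measurable]: "u \<in> borel_measurable borel" "Du \<in> borel_measurable borel"
    and u2: "integrable lborel (\<lambda>x. (u x)\<^sup>2)" and D2: "integrable lborel (\<lambda>x. (norm (Du x))\<^sup>2)"
    and uD2: "integrable lborel (\<lambda>x. (u x)\<^sup>2 * (norm (Du x))\<^sup>2)"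
  shows "diff_bound (4 * (\<integral>x. (u x)\<^sup>2 * (norm (Du x))\<^sup>2 \<partial>lborel)) (\<lambda>x. (u x)\<^sup>2)"
  unfolding diff_bound_def
proof
  fix h
  have "(\<integral>\<^sup>+x. ennreal (((u (x + h))\<^sup>2 - (u x)\<^sup>2)\<^sup>2) \<partial>lborel) \<le> (\<integral>\<^sup>+x. ennreal ((2 * u x * (Du x \<bullet> h))\<^sup>2) \<partial>lborel)"
    by (rule line_square_le[OF _ weak_grad_square_line[OF w _ _ u2 D2]]) measurable
  also have "\<dots> \<le> (\<integral>\<^sup>+x. ennreal ((norm h)\<^sup>2 * 4 * ((u x)\<^sup>2 * (norm (Du x))\<^sup>2)) \<partial>lborel)"
  proof (intro nn_integral_mono ennreal_leI)
    fix x
    have "(Du x \<bullet> h)\<^sup>2 \<le> (norm (Du x))\<^sup>2 * (norm h)\<^sup>2"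
      unfolding power_mult_distrib[symmetric] by (simp add: abs_le_square_iff[symmetric] abs_mult Cauchy_Schwarz_ineq2)
    then have "4 * (u x)\<^sup>2 * (Du x \<bullet> h)\<^sup>2 \<le> 4 * (u x)\<^sup>2 * ((norm (Du x))\<^sup>2 * (norm h)\<^sup>2)"
      by (intro mult_left_mono) auto
    then show "(2 * u x * (Du x \<bullet> h))\<^sup>2 \<le> (norm h)\<^sup>2 * 4 * ((u x)\<^sup>2 * (norm (Du x))\<^sup>2)"
      by (simp add: power_mult_distrib mult_ac)
  qed
  also have "\<dots> = ennreal (\<integral>x. (norm h)\<^sup>2 * 4 * ((u x)\<^sup>2 * (norm (Du x))\<^sup>2) \<partial>lborel)"
    by (rule nn_integral_eq_integral) (use uD2 in auto)
  finally show "(\<integral>\<^sup>+x. ennreal (((u (x + h))\<^sup>2 - (u x)\<^sup>2)\<^sup>2) \<partial>lborel)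
      \<le> ennreal ((norm h)\<^sup>2 * (4 * (\<integral>x. (u x)\<^sup>2 * (norm (Du x))\<^sup>2 \<partial>lborel)))"
    by (simp add: mult.assoc)
qed

section \<open>A Nash inequality by averaging over small cubes\<close>

lemma emeasure_Q:
  assumes "0 \<le> r" shows "emeasure lborel (Q r :: (real^'n) set) = ennreal ((2 * r) ^ CARD('n))"
proof -
  have ne: "cbox (\<chi> i. - r) (\<chi> i. r) \<noteq> ({} :: (real^'n) set)"
    using assms by (auto simp: interval_ne_empty_cart)
  have "measure lborel (Q r :: (real^'n) set) = (2 * r) ^ CARD('n)"
    unfolding Q_cbox content_cbox_cart[OF ne] by simp
  moreover have "emeasure lborel (Q r :: (real^'n) set) = ennreal (measure lborel (Q r :: (real^'n) set))"
    by (rule emeasure_eq_ennreal_measure) (metis Q_cbox emeasure_lborel_cbox_finite less_irrefl infinity_ennreal_def)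
  ultimately show ?thesis by simp
qed

lemma nn_integral_const_Q:
  assumes "0 \<le> r"
  shows "(\<integral>\<^sup>+h. c * indicator (Q r :: (real^'n) set) h \<partial>lborel) = c * ennreal ((2 * r) ^ CARD('n))"
  using assms by (subst nn_integral_cmult_indicator) (auto simp: emeasure_Q)

lemma norm_Q_le:
  fixes x :: "real^'n" and r :: real assumes "x \<in> Q r" shows "(norm x)\<^sup>2 \<le> CARD('n) * r\<^sup>2"
proof -
  have "(norm x)\<^sup>2 = (\<Sum>i\<in>UNIV. (x $ i)\<^sup>2)"
    unfolding power2_norm_eq_inner by (simp add: inner_vec_def power2_eq_square)
  also have "\<dots> \<le> (\<Sum>i\<in>(UNIV::'n set). r\<^sup>2)"
    using assms by (intro sum_mono) (auto simp: Q_def abs_le_square_iff[symmetric] intro: order_trans[OF _ abs_ge_self])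
  finally show ?thesis by simp
qed

lemma diff_boundD: "diff_bound K f \<Longrightarrow> (\<integral>\<^sup>+x. ennreal ((f (x + h) - f x)\<^sup>2) \<partial>lborel) \<le> ennreal ((norm h)\<^sup>2 * K)"
  by (simp add: diff_bound_def)

text \<open>After exchanging the integrals, each shift h in the cube contributes at most |h|^2 K,
  and |h|^2 \<le> N r^2 there; the remaining factor is the volume of the cube.\<close>

lemma diff_bound_average:
  fixes f :: "real^'n \<Rightarrow> real" and r K \<kappa> :: real
  assumes [measurable]: "f \<in> borel_measurable borel" and d: "diff_bound K f" and K: "0 \<le> K" and r: "0 \<le> r"
  shows "(\<integral>\<^sup>+x. (\<integral>\<^sup>+h. indicator (Q r) h * ennreal ((f (x + h) - f x)\<^sup>2) \<partial>lborel) \<partial>lborel)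
    \<le> ennreal ((2 * r) ^ CARD('n) * (CARD('n) * r\<^sup>2 * K))"
proof -
  have "(\<integral>\<^sup>+x. (\<integral>\<^sup>+h. indicator (Q r) h * ennreal ((f (x + h) - f x)\<^sup>2) \<partial>lborel) \<partial>lborel) =
    (\<integral>\<^sup>+h. (\<integral>\<^sup>+x. indicator (Q r) h * ennreal ((f (x + h) - f x)\<^sup>2) \<partial>lborel) \<partial>lborel)"
    by (rule lborel_pair.Fubini') measurable
  also have "\<dots> \<le> (\<integral>\<^sup>+(h::real^'n). ennreal (CARD('n) * r\<^sup>2 * K) * indicator (Q r) h \<partial>lborel)"
  proof (rule nn_integral_mono)
    fix h :: "real^'n"
    have "(\<integral>\<^sup>+x. indicator (Q r) h * ennreal ((f (x + h) - f x)\<^sup>2) \<partial>lborel) =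
       indicator (Q r) h * (\<integral>\<^sup>+x. ennreal ((f (x + h) - f x)\<^sup>2) \<partial>lborel)"
      by (rule nn_integral_cmult) measurable
    also have "\<dots> \<le> indicator (Q r) h * ennreal ((norm h)\<^sup>2 * K)"
      by (intro mult_left_mono diff_boundD d) simp
    also have "\<dots> \<le> ennreal (CARD('n) * r\<^sup>2 * K) * indicator (Q r) h"
      using norm_Q_le[of h r] K by (auto simp: indicator_def intro!: ennreal_leI mult_right_mono)
    finally show "(\<integral>\<^sup>+x. indicator (Q r) h * ennreal ((f (x + h) - f x)\<^sup>2) \<partial>lborel)
      \<le> ennreal (CARD('n) * r\<^sup>2 * K) * indicator (Q r) h" .
  qed
  also have "\<dots> = ennreal ((2 * r) ^ CARD('n) * (CARD('n) * r\<^sup>2 * K))"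
    using r K by (subst nn_integral_const_Q) (auto simp: ennreal_mult[symmetric] mult.commute)
  finally show ?thesis .
qed

lemma nn_integral_shift_indicator:
  fixes g :: "real^'n \<Rightarrow> ennreal"
  assumes [measurable]: "g \<in> borel_measurable borel"
  shows "(\<integral>\<^sup>+h. indicator A h * g (x + h) \<partial>lborel) \<le> (\<integral>\<^sup>+y. g y \<partial>lborel)"
proof -
  have "(\<integral>\<^sup>+h. indicator A h * g (x + h) \<partial>lborel) \<le> (\<integral>\<^sup>+h. g (h + x) \<partial>lborel)"
    by (intro nn_integral_mono) (auto simp: indicator_def add.commute)
  also have "\<dots> = (\<integral>\<^sup>+y. g y \<partial>lborel)" by (rule nn_integral_lborel_shift) measurable
  finally show ?thesis .
qed

text \<open>For x in \<open>A\<close> and a shift h one has \<kappa>^2 \<le> f(x)^2 \<le> 2 (f(x +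
  h) - f(x))^2 + 2 f(x + h)^2. If the mean of f^2 over the cube around x is at most \<kappa>^2 / 4,
  the mean of the squared difference is at least \<kappa>^2 / 4. Integration over \<open>A\<close>
  compares this with \<open>diff_bound_average\<close>.\<close>

lemma level_set_bound:
  fixes f :: "real^'n \<Rightarrow> real" and r K \<kappa> :: real
  assumes [measurable]: "f \<in> borel_measurable borel" "A \<in> sets borel"
    and d: "diff_bound K f" and K: "0 \<le> K" and r: "0 < r"
    and big: "\<And>x. x \<in> A \<Longrightarrow> \<kappa> \<le> \<bar>f x\<bar>" and l: "0 < \<kappa>"
    and small: "\<And>x. x \<in> A \<Longrightarrow> (\<integral>\<^sup>+h. indicator (Q r) h * ennreal ((f (x + h))\<^sup>2) \<partial>lborel) \<le> ennreal ((2 * r) ^ CARD('n) * (\<kappa>\<^sup>2 / 4))"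
  shows "ennreal (\<kappa>\<^sup>2 / 4) * emeasure lborel A \<le> ennreal (CARD('n) * r\<^sup>2 * K)"
proof -
  define q where "q = (2 * r) ^ CARD('n)"
  have q: "q > 0" using r by (simp add: q_def)
  define X where "X x = (\<integral>\<^sup>+h. indicator (Q r) h * ennreal ((f (x + h) - f x)\<^sup>2) \<partial>lborel)" for x
  have [measurable]: "X \<in> borel_measurable borel" unfolding X_def by measurable
  have low: "ennreal (q * (\<kappa>\<^sup>2 / 4)) \<le> X x" if x: "x \<in> A" for x
  proof -
    define Y where "Y = (\<integral>\<^sup>+h. indicator (Q r) h * ennreal ((f (x + h))\<^sup>2) \<partial>lborel)"
    have "ennreal (q * (\<kappa>\<^sup>2 / 4) + q * (\<kappa>\<^sup>2 / 4)) = (\<integral>\<^sup>+(h::real^'n). ennreal (\<kappa>\<^sup>2 / 2) * indicator (Q r) h \<partial>lborel)"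
      using r q by (subst nn_integral_const_Q, simp, simp only: q_def[symmetric], subst ennreal_mult[symmetric]) (auto simp: algebra_simps)
    also have "\<dots> \<le> (\<integral>\<^sup>+h. indicator (Q r) h * ennreal ((f (x + h) - f x)\<^sup>2) + indicator (Q r) h * ennreal ((f (x + h))\<^sup>2) \<partial>lborel)"
    proof (rule nn_integral_mono)
      fix h
      have "\<kappa>\<^sup>2 \<le> (f x)\<^sup>2" using big[OF x] l by (simp add: abs_le_square_iff[symmetric])
      also have "(f x)\<^sup>2 \<le> 2 * ((f (x + h) - f x)\<^sup>2 + (f (x + h))\<^sup>2)"
        using zero_le_power2[of "2 * f (x + h) - f x"] by (simp add: power2_eq_square algebra_simps)
      finally have "ennreal (\<kappa>\<^sup>2 / 2) \<le> ennreal ((f (x + h) - f x)\<^sup>2 + (f (x + h))\<^sup>2)"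
        by (intro ennreal_leI) simp
      then show "ennreal (\<kappa>\<^sup>2 / 2) * indicator (Q r) h \<le> indicator (Q r) h * ennreal ((f (x + h) - f x)\<^sup>2) + indicator (Q r) h * ennreal ((f (x + h))\<^sup>2)"
        by (auto simp: indicator_def)
    qed
    also have "\<dots> = X x + Y" unfolding X_def Y_def by (rule nn_integral_add) measurable
    also have "\<dots> \<le> X x + ennreal (q * (\<kappa>\<^sup>2 / 4))"
      using small[OF x] by (intro add_left_mono) (simp add: Y_def q_def)
    finally have s: "ennreal (q * (\<kappa>\<^sup>2 / 4) + q * (\<kappa>\<^sup>2 / 4)) \<le> X x + ennreal (q * (\<kappa>\<^sup>2 / 4))" .
    have n: "0 \<le> q * (\<kappa>\<^sup>2 / 4)" using q by simp
    show ?thesis using s unfolding ennreal_plus[OF n n] by (simp add: ennreal_add_left_cancel_le add.commute)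
  qed
  have "ennreal q * (ennreal (\<kappa>\<^sup>2 / 4) * emeasure lborel A) = (\<integral>\<^sup>+x. ennreal (q * (\<kappa>\<^sup>2 / 4)) * indicator A x \<partial>lborel)"
  proof -
    have "ennreal (q * (\<kappa>\<^sup>2 / 4)) = ennreal q * ennreal (\<kappa>\<^sup>2 / 4)" using q by (intro ennreal_mult) auto
    then show ?thesis by (simp only: mult.assoc) (simp add: nn_integral_cmult_indicator nn_integral_cmult)
  qed
  also have "\<dots> \<le> (\<integral>\<^sup>+x. X x \<partial>lborel)"
    using low by (intro nn_integral_mono) (auto simp: indicator_def)
  also have "\<dots> \<le> ennreal (q * (CARD('n) * r\<^sup>2 * K))"
    unfolding X_def q_def by (rule diff_bound_average) (use d K r in auto)
  also have "\<dots> = ennreal q * ennreal (CARD('n) * r\<^sup>2 * K)" using q K by (simp add: ennreal_mult)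
  finally show ?thesis using q by (simp add: ennreal_mult_le_mult_iff)
qed

text \<open>Contrapositive of the level set bound: a level set that is too large for
  \<open>K\<close> forces some cube of size \<open>r\<close> to carry a definite amount of mass. It
  takes the place of Lions' vanishing lemma.\<close>

lemma nonvanishing_cube:
  fixes u :: "real^'n \<Rightarrow> real" and r K \<kappa> :: real
  assumes [measurable]: "u \<in> borel_measurable borel" and d: "diff_bound K u" and K: "0 \<le> K" and r: "0 < r" and l: "0 < \<kappa>"
    and lev: "ennreal (CARD('n) * r\<^sup>2 * K) < ennreal (\<kappa>\<^sup>2 / 4) * emeasure lborel {x. \<kappa> < \<bar>u x\<bar>}"
  obtains x where "ennreal ((2 * r) ^ CARD('n) * (\<kappa>\<^sup>2 / 4)) < (\<integral>\<^sup>+h. indicator (Q r) h * ennreal ((u (x + h))\<^sup>2) \<partial>lborel)"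
  using level_set_bound[OF assms(1) _ d K r _ l, of "{x. \<kappa> < \<bar>u x\<bar>}"] lev
  by (auto simp: not_le[symmetric])

text \<open>On a sufficiently large cube the mean of u^2 falls below \<kappa>^2 / 4, because the
  total mass is finite. With \<open>K = 0\<close> the level set bound then makes every level set
  null, whatever the size of the cube.\<close>

lemma diff_bound_zero_AE:
  fixes u :: "real^'n \<Rightarrow> real" and r K \<kappa> :: real
  assumes [measurable]: "u \<in> borel_measurable borel" and d: "diff_bound 0 u" and i: "integrable lborel (\<lambda>x. (u x)\<^sup>2)"
  shows "AE x in lborel. u x = 0"
proof -
  have "AE x in lborel. \<bar>u x\<bar> \<le> inverse (real (Suc k))" for k
  proof -
    define \<kappa> where "\<kappa> = inverse (real (Suc k))"
    define S where "S = (\<integral>x. (u x)\<^sup>2 \<partial>lborel)"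
    have l: "\<kappa> > 0" by (simp add: \<kappa>_def)
    have S0: "S \<ge> 0" by (simp add: S_def)
    \<comment> \<open>With 2 r \<ge> 1 the volume (2 r)^N is at least 2 r, so this choice makes the
      mean of u^2 over any cube at most \<kappa>^2 / 4 in every dimension.\<close>
    define r where "r = max 1 (4 * S / \<kappa>\<^sup>2)"
    have r: "r \<ge> 1" "4 * S / \<kappa>\<^sup>2 \<le> r" by (auto simp: r_def)
    have "4 * S / \<kappa>\<^sup>2 \<le> (2 * r) ^ 1" using r by simp
    also have "\<dots> \<le> (2 * r) ^ CARD('n)" using r by (intro power_increasing) (auto simp: Suc_leI)
    finally have big: "S \<le> (2 * r) ^ CARD('n) * (\<kappa>\<^sup>2 / 4)" using l by (simp add: field_simps)
    have "ennreal (\<kappa>\<^sup>2 / 4) * emeasure lborel {x. \<kappa> < \<bar>u x\<bar>} \<le> ennreal (CARD('n) * r\<^sup>2 * 0)"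
    proof (rule level_set_bound[OF assms(1) _ d])
      fix x
      have "(\<integral>\<^sup>+h. indicator (Q r) h * ennreal ((u (x + h))\<^sup>2) \<partial>lborel) \<le> (\<integral>\<^sup>+y. ennreal ((u y)\<^sup>2) \<partial>lborel)"
        by (rule nn_integral_shift_indicator) measurable
      also have "\<dots> = ennreal S" unfolding S_def by (rule nn_integral_eq_integral[OF i]) simp
      also have "\<dots> \<le> ennreal ((2 * r) ^ CARD('n) * (\<kappa>\<^sup>2 / 4))" by (rule ennreal_leI[OF big])
      finally show "(\<integral>\<^sup>+h. indicator (Q r) h * ennreal ((u (x + h))\<^sup>2) \<partial>lborel) \<le> ennreal ((2 * r) ^ CARD('n) * (\<kappa>\<^sup>2 / 4))" .
    qed (use l r in auto)
    then have "emeasure lborel {x. \<kappa> < \<bar>u x\<bar>} = 0" using l by (simp add: ennreal_eq_0_iff)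
    then have "AE x in lborel. \<not> (\<kappa> < \<bar>u x\<bar>)" by (subst AE_iff_measurable[OF _ refl]) simp_all
    then show ?thesis by (rule AE_mp) (auto simp: \<kappa>_def)
  qed
  then have "AE x in lborel. \<forall>k. \<bar>u x\<bar> \<le> inverse (real (Suc k))" unfolding AE_all_countable by (rule allI)
  then show ?thesis
  proof eventually_elim
    case (elim x)
    then have "\<bar>u x\<bar> \<le> 0" using LIMSEQ_le_const[OF LIMSEQ_inverse_real_of_nat] by blast
    then show ?case by simp
  qed
qed

text \<open>From w(x)^2 \<le> (w(x + h) - w(x))^2 + 2 w(x) w(x + h), averaged over h in the cube:
  the first term is controlled by \<open>diff_bound_average\<close>, the second by the square of the
  L^1 norm divided by the volume. The free radius r is optimised later.\<close>

lemma nash_step: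
  fixes w :: "real^'n \<Rightarrow> real" and r K M :: real
  assumes [measurable]: "w \<in> borel_measurable borel" and w0: "\<And>x. 0 \<le> w x"
    and d: "diff_bound K w" and K: "0 \<le> K" and M: "(\<integral>\<^sup>+x. ennreal (w x) \<partial>lborel) \<le> ennreal M" "0 \<le> M" and r: "0 < r"
  shows "(\<integral>\<^sup>+x. ennreal ((w x)\<^sup>2) \<partial>lborel) \<le> ennreal (CARD('n) * r\<^sup>2 * K + 2 * M\<^sup>2 / (2 * r) ^ CARD('n))"
proof -
  define q where "q = (2 * r) ^ CARD('n)"
  have q: "q > 0" using r by (simp add: q_def)
  have "ennreal q * (\<integral>\<^sup>+x. ennreal ((w x)\<^sup>2) \<partial>lborel) = (\<integral>\<^sup>+x. ennreal q * ennreal ((w x)\<^sup>2) \<partial>lborel)"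
    by (rule nn_integral_cmult[symmetric]) measurable
  also have "\<dots> = (\<integral>\<^sup>+x. (\<integral>\<^sup>+(h::real^'n). ennreal ((w x)\<^sup>2) * indicator (Q r) h \<partial>lborel) \<partial>lborel)"
    using r by (subst nn_integral_const_Q) (auto simp: q_def mult.commute)
  also have "\<dots> \<le> (\<integral>\<^sup>+x. (\<integral>\<^sup>+h. indicator (Q r) h * ennreal ((w (x + h) - w x)\<^sup>2) \<partial>lborel)
      + 2 * (ennreal (w x) * (\<integral>\<^sup>+h. indicator (Q r) h * ennreal (w (x + h)) \<partial>lborel)) \<partial>lborel)"
  proof (rule nn_integral_mono)
    fix x
    have "(\<integral>\<^sup>+(h::real^'n). ennreal ((w x)\<^sup>2) * indicator (Q r) h \<partial>lborel) \<le>
      (\<integral>\<^sup>+h. indicator (Q r) h * ennreal ((w (x + h) - w x)\<^sup>2) + (2 * ennreal (w x)) * (indicator (Q r) h * ennreal (w (x + h))) \<partial>lborel)"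
    proof (rule nn_integral_mono)
      fix h
      have "(w x)\<^sup>2 \<le> (w (x + h) - w x)\<^sup>2 + 2 * w x * w (x + h)" by (simp add: power2_eq_square algebra_simps)
      then have "ennreal ((w x)\<^sup>2) \<le> ennreal ((w (x + h) - w x)\<^sup>2 + 2 * w x * w (x + h))" by (rule ennreal_leI)
      also have "\<dots> = ennreal ((w (x + h) - w x)\<^sup>2) + ennreal (2 * w x * w (x + h))"
        using w0 by (intro ennreal_plus) auto
      also have "ennreal (2 * w x * w (x + h)) = 2 * ennreal (w x) * ennreal (w (x + h))"
        using w0 by (simp add: ennreal_mult)
      finally show "ennreal ((w x)\<^sup>2) * indicator (Q r) h \<le> indicator (Q r) h * ennreal ((w (x + h) - w x)\<^sup>2) + (2 * ennreal (w x)) * (indicator (Q r) h * ennreal (w (x + h)))"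
        by (auto simp: indicator_def)
    qed
    also have "\<dots> = (\<integral>\<^sup>+h. indicator (Q r) h * ennreal ((w (x + h) - w x)\<^sup>2) \<partial>lborel) + (\<integral>\<^sup>+h. (2 * ennreal (w x)) * (indicator (Q r) h * ennreal (w (x + h))) \<partial>lborel)"
      by (rule nn_integral_add) measurable
    also have "(\<integral>\<^sup>+h. (2 * ennreal (w x)) * (indicator (Q r) h * ennreal (w (x + h))) \<partial>lborel) =
       (2 * ennreal (w x)) * (\<integral>\<^sup>+h. indicator (Q r) h * ennreal (w (x + h)) \<partial>lborel)"
      by (rule nn_integral_cmult) measurable
    finally show "(\<integral>\<^sup>+(h::real^'n). ennreal ((w x)\<^sup>2) * indicator (Q r) h \<partial>lborel) \<le> (\<integral>\<^sup>+h. indicator (Q r) h * ennreal ((w (x + h) - w x)\<^sup>2) \<partial>lborel)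
      + 2 * (ennreal (w x) * (\<integral>\<^sup>+h. indicator (Q r) h * ennreal (w (x + h)) \<partial>lborel))" by (simp add: mult.assoc)
  qed
  also have "\<dots> \<le> (\<integral>\<^sup>+x. (\<integral>\<^sup>+h. indicator (Q r) h * ennreal ((w (x + h) - w x)\<^sup>2) \<partial>lborel)
      + (2 * ennreal M) * ennreal (w x) \<partial>lborel)"
  proof (intro nn_integral_mono add_left_mono)
    fix x
    have "(\<integral>\<^sup>+h. indicator (Q r) h * ennreal (w (x + h)) \<partial>lborel) \<le> ennreal M"
      by (rule order_trans[OF nn_integral_shift_indicator M(1)]) measurable
    then have "2 * (ennreal (w x) * (\<integral>\<^sup>+h. indicator (Q r) h * ennreal (w (x + h)) \<partial>lborel)) \<le> 2 * (ennreal (w x) * ennreal M)"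
      by (intro mult_left_mono) auto
    then show "2 * (ennreal (w x) * (\<integral>\<^sup>+h. indicator (Q r) h * ennreal (w (x + h)) \<partial>lborel)) \<le> (2 * ennreal M) * ennreal (w x)"
      by (simp add: mult_ac)
  qed
  also have "\<dots> = (\<integral>\<^sup>+x. (\<integral>\<^sup>+h. indicator (Q r) h * ennreal ((w (x + h) - w x)\<^sup>2) \<partial>lborel) \<partial>lborel)
      + (2 * ennreal M) * (\<integral>\<^sup>+x. ennreal (w x) \<partial>lborel)"
    by (subst nn_integral_add) (auto simp: nn_integral_cmult)
  also have "\<dots> \<le> ennreal (q * (CARD('n) * r\<^sup>2 * K)) + (2 * ennreal M) * ennreal M"
    unfolding q_def using d K r M by (intro add_mono diff_bound_average mult_left_mono) auto
  also have "(2 * ennreal M) * ennreal M = ennreal (2 * M\<^sup>2)"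
    using M by (simp add: ennreal_mult power2_eq_square mult.assoc)
  also have "ennreal (q * (CARD('n) * r\<^sup>2 * K)) + ennreal (2 * M\<^sup>2) = ennreal q * ennreal (CARD('n) * r\<^sup>2 * K + 2 * M\<^sup>2 / q)"
    using q K by (simp add: ennreal_plus[symmetric] ennreal_mult[symmetric] distrib_left del: ennreal_plus)
  finally show ?thesis using q unfolding q_def[symmetric] by (simp add: ennreal_mult_le_mult_iff)
qed

section \<open>From tail estimates to the Gagliardo-Nirenberg inequality\<close>

lemma dyadic_power_bound:
  fixes w T a :: real
  assumes w: "0 \<le> w" and T: "0 < T" and a: "1 \<le> a"
  shows "ennreal (w powr a) \<le> ennreal (T powr (a - 1)) * ennreal w +
    (\<Sum>k. ennreal ((2 ^ Suc k * T) powr a) * indicator {x. 2 ^ k * T < x} w)"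
proof (cases "w \<le> T")
  case True
  have "w powr a = w powr (a - 1) * w" using w a by (cases "w = 0") (simp_all add: powr_diff)
  also have "\<dots> \<le> T powr (a - 1) * w" using w True a by (intro mult_right_mono powr_mono2) auto
  finally have "ennreal (w powr a) \<le> ennreal (T powr (a - 1)) * ennreal w"
    using w by (simp add: ennreal_mult[symmetric])
  then show ?thesis by (rule order_trans) simp
next
  case False
  obtain n :: nat where n: "w / T < 2 ^ n" using real_arch_pow[of 2 "w / T"] by auto
  \<comment> \<open>The dyadic level just below \<open>w\<close>: minimality of \<open>k\<close>
    gives \<open>2 ^ k * T < w\<close>, so the term with index \<open>k\<close> alone dominates
    \<open>w powr a\<close>.\<close>
  define k where "k = (LEAST k. w \<le> 2 ^ Suc k * T)"
  have "w \<le> 2 ^ Suc n * T" using n T w by (simp add: field_simps)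
  then have k: "w \<le> 2 ^ Suc k * T" unfolding k_def by (rule LeastI)
  have k2: "2 ^ k * T < w"
  proof (cases k)
    case 0 then show ?thesis using False by simp
  next
    case (Suc j)
    then have "\<not> w \<le> 2 ^ Suc j * T" using not_less_Least[of j "\<lambda>k. w \<le> 2 ^ Suc k * T"] k_def by auto
    then show ?thesis using Suc by simp
  qed
  let ?f = "\<lambda>k. ennreal ((2 ^ Suc k * T) powr a) * indicator {x. 2 ^ k * T < x} w"
  have "ennreal (w powr a) \<le> ennreal ((2 ^ Suc k * T) powr a)"
    using k w a by (intro ennreal_leI powr_mono2) auto
  also have "\<dots> = sum ?f {k}" using k2 by simp
  also have "\<dots> \<le> (\<Sum>k. ?f k)" by (rule sum_le_suminf) auto
  finally show ?thesis by (rule order_trans) simp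
qed

text \<open>Marcinkiewicz-type passage from tail estimates to a power integral, by a dyadic decomposition of the levels above \<open>T\<close>.\<close>

lemma weak_type_strong:
  fixes w :: "'a::euclidean_space \<Rightarrow> real"
  assumes [measurable]: "w \<in> borel_measurable borel" and w0: "\<And>x. 0 \<le> w x"
    and T: "0 < T" and a: "1 \<le> a" "a < s" and B: "0 \<le> B"
    and wk: "\<And>l. T \<le> l \<Longrightarrow> emeasure lborel {x. l < w x} \<le> ennreal (B * l powr (- s))"
    and M: "(\<integral>\<^sup>+x. ennreal (w x) \<partial>lborel) \<le> ennreal M" "0 \<le> M"
  shows "(\<integral>\<^sup>+x. ennreal (w x powr a) \<partial>lborel) \<le>
    ennreal (T powr (a - 1) * M + 2 powr a * B * T powr (a - s) / (1 - 2 powr (a - s)))"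
proof -
  define \<rho> where "\<rho> = (2::real) powr (a - s)"
  have rho: "0 < \<rho>" "\<rho> < 1" using a by (auto simp: \<rho>_def powr_less_one)
  have "(\<integral>\<^sup>+x. ennreal (w x powr a) \<partial>lborel) \<le> (\<integral>\<^sup>+x. ennreal (T powr (a - 1)) * ennreal (w x) +
    (\<Sum>k. ennreal ((2 ^ Suc k * T) powr a) * indicator {x. 2 ^ k * T < x} (w x)) \<partial>lborel)"
    by (intro nn_integral_mono dyadic_power_bound w0 T a)
  also have "\<dots> = (\<integral>\<^sup>+x. ennreal (T powr (a - 1)) * ennreal (w x) \<partial>lborel) +
    (\<integral>\<^sup>+x. (\<Sum>k. ennreal ((2 ^ Suc k * T) powr a) * indicator {x. 2 ^ k * T < x} (w x)) \<partial>lborel)"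
    by (rule nn_integral_add) measurable
  also have "(\<integral>\<^sup>+x. (\<Sum>k. ennreal ((2 ^ Suc k * T) powr a) * indicator {x. 2 ^ k * T < x} (w x)) \<partial>lborel) =
     (\<Sum>k. (\<integral>\<^sup>+x. ennreal ((2 ^ Suc k * T) powr a) * indicator {x. 2 ^ k * T < x} (w x) \<partial>lborel))"
    by (rule nn_integral_suminf) measurable
  also have "\<dots> \<le> (\<Sum>k. ennreal (2 powr a * B * T powr (a - s) * \<rho> ^ k))"
  proof (rule suminf_le)
    fix k :: nat
    have "(\<integral>\<^sup>+x. ennreal ((2 ^ Suc k * T) powr a) * indicator {x. 2 ^ k * T < x} (w x) \<partial>lborel) =
      (\<integral>\<^sup>+x. ennreal ((2 ^ Suc k * T) powr a) * indicator {x. 2 ^ k * T < w x} x \<partial>lborel)"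
      by (intro nn_integral_cong) (auto simp: indicator_def)
    also have "\<dots> = ennreal ((2 ^ Suc k * T) powr a) * emeasure lborel {x. 2 ^ k * T < w x}"
      by (rule nn_integral_cmult_indicator) measurable
    also have "\<dots> \<le> ennreal ((2 ^ Suc k * T) powr a) * ennreal (B * (2 ^ k * T) powr (- s))"
      using T by (intro mult_left_mono wk) (auto simp: mult_le_cancel_right1)
    also have "\<dots> = ennreal ((2 ^ Suc k * T) powr a * (B * (2 ^ k * T) powr (- s)))"
      using B by (simp add: ennreal_mult)
    also have "(2 ^ Suc k * T) powr a * (B * (2 ^ k * T) powr (- s)) = 2 powr a * B * T powr (a - s) * \<rho> ^ k"
    proof -
      have p: "(2 ^ k * T) powr (a - s) = T powr (a - s) * \<rho> ^ k"
        using T by (simp add: powr_mult \<rho>_def powr_realpow[symmetric] powr_powr mult.commute)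
      have "(2 ^ Suc k * T) powr a = 2 powr a * (2 ^ k * T) powr a"
        using T by (simp add: powr_mult mult.assoc)
      then have "(2 ^ Suc k * T) powr a * (B * (2 ^ k * T) powr (- s)) = 2 powr a * B * ((2 ^ k * T) powr a * (2 ^ k * T) powr (- s))"
        by simp
      also have "(2 ^ k * T) powr a * (2 ^ k * T) powr (- s) = (2 ^ k * T) powr (a - s)"
        by (simp add: powr_add[symmetric])
      finally show ?thesis using p by simp
    qed
    finally show "(\<integral>\<^sup>+x. ennreal ((2 ^ Suc k * T) powr a) * indicator {x. 2 ^ k * T < x} (w x) \<partial>lborel)
      \<le> ennreal (2 powr a * B * T powr (a - s) * \<rho> ^ k)" .
  qed auto
  also have "\<dots> = ennreal (\<Sum>k. 2 powr a * B * T powr (a - s) * \<rho> ^ k)"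
    using rho B by (intro suminf_ennreal2) (auto intro!: summable_mult summable_geometric)
  also have "(\<Sum>k. 2 powr a * B * T powr (a - s) * \<rho> ^ k) = 2 powr a * B * T powr (a - s) / (1 - \<rho>)"
    using rho by (subst suminf_mult) (auto simp: suminf_geometric summable_geometric)
  also have "(\<integral>\<^sup>+x. ennreal (T powr (a - 1)) * ennreal (w x) \<partial>lborel) \<le> ennreal (T powr (a - 1) * M)"
    using M by (subst nn_integral_cmult) (auto simp: ennreal_mult intro: mult_left_mono)
  also have "ennreal (T powr (a - 1) * M) + ennreal (2 powr a * B * T powr (a - s) / (1 - \<rho>)) =
     ennreal (T powr (a - 1) * M + 2 powr a * B * T powr (a - s) / (1 - \<rho>))"
    using M B rho by (intro ennreal_plus[symmetric]) auto
  finally show ?thesis by (simp add: \<rho>_def add_right_mono)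
qed

text \<open>\<open>nash_step\<close> first bounds the L^2 norm, which yields tail estimates with
  exponent 2 + 4/N through \<open>level_set_bound\<close>. Since 2 + 2/N lies strictly below this
  exponent, the dyadic summation closes. The bound is linear in \<open>K\<close>; this is what makes
  4 + 4/N the critical exponent for u when w = u^2.\<close>

lemma gagliardo_nirenberg:
  fixes w :: "real^'n \<Rightarrow> real" and K M :: real
  defines "N \<equiv> real CARD('n)"
  assumes [measurable]: "w \<in> borel_measurable borel" and w0: "\<And>x. 0 \<le> w x"
    and d: "diff_bound K w" and K: "0 < K" and M: "(\<integral>\<^sup>+x. ennreal (w x) \<partial>lborel) \<le> ennreal M" "0 < M"
  shows "(\<integral>\<^sup>+x. ennreal (w x powr (2 + 2 / N)) \<partial>lborel) \<le>
    ennreal ((1 / 4 + 2 powr (2 + 2 / N) * N * (4 * (N + 2)) powr (2 / N) / (1 - 2 powr (- 2 / N))) * (M powr (2 / N) * K))"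
proof -
  let ?n = "CARD('n)"
  have N: "N \<ge> 1" unfolding N_def by (simp add: Suc_leI)
  \<comment> \<open>This radius balances the two terms of \<open>nash_step\<close>: r^2 K equals M^2
    / (2 r)^N. Both are then T M, where T is the mean of a mass M over the cube.\<close>
  define r where "r = root (?n + 2) (M\<^sup>2 / (K * 2 ^ ?n))"
  have r: "r > 0" unfolding r_def using M K by (simp add: real_root_gt_zero)
  have rp: "r ^ (?n + 2) = M\<^sup>2 / (K * 2 ^ ?n)" unfolding r_def using M K by (intro real_root_pow_pos2) auto
  define T where "T = M / (2 * r) ^ ?n"
  have T: "T > 0" using M r by (simp add: T_def)
  have rK: "r\<^sup>2 * K = T * M"
  proof -
    have "r ^ ?n * r\<^sup>2 = M\<^sup>2 / (K * 2 ^ ?n)" using rp by (simp add: power2_eq_square mult_ac)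
    moreover have "r\<^sup>2 = r ^ ?n * r\<^sup>2 / r ^ ?n" using r by simp
    ultimately have "r\<^sup>2 = M\<^sup>2 / (K * 2 ^ ?n) / r ^ ?n" by simp
    then show ?thesis using K r by (simp add: T_def power_mult_distrib power2_eq_square field_simps)
  qed
  define S where "S = (N + 2) * (T * M)"
  have S: "S > 0" using N T M by (simp add: S_def)
  have "(\<integral>\<^sup>+x. ennreal ((w x)\<^sup>2) \<partial>lborel) \<le> ennreal (?n * r\<^sup>2 * K + 2 * M\<^sup>2 / (2 * r) ^ ?n)"
    by (rule nash_step) (use w0 d K M r in auto)
  also have "?n * r\<^sup>2 * K + 2 * M\<^sup>2 / (2 * r) ^ ?n = S"
    using rK by (simp add: S_def N_def T_def distrib_right mult.assoc power2_eq_square add_divide_distrib)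
  finally have S2: "(\<integral>\<^sup>+x. ennreal ((w x)\<^sup>2) \<partial>lborel) \<le> ennreal S" .
  define B where "B = N * K * (4 * S) powr (2 / N)"
  have B: "B \<ge> 0" using N K by (simp add: B_def)
  have wk: "emeasure lborel {x. l < w x} \<le> ennreal (B * l powr (- (2 + 4 / N)))" if l: "T \<le> l" for l
  proof -
    have l0: "l > 0" using l T by simp
    \<comment> \<open>The cube of volume \<open>y\<close> is the one on which the mean of w^2 is at
      most l^2 / 4, given the total \<open>S\<close> of w^2. The radius \<rho> is half the side of
      that cube.\<close>
    define y where "y = 4 * S / l\<^sup>2"
    have y: "y > 0" using S l0 by (simp add: y_def)
    define \<rho> where "\<rho> = root ?n y / 2"
    have rho: "\<rho> > 0" using y by (simp add: \<rho>_def real_root_gt_zero)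
    have rn: "(2 * \<rho>) ^ ?n = y" unfolding \<rho>_def using y by (simp add: real_root_pow_pos2)
    have "(2 * \<rho>)\<^sup>2 = y powr (2 / N)"
    proof -
      have "2 * \<rho> = y powr (1 / N)" unfolding \<rho>_def N_def using y by (simp add: root_powr_inverse)
      then show ?thesis using y by (simp add: powr_realpow[symmetric] powr_powr)
    qed
    then have rho2: "\<rho>\<^sup>2 = y powr (2 / N) / 4" by (simp add: power_mult_distrib)
    have "ennreal (l\<^sup>2 / 4) * emeasure lborel {x. l < w x} \<le> ennreal (?n * \<rho>\<^sup>2 * K)"
    proof (rule level_set_bound[OF _ _ d])
      fix x
      have "(\<integral>\<^sup>+h. indicator (Q \<rho>) h * ennreal ((w (x + h))\<^sup>2) \<partial>lborel) \<le> (\<integral>\<^sup>+y. ennreal ((w y)\<^sup>2) \<partial>lborel)"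
        by (rule nn_integral_shift_indicator) measurable
      also note S2
      also have "S = (2 * \<rho>) ^ ?n * (l\<^sup>2 / 4)" unfolding rn y_def using l0 by simp
      finally show "(\<integral>\<^sup>+h. indicator (Q \<rho>) h * ennreal ((w (x + h))\<^sup>2) \<partial>lborel) \<le> ennreal ((2 * \<rho>) ^ ?n * (l\<^sup>2 / 4))" .
    qed (use K rho l0 w0 in \<open>auto simp: abs_of_nonneg\<close>)
    then have "ennreal (4 / l\<^sup>2) * (ennreal (l\<^sup>2 / 4) * emeasure lborel {x. l < w x}) \<le> ennreal (4 / l\<^sup>2) * ennreal (?n * \<rho>\<^sup>2 * K)"
      by (rule mult_left_mono) simp
    moreover have "ennreal (4 / l\<^sup>2) * (ennreal (l\<^sup>2 / 4) * emeasure lborel {x. l < w x}) = emeasure lborel {x. l < w x}"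
      using l0 by (simp add: mult.assoc[symmetric] ennreal_mult[symmetric])
    moreover have "ennreal (4 / l\<^sup>2) * ennreal (?n * \<rho>\<^sup>2 * K) = ennreal (4 / l\<^sup>2 * (?n * \<rho>\<^sup>2 * K))"
      using K by (intro ennreal_mult[symmetric]) auto
    moreover have "4 / l\<^sup>2 * (?n * \<rho>\<^sup>2 * K) = B * l powr (- (2 + 4 / N))"
    proof -
      have "y powr (2 / N) = (4 * S) powr (2 / N) / (l powr 2) powr (2 / N)"
        unfolding y_def using S l0 by (simp add: powr_divide)
      also have "(l powr 2) powr (2 / N) = l powr (4 / N)" by (simp add: powr_powr)
      finally have "4 / l\<^sup>2 * (?n * \<rho>\<^sup>2 * K) = N * K * (4 * S) powr (2 / N) / (l powr 2 * l powr (4 / N))"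
        using l0 by (simp add: rho2 N_def)
      also have "l powr 2 * l powr (4 / N) = l powr (2 + 4 / N)" by (simp add: powr_add)
      finally show ?thesis unfolding B_def powr_minus_divide times_divide_eq_right mult_1_right .
    qed
    ultimately show ?thesis by simp
  qed
  \<comment> \<open>Below \<open>T\<close> the L^1 norm is used, above \<open>T\<close> the tail
    estimate. By the choice of \<open>T\<close> both contributions are multiples of M^(2/N) K: T^(1
    + 2/N) M equals one quarter of it, and T^(2/N) from \<open>B\<close> cancels T^(-2/N).\<close>
  have "(\<integral>\<^sup>+x. ennreal (w x powr (2 + 2 / N)) \<partial>lborel) \<le>
    ennreal (T powr (2 + 2 / N - 1) * M + 2 powr (2 + 2 / N) * B * T powr (2 + 2 / N - (2 + 4 / N)) / (1 - 2 powr (2 + 2 / N - (2 + 4 / N))))"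
    by (rule weak_type_strong[OF _ _ T _ _ B wk M(1)]) (use N w0 M in \<open>auto simp: divide_simps\<close>)
  also have "2 + 2 / N - (2 + 4 / N) = - 2 / N" by simp
  also have "T powr (2 + 2 / N - 1) * M = 1 / 4 * (M powr (2 / N) * K)"
  proof -
    have "2 + 2 / N - 1 = 1 + 2 / N" by simp
    then have 1: "T powr (2 + 2 / N - 1) = T * T powr (2 / N)" using T by (simp only: powr_add powr_one)
    have 2: "T powr (2 / N) = M powr (2 / N) / (4 * r\<^sup>2)"
    proof -
      have e: "(2 * r) ^ ?n = (2 * r) powr N" unfolding N_def using r by (intro powr_realpow[symmetric]) simp
      have "((2 * r) ^ ?n) powr (2 / N) = (2 * r) powr 2" unfolding e powr_powr using N by simp
      also have "\<dots> = 4 * r\<^sup>2" using r by (simp add: power_mult_distrib)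
      finally have "((2 * r) ^ ?n) powr (2 / N) = 4 * r\<^sup>2" .
      then show ?thesis unfolding T_def using M r by (subst powr_divide) auto
    qed
    have "T powr (2 + 2 / N - 1) * M = (T * M) * (M powr (2 / N) / (4 * r\<^sup>2))" unfolding 1 2 by simp
    also have "\<dots> = 1 / 4 * (M powr (2 / N) * K)" unfolding rK[symmetric] using r by simp
    finally show ?thesis .
  qed
  also have "2 powr (2 + 2 / N) * B * T powr (- 2 / N) = 2 powr (2 + 2 / N) * N * (4 * (N + 2)) powr (2 / N) * (M powr (2 / N) * K)"
  proof -
    have S': "(4 * S) powr (2 / N) = (4 * (N + 2)) powr (2 / N) * T powr (2 / N) * M powr (2 / N)"
    proof -
      have "4 * S = 4 * (N + 2) * T * M" by (simp add: S_def)
      then show ?thesis using N T M by (simp only: powr_mult)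
    qed
    have "T powr (2 / N) * T powr (- 2 / N) = T powr (2 / N + - 2 / N)" by (rule powr_add[symmetric])
    also have "\<dots> = 1" using T by simp
    finally have 1: "T powr (2 / N) * T powr (- 2 / N) = 1" .
    have "2 powr (2 + 2 / N) * B * T powr (- 2 / N) =
      2 powr (2 + 2 / N) * N * (4 * (N + 2)) powr (2 / N) * (M powr (2 / N) * K) * (T powr (2 / N) * T powr (- 2 / N))"
      unfolding B_def S' by (simp only: mult_ac)
    then show ?thesis unfolding 1 by simp
  qed
  finally show ?thesis by (simp only: distrib_right times_divide_eq_left)
qed

section \<open>Compactness\<close>

lemma UN_Q: "\<exists>n. (x::real^'n) \<in> Q (real n)"
proof -
  obtain n where n: "norm x \<le> real n" using real_arch_simple by blast
  have "x \<in> Q (real n)" unfolding Q_def using order_trans[OF component_le_norm_cart n] by simp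
  then show ?thesis by blast
qed

lemma emeasure_Q_finite: "emeasure lborel (Q R :: (real^'n) set) < \<infinity>"
  by (simp add: Q_cbox emeasure_lborel_cbox_finite del: infinity_ennreal_def)

text \<open>Integration of |f| \<le> d + |f|^2 / d over the cube. The free parameter
  \<open>d\<close> is later taken small first, and the L^2 error small compared with
  \<open>d\<close> afterwards.\<close>

lemma L1_le_L2_Q:
  fixes f :: "real^'n \<Rightarrow> 'b::euclidean_space"
  assumes [measurable]: "f \<in> borel_measurable borel" and d: "d > 0"
    and e: "(\<integral>\<^sup>+x. indicator (Q R) x * ennreal ((norm (f x))\<^sup>2) \<partial>lborel) \<le> ennreal e" "e \<ge> 0"
  shows "integrable lborel (\<lambda>x. indicator (Q R) x *\<^sub>R f x)"
    and "(\<integral>x. norm (indicator (Q R) x *\<^sub>R f x) \<partial>lborel) \<le> d * measure lborel (Q R :: (real^'n) set) + e / d"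
proof -
  have "(\<integral>\<^sup>+x. ennreal (norm (indicator (Q R) x *\<^sub>R f x)) \<partial>lborel) \<le>
     (\<integral>\<^sup>+x. ennreal d * indicator (Q R) x + ennreal (1 / d) * (indicator (Q R) x * ennreal ((norm (f x))\<^sup>2)) \<partial>lborel)"
  proof (rule nn_integral_mono)
    fix x
    have "2 * d * norm (f x) \<le> d\<^sup>2 + (norm (f x))\<^sup>2" by (rule sum_squares_bound)
    moreover have "0 \<le> d * norm (f x)" using d by simp
    ultimately have "d * norm (f x) \<le> d\<^sup>2 + (norm (f x))\<^sup>2" by linarith
    then have "norm (f x) \<le> d + 1 / d * (norm (f x))\<^sup>2" using d by (simp add: field_simps power2_eq_square)
    then have "ennreal (norm (f x)) \<le> ennreal (d + 1 / d * (norm (f x))\<^sup>2)" by (rule ennreal_leI)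
    also have "\<dots> = ennreal d + ennreal (1 / d) * ennreal ((norm (f x))\<^sup>2)" using d by (simp add: ennreal_mult[symmetric])
    finally show "ennreal (norm (indicator (Q R) x *\<^sub>R f x)) \<le> ennreal d * indicator (Q R) x + ennreal (1 / d) * (indicator (Q R) x * ennreal ((norm (f x))\<^sup>2))"
      by (auto simp: indicator_def)
  qed
  also have "\<dots> = (\<integral>\<^sup>+x. ennreal d * indicator (Q R) (x::real^'n) \<partial>lborel) + (\<integral>\<^sup>+x. ennreal (1 / d) * (indicator (Q R) x * ennreal ((norm (f x))\<^sup>2)) \<partial>lborel)"
    by (rule nn_integral_add) measurable
  also have "\<dots> = ennreal d * emeasure lborel (Q R :: (real^'n) set) + ennreal (1 / d) * (\<integral>\<^sup>+x. indicator (Q R) x * ennreal ((norm (f x))\<^sup>2) \<partial>lborel)"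
    by (subst nn_integral_cmult_indicator, simp, subst nn_integral_cmult) measurable
  also have "\<dots> \<le> ennreal d * ennreal (measure lborel (Q R :: (real^'n) set)) + ennreal (1 / d) * ennreal e"
  proof -
    have "emeasure lborel (Q R :: (real^'n) set) = ennreal (measure lborel (Q R :: (real^'n) set))"
      by (rule emeasure_eq_ennreal_measure) (metis emeasure_Q_finite less_irrefl infinity_ennreal_def)
    then show ?thesis using e by (intro add_mono mult_left_mono) auto
  qed
  also have "\<dots> = ennreal (d * measure lborel (Q R :: (real^'n) set) + e / d)"
    using d e by (simp add: ennreal_mult[symmetric])
  finally have b: "(\<integral>\<^sup>+x. ennreal (norm (indicator (Q R) x *\<^sub>R f x)) \<partial>lborel) \<le> ennreal (d * measure lborel (Q R :: (real^'n) set) + e / d)" .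
  show i: "integrable lborel (\<lambda>x. indicator (Q R) x *\<^sub>R f x)"
    by (rule integrableI_bounded) (use b in \<open>auto intro: le_less_trans\<close>)
  have "ennreal (\<integral>x. norm (indicator (Q R) x *\<^sub>R f x) \<partial>lborel) \<le> ennreal (d * measure lborel (Q R :: (real^'n) set) + e / d)"
    using b unfolding nn_integral_eq_integral[OF integrable_norm[OF i], simplified real_norm_def] by (subst nn_integral_eq_integral[OF integrable_norm[OF i], symmetric]) auto
  then show "(\<integral>x. norm (indicator (Q R) x *\<^sub>R f x) \<partial>lborel) \<le> d * measure lborel (Q R :: (real^'n) set) + e / d"
    using d e by (subst (asm) ennreal_le_iff) auto
qed

text \<open>Completeness of L^2 on all cubes simultaneously. On each cube the sequence is Cauchy in
  L^1, hence has an almost everywhere convergent subsequence; a diagonal subsequence works on all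
  cubes and defines \<open>g\<close>.\<close>

lemma L2_local_Cauchy:
  fixes f :: "nat \<Rightarrow> real^'n \<Rightarrow> 'b::euclidean_space"
  assumes [measurable]: "\<And>n. f n \<in> borel_measurable borel"
    and C: "\<And>R e. e > 0 \<Longrightarrow> \<exists>n0. \<forall>i\<ge>n0. \<forall>j\<ge>n0. (\<integral>\<^sup>+x. indicator (Q R) x * ennreal ((norm (f i x - f j x))\<^sup>2) \<partial>lborel) \<le> ennreal e"
    and fin: "\<And>n R. (\<integral>\<^sup>+x. indicator (Q R) x * ennreal ((norm (f n x))\<^sup>2) \<partial>lborel) < \<infinity>"
  obtains r g where "strict_mono r" "g \<in> borel_measurable borel" "AE x in lborel. (\<lambda>n. f (r n) x) \<longlonglongrightarrow> g x"
    "\<And>R e. e > 0 \<Longrightarrow> \<exists>n0. \<forall>n\<ge>n0. (\<integral>\<^sup>+x. indicator (Q R) x * ennreal ((norm (f n x - g x))\<^sup>2) \<partial>lborel) \<le> ennreal e"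
proof -
  define P where "P n s \<longleftrightarrow> (AE x in lborel. x \<in> Q (real n) \<longrightarrow> Cauchy (\<lambda>i. f (s i) x))" for n :: nat and s :: "nat \<Rightarrow> nat"
  interpret subseqs P
  proof
    fix n :: nat and s :: "nat \<Rightarrow> nat" assume s: "strict_mono s"
    define v where "v i x = indicator (Q (real n)) x *\<^sub>R f (s i) x" for i x
    have int: "integrable lborel (v i)" for i
    proof -
      have "(\<integral>\<^sup>+x. indicator (Q (real n)) x * ennreal ((norm (f (s i) x))\<^sup>2) \<partial>lborel) \<le>
        ennreal (enn2real (\<integral>\<^sup>+x. indicator (Q (real n)) x * ennreal ((norm (f (s i) x))\<^sup>2) \<partial>lborel))"
        using fin by simp
      from L1_le_L2_Q(1)[OF _ zero_less_one this] show ?thesis by (simp add: v_def[abs_def])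
    qed
    have cau: "\<exists>N. \<forall>i\<ge>N. \<forall>j\<ge>N. (LINT x|lborel. norm (v i x - v j x)) < e" if e: "e > 0" for e
    proof -
      define m where "m = measure lborel (Q (real n) :: (real^'n) set)"
      have m: "m \<ge> 0" by (simp add: m_def)
      define d where "d = e / (4 * (m + 1))"
      have d: "d > 0" using e m by (simp add: d_def)
      have dm: "d * m \<le> e / 4"
      proof -
        have "d * m \<le> d * (m + 1)" using d by (intro mult_left_mono) auto
        also have "\<dots> = e / 4" unfolding d_def using m by (auto simp: divide_simps)
        finally show ?thesis .
      qed
      obtain n0 where n0: "\<And>i j. i \<ge> n0 \<Longrightarrow> j \<ge> n0 \<Longrightarrow> (\<integral>\<^sup>+x. indicator (Q (real n)) x * ennreal ((norm (f i x - f j x))\<^sup>2) \<partial>lborel) \<le> ennreal (d * e / 4)"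
        using C[of "d * e / 4" "real n"] d e by auto
      show ?thesis
      proof (intro exI[of _ n0] allI impI)
        fix i j assume ij: "i \<ge> n0" "j \<ge> n0"
        then have "s i \<ge> n0" "s j \<ge> n0" using seq_suble[OF s] by (meson le_trans)+
        note b = n0[OF this]
        have "(LINT x|lborel. norm (indicator (Q (real n)) x *\<^sub>R (f (s i) x - f (s j) x))) \<le> d * m + (d * e / 4) / d"
          unfolding m_def by (rule L1_le_L2_Q(2)[OF _ d b]) (use d e in auto)
        also have "\<dots> < e" using dm d e by simp
        finally show "(LINT x|lborel. norm (v i x - v j x)) < e"
          by (simp add: v_def scaleR_diff_right)
      qed
    qed
    obtain r where r: "strict_mono r" "AE x in lborel. Cauchy (\<lambda>i. v (r i) x)"
      using cauchy_L1_AE_cauchy_subseq[OF int cau] by metis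
    have "P n (s \<circ> r)" unfolding P_def using r(2)
    proof eventually_elim
      case (elim x) then show ?case by (cases "x \<in> Q (real n)") (simp_all add: v_def)
    qed
    then show "\<exists>r'. strict_mono r' \<and> P n (s \<circ> r')" using r(1) by blast
  qed
  define r where "r = diagseq"
  have r: "strict_mono r" unfolding r_def by (rule subseq_diagseq)
  \<comment> \<open>The diagonal sequence is a subsequence of the stage-n sequence only from index
    \<open>Suc n\<close> on; a shift of the index does not affect convergence.\<close>
  have "P n (r \<circ> ((+) (Suc n)))" for n
    unfolding r_def
  proof (rule diagseq_holds)
    fix s t :: "nat \<Rightarrow> nat" and n assume st: "strict_mono t" "P n s"
    show "P n (s \<circ> t)" using st(2) unfolding P_def
    proof eventually_elim
      case (elim x) then show ?case using Cauchy_subseq_Cauchy[OF _ st(1), of "\<lambda>i. f (s i) x"] by (simp add: o_def)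
    qed
  qed
  then have "AE x in lborel. \<forall>n. x \<in> Q (real n) \<longrightarrow> Cauchy (\<lambda>i. f (r (Suc n + i)) x)"
    unfolding AE_all_countable P_def o_def by simp
  then have conv: "AE x in lborel. convergent (\<lambda>i. f (r i) x)"
  proof eventually_elim
    case (elim x)
    obtain n where "x \<in> Q (real n)" using UN_Q by blast
    then have "convergent (\<lambda>i. f (r (Suc n + i)) x)" using elim unfolding Cauchy_convergent_iff by blast
    then have "convergent (\<lambda>i. f (r (i + Suc n)) x)" by (simp only: add.commute[of _ "Suc n"])
    then show ?case using convergent_ignore_initial_segment[of "\<lambda>i. f (r i) x" "Suc n"] by simp
  qed
  define g where "g x = lim (\<lambda>i. f (r i) x)" for x
  have gb [measurable]: "g \<in> borel_measurable borel" unfolding g_def by measurable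
  have lim: "AE x in lborel. (\<lambda>n. f (r n) x) \<longlonglongrightarrow> g x"
    using conv by eventually_elim (simp add: g_def convergent_LIMSEQ_iff)
  \<comment> \<open>Fatou's lemma in the second index: f_n - g is the almost everywhere limit of f_n
    - f_(r k). The estimate therefore holds for the whole sequence, not only along
    \<open>r\<close>.\<close>
  have E: "\<exists>n0. \<forall>n\<ge>n0. (\<integral>\<^sup>+x. indicator (Q R) x * ennreal ((norm (f n x - g x))\<^sup>2) \<partial>lborel) \<le> ennreal e" if e: "e > 0" for R e
  proof -
    obtain n0 where n0: "\<And>i j. i \<ge> n0 \<Longrightarrow> j \<ge> n0 \<Longrightarrow> (\<integral>\<^sup>+x. indicator (Q R) x * ennreal ((norm (f i x - f j x))\<^sup>2) \<partial>lborel) \<le> ennreal e"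
      using C[OF e] by blast
    show ?thesis
    proof (intro exI[of _ n0] allI impI)
      fix n assume n: "n \<ge> n0"
      have "(\<integral>\<^sup>+x. indicator (Q R) x * ennreal ((norm (f n x - g x))\<^sup>2) \<partial>lborel) =
        (\<integral>\<^sup>+x. liminf (\<lambda>k. indicator (Q R) x * ennreal ((norm (f n x - f (r k) x))\<^sup>2)) \<partial>lborel)"
      proof (rule nn_integral_cong_AE)
        show "AE x in lborel. indicator (Q R) x * ennreal ((norm (f n x - g x))\<^sup>2) = liminf (\<lambda>k. indicator (Q R) x * ennreal ((norm (f n x - f (r k) x))\<^sup>2))"
          using lim
        proof eventually_elim
          case (elim x)
          have "(\<lambda>k. ennreal (indicator (Q R) x * (norm (f n x - f (r k) x))\<^sup>2)) \<longlonglongrightarrow> ennreal (indicator (Q R) x * (norm (f n x - g x))\<^sup>2)"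
            by (intro tendsto_ennrealI tendsto_intros elim)
          then have "(\<lambda>k. indicator (Q R) x * ennreal ((norm (f n x - f (r k) x))\<^sup>2)) \<longlonglongrightarrow> indicator (Q R) x * ennreal ((norm (f n x - g x))\<^sup>2)"
            by (auto simp: indicator_def split: if_splits)
          then show ?case using lim_imp_Liminf[OF sequentially_bot] by metis
        qed
      qed
      also have "\<dots> \<le> liminf (\<lambda>k. \<integral>\<^sup>+x. indicator (Q R) x * ennreal ((norm (f n x - f (r k) x))\<^sup>2) \<partial>lborel)"
        by (rule nn_integral_liminf) measurable
      also have "\<dots> \<le> ennreal e"
      proof (rule Liminf_le)
        show "\<forall>\<^sub>F k in sequentially. (\<integral>\<^sup>+x. indicator (Q R) x * ennreal ((norm (f n x - f (r k) x))\<^sup>2) \<partial>lborel) \<le> ennreal e"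
          unfolding eventually_sequentially using n0 n seq_suble[OF r] by (meson le_trans)
      qed simp
      finally show "(\<integral>\<^sup>+x. indicator (Q R) x * ennreal ((norm (f n x - g x))\<^sup>2) \<partial>lborel) \<le> ennreal e" .
    qed
  qed
  show ?thesis by (rule that[OF r gb lim E])
qed

section \<open>Cell averages and local compactness\<close>

text \<open>Closed grid cells of side \<open>1 / Suc j\<close>, labelled by the integer vector of
  the lower corner. Neighbours share faces; for averages each point selects a single cell through
  \<open>corner\<close>.\<close>

definition cell :: "nat \<Rightarrow> ('n \<Rightarrow> int) \<Rightarrow> (real^'n) set" where
  "cell j k = {y. \<forall>i. real_of_int (k i) \<le> real (Suc j) * y $ i \<and> real (Suc j) * y $ i \<le> real_of_int (k i) + 1}"

lemma cell_cbox: "cell j k = cbox (\<chi> i. real_of_int (k i) / real (Suc j)) (\<chi> i. (real_of_int (k i) + 1) / real (Suc j))"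
proof -
  have p: "0 < real (Suc j)" by simp
  show ?thesis unfolding cell_def set_eq_iff mem_box_cart
    by (simp add: pos_divide_le_eq[OF p] pos_le_divide_eq[OF p] mult.commute del: of_nat_Suc) 
qed

lemma cell_borel [measurable]: "cell j k \<in> sets borel" by (simp add: cell_cbox)

lemma emeasure_cell: "emeasure lborel (cell j k :: (real^'n) set) = ennreal (1 / real (Suc j) ^ CARD('n))"
proof -
  have ne: "cell j k \<noteq> ({} :: (real^'n) set)"
    unfolding cell_cbox by (simp add: interval_ne_empty_cart divide_right_mono)
  have "measure lborel (cell j k :: (real^'n) set) = 1 / real (Suc j) ^ CARD('n)"
    using content_cbox_cart[OF ne[unfolded cell_cbox]] unfolding cell_cbox
    by (simp add: diff_divide_distrib[symmetric] power_one_over)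
  moreover have "emeasure lborel (cell j k :: (real^'n) set) = ennreal (measure lborel (cell j k :: (real^'n) set))"
    by (rule emeasure_eq_ennreal_measure) (metis cell_cbox emeasure_lborel_cbox_finite less_irrefl infinity_ennreal_def)
  ultimately show ?thesis by simp
qed

definition corner :: "nat \<Rightarrow> real^'n \<Rightarrow> 'n \<Rightarrow> int" where "corner j x i = \<lfloor>real (Suc j) * x $ i\<rfloor>"

lemma cell_corner_diff:
  assumes "x + h \<in> cell j (corner j x)" shows "h \<in> Q (1 / real (Suc j))"
proof -
  have "\<bar>h $ i\<bar> \<le> 1 / real (Suc j)" for i
  proof -
    have "real_of_int \<lfloor>real (Suc j) * x $ i\<rfloor> \<le> real (Suc j) * (x $ i + h $ i)"
      "real (Suc j) * (x $ i + h $ i) \<le> real_of_int \<lfloor>real (Suc j) * x $ i\<rfloor> + 1"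
      using assms by (auto simp: cell_def corner_def)
    moreover have "real_of_int \<lfloor>real (Suc j) * x $ i\<rfloor> \<le> real (Suc j) * x $ i" "real (Suc j) * x $ i < real_of_int \<lfloor>real (Suc j) * x $ i\<rfloor> + 1"
      by linarith+
    ultimately have "real (Suc j) * h $ i \<le> 1" "- 1 \<le> real (Suc j) * h $ i" unfolding distrib_left by linarith+
    then have "\<bar>real (Suc j) * h $ i\<bar> \<le> 1" by linarith
    then show ?thesis by (simp add: abs_mult field_simps)
  qed
  then show ?thesis by (simp add: Q_def)
qed

text \<open>Conditional expectation with respect to the grid. It depends on \<open>x\<close> only
  through \<open>corner j x\<close>, so one function has countably many averages in all, which is
  what a diagonal argument can handle.\<close>

definition cell_avg :: "nat \<Rightarrow> (real^'n \<Rightarrow> real) \<Rightarrow> real^'n \<Rightarrow> real" where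
  "cell_avg j f x = real (Suc j) ^ CARD('n) * (\<integral>y. indicator (cell j (corner j x)) y * f y \<partial>lborel)"

lemma cell_corner_measurable [measurable]:
  "Measurable.pred (borel \<Otimes>\<^sub>M borel) (\<lambda>(x :: real^'n, y). y \<in> cell j (corner j x))"
  unfolding cell_def corner_def by measurable

lemma cell_avg_borel [measurable]:
  fixes f :: "real^'n \<Rightarrow> real"
  assumes [measurable]: "f \<in> borel_measurable borel"
  shows "cell_avg j f \<in> borel_measurable borel"
proof -
  have "(\<lambda>(x :: real^'n, y). if y \<in> cell j (corner j x) then f y else 0) \<in> borel_measurable (borel \<Otimes>\<^sub>M lborel)"
    by measurable
  then have "(\<lambda>x. \<integral>y. (if y \<in> cell j (corner j x) then f y else 0) \<partial>lborel) \<in> borel_measurable borel"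
    by (rule lborel.borel_measurable_lebesgue_integral)
  moreover have "cell_avg j f = (\<lambda>x. real (Suc j) ^ CARD('n) * (\<integral>y. (if y \<in> cell j (corner j x) then f y else 0) \<partial>lborel))"
    unfolding cell_avg_def by (intro ext arg_cong[where f="\<lambda>z. _ * z"] Bochner_Integration.integral_cong) auto
  ultimately show ?thesis by simp
qed

text \<open>Cauchy-Schwarz on a cell of volume \<open>1 / real (Suc j) ^ CARD('n)\<close>. A
  non-integrable integrand has integral 0, and the left side vanishes.\<close>

lemma cell_square_le:
  fixes z :: "real^'n \<Rightarrow> real"
  assumes [measurable]: "z \<in> borel_measurable borel"
  shows "ennreal ((real (Suc j) ^ CARD('n) * (\<integral>y. indicator (cell j k) y * z y \<partial>lborel))\<^sup>2)
    \<le> ennreal (real (Suc j) ^ CARD('n)) * (\<integral>\<^sup>+y. indicator (cell j k) y * ennreal ((z y)\<^sup>2) \<partial>lborel)"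
proof (cases "integrable lborel (\<lambda>y. indicator (cell j k) y * z y)")
  case True
  let ?q = "real (Suc j) ^ CARD('n)"
  have "ennreal ((\<integral>y. indicator (cell j k) y * z y \<partial>lborel)\<^sup>2) = (ennreal (norm (\<integral>y. indicator (cell j k) y * z y \<partial>lborel)))\<^sup>2"
    by (simp add: ennreal_power)
  also have "\<dots> \<le> (\<integral>\<^sup>+y. norm (indicator (cell j k) y * z y) \<partial>lborel)\<^sup>2"
    by (intro power_mono integral_norm_bound_ennreal True) simp
  also have "(\<integral>\<^sup>+y. norm (indicator (cell j k) y * z y) \<partial>lborel) = (\<integral>\<^sup>+y. indicator (cell j k) y * (indicator (cell j k) y * ennreal \<bar>z y\<bar>) \<partial>lborel)"
    by (intro nn_integral_cong) (auto simp: indicator_def)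
  also have "\<dots>\<^sup>2 \<le> (\<integral>\<^sup>+y. (indicator (cell j k) (y::real^'n))\<^sup>2 \<partial>lborel) * (\<integral>\<^sup>+y. (indicator (cell j k) y * ennreal \<bar>z y\<bar>)\<^sup>2 \<partial>lborel)"
    by (rule Cauchy_Schwarz_nn_integral) measurable
  also have "(\<integral>\<^sup>+y. (indicator (cell j k) (y::real^'n))\<^sup>2 \<partial>lborel) = (\<integral>\<^sup>+y. (indicator (cell j k) (y::real^'n)) \<partial>lborel)"
    by (intro nn_integral_cong) (auto simp: indicator_def)
  also have "\<dots> = ennreal (1 / ?q)" by (simp add: emeasure_cell)
  also have "(\<integral>\<^sup>+y. (indicator (cell j k) y * ennreal \<bar>z y\<bar>)\<^sup>2 \<partial>lborel) = (\<integral>\<^sup>+y. indicator (cell j k) y * ennreal ((z y)\<^sup>2) \<partial>lborel)"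
    by (intro nn_integral_cong) (auto simp: indicator_def ennreal_power)
  finally have "ennreal (?q\<^sup>2) * ennreal ((\<integral>y. indicator (cell j k) y * z y \<partial>lborel)\<^sup>2) \<le>
     ennreal (?q\<^sup>2) * (ennreal (1 / ?q) * (\<integral>\<^sup>+y. indicator (cell j k) y * ennreal ((z y)\<^sup>2) \<partial>lborel))"
    by (rule mult_left_mono) simp
  also have "\<dots> = ennreal (?q\<^sup>2 * (1 / ?q)) * (\<integral>\<^sup>+y. indicator (cell j k) y * ennreal ((z y)\<^sup>2) \<partial>lborel)"
  proof -
    have "ennreal (?q\<^sup>2 * (1 / ?q)) = ennreal (?q\<^sup>2) * ennreal (1 / ?q)" by (rule ennreal_mult) auto
    then show ?thesis by (simp only: mult.assoc)
  qed
  also have "?q\<^sup>2 * (1 / ?q) = ?q" by (simp add: power2_eq_square)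
  finally show ?thesis by (simp add: power_mult_distrib ennreal_mult)
qed (simp add: not_integrable_integral_eq)

text \<open>By Cauchy-Schwarz the squared error at x is at most the mean of (f(y) - f(x))^2 over the
  cell of x, and y - x lies in the cube of size 1/(j + 1). The cell is thereby enlarged to a cube
  with twice the side, the origin of the factor 2^N.\<close>

lemma cell_avg_error:
  fixes f :: "real^'n \<Rightarrow> real" and K :: real
  assumes [measurable]: "f \<in> borel_measurable borel" and d: "diff_bound K f" and K: "0 \<le> K"
    and i: "integrable lborel (\<lambda>x. (f x)\<^sup>2)"
  shows "(\<integral>\<^sup>+x. ennreal ((cell_avg j f x - f x)\<^sup>2) \<partial>lborel) \<le> ennreal (2 ^ CARD('n) * CARD('n) * K / (real (Suc j))\<^sup>2)"
proof -
  let ?q = "real (Suc j) ^ CARD('n)"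
  have int: "integrable lborel (\<lambda>y. indicator (cell j k) y * f y)" for k
  proof (rule integrable_mult_of_squares)
    show "integrable lborel (\<lambda>y::real^'n. (indicator (cell j k) y)\<^sup>2 :: real)"
      by (simp add: power2_eq_square indicator_inter_arith[symmetric] emeasure_cell)
  qed (use i in measurable)
  have "(\<integral>\<^sup>+x. ennreal ((cell_avg j f x - f x)\<^sup>2) \<partial>lborel) \<le>
    (\<integral>\<^sup>+x. ennreal ?q * (\<integral>\<^sup>+h. indicator (Q (1 / real (Suc j))) h * ennreal ((f (x + h) - f x)\<^sup>2) \<partial>lborel) \<partial>lborel)"
  proof (rule nn_integral_mono)
    fix x :: "real^'n"
    let ?c = "cell j (corner j x)"
    have m: "(\<integral>y. indicator ?c (y::real^'n) \<partial>lborel) = 1 / ?q"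
      using emeasure_cell[of j "corner j x"] by (simp add: measure_def)
    have "cell_avg j f x - f x = ?q * ((\<integral>y. indicator ?c y * f y \<partial>lborel) - f x * (\<integral>y. indicator ?c (y::real^'n) \<partial>lborel))"
      unfolding cell_avg_def m by (simp add: right_diff_distrib)
    also have "(\<integral>y. indicator ?c y * f y \<partial>lborel) - f x * (\<integral>y. indicator ?c (y::real^'n) \<partial>lborel) = (\<integral>y. indicator ?c y * f y - f x * indicator ?c y \<partial>lborel)"
      using int emeasure_cell[of j "corner j x"] by simp
    also have "\<dots> = (\<integral>y. indicator ?c y * (f y - f x) \<partial>lborel)" by (simp add: algebra_simps)
    finally have "ennreal ((cell_avg j f x - f x)\<^sup>2) \<le> ennreal ?q * (\<integral>\<^sup>+y. indicator ?c y * ennreal ((f y - f x)\<^sup>2) \<partial>lborel)"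
      using cell_square_le[of "\<lambda>y. f y - f x" j "corner j x"] by simp
    also have "(\<integral>\<^sup>+y. indicator ?c y * ennreal ((f y - f x)\<^sup>2) \<partial>lborel) = (\<integral>\<^sup>+h. indicator ?c (h + x) * ennreal ((f (h + x) - f x)\<^sup>2) \<partial>lborel)"
      by (rule nn_integral_lborel_shift[symmetric]) measurable
    also have "\<dots> \<le> (\<integral>\<^sup>+h. indicator (Q (1 / real (Suc j))) h * ennreal ((f (x + h) - f x)\<^sup>2) \<partial>lborel)"
    proof (intro nn_integral_mono)
      fix h
      show "indicator ?c (h + x) * ennreal ((f (h + x) - f x)\<^sup>2) \<le> indicator (Q (1 / real (Suc j))) h * ennreal ((f (x + h) - f x)\<^sup>2)"
        using cell_corner_diff[of x h j] by (auto simp: indicator_def add.commute)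
    qed
    finally show "ennreal ((cell_avg j f x - f x)\<^sup>2) \<le> ennreal ?q * (\<integral>\<^sup>+h. indicator (Q (1 / real (Suc j))) h * ennreal ((f (x + h) - f x)\<^sup>2) \<partial>lborel)"
      by (simp add: mult_left_mono)
  qed
  also have "\<dots> = ennreal ?q * (\<integral>\<^sup>+x. (\<integral>\<^sup>+h. indicator (Q (1 / real (Suc j))) h * ennreal ((f (x + h) - f x)\<^sup>2) \<partial>lborel) \<partial>lborel)"
    by (rule nn_integral_cmult) measurable
  also have "\<dots> \<le> ennreal ?q * ennreal ((2 * (1 / real (Suc j))) ^ CARD('n) * (CARD('n) * (1 / real (Suc j))\<^sup>2 * K))"
    by (intro mult_left_mono diff_bound_average d K) auto
  also have "\<dots> = ennreal (2 ^ CARD('n) * CARD('n) * K / (real (Suc j))\<^sup>2)"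
    using K by (subst ennreal_mult[symmetric]) (auto simp: power_divide)
  finally show ?thesis .
qed

lemma four_squares:
  fixes a b c d :: real
  shows "2 * (b - a)\<^sup>2 + 2 * (d - c)\<^sup>2 \<le> 4 * (a\<^sup>2 + b\<^sup>2 + c\<^sup>2 + d\<^sup>2)"
  using zero_le_power2[of "a + b"] zero_le_power2[of "c + d"] by (simp add: power2_eq_square algebra_simps)

text \<open>The error of averaging over cells is small uniformly along the sequence by
  \<open>cell_avg_error\<close>, while for a fixed grid the averages are countably many bounded
  sequences of reals. A diagonal subsequence makes all averages converge, and a three-term
  comparison shows that the subsequence is Cauchy in L^2 on every cube.\<close>

theorem rellich:
  fixes u :: "nat \<Rightarrow> real^'n \<Rightarrow> real" and K M :: real
  assumes [measurable]: "\<And>n. u n \<in> borel_measurable borel"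
    and i: "\<And>n. integrable lborel (\<lambda>x. (u n x)\<^sup>2)" and M: "\<And>n. (\<integral>x. (u n x)\<^sup>2 \<partial>lborel) \<le> M"
    and d: "\<And>n. diff_bound K (u n)" and K: "0 \<le> K"
  obtains r g where "strict_mono r" "g \<in> borel_measurable borel" "AE x in lborel. (\<lambda>n. u (r n) x) \<longlonglongrightarrow> g x"
    "\<And>R e. e > 0 \<Longrightarrow> \<exists>n0. \<forall>n\<ge>n0. (\<integral>\<^sup>+x. indicator (Q R) x * ennreal ((u (r n) x - g x)\<^sup>2) \<partial>lborel) \<le> ennreal e"
proof -
  define a where "a n p = (\<integral>y. indicator (cell (fst p) (snd p)) y * u n y \<partial>lborel)" for n and p :: "nat \<times> ('n \<Rightarrow> int)"
  have M0: "M \<ge> 0" using order_trans[OF integral_nonneg_AE M[of 0]] by simp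
  have a_bound: "\<bar>a n p\<bar> \<le> 1 + M" for n p
  proof -
    let ?c = "cell (fst p) (snd p) :: (real^'n) set"
    have c: "integrable lborel (indicator ?c :: _ \<Rightarrow> real)" by (simp add: emeasure_cell)
    have c1: "(\<integral>y. indicator ?c y \<partial>lborel) \<le> (1::real)"
      using emeasure_cell[of "fst p" "snd p"] by (simp add: measure_def)
    have "\<bar>a n p\<bar> \<le> (\<integral>y. indicator ?c y + (u n y)\<^sup>2 \<partial>lborel)"
      unfolding a_def
    proof (rule order_trans[OF integral_abs_bound], rule integral_mono_AE')
      show "integrable lborel (\<lambda>y. indicator ?c y + (u n y)\<^sup>2)" using c i by simp
      show "AE y in lborel. \<bar>indicator ?c y * u n y\<bar> \<le> indicator ?c y + (u n y)\<^sup>2"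
      proof (rule AE_I2)
        fix y
        have "2 * 1 * \<bar>u n y\<bar> \<le> 1\<^sup>2 + \<bar>u n y\<bar>\<^sup>2" by (rule sum_squares_bound)
        then have "\<bar>u n y\<bar> \<le> 1 + (u n y)\<^sup>2" by simp
        then show "\<bar>indicator ?c y * u n y\<bar> \<le> indicator ?c y + (u n y)\<^sup>2" by (auto simp: indicator_def)
      qed
    qed auto
    also have "\<dots> = (\<integral>y. indicator ?c y \<partial>lborel) + (\<integral>y. (u n y)\<^sup>2 \<partial>lborel)" using c i by simp
    finally show ?thesis using c1 M[of n] by linarith
  qed
  \<comment> \<open>Pairs of a mesh index and a corner index form a countable type, so
    \<open>from_nat\<close> enumerates all cells of all grids.\<close>
  define P where "P n s \<longleftrightarrow> convergent (\<lambda>i. a (s i) (from_nat n))" for n :: nat and s :: "nat \<Rightarrow> nat"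
  interpret subseqs P
  proof
    fix n :: nat and s :: "nat \<Rightarrow> nat" assume "strict_mono s"
    have "bounded (range (\<lambda>i. a (s i) (from_nat n)))" using a_bound unfolding bounded_iff by (intro exI[of _ "1 + M"]) auto
    then obtain l r where "strict_mono (r :: nat \<Rightarrow> nat)" "((\<lambda>i. a (s i) (from_nat n)) \<circ> r) \<longlonglongrightarrow> l"
      using bounded_imp_convergent_subsequence by metis
    then show "\<exists>r'. strict_mono r' \<and> P n (s \<circ> r')" by (auto simp: P_def o_def convergent_def)
  qed
  define s where "s = diagseq"
  have s: "strict_mono s" unfolding s_def by (rule subseq_diagseq)
  have "P n (s \<circ> ((+) (Suc n)))" for n
    unfolding s_def
  proof (rule diagseq_holds)
    fix t t' :: "nat \<Rightarrow> nat" and n assume "strict_mono t" "P n t'"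
    then show "P n (t' \<circ> t)" unfolding P_def
      using convergent_subseq_convergent[of "\<lambda>i. a (t' i) (from_nat n)" t] by (simp add: o_def)
  qed
  then have "convergent (\<lambda>i. a (s (Suc n + i)) (from_nat n))" for n unfolding P_def o_def .
  then have "convergent (\<lambda>i. a (s (i + Suc n)) (from_nat n))" for n by (simp only: add.commute[of _ "Suc n"])
  then have conv0: "convergent (\<lambda>i. a (s i) (from_nat n))" for n
    using convergent_ignore_initial_segment[of "\<lambda>i. a (s i) (from_nat n)" "Suc n"] by simp
  have conv: "convergent (\<lambda>i. a (s i) p)" for p using conv0[of "to_nat p"] by simp
  define v where "v i = u (s i)" for i
  have vb [measurable]: "v i \<in> borel_measurable borel" for i unfolding v_def by measurable
  have C: "\<exists>n0. \<forall>i\<ge>n0. \<forall>l\<ge>n0. (\<integral>\<^sup>+x. indicator (Q R) x * ennreal ((norm (v i x - v l x))\<^sup>2) \<partial>lborel) \<le> ennreal e" if e: "e > 0" for R e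
  proof -
    define c where "c = 2 ^ CARD('n) * CARD('n) * K"
    have c0: "c \<ge> 0" using K by (simp add: c_def)
    \<comment> \<open>The mesh makes each averaging error at most e / 16. Four such contributions,
      multiplied by the factor 4 of \<open>four_squares\<close>, add up to \<open>e\<close>.\<close>
    obtain j :: nat where j: "16 * c / e \<le> real j" using real_arch_simple by blast
    have cj: "c / (real (Suc j))\<^sup>2 \<le> e / 16"
    proof -
      have "16 * c / e \<le> real (Suc j) * 1" using j by simp
      also have "\<dots> \<le> real (Suc j) * real (Suc j)" by (intro mult_left_mono) auto
      finally have "16 * c \<le> e * (real (Suc j))\<^sup>2" using e by (simp add: power2_eq_square field_simps del: of_nat_Suc)
      then show ?thesis by (subst pos_divide_le_eq) auto
    qed
    define P where "P i = cell_avg j (v i)" for i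
    have [measurable]: "P i \<in> borel_measurable borel" for i unfolding P_def by measurable
    define q where "q = real (Suc j) ^ CARD('n)"
    have Pa: "P i x = q * a (s i) (j, corner j x)" for i x by (simp add: P_def cell_avg_def q_def a_def v_def)
    define p where "p x = lim (\<lambda>i. P i x)" for x
    have [measurable]: "p \<in> borel_measurable borel" unfolding p_def by measurable
    have lim: "(\<lambda>i. P i x) \<longlonglongrightarrow> p x" for x
      unfolding p_def using conv by (subst convergent_LIMSEQ_iff[symmetric]) (auto simp: Pa intro!: convergent_mult convergent_const)
    have Pb: "\<bar>P i x\<bar> \<le> q * (1 + M)" for i x
      unfolding Pa abs_mult using a_bound by (intro mult_mono) (auto simp: q_def)
    have pb: "\<bar>p x\<bar> \<le> q * (1 + M)" for x
      using tendsto_upperbound[OF tendsto_rabs[OF lim]] Pb by auto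
    have err: "(\<integral>\<^sup>+x. indicator (Q R) x * ennreal ((P i x - v i x)\<^sup>2) \<partial>lborel) \<le> ennreal (e / 16)" for i
    proof -
      have "(\<integral>\<^sup>+x. indicator (Q R) x * ennreal ((P i x - v i x)\<^sup>2) \<partial>lborel) \<le> (\<integral>\<^sup>+x. ennreal ((P i x - v i x)\<^sup>2) \<partial>lborel)"
        by (intro nn_integral_mono) (auto simp: indicator_def)
      also have "\<dots> \<le> ennreal (c / (real (Suc j))\<^sup>2)"
        unfolding P_def c_def by (rule cell_avg_error) (use d K i in \<open>auto simp: v_def\<close>)
      also have "\<dots> \<le> ennreal (e / 16)" using cj by (rule ennreal_leI)
      finally show ?thesis .
    qed
    \<comment> \<open>With the mesh fixed, the averages converge pointwise and are bounded by q (1 +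
      M), so dominated convergence applies on the cube.\<close>
    have "(\<lambda>i. \<integral>\<^sup>+x. indicator (Q R) x * ennreal ((P i x - p x)\<^sup>2) \<partial>lborel) \<longlonglongrightarrow> (\<integral>\<^sup>+x. (0::ennreal) \<partial>(lborel :: (real^'n) measure))"
    proof (rule nn_integral_dominated_convergence[where w="\<lambda>x. ennreal ((2 * (q * (1 + M)))\<^sup>2) * indicator (Q R) x"])
      show "(\<integral>\<^sup>+x. ennreal ((2 * (q * (1 + M)))\<^sup>2) * indicator (Q R) (x::real^'n) \<partial>lborel) < \<infinity>"
        by (subst nn_integral_cmult_indicator) (auto simp: ennreal_mult_less_top emeasure_Q_finite[unfolded infinity_ennreal_def])
      show "AE x in lborel. indicator (Q R) x * ennreal ((P i x - p x)\<^sup>2) \<le> ennreal ((2 * (q * (1 + M)))\<^sup>2) * indicator (Q R) x" for i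
      proof (rule AE_I2)
        fix x
        have "\<bar>P i x - p x\<bar> \<le> 2 * (q * (1 + M))" using Pb[of i x] pb[of x] by linarith
        then have "\<bar>P i x - p x\<bar>\<^sup>2 \<le> (2 * (q * (1 + M)))\<^sup>2" by (rule power_mono) simp
        then show "indicator (Q R) x * ennreal ((P i x - p x)\<^sup>2) \<le> ennreal ((2 * (q * (1 + M)))\<^sup>2) * indicator (Q R) x"
          by (auto simp: indicator_def intro: ennreal_leI)
      qed
      show "AE x in lborel. (\<lambda>i. indicator (Q R) x * ennreal ((P i x - p x)\<^sup>2)) \<longlonglongrightarrow> 0"
      proof (rule AE_I2)
        fix x
        have "(\<lambda>i. ennreal (indicator (Q R) x * (P i x - p x)\<^sup>2)) \<longlonglongrightarrow> ennreal (indicator (Q R) x * (p x - p x)\<^sup>2)"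
          by (intro tendsto_ennrealI tendsto_intros lim)
        then show "(\<lambda>i. indicator (Q R) x * ennreal ((P i x - p x)\<^sup>2)) \<longlonglongrightarrow> 0"
          by (auto simp: indicator_def split: if_splits)
      qed
    qed measurable
    then have "\<forall>\<^sub>F i in sequentially. (\<integral>\<^sup>+x. indicator (Q R) x * ennreal ((P i x - p x)\<^sup>2) \<partial>lborel) < ennreal (e / 16)"
      using e by (intro order_tendstoD(2)) auto
    then obtain n0 where n0: "\<And>i. i \<ge> n0 \<Longrightarrow> (\<integral>\<^sup>+x. indicator (Q R) x * ennreal ((P i x - p x)\<^sup>2) \<partial>lborel) < ennreal (e / 16)"
      unfolding eventually_sequentially by blast
    show ?thesis
    proof (intro exI[of _ n0] allI impI)
      fix i l assume il: "i \<ge> n0" "l \<ge> n0"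
      let ?I = "\<lambda>f. \<integral>\<^sup>+x. indicator (Q R) x * ennreal ((f x)\<^sup>2) \<partial>(lborel :: (real^'n) measure)"
      have "(\<integral>\<^sup>+x. indicator (Q R) x * ennreal ((norm (v i x - v l x))\<^sup>2) \<partial>lborel) \<le>
        (\<integral>\<^sup>+x. 4 * (indicator (Q R) x * ennreal ((P i x - v i x)\<^sup>2) + indicator (Q R) x * ennreal ((P i x - p x)\<^sup>2) +
          indicator (Q R) x * ennreal ((P l x - p x)\<^sup>2) + indicator (Q R) x * ennreal ((P l x - v l x)\<^sup>2)) \<partial>lborel)"
      proof (rule nn_integral_mono)
        fix x
        let ?a = "P i x - v i x" and ?b = "P i x - p x" and ?c = "P l x - p x" and ?d = "P l x - v l x"
        have sq: "(y + z)\<^sup>2 \<le> 2 * y\<^sup>2 + 2 * z\<^sup>2" for y z :: real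
          using zero_le_power2[of "y - z"] by (simp add: power2_eq_square algebra_simps)
        have "(v i x - v l x)\<^sup>2 = ((?b - ?a) + (?d - ?c))\<^sup>2" by simp
        also have "\<dots> \<le> 2 * (?b - ?a)\<^sup>2 + 2 * (?d - ?c)\<^sup>2" by (rule sq)
        also have "\<dots> \<le> 4 * (?a\<^sup>2 + ?b\<^sup>2 + ?c\<^sup>2 + ?d\<^sup>2)" by (rule four_squares)
        finally have "ennreal ((v i x - v l x)\<^sup>2) \<le> ennreal (4 * (?a\<^sup>2 + ?b\<^sup>2 + ?c\<^sup>2 + ?d\<^sup>2))" by (rule ennreal_leI)
        also have "\<dots> = 4 * (ennreal (?a\<^sup>2) + ennreal (?b\<^sup>2) + ennreal (?c\<^sup>2) + ennreal (?d\<^sup>2))"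
          by (simp add: ennreal_mult)
        finally show "indicator (Q R) x * ennreal ((norm (v i x - v l x))\<^sup>2) \<le>
          4 * (indicator (Q R) x * ennreal (?a\<^sup>2) + indicator (Q R) x * ennreal (?b\<^sup>2) +
          indicator (Q R) x * ennreal (?c\<^sup>2) + indicator (Q R) x * ennreal (?d\<^sup>2))"
          by (auto simp: indicator_def)
      qed
      also have "\<dots> = 4 * (?I (\<lambda>x. P i x - v i x) + ?I (\<lambda>x. P i x - p x) + ?I (\<lambda>x. P l x - p x) + ?I (\<lambda>x. P l x - v l x))"
        by (simp add: nn_integral_cmult nn_integral_add)
      also have "\<dots> \<le> 4 * (ennreal (e / 16) + ennreal (e / 16) + ennreal (e / 16) + ennreal (e / 16))"
        using n0[OF il(1)] n0[OF il(2)] err by (intro mult_left_mono add_mono) (auto intro: less_imp_le)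
      also have "\<dots> = ennreal 4 * ennreal (e / 16 + e / 16 + e / 16 + e / 16)"
      proof -
        have "0 \<le> e / 16" using e by simp
        then show ?thesis by (simp only: ennreal_plus add_nonneg_nonneg ennreal_numeral)
      qed
      also have "\<dots> = ennreal e" using e by (subst ennreal_mult[symmetric]) auto
      finally show "(\<integral>\<^sup>+x. indicator (Q R) x * ennreal ((norm (v i x - v l x))\<^sup>2) \<partial>lborel) \<le> ennreal e" .
    qed
  qed
  have fin: "(\<integral>\<^sup>+x. indicator (Q R) x * ennreal ((norm (v n x))\<^sup>2) \<partial>lborel) < \<infinity>" for n R
  proof -
    have "(\<integral>\<^sup>+x. indicator (Q R) x * ennreal ((norm (v n x))\<^sup>2) \<partial>lborel) \<le> (\<integral>\<^sup>+x. ennreal ((v n x)\<^sup>2) \<partial>lborel)"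
      by (intro nn_integral_mono) (auto simp: indicator_def)
    also have "\<dots> = ennreal (\<integral>x. (v n x)\<^sup>2 \<partial>lborel)" by (rule nn_integral_eq_integral) (use i in \<open>auto simp: v_def\<close>)
    also have "\<dots> < \<infinity>" by simp
    finally show ?thesis .
  qed
  obtain r g where r: "strict_mono r" "g \<in> borel_measurable borel" "AE x in lborel. (\<lambda>n. v (r n) x) \<longlonglongrightarrow> g x"
    "\<And>R e. e > 0 \<Longrightarrow> \<exists>n0. \<forall>n\<ge>n0. (\<integral>\<^sup>+x. indicator (Q R) x * ennreal ((norm (v n x - g x))\<^sup>2) \<partial>lborel) \<le> ennreal e"
    using L2_local_Cauchy[OF vb C fin] by blast
  show ?thesis
  proof (rule that[of "s \<circ> r" g])
    show "strict_mono (s \<circ> r)" using s r(1) by (rule strict_mono_o)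
    show "AE x in lborel. (\<lambda>n. u ((s \<circ> r) n) x) \<longlonglongrightarrow> g x" using r(3) by (simp add: v_def)
    show "\<exists>n0. \<forall>n\<ge>n0. (\<integral>\<^sup>+x. indicator (Q R) x * ennreal ((u ((s \<circ> r) n) x - g x)\<^sup>2) \<partial>lborel) \<le> ennreal e" if e: "e > 0" for R e
    proof -
      obtain n0 where "\<And>n. n \<ge> n0 \<Longrightarrow> (\<integral>\<^sup>+x. indicator (Q R) x * ennreal ((norm (v n x - g x))\<^sup>2) \<partial>lborel) \<le> ennreal e"
        using r(4)[OF e] by blast
      moreover have "n0 \<le> r n" if "n \<ge> n0" for n using le_trans[OF that seq_suble[OF r(1)]] .
      ultimately show ?thesis unfolding v_def o_def real_norm_def power2_abs by blast
    qed
  qed (rule r(2))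
qed

text \<open>Iterated midpoints of a tail of \<open>F\<close>: enough convex combinations for the Mazur argument below, by the parallelogram law.\<close>

inductive mid_hull :: "(nat \<Rightarrow> 'a \<Rightarrow> 'b::real_vector) \<Rightarrow> nat \<Rightarrow> ('a \<Rightarrow> 'b) \<Rightarrow> bool" for F k where
  base: "n \<ge> k \<Longrightarrow> mid_hull F k (F n)"
| mid: "mid_hull F k a \<Longrightarrow> mid_hull F k b \<Longrightarrow> mid_hull F k (\<lambda>x. (1/2) *\<^sub>R (a x + b x))"

lemma mid_hull_mono: "mid_hull F l h \<Longrightarrow> k \<le> l \<Longrightarrow> mid_hull F k h"
  by (induction rule: mid_hull.induct) (auto intro: mid_hull.intros)

lemma mid_hull_borel:
  fixes F :: "nat \<Rightarrow> 'a::euclidean_space \<Rightarrow> 'b::euclidean_space"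
  assumes "mid_hull F k h" "\<And>n. F n \<in> borel_measurable borel"
  shows "h \<in> borel_measurable borel"
  using assms by (induction rule: mid_hull.induct) (auto intro!: borel_measurable_scaleR borel_measurable_add)

text \<open>Midpoint convexity in the second argument of \<Phi> propagates an integral bound through
  the hull. The dependence of \<Phi> on x allows restrictions to a cube and distances to a given
  function.\<close>

lemma mid_hull_convex_bound:
  fixes F :: "nat \<Rightarrow> 'a::euclidean_space \<Rightarrow> 'b::euclidean_space"
  assumes "mid_hull F k h" and F: "\<And>n. F n \<in> borel_measurable borel"
    and meas: "(\<lambda>(x, y). \<Phi> x y) \<in> borel_measurable (borel \<Otimes>\<^sub>M borel)"
    and nn: "\<And>x y. 0 \<le> \<Phi> x y" and conv: "\<And>x a b. \<Phi> x ((1/2) *\<^sub>R (a + b)) \<le> (\<Phi> x a + \<Phi> x b) / (2::real)"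
    and B: "\<And>n. n \<ge> k \<Longrightarrow> (\<integral>\<^sup>+x. ennreal (\<Phi> x (F n x)) \<partial>lborel) \<le> ennreal B"
  shows "(\<integral>\<^sup>+x. ennreal (\<Phi> x (h x)) \<partial>lborel) \<le> ennreal B"
  using assms(1)
proof (induction rule: mid_hull.induct)
  case (base n) then show ?case by (rule B)
next
  case (mid a b)
  have [measurable]: "a \<in> borel_measurable borel" "b \<in> borel_measurable borel"
    using mid_hull_borel[OF _ F] mid by auto
  have m: "(\<lambda>x. \<Phi> x (z x)) \<in> borel_measurable lborel" if [measurable]: "z \<in> borel_measurable borel" for z
    using measurable_compose[OF _ meas, of "\<lambda>x. (x, z x)" lborel] by simp
  note [measurable] = m[of a] m[of b]
  have "(\<integral>\<^sup>+x. ennreal (\<Phi> x ((1/2) *\<^sub>R (a x + b x))) \<partial>lborel) \<le> (\<integral>\<^sup>+x. ennreal (1/2) * ennreal (\<Phi> x (a x)) + ennreal (1/2) * ennreal (\<Phi> x (b x)) \<partial>lborel)"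
  proof (rule nn_integral_mono)
    fix x
    have "ennreal (\<Phi> x ((1/2) *\<^sub>R (a x + b x))) \<le> ennreal (1/2 * \<Phi> x (a x) + 1/2 * \<Phi> x (b x))"
      using conv[of x "a x" "b x"] by (intro ennreal_leI) simp
    also have "\<dots> = ennreal (1/2 * \<Phi> x (a x)) + ennreal (1/2 * \<Phi> x (b x))"
      using nn[of x] by (intro ennreal_plus) auto
    also have "\<dots> = ennreal (1/2) * ennreal (\<Phi> x (a x)) + ennreal (1/2) * ennreal (\<Phi> x (b x))"
      using nn[of x] by (subst (1 2) ennreal_mult) auto
    finally show "ennreal (\<Phi> x ((1/2) *\<^sub>R (a x + b x))) \<le> ennreal (1/2) * ennreal (\<Phi> x (a x)) + ennreal (1/2) * ennreal (\<Phi> x (b x))" .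
  qed
  also have "\<dots> = ennreal (1/2) * (\<integral>\<^sup>+x. ennreal (\<Phi> x (a x)) \<partial>lborel) + ennreal (1/2) * (\<integral>\<^sup>+x. ennreal (\<Phi> x (b x)) \<partial>lborel)"
    by (subst nn_integral_add) (auto simp: nn_integral_cmult)
  also have "\<dots> \<le> ennreal (1/2) * ennreal B + ennreal (1/2) * ennreal B"
    using mid by (intro add_mono mult_left_mono) auto
  also have "\<dots> = (ennreal (1/2) + ennreal (1/2)) * ennreal B" by (simp only: distrib_right)
  also have "ennreal (1/2) + ennreal (1/2) = 1" by (subst ennreal_plus[symmetric]) auto
  finally show ?case by simp
qed

text \<open>\<open>A k\<close> is the infimum of the squared L^2 norms over the hull of the tail
  from k. It is nondecreasing and bounded, hence convergent. Near-minimisers \<open>h k\<close> form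
  a Cauchy sequence by the parallelogram law, because the midpoint of \<open>h i\<close> and
  \<open>h j\<close> lies in the hull of the tail from min i j and cannot have norm below the
  infimum there.\<close>

lemma mazur_Cauchy:
  fixes F :: "nat \<Rightarrow> 'a::euclidean_space \<Rightarrow> 'b::euclidean_space"
  assumes F: "\<And>n. F n \<in> borel_measurable borel" and C: "\<And>n. (\<integral>\<^sup>+x. ennreal ((norm (F n x))\<^sup>2) \<partial>lborel) \<le> ennreal C" "0 \<le> C"
  obtains h where "\<And>k. mid_hull F k (h k)" 
    "\<And>e. e > 0 \<Longrightarrow> \<exists>n0. \<forall>i\<ge>n0. \<forall>j\<ge>n0. (\<integral>\<^sup>+x. ennreal ((norm (h i x - h j x))\<^sup>2) \<partial>lborel) \<le> ennreal e"
proof -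
  define I where "I z = (\<integral>x. (norm (z x))\<^sup>2 \<partial>lborel)" for z :: "'a \<Rightarrow> 'b"
  have par: "(norm (x - y))\<^sup>2 = 2 * (norm x)\<^sup>2 + 2 * (norm y)\<^sup>2 - 4 * (norm ((1/2) *\<^sub>R (x + y)))\<^sup>2" for x y :: 'b
    unfolding power2_norm_eq_inner by (simp add: inner_simps inner_commute add_divide_distrib)
  have b: "(\<integral>\<^sup>+x. ennreal ((norm (z x))\<^sup>2) \<partial>lborel) \<le> ennreal C" if z: "mid_hull F k z" for z k
  proof (rule mid_hull_convex_bound[OF z F, where \<Phi>="\<lambda>x y. (norm y)\<^sup>2"])
    show "(norm ((1/2) *\<^sub>R (x + y)))\<^sup>2 \<le> ((norm x)\<^sup>2 + (norm y)\<^sup>2) / 2" for x y :: 'b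
      using par[of x y] zero_le_power2[of "norm (x - y)"] by simp
  qed (use C in auto)
  have int: "integrable lborel (\<lambda>x. (norm (z x))\<^sup>2)" if z: "mid_hull F k z" for z k
  proof (rule integrableI_bounded)
    show "(\<lambda>x. (norm (z x))\<^sup>2) \<in> borel_measurable lborel" using mid_hull_borel[OF z F] by measurable
    show "(\<integral>\<^sup>+x. ennreal (norm ((norm (z x))\<^sup>2)) \<partial>lborel) < \<infinity>" using b[OF z] by (auto intro: le_less_trans)
  qed
  have IC: "I z \<le> C" if z: "mid_hull F k z" for z k
    using b[OF z] C(2) unfolding nn_integral_eq_integral[OF int[OF z], simplified] by (simp add: I_def)
  have I0: "0 \<le> I z" for z by (simp add: I_def)
  define A where "A k = Inf (I ` {z. mid_hull F k z})" for k
  have bdd: "bdd_below (I ` X)" for X using I0 by (auto intro: bdd_belowI[of _ 0])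
  have ne: "{z. mid_hull F k z} \<noteq> {}" for k using mid_hull.base[of k k F] by auto
  have low: "A k \<le> I z" if "mid_hull F k z" for z k
    unfolding A_def by (rule cInf_lower[OF _ bdd]) (use that in auto)
  have Amono: "A k \<le> A l" if "k \<le> l" for k l
    unfolding A_def by (rule cInf_superset_mono[OF _ bdd]) (use ne that in \<open>auto intro: mid_hull_mono\<close>)
  have AC: "A k \<le> C" for k using order_trans[OF low IC] mid_hull.base[of k k F] by blast
  have "norm (A k) \<le> \<bar>A 0\<bar> + C" for k using Amono[of 0 k] AC[of k] C(2) unfolding real_norm_def by linarith
  then have "convergent A"
    using Amono by (intro Bseq_monoseq_convergent BseqI'[of A "\<bar>A 0\<bar> + C"] incseq_imp_monoseq) (auto simp: incseq_def)
  then have cau: "Cauchy A" by (simp add: Cauchy_convergent_iff)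
  have "\<exists>z. mid_hull F k z \<and> I z < A k + inverse (real (Suc k))" for k
  proof -
    have "A k < A k + inverse (real (Suc k))" by simp
    then show ?thesis unfolding A_def using cInf_lessD[of "I ` {z. mid_hull F k z}"] ne by auto
  qed
  then obtain h where h: "\<And>k. mid_hull F k (h k)" "\<And>k. I (h k) < A k + inverse (real (Suc k))" by metis
  have "\<exists>n0. \<forall>i\<ge>n0. \<forall>j\<ge>n0. (\<integral>\<^sup>+x. ennreal ((norm (h i x - h j x))\<^sup>2) \<partial>lborel) \<le> ennreal e" if e: "e > 0" for e
  proof -
    obtain n1 where n1: "\<And>i j. i \<ge> n1 \<Longrightarrow> j \<ge> n1 \<Longrightarrow> \<bar>A i - A j\<bar> < e / 8"
      using cau e unfolding Cauchy_def dist_real_def by (meson divide_pos_pos zero_less_numeral)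
    obtain n2 where n2: "inverse (real (Suc n2)) < e / 8" using reals_Archimedean[of "e / 8"] e by auto
    show ?thesis
    proof (intro exI[of _ "max n1 n2"] allI impI)
      fix i j assume "i \<ge> max n1 n2" "j \<ge> max n1 n2"
      then have ij: "i \<ge> n1" "j \<ge> n1" "i \<ge> n2" "j \<ge> n2" by auto
      have inv: "inverse (real (Suc k)) \<le> inverse (real (Suc n2))" if "k \<ge> n2" for k
        using that by (intro le_imp_inverse_le) auto
      define m where "m = min i j"
      have hm: "mid_hull F m (\<lambda>x. (1/2) *\<^sub>R (h i x + h j x))"
        using h(1) by (intro mid_hull.mid mid_hull_mono[OF h(1)[of i]] mid_hull_mono[OF h(1)[of j]]) (auto simp: m_def)
      have mi: "integrable lborel (\<lambda>x. (norm ((1/2) *\<^sub>R (h i x + h j x)))\<^sup>2)" by (rule int[OF hm])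
      have "(\<integral>\<^sup>+x. ennreal ((norm (h i x - h j x))\<^sup>2) \<partial>lborel) = ennreal (\<integral>x. (norm (h i x - h j x))\<^sup>2 \<partial>lborel)"
      proof (rule nn_integral_eq_integral)
        show "integrable lborel (\<lambda>x. (norm (h i x - h j x))\<^sup>2)"
          unfolding par using int[OF h(1)] mi by (intro Bochner_Integration.integrable_diff Bochner_Integration.integrable_add integrable_mult_right)
      qed simp
      also have "(\<integral>x. (norm (h i x - h j x))\<^sup>2 \<partial>lborel) = 2 * I (h i) + 2 * I (h j) - 4 * I (\<lambda>x. (1/2) *\<^sub>R (h i x + h j x))"
        unfolding par I_def using int[OF h(1)] mi
        by (subst Bochner_Integration.integral_diff, simp, simp, subst Bochner_Integration.integral_add, simp, simp) (simp only: integral_mult_right_zero)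
      also have "\<dots> \<le> 2 * (A i + e / 8) + 2 * (A j + e / 8) - 4 * A m"
      proof -
        have "I (h i) \<le> A i + e / 8" using h(2)[of i] inv[OF ij(3)] n2 by linarith
        moreover have "I (h j) \<le> A j + e / 8" using h(2)[of j] inv[OF ij(4)] n2 by linarith
        ultimately show ?thesis using low[OF hm] by (intro diff_mono add_mono mult_left_mono) auto
      qed
      also have "\<dots> \<le> e"
      proof -
        \<comment> \<open>The right-hand side is e / 2 plus twice a difference of \<open>A i\<close>
          and \<open>A j\<close>, since \<open>m\<close> is one of the two indices.\<close>
        have "A m = A i \<or> A m = A j" by (auto simp: m_def min_def)
        moreover have "A i - A j < e / 8" "A j - A i < e / 8" using n1[OF ij(1,2)] by linarith+
        ultimately show ?thesis by auto
      qed
      finally show "(\<integral>\<^sup>+x. ennreal ((norm (h i x - h j x))\<^sup>2) \<partial>lborel) \<le> ennreal e" by (simp add: ennreal_leI)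
    qed
  qed
  then show ?thesis using that[of h] h(1) by blast
qed

section \<open>Weak limits\<close>

lemma borel_measurable_fst_snd [measurable (raw)]:
  fixes f :: "'a \<Rightarrow> 'b::topological_space \<times> 'c::topological_space"
  assumes f: "f \<in> borel_measurable M"
  shows "(\<lambda>x. fst (f x)) \<in> borel_measurable M" "(\<lambda>x. snd (f x)) \<in> borel_measurable M"
proof -
  have "fst \<in> borel_measurable (borel :: ('b \<times> 'c) measure)" "snd \<in> borel_measurable (borel :: ('b \<times> 'c) measure)"
    by (intro borel_measurable_continuous_onI continuous_intros)+
  then show "(\<lambda>x. fst (f x)) \<in> borel_measurable M" "(\<lambda>x. snd (f x)) \<in> borel_measurable M"
    using f by (auto intro: measurable_compose)
qed

lemma nn_fatou_le:
  fixes f :: "nat \<Rightarrow> 'a \<Rightarrow> real"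
  assumes [measurable]: "\<And>k. f k \<in> borel_measurable M"
    and l: "AE x in M. (\<lambda>k. f k x) \<longlonglongrightarrow> g x"
    and B: "\<forall>\<^sub>F k in sequentially. (\<integral>\<^sup>+x. ennreal (f k x) \<partial>M) \<le> B"
  shows "(\<integral>\<^sup>+x. ennreal (g x) \<partial>M) \<le> B"
proof -
  have "(\<integral>\<^sup>+x. ennreal (g x) \<partial>M) = (\<integral>\<^sup>+x. liminf (\<lambda>k. ennreal (f k x)) \<partial>M)"
  proof (rule nn_integral_cong_AE)
    show "AE x in M. ennreal (g x) = liminf (\<lambda>k. ennreal (f k x))"
      using l
    proof eventually_elim
      case (elim x)
      show ?case using lim_imp_Liminf[OF sequentially_bot tendsto_ennrealI[OF elim]] by simp
    qed
  qed
  also have "\<dots> \<le> liminf (\<lambda>k. \<integral>\<^sup>+x. ennreal (f k x) \<partial>M)" by (rule nn_integral_liminf) measurable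
  also have "\<dots> \<le> B" by (rule Liminf_le[OF sequentially_bot B])
  finally show ?thesis .
qed

text \<open>A bounded \<psi> supported in one cube sees only the L^2 convergence on that cube. This
  lets integral identities pass to limits that are merely local.\<close>

lemma L2_local_test_tendsto:
  fixes f :: "nat \<Rightarrow> real^'n \<Rightarrow> real"
  assumes [measurable]: "\<And>k. f k \<in> borel_measurable borel" "g \<in> borel_measurable borel" "\<psi> \<in> borel_measurable borel"
    and f2: "\<And>k. integrable lborel (\<lambda>x. (f k x)\<^sup>2)" and g2: "integrable lborel (\<lambda>x. (g x)\<^sup>2)"
    and conv: "\<And>e. e > 0 \<Longrightarrow> \<exists>n0. \<forall>k\<ge>n0. (\<integral>\<^sup>+x. indicator (Q R) x * ennreal ((f k x - g x)\<^sup>2) \<partial>lborel) \<le> ennreal e"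
    and psi: "\<And>x. \<bar>\<psi> x\<bar> \<le> B * indicator (Q R) x"
  shows "(\<lambda>k. \<integral>x. f k x * \<psi> x \<partial>lborel) \<longlonglongrightarrow> (\<integral>x. g x * \<psi> x \<partial>lborel)"
proof -
  have psi2: "integrable lborel (\<lambda>x. (\<psi> x)\<^sup>2)"
  proof (rule Bochner_Integration.integrable_bound)
    show "integrable lborel (\<lambda>x. B\<^sup>2 * indicator (Q R) (x::real^'n) :: real)"
      by (intro integrable_mult_right integrable_real_indicator) (auto simp: emeasure_Q_finite[unfolded infinity_ennreal_def])
    show "AE x in lborel. norm ((\<psi> x)\<^sup>2) \<le> norm (B\<^sup>2 * indicator (Q R) x :: real)"
    proof (rule AE_I2)
      fix x show "norm ((\<psi> x)\<^sup>2) \<le> norm (B\<^sup>2 * indicator (Q R) x :: real)"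
        using power_mono[OF psi[of x] abs_ge_zero, of 2] by (auto simp: power_mult_distrib indicator_def split: if_splits)
    qed
  qed measurable
  have i1: "integrable lborel (\<lambda>x. f k x * \<psi> x)" for k by (rule integrable_mult_of_squares[OF _ _ f2 psi2]) measurable
  have i2: "integrable lborel (\<lambda>x. g x * \<psi> x)" by (rule integrable_mult_of_squares[OF _ _ g2 psi2]) measurable
  show ?thesis
  proof (rule LIMSEQ_I)
    fix \<eta> :: real assume eta: "\<eta> > 0"
    define m where "m = measure lborel (Q R :: (real^'n) set) + 1"
    have m: "m > 0" "measure lborel (Q R :: (real^'n) set) < m" unfolding m_def by (auto simp: add_nonneg_pos)
    define b where "b = \<bar>B\<bar> + 1"
    have b: "b > 0" "B \<le> b" by (auto simp: b_def)
    define d where "d = \<eta> / (2 * b * m)"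
    have d: "d > 0" using eta b m by (simp add: d_def)
    define e where "e = d * \<eta> / (4 * b)"
    have e: "e > 0" using eta d b by (simp add: e_def)
    obtain n0 where n0: "\<And>k. k \<ge> n0 \<Longrightarrow> (\<integral>\<^sup>+x. indicator (Q R) x * ennreal ((f k x - g x)\<^sup>2) \<partial>lborel) \<le> ennreal e"
      using conv[OF e] by blast
    show "\<exists>n0. \<forall>k\<ge>n0. norm ((\<integral>x. f k x * \<psi> x \<partial>lborel) - (\<integral>x. g x * \<psi> x \<partial>lborel)) < \<eta>"
    proof (intro exI[of _ n0] allI impI)
      fix k assume k: "k \<ge> n0"
      have L: "(\<integral>\<^sup>+x. indicator (Q R) x * ennreal ((norm (f k x - g x))\<^sup>2) \<partial>lborel) \<le> ennreal e" using n0[OF k] by simp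
      have mm: "(\<lambda>x. f k x - g x) \<in> borel_measurable borel" by measurable
      note L1 = L1_le_L2_Q[OF mm d L less_imp_le[OF e]]
      have "norm ((\<integral>x. f k x * \<psi> x \<partial>lborel) - (\<integral>x. g x * \<psi> x \<partial>lborel)) = norm (\<integral>x. f k x * \<psi> x - g x * \<psi> x \<partial>lborel)"
        using i1 i2 by simp
      also have "\<dots> \<le> (\<integral>x. norm (f k x * \<psi> x - g x * \<psi> x) \<partial>lborel)" by (rule integral_norm_bound)
      also have "\<dots> \<le> (\<integral>x. b * norm (indicator (Q R) x *\<^sub>R (f k x - g x)) \<partial>lborel)"
      proof (rule integral_mono)
        fix x
        have "\<bar>\<psi> x\<bar> \<le> b * indicator (Q R) x"
          using order_trans[OF psi mult_right_mono[OF b(2)]] by (simp add: indicator_def split: if_splits)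
        then have "\<bar>f k x - g x\<bar> * \<bar>\<psi> x\<bar> \<le> \<bar>f k x - g x\<bar> * (b * indicator (Q R) x)" by (rule mult_left_mono) simp
        then show "norm (f k x * \<psi> x - g x * \<psi> x) \<le> b * norm (indicator (Q R) x *\<^sub>R (f k x - g x))"
          by (simp add: abs_mult[symmetric] left_diff_distrib[symmetric] del: abs_mult) (simp add: abs_mult mult_ac)
      qed (use i1 i2 L1(1) in \<open>auto intro!: integrable_norm simp del: norm_scaleR real_norm_def\<close>)
      also have "\<dots> = b * (\<integral>x. norm (indicator (Q R) x *\<^sub>R (f k x - g x)) \<partial>lborel)" by simp
      also have "\<dots> \<le> b * (d * measure lborel (Q R :: (real^'n) set) + e / d)"
        using b L1(2) by (intro mult_left_mono) auto
      also have "\<dots> < b * (d * m + e / d)" using b d m by (intro mult_strict_left_mono add_strict_right_mono mult_strict_left_mono) auto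
      also have "\<dots> \<le> \<eta>" using b m d eta unfolding e_def d_def by (simp add: distrib_left)
      finally show "norm ((\<integral>x. f k x * \<psi> x \<partial>lborel) - (\<integral>x. g x * \<psi> x \<partial>lborel)) < \<eta>" .
    qed
  qed
qed

lemma cball_subset_Q: "cball 0 R \<subseteq> (Q R :: (real^'n) set)"
  unfolding Q_def using order_trans[OF component_le_norm_cart] by auto

lemma norm_midpoint_square_le:
  fixes a b :: "'b::real_inner"
  shows "(norm ((1/2) *\<^sub>R (a + b)))\<^sup>2 \<le> ((norm a)\<^sup>2 + (norm b)\<^sup>2) / 2"
proof -
  have "(norm (a - b))\<^sup>2 = 2 * (norm a)\<^sup>2 + 2 * (norm b)\<^sup>2 - 4 * (norm ((1/2) *\<^sub>R (a + b)))\<^sup>2"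
    unfolding power2_norm_eq_inner by (simp add: inner_simps inner_commute add_divide_distrib)
  then show ?thesis using zero_le_power2[of "norm (a - b)"] by simp
qed

lemma real_midpoint_square:
  fixes p q c :: real
  shows "((p + q) / 2 - c)\<^sup>2 \<le> ((p - c)\<^sup>2 + (q - c)\<^sup>2) / 2"
  using zero_le_power2[of "p - q"] by (simp add: power2_eq_square field_simps)

lemma norm_triple_square:
  fixes y :: "real \<times> (real^'n) \<times> (real^'n)"
  shows "(norm y)\<^sup>2 = (fst y)\<^sup>2 + (norm (fst (snd y)))\<^sup>2 + (norm (snd (snd y)))\<^sup>2"
  by (simp add: norm_prod_def)

text \<open>The triples (u, Du, u Du) are bounded in L^2, and Mazur's argument gives midpoint
  combinations converging almost everywhere along a subsequence and in L^2 on cubes to some (a, V,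
  W). Strong local convergence of u identifies a = g and W = g V. The kinetic density is |V|^2 + 2
  |W|^2, convex in the triple, so its localised integrals are lower semicontinuous even though (1 +
  2 u^2) |Du|^2 is not convex in (u, Du).\<close>

theorem weak_limit:
  fixes u :: "nat \<Rightarrow> real^'n \<Rightarrow> real" and Du :: "nat \<Rightarrow> real^'n \<Rightarrow> real^'n" and C :: real
  assumes [measurable]: "\<And>n. u n \<in> borel_measurable borel" "\<And>n. Du n \<in> borel_measurable borel" "g \<in> borel_measurable borel"
    and wg: "\<And>n. weak_grad (u n) (Du n)"
    and u2: "\<And>n. integrable lborel (\<lambda>x. (u n x)\<^sup>2)" "\<And>n. (\<integral>x. (u n x)\<^sup>2 \<partial>lborel) \<le> C"
    and D2: "\<And>n. integrable lborel (\<lambda>x. (norm (Du n x))\<^sup>2)" "\<And>n. (\<integral>x. (norm (Du n x))\<^sup>2 \<partial>lborel) \<le> C"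
    and uD2: "\<And>n. integrable lborel (\<lambda>x. (u n x)\<^sup>2 * (norm (Du n x))\<^sup>2)" "\<And>n. (\<integral>x. (u n x)\<^sup>2 * (norm (Du n x))\<^sup>2 \<partial>lborel) \<le> C"
    and g2: "integrable lborel (\<lambda>x. (g x)\<^sup>2)"
    and conv: "\<And>R e. e > 0 \<Longrightarrow> \<exists>n0. \<forall>n\<ge>n0. (\<integral>\<^sup>+x. indicator (Q R) x * ennreal ((u n x - g x)\<^sup>2) \<partial>lborel) \<le> ennreal e"
  obtains Dg where "Dg \<in> borel_measurable borel" "weak_grad g Dg" "integrable lborel (\<lambda>x. (norm (Dg x))\<^sup>2)"
    "integrable lborel (\<lambda>x. (g x)\<^sup>2 * (norm (Dg x))\<^sup>2)"
    "\<And>R B k. (\<And>n. n \<ge> k \<Longrightarrow> (\<integral>\<^sup>+x. ennreal (indicator (Q R) x * ((1 + 2 * (u n x)\<^sup>2) * (norm (Du n x))\<^sup>2)) \<partial>lborel) \<le> ennreal B) \<Longrightarrow>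
       (\<integral>\<^sup>+x. ennreal (indicator (Q R) x * ((1 + 2 * (g x)\<^sup>2) * (norm (Dg x))\<^sup>2)) \<partial>lborel) \<le> ennreal B"
proof -
  have C0: "0 \<le> C" using order_trans[OF integral_nonneg_AE u2(2)[of 0]] by simp
  \<comment> \<open>The product u Du is carried along as an independent component; the relation to
    the other two is nonlinear and lost in convex combinations.\<close>
  define F where "F n x = (u n x, Du n x, u n x *\<^sub>R Du n x)" for n x
  have Fb [measurable]: "F n \<in> borel_measurable borel" for n unfolding F_def by measurable
  have Fn: "(\<integral>\<^sup>+x. ennreal ((norm (F n x))\<^sup>2) \<partial>lborel) \<le> ennreal (3 * C)" for n
  proof -
    have e: "(norm (F n x))\<^sup>2 = (u n x)\<^sup>2 + (norm (Du n x))\<^sup>2 + (u n x)\<^sup>2 * (norm (Du n x))\<^sup>2" for x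
      unfolding norm_triple_square by (simp add: F_def power_mult_distrib)
    have "(\<integral>\<^sup>+x. ennreal ((norm (F n x))\<^sup>2) \<partial>lborel) = ennreal (\<integral>x. (norm (F n x))\<^sup>2 \<partial>lborel)"
      by (rule nn_integral_eq_integral) (use u2 D2 uD2 in \<open>auto simp: e\<close>)
    also have "(\<integral>x. (norm (F n x))\<^sup>2 \<partial>lborel) \<le> 3 * C"
      unfolding e using u2[of n] D2[of n] uD2[of n] by simp
    finally show ?thesis by (simp add: ennreal_leI)
  qed
  have C3: "0 \<le> 3 * C" using C0 by simp
  obtain h where h: "\<And>k. mid_hull F k (h k)"
    "\<And>e. e > 0 \<Longrightarrow> \<exists>n0. \<forall>i\<ge>n0. \<forall>j\<ge>n0. (\<integral>\<^sup>+x. ennreal ((norm (h i x - h j x))\<^sup>2) \<partial>lborel) \<le> ennreal e"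
    by (rule mazur_Cauchy[OF Fb Fn C3], rule that, assumption+)
  have hull_b: "z \<in> borel_measurable borel" if "mid_hull F k z" for z k
    by (rule mid_hull_borel[OF that]) measurable
  have hull_n: "(\<integral>\<^sup>+x. ennreal ((norm (z x))\<^sup>2) \<partial>lborel) \<le> ennreal (3 * C)" if z: "mid_hull F k z" for z k
    by (rule mid_hull_convex_bound[OF z, where \<Phi>="\<lambda>x y. (norm y)\<^sup>2"]) (use Fn norm_midpoint_square_le in auto)
  have hull_i: "integrable lborel (\<lambda>x. (norm (z x))\<^sup>2)" if z: "mid_hull F k z" for z k
  proof (rule integrableI_bounded)
    show "(\<lambda>x. (norm (z x))\<^sup>2) \<in> borel_measurable lborel" using hull_b[OF z] by measurable
    show "(\<integral>\<^sup>+x. ennreal (norm ((norm (z x))\<^sup>2)) \<partial>lborel) < \<infinity>" using hull_n[OF z] by (auto intro: le_less_trans)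
  qed
  have comp: "integrable lborel (\<lambda>x. (fst (z x))\<^sup>2)" "integrable lborel (\<lambda>x. (fst (snd (z x)) $ i)\<^sup>2)"
    if zb [measurable]: "z \<in> borel_measurable borel" and zi: "integrable lborel (\<lambda>x. (norm (z x))\<^sup>2)"
    for z :: "real^'n \<Rightarrow> real \<times> (real^'n) \<times> (real^'n)" and i
  proof -
    show "integrable lborel (\<lambda>x. (fst (z x))\<^sup>2)"
      by (rule Bochner_Integration.integrable_bound[OF zi]) (auto intro!: AE_I2 simp: norm_triple_square)
    have "(fst (snd y) $ i)\<^sup>2 \<le> (norm y)\<^sup>2" for y :: "real \<times> (real^'n) \<times> (real^'n)"
    proof -
      have "\<bar>fst (snd y) $ i\<bar>\<^sup>2 \<le> (norm (fst (snd y)))\<^sup>2" by (intro power_mono component_le_norm_cart) simp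
      then show ?thesis unfolding norm_triple_square by (simp add: add_nonneg_nonneg add_increasing2 add_increasing)
    qed
    then show "integrable lborel (\<lambda>x. (fst (snd (z x)) $ i)\<^sup>2)"
      by (intro Bochner_Integration.integrable_bound[OF zi]) (auto intro!: AE_I2)
  qed
  have hull_w: "(\<integral>x. fst (z x) * pderiv_i \<phi> i x \<partial>lborel) = - (\<integral>x. fst (snd (z x)) $ i * \<phi> x \<partial>lborel)"
    if "mid_hull F k z" and t: "test_fun \<phi>" for z k \<phi> i
    using that(1)
  proof (induction rule: mid_hull.induct)
    case (base n) then show ?case using wg[of n] t by (simp add: F_def weak_grad_def)
  next
    case (mid a b)
    note [measurable] = hull_b[OF mid(1)] hull_b[OF mid(2)] test_fun_borel[OF t] test_fun_borel[OF test_fun_pderiv[OF t]]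
    note p2 = test_fun_square_integrable[OF t] test_fun_square_integrable[OF test_fun_pderiv[OF t]]
    have i1: "integrable lborel (\<lambda>x. fst (z x) * pderiv_i \<phi> i x)" "integrable lborel (\<lambda>x. fst (snd (z x)) $ i * \<phi> x)"
      if z: "mid_hull F k z" for z
    proof -
      note [measurable] = hull_b[OF z]
      show "integrable lborel (\<lambda>x. fst (z x) * pderiv_i \<phi> i x)"
        by (rule integrable_mult_of_squares[OF _ _ comp(1)[OF hull_b[OF z] hull_i[OF z]] p2(2)]) measurable
      show "integrable lborel (\<lambda>x. fst (snd (z x)) $ i * \<phi> x)"
        by (rule integrable_mult_of_squares[OF _ _ comp(2)[OF hull_b[OF z] hull_i[OF z]] p2(1)]) measurable
    qed
    have "(\<integral>x. fst ((1/2) *\<^sub>R (a x + b x)) * pderiv_i \<phi> i x \<partial>lborel) = (\<integral>x. 1/2 * (fst (a x) * pderiv_i \<phi> i x + fst (b x) * pderiv_i \<phi> i x) \<partial>lborel)"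
      by (intro Bochner_Integration.integral_cong refl) (simp add: algebra_simps)
    also have "\<dots> = 1/2 * ((\<integral>x. fst (a x) * pderiv_i \<phi> i x \<partial>lborel) + (\<integral>x. fst (b x) * pderiv_i \<phi> i x \<partial>lborel))"
      using i1[OF mid(1)] i1[OF mid(2)] by (simp only: integral_mult_right_zero Bochner_Integration.integral_add)
    also have "\<dots> = - (1/2 * ((\<integral>x. fst (snd (a x)) $ i * \<phi> x \<partial>lborel) + (\<integral>x. fst (snd (b x)) $ i * \<phi> x \<partial>lborel)))"
      unfolding mid.IH by (simp add: add_divide_distrib)
    also have "1/2 * ((\<integral>x. fst (snd (a x)) $ i * \<phi> x \<partial>lborel) + (\<integral>x. fst (snd (b x)) $ i * \<phi> x \<partial>lborel)) =
      (\<integral>x. 1/2 * (fst (snd (a x)) $ i * \<phi> x + fst (snd (b x)) $ i * \<phi> x) \<partial>lborel)"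
      using i1[OF mid(1)] i1[OF mid(2)] by (simp only: integral_mult_right_zero Bochner_Integration.integral_add)
    also have "\<dots> = (\<integral>x. fst (snd ((1/2) *\<^sub>R (a x + b x))) $ i * \<phi> x \<partial>lborel)"
      by (intro Bochner_Integration.integral_cong refl) (simp add: algebra_simps)
    finally show ?case .
  qed
  have hb [measurable]: "h k \<in> borel_measurable borel" for k using hull_b[OF h(1)] .
  have hC: "\<exists>n0. \<forall>i\<ge>n0. \<forall>j\<ge>n0. (\<integral>\<^sup>+x. indicator (Q R) x * ennreal ((norm (h i x - h j x))\<^sup>2) \<partial>lborel) \<le> ennreal e" if e: "e > 0" for R e
  proof -
    have "(\<integral>\<^sup>+x. indicator (Q R) x * ennreal ((norm (h i x - h j x))\<^sup>2) \<partial>lborel) \<le> (\<integral>\<^sup>+x. ennreal ((norm (h i x - h j x))\<^sup>2) \<partial>lborel)" for i j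
      by (intro nn_integral_mono) (auto simp: indicator_def)
    then show ?thesis using h(2)[OF e] by (meson order_trans)
  qed
  have hfin: "(\<integral>\<^sup>+x. indicator (Q R) x * ennreal ((norm (h k x))\<^sup>2) \<partial>lborel) < \<infinity>" for k R
  proof -
    have "(\<integral>\<^sup>+x. indicator (Q R) x * ennreal ((norm (h k x))\<^sup>2) \<partial>lborel) \<le> (\<integral>\<^sup>+x. ennreal ((norm (h k x))\<^sup>2) \<partial>lborel)"
      by (intro nn_integral_mono) (auto simp: indicator_def)
    also note hull_n[OF h(1)]
    finally show ?thesis by (auto intro: le_less_trans)
  qed
  obtain r H where r: "strict_mono r" and Hb [measurable]: "H \<in> borel_measurable borel" and Hl: "AE x in lborel. (\<lambda>n. h (r n) x) \<longlonglongrightarrow> H x"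
    and Hc: "\<And>R e. e > 0 \<Longrightarrow> \<exists>n0. \<forall>n\<ge>n0. (\<integral>\<^sup>+x. indicator (Q R) x * ennreal ((norm (h n x - H x))\<^sup>2) \<partial>lborel) \<le> ennreal e"
  proof (rule L2_local_Cauchy[OF hb hC hfin])
    fix r g assume *: "strict_mono r" "g \<in> borel_measurable borel" "AE x in lborel. (\<lambda>n. h (r n) x) \<longlonglongrightarrow> g x"
      "\<And>R e. e > 0 \<Longrightarrow> \<exists>n0. \<forall>n\<ge>n0. (\<integral>\<^sup>+x. indicator (Q R) x * ennreal ((norm (h n x - g x))\<^sup>2) \<partial>lborel) \<le> ennreal e"
    show ?thesis by (rule that[OF *])
  qed
  have hr: "mid_hull F k (h (r n))" if "n \<ge> k" for n k
    using mid_hull_mono[OF h(1)] seq_suble[OF r, of n] that by (meson le_trans)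
  \<comment> \<open>An integral bound convex in the triple holds on the hull of a tail, and Fatou's
    lemma carries it to the limit \<open>H\<close>. All properties of the limit below except the
    weak gradient identity are instances for suitable \<Phi>.\<close>
  have lsc: "(\<integral>\<^sup>+x. ennreal (\<Phi> x (H x)) \<partial>lborel) \<le> ennreal B"
    if m: "(\<lambda>(x, y). \<Phi> x y) \<in> borel_measurable (borel \<Otimes>\<^sub>M borel)"
    and nn: "\<And>x y. 0 \<le> \<Phi> x y" and cv: "\<And>x a b. \<Phi> x ((1/2) *\<^sub>R (a + b)) \<le> (\<Phi> x a + \<Phi> x b) / (2::real)"
    and cont: "\<And>x. continuous_on UNIV (\<Phi> x)"
    and B: "\<And>n. n \<ge> k \<Longrightarrow> (\<integral>\<^sup>+x. ennreal (\<Phi> x (F n x)) \<partial>lborel) \<le> ennreal B" for \<Phi> B k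
  proof (rule nn_fatou_le[where f="\<lambda>n x. \<Phi> x (h (r n) x)"])
    show "(\<lambda>x. \<Phi> x (h (r n) x)) \<in> borel_measurable lborel" for n
      using measurable_compose[OF _ m, of "\<lambda>x. (x, h (r n) x)" lborel] by simp
    show "AE x in lborel. (\<lambda>n. \<Phi> x (h (r n) x)) \<longlonglongrightarrow> \<Phi> x (H x)"
      using Hl
    proof eventually_elim
      case (elim x)
      have "isCont (\<Phi> x) (H x)" using cont[of x] unfolding continuous_on_eq_continuous_at[OF open_UNIV] by blast
      then show ?case using elim by (rule isCont_tendsto_compose)
    qed
    show "\<forall>\<^sub>F n in sequentially. (\<integral>\<^sup>+x. ennreal (\<Phi> x (h (r n) x)) \<partial>lborel) \<le> ennreal B"
      unfolding eventually_sequentially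
      by (intro exI[of _ k] allI impI mid_hull_convex_bound[OF hr _ m nn cv B]) auto
  qed
  define a V W where "a x = fst (H x)" and "V x = fst (snd (H x))" and "W x = snd (snd (H x))" for x
  have [measurable]: "a \<in> borel_measurable borel" "V \<in> borel_measurable borel" "W \<in> borel_measurable borel"
    unfolding a_def V_def W_def by measurable
  have HC: "(\<integral>\<^sup>+x. ennreal ((norm (H x))\<^sup>2) \<partial>lborel) \<le> ennreal (3 * C)"
    by (rule lsc[where \<Phi>="\<lambda>x y. (norm y)\<^sup>2" and k=0]) (use norm_midpoint_square_le Fn in \<open>auto intro!: continuous_intros\<close>)
  have Hi: "integrable lborel (\<lambda>x. (norm (H x))\<^sup>2)"
    by (rule integrableI_bounded) (use HC in \<open>auto intro: le_less_trans\<close>)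
  have zero_AE: "AE x in lborel. f x = 0"
    if [measurable]: "f \<in> borel_measurable borel" and nn: "\<And>x. 0 \<le> f x" 
      and z: "\<And>n e. e > 0 \<Longrightarrow> (\<integral>\<^sup>+x. ennreal (indicator (Q (real n)) x * f x) \<partial>lborel) \<le> ennreal e" for f :: "real^'n \<Rightarrow> real"
  proof -
    have "AE x in lborel. indicator (Q (real n)) x * f x = 0" for n
    proof -
      have "(\<integral>\<^sup>+x. ennreal (indicator (Q (real n)) x * f x) \<partial>lborel) \<le> 0"
        by (rule ennreal_le_epsilon) (use z in auto)
      then have "(\<integral>\<^sup>+x. ennreal (indicator (Q (real n)) x * f x) \<partial>lborel) = 0" by simp
      then have "AE x in lborel. ennreal (indicator (Q (real n)) x * f x) = 0" by (subst (asm) nn_integral_0_iff_AE) auto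
      then show ?thesis by eventually_elim (use nn in \<open>auto simp: indicator_def ennreal_eq_0_iff intro: antisym split: if_splits\<close>)
    qed
    then have "AE x in lborel. \<forall>n. indicator (Q (real n)) x * f x = 0" unfolding AE_all_countable by (rule allI)
    then show ?thesis
    proof eventually_elim
      case (elim x)
      obtain n where "x \<in> Q (real n)" using UN_Q by blast
      then show ?case using elim[rule_format, of n] by simp
    qed
  qed
  \<comment> \<open>The instance is \<Phi> = (first component - g(x))^2 on a cube, convex and
    eventually of small integral along the sequence.\<close>
  have ag: "AE x in lborel. (a x - g x)\<^sup>2 = 0"
  proof (rule zero_AE)
    fix n and e :: real assume e: "e > 0"
    obtain n0 where n0: "\<And>k. k \<ge> n0 \<Longrightarrow> (\<integral>\<^sup>+x. indicator (Q (real n)) x * ennreal ((u k x - g x)\<^sup>2) \<partial>lborel) \<le> ennreal e" using conv[OF e] by blast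
    show "(\<integral>\<^sup>+x. ennreal (indicator (Q (real n)) x * (a x - g x)\<^sup>2) \<partial>lborel) \<le> ennreal e"
      unfolding a_def
    proof (rule lsc[where k=n0])
      show "(\<lambda>(x, y :: real \<times> (real^'n) \<times> (real^'n)). indicator (Q (real n)) x * (fst y - g x)\<^sup>2) \<in> borel_measurable (borel \<Otimes>\<^sub>M borel)" by measurable
      show "indicator (Q (real n)) x * (fst ((1/2) *\<^sub>R (y + z)) - g x)\<^sup>2 \<le> (indicator (Q (real n)) x * (fst y - g x)\<^sup>2 + indicator (Q (real n)) x * (fst z - g x)\<^sup>2) / 2"
        for x and y z :: "real \<times> (real^'n) \<times> (real^'n)"
      proof -
        have "fst ((1/2) *\<^sub>R (y + z)) - g x = (fst y + fst z) / 2 - g x" by simp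
        then show ?thesis using real_midpoint_square[of "fst y" "fst z" "g x"] by (auto simp: indicator_def)
      qed
      show "continuous_on UNIV (\<lambda>y :: real \<times> (real^'n) \<times> (real^'n). indicator (Q (real n)) x * (fst y - g x)\<^sup>2)" for x
        by (intro continuous_intros)
      show "(\<integral>\<^sup>+x. ennreal (indicator (Q (real n)) x * (fst (F k x) - g x)\<^sup>2) \<partial>lborel) \<le> ennreal e" if "k \<ge> n0" for k
      proof -
        have "(\<integral>\<^sup>+x. ennreal (indicator (Q (real n)) x * (fst (F k x) - g x)\<^sup>2) \<partial>lborel) = (\<integral>\<^sup>+x. indicator (Q (real n)) x * ennreal ((u k x - g x)\<^sup>2) \<partial>lborel)"
          by (intro nn_integral_cong) (auto simp: indicator_def F_def)
        then show ?thesis using n0[OF that] by simp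
      qed
    qed auto
  qed measurable
  have pm: "(\<lambda>p. indicator (Q (real n)) (fst p) :: real) \<in> borel_measurable (borel \<Otimes>\<^sub>M borel)"
    "(\<lambda>p. g (fst p)) \<in> borel_measurable (borel \<Otimes>\<^sub>M borel)"
    "snd \<in> borel_measurable (borel \<Otimes>\<^sub>M borel)" for n
    by measurable
  \<comment> \<open>The instance is \<Phi> = |W - g(x) V| on a cube, convex because g(x) is a fixed
    coefficient. On the sequence it equals |u - g| |Du|, which is small in L^1 on the cube by the
    weighted inequality |u - g|^2 / d + d |Du|^2.\<close>
  have WV: "AE x in lborel. norm (W x - g x *\<^sub>R V x) = 0"
  proof (rule zero_AE)
    fix n and e :: real assume e: "e > 0"
    define d where "d = e / (2 * (C + 1))"
    have d: "d > 0" using e C0 by (simp add: d_def)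
    have dC: "d * C \<le> e / 2"
    proof -
      have "d * C \<le> d * (C + 1)" using d by (intro mult_left_mono) auto
      also have "\<dots> = e / 2" unfolding d_def using C0 by (auto simp: divide_simps)
      finally show ?thesis .
    qed
    have de: "d * (e / 2) > 0" using d e by simp
    obtain n0 where n0: "\<And>k. k \<ge> n0 \<Longrightarrow> (\<integral>\<^sup>+x. indicator (Q (real n)) x * ennreal ((u k x - g x)\<^sup>2) \<partial>lborel) \<le> ennreal (d * (e / 2))" using conv[OF de] by blast
    show "(\<integral>\<^sup>+x. ennreal (indicator (Q (real n)) x * norm (W x - g x *\<^sub>R V x)) \<partial>lborel) \<le> ennreal e"
      unfolding W_def V_def
    proof (rule lsc[where k=n0])
      show "(\<lambda>(x, y :: real \<times> (real^'n) \<times> (real^'n)). indicator (Q (real n)) x * norm (snd (snd y) - g x *\<^sub>R fst (snd y))) \<in> borel_measurable (borel \<Otimes>\<^sub>M borel)"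
      proof -
        have 1: "(\<lambda>p. snd (snd (snd p))) \<in> borel_measurable (borel \<Otimes>\<^sub>M (borel :: (real \<times> (real^'n) \<times> (real^'n)) measure))"
          "(\<lambda>p. fst (snd (snd p))) \<in> borel_measurable (borel \<Otimes>\<^sub>M (borel :: (real \<times> (real^'n) \<times> (real^'n)) measure))"
          by (intro borel_measurable_fst_snd pm)+
        have 2: "(\<lambda>p. g (fst p) *\<^sub>R fst (snd (snd p))) \<in> borel_measurable (borel \<Otimes>\<^sub>M (borel :: (real \<times> (real^'n) \<times> (real^'n)) measure))"
          by (rule borel_measurable_scaleR[OF pm(2) 1(2)])
        have 3: "(\<lambda>p. snd (snd (snd p)) - g (fst p) *\<^sub>R fst (snd (snd p))) \<in> borel_measurable (borel \<Otimes>\<^sub>M (borel :: (real \<times> (real^'n) \<times> (real^'n)) measure))"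
          by (rule borel_measurable_diff[OF 1(1) 2])
        show ?thesis unfolding split_beta'
          by (rule borel_measurable_times[OF pm(1) measurable_compose[OF 3 borel_measurable_norm]])
      qed
      show "indicator (Q (real n)) x * norm (snd (snd ((1/2) *\<^sub>R (y + z))) - g x *\<^sub>R fst (snd ((1/2) *\<^sub>R (y + z))))
        \<le> (indicator (Q (real n)) x * norm (snd (snd y) - g x *\<^sub>R fst (snd y)) + indicator (Q (real n)) x * norm (snd (snd z) - g x *\<^sub>R fst (snd z))) / 2"
        for x and y z :: "real \<times> (real^'n) \<times> (real^'n)"
      proof -
        have "snd (snd ((1/2) *\<^sub>R (y + z))) - g x *\<^sub>R fst (snd ((1/2) *\<^sub>R (y + z))) =
          (1/2) *\<^sub>R ((snd (snd y) - g x *\<^sub>R fst (snd y)) + (snd (snd z) - g x *\<^sub>R fst (snd z)))" by (simp add: algebra_simps)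
        moreover have "norm ((1/2) *\<^sub>R (p + q)) \<le> (norm p + norm q) / 2" for p q :: "real^'n"
          using norm_triangle_ineq[of p q] by simp
        ultimately show ?thesis by (auto simp: indicator_def)
      qed
      show "continuous_on UNIV (\<lambda>y :: real \<times> (real^'n) \<times> (real^'n). indicator (Q (real n)) x * norm (snd (snd y) - g x *\<^sub>R fst (snd y)))" for x
        by (intro continuous_intros)
      show "(\<integral>\<^sup>+x. ennreal (indicator (Q (real n)) x * norm (snd (snd (F k x)) - g x *\<^sub>R fst (snd (F k x)))) \<partial>lborel) \<le> ennreal e" if "k \<ge> n0" for k
      proof -
        have "(\<integral>\<^sup>+x. ennreal (indicator (Q (real n)) x * norm (snd (snd (F k x)) - g x *\<^sub>R fst (snd (F k x)))) \<partial>lborel) \<le>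
          (\<integral>\<^sup>+x. ennreal (1 / d) * (indicator (Q (real n)) x * ennreal ((u k x - g x)\<^sup>2)) + ennreal d * ennreal ((norm (Du k x))\<^sup>2) \<partial>lborel)"
        proof (rule nn_integral_mono)
          fix x
          let ?p = "\<bar>u k x - g x\<bar>" and ?q = "norm (Du k x)"
          have n: "norm (snd (snd (F k x)) - g x *\<^sub>R fst (snd (F k x))) = ?p * ?q"
            by (simp add: F_def scaleR_left_diff_distrib[symmetric])
          have "2 * (?p * (d * ?q)) \<le> ?p\<^sup>2 + d\<^sup>2 * ?q\<^sup>2"
            using sum_squares_bound[of ?p "d * ?q"] by (simp only: power_mult_distrib mult.assoc)
          moreover have "0 \<le> ?p * (d * ?q)" using d by simp
          ultimately have "?p * (d * ?q) \<le> ?p\<^sup>2 + d\<^sup>2 * ?q\<^sup>2" by linarith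
          then have "d * (?p * ?q) \<le> ?p\<^sup>2 + d\<^sup>2 * ?q\<^sup>2" by (simp only: mult.left_commute)
          then have "?p * ?q \<le> 1 / d * (u k x - g x)\<^sup>2 + d * ?q\<^sup>2"
            using d by (simp add: field_simps power2_eq_square)
          then have "ennreal (?p * ?q) \<le> ennreal (1 / d * (u k x - g x)\<^sup>2 + d * ?q\<^sup>2)" by (rule ennreal_leI)
          also have "\<dots> = ennreal (1 / d) * ennreal ((u k x - g x)\<^sup>2) + ennreal d * ennreal (?q\<^sup>2)"
            using d by (subst ennreal_plus) (auto simp: ennreal_mult[symmetric])
          finally show "ennreal (indicator (Q (real n)) x * norm (snd (snd (F k x)) - g x *\<^sub>R fst (snd (F k x)))) \<le>
            ennreal (1 / d) * (indicator (Q (real n)) x * ennreal ((u k x - g x)\<^sup>2)) + ennreal d * ennreal ((norm (Du k x))\<^sup>2)"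
            unfolding n by (auto simp: indicator_def)
        qed
        also have "\<dots> = ennreal (1 / d) * (\<integral>\<^sup>+x. indicator (Q (real n)) x * ennreal ((u k x - g x)\<^sup>2) \<partial>lborel) + ennreal d * (\<integral>\<^sup>+x. ennreal ((norm (Du k x))\<^sup>2) \<partial>lborel)"
          by (subst nn_integral_add) (auto simp: nn_integral_cmult)
        also have "(\<integral>\<^sup>+x. ennreal ((norm (Du k x))\<^sup>2) \<partial>lborel) = ennreal (\<integral>x. (norm (Du k x))\<^sup>2 \<partial>lborel)"
          by (rule nn_integral_eq_integral) (use D2 in auto)
        also have "ennreal (1 / d) * (\<integral>\<^sup>+x. indicator (Q (real n)) x * ennreal ((u k x - g x)\<^sup>2) \<partial>lborel) + ennreal d * ennreal (\<integral>x. (norm (Du k x))\<^sup>2 \<partial>lborel) \<le>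
          ennreal (1 / d) * ennreal (d * (e / 2)) + ennreal d * ennreal C"
          using n0[OF that] D2(2)[of k] by (intro add_mono mult_left_mono ennreal_leI) auto
        also have "\<dots> = ennreal (e / 2 + d * C)"
          using d e C0 by (simp add: ennreal_mult[symmetric])
        also have "\<dots> \<le> ennreal e" using dC by (intro ennreal_leI) simp
        finally show ?thesis .
      qed
    qed auto
  qed measurable
  have V2: "integrable lborel (\<lambda>x. (norm (V x))\<^sup>2)"
    by (rule Bochner_Integration.integrable_bound[OF Hi]) (auto intro!: AE_I2 simp: norm_triple_square V_def)
  have W2: "integrable lborel (\<lambda>x. (norm (W x))\<^sup>2)"
    by (rule Bochner_Integration.integrable_bound[OF Hi]) (auto intro!: AE_I2 simp: norm_triple_square W_def)
  have gV2: "integrable lborel (\<lambda>x. (g x)\<^sup>2 * (norm (V x))\<^sup>2)"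
  proof (rule integrable_cong_AE[THEN iffD1, OF _ _ _ W2])
    show "AE x in lborel. (norm (W x))\<^sup>2 = (g x)\<^sup>2 * (norm (V x))\<^sup>2"
      using WV by eventually_elim (simp add: power_mult_distrib)
  qed measurable
  \<comment> \<open>The identity is linear in the triple, so \<open>hull_w\<close> provides it for
    every midpoint combination; both sides converge on a cube containing the support of
    \<phi>.\<close>
  have weak: "weak_grad g V"
    unfolding weak_grad_def
  proof (intro allI impI)
    fix \<phi> :: "real^'n \<Rightarrow> real" and i assume t: "test_fun \<phi>"
    note [measurable] = test_fun_borel[OF t] test_fun_borel[OF test_fun_pderiv[OF t]]
    obtain R B where RB: "B > 0" "\<And>x. \<bar>\<phi> x\<bar> \<le> B * indicator (cball 0 R) x" "\<And>x i. \<bar>pderiv_i \<phi> i x\<bar> \<le> B * indicator (cball 0 R) x"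
      using test_fun_grad_bound[OF t] by metis
    have ind: "B * indicator (cball 0 R) x \<le> B * indicator (Q R) x" for x :: "real^'n"
      using RB(1) cball_subset_Q[of R] by (auto simp: indicator_def)
    have cmp: "\<exists>n0. \<forall>n\<ge>n0. (\<integral>\<^sup>+x. indicator (Q R) x * ennreal ((c (h n x) - c (H x))\<^sup>2) \<partial>lborel) \<le> ennreal e"
      if e: "e > 0" and c: "\<And>y z. (c y - c z)\<^sup>2 \<le> (norm (y - z))\<^sup>2" for e and c :: "real \<times> (real^'n) \<times> (real^'n) \<Rightarrow> real"
    proof -
      have "(\<integral>\<^sup>+x. indicator (Q R) x * ennreal ((c (h n x) - c (H x))\<^sup>2) \<partial>lborel) \<le> (\<integral>\<^sup>+x. indicator (Q R) x * ennreal ((norm (h n x - H x))\<^sup>2) \<partial>lborel)" for n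
        by (intro nn_integral_mono mult_left_mono ennreal_leI c) auto
      then show ?thesis using Hc[OF e, of R] by (meson order_trans)
    qed
    have "(\<lambda>k. \<integral>x. fst (h k x) * pderiv_i \<phi> i x \<partial>lborel) \<longlonglongrightarrow> (\<integral>x. fst (H x) * pderiv_i \<phi> i x \<partial>lborel)"
    proof (rule L2_local_test_tendsto[where R=R and B=B])
      show "\<exists>n0. \<forall>k\<ge>n0. (\<integral>\<^sup>+x. indicator (Q R) x * ennreal ((fst (h k x) - fst (H x))\<^sup>2) \<partial>lborel) \<le> ennreal e" if "e > 0" for e
        by (rule cmp[OF that, of fst]) (simp add: norm_triple_square)
      show "\<bar>pderiv_i \<phi> i x\<bar> \<le> B * indicator (Q R) x" for x using order_trans[OF RB(3) ind] .
    qed (use comp(1)[OF hb hull_i[OF h(1)]] comp(1)[OF Hb Hi] in measurable)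
    moreover have "(\<lambda>k. \<integral>x. fst (snd (h k x)) $ i * \<phi> x \<partial>lborel) \<longlonglongrightarrow> (\<integral>x. fst (snd (H x)) $ i * \<phi> x \<partial>lborel)"
    proof (rule L2_local_test_tendsto[where R=R and B=B])
      show "\<exists>n0. \<forall>k\<ge>n0. (\<integral>\<^sup>+x. indicator (Q R) x * ennreal ((fst (snd (h k x)) $ i - fst (snd (H x)) $ i)\<^sup>2) \<partial>lborel) \<le> ennreal e" if "e > 0" for e
      proof (rule cmp[OF that, of "\<lambda>y. fst (snd y) $ i"])
        fix y z :: "real \<times> (real^'n) \<times> (real^'n)"
        have "\<bar>(fst (snd (y - z))) $ i\<bar>\<^sup>2 \<le> (norm (fst (snd (y - z))))\<^sup>2" by (intro power_mono component_le_norm_cart) simp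
        then show "(fst (snd y) $ i - fst (snd z) $ i)\<^sup>2 \<le> (norm (y - z))\<^sup>2"
          unfolding norm_triple_square by (simp add: add_increasing2 add_increasing)
      qed
      show "\<bar>\<phi> x\<bar> \<le> B * indicator (Q R) x" for x using order_trans[OF RB(2) ind] .
    qed (use comp(2)[OF hb hull_i[OF h(1)]] comp(2)[OF Hb Hi] in measurable)
    ultimately have "(\<integral>x. fst (H x) * pderiv_i \<phi> i x \<partial>lborel) = - (\<integral>x. fst (snd (H x)) $ i * \<phi> x \<partial>lborel)"
      unfolding hull_w[OF h(1) t] using LIMSEQ_unique tendsto_minus by blast
    moreover have "(\<integral>x. fst (H x) * pderiv_i \<phi> i x \<partial>lborel) = (\<integral>x. g x * pderiv_i \<phi> i x \<partial>lborel)"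
    proof (rule integral_cong_AE)
      show "AE x in lborel. fst (H x) * pderiv_i \<phi> i x = g x * pderiv_i \<phi> i x"
        using ag by eventually_elim (simp add: a_def)
    qed measurable
    ultimately show "(\<integral>x. g x * pderiv_i \<phi> i x \<partial>lborel) = - (\<integral>x. V x $ i * \<phi> x \<partial>lborel)"
      by (simp add: V_def)
  qed
  show ?thesis
  proof (rule that[of V])
    fix R B k
    assume as: "\<And>n. n \<ge> k \<Longrightarrow> (\<integral>\<^sup>+x. ennreal (indicator (Q R) x * ((1 + 2 * (u n x)\<^sup>2) * (norm (Du n x))\<^sup>2)) \<partial>lborel) \<le> ennreal B"
    have "(\<integral>\<^sup>+x. ennreal (indicator (Q R) x * ((norm (fst (snd (H x))))\<^sup>2 + 2 * (norm (snd (snd (H x))))\<^sup>2)) \<partial>lborel) \<le> ennreal B"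
    proof (rule lsc[where k=k])
      show "(\<lambda>(x, y :: real \<times> (real^'n) \<times> (real^'n)). indicator (Q R) x * ((norm (fst (snd y)))\<^sup>2 + 2 * (norm (snd (snd y)))\<^sup>2)) \<in> borel_measurable (borel \<Otimes>\<^sub>M borel)" by measurable
      show "indicator (Q R) x * ((norm (fst (snd ((1/2) *\<^sub>R (y + z)))))\<^sup>2 + 2 * (norm (snd (snd ((1/2) *\<^sub>R (y + z)))))\<^sup>2)
        \<le> (indicator (Q R) x * ((norm (fst (snd y)))\<^sup>2 + 2 * (norm (snd (snd y)))\<^sup>2) + indicator (Q R) x * ((norm (fst (snd z)))\<^sup>2 + 2 * (norm (snd (snd z)))\<^sup>2)) / 2"
        for x and y z :: "real \<times> (real^'n) \<times> (real^'n)"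
        using norm_midpoint_square_le[of "fst (snd y)" "fst (snd z)"] norm_midpoint_square_le[of "snd (snd y)" "snd (snd z)"]
        by (auto simp: indicator_def)
      show "continuous_on UNIV (\<lambda>y :: real \<times> (real^'n) \<times> (real^'n). indicator (Q R) x * ((norm (fst (snd y)))\<^sup>2 + 2 * (norm (snd (snd y)))\<^sup>2))" for x
        by (intro continuous_intros)
      show "(\<integral>\<^sup>+x. ennreal (indicator (Q R) x * ((norm (fst (snd (F n x))))\<^sup>2 + 2 * (norm (snd (snd (F n x))))\<^sup>2)) \<partial>lborel) \<le> ennreal B" if "n \<ge> k" for n
        using as[OF that] by (simp add: F_def power_mult_distrib distrib_right mult.assoc)
    qed auto
    also have "(\<integral>\<^sup>+x. ennreal (indicator (Q R) x * ((norm (fst (snd (H x))))\<^sup>2 + 2 * (norm (snd (snd (H x))))\<^sup>2)) \<partial>lborel) =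
      (\<integral>\<^sup>+x. ennreal (indicator (Q R) x * ((1 + 2 * (g x)\<^sup>2) * (norm (V x))\<^sup>2)) \<partial>lborel)"
    proof (rule nn_integral_cong_AE)
      show "AE x in lborel. ennreal (indicator (Q R) x * ((norm (fst (snd (H x))))\<^sup>2 + 2 * (norm (snd (snd (H x))))\<^sup>2)) =
        ennreal (indicator (Q R) x * ((1 + 2 * (g x)\<^sup>2) * (norm (V x))\<^sup>2))"
        using WV by eventually_elim (simp add: V_def W_def power_mult_distrib distrib_right mult.assoc)
    qed
    finally show "(\<integral>\<^sup>+x. ennreal (indicator (Q R) x * ((1 + 2 * (g x)\<^sup>2) * (norm (V x))\<^sup>2)) \<partial>lborel) \<le> ennreal B" .
  qed (use V2 gV2 weak in auto)
qed

section \<open>The energy functional\<close>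

text \<open>The Borel counterpart of membership in \<open>Sm m\<close>, with the value of the mass
  left open.\<close>

definition finite_energy :: "(real^'n \<Rightarrow> real) \<Rightarrow> (real^'n \<Rightarrow> real^'n) \<Rightarrow> bool" where
  "finite_energy u Du \<longleftrightarrow> u \<in> borel_measurable borel \<and> Du \<in> borel_measurable borel \<and> weak_grad u Du \<and>
     integrable lborel (\<lambda>x. (u x)\<^sup>2) \<and> integrable lborel (\<lambda>x. (norm (Du x))\<^sup>2) \<and>
     integrable lborel (\<lambda>x. (u x)\<^sup>2 * (norm (Du x))\<^sup>2)"

lemma finite_energyD:
  assumes "finite_energy u Du"
  shows "u \<in> borel_measurable borel" "Du \<in> borel_measurable borel" "weak_grad u Du"
    "integrable lborel (\<lambda>x. (u x)\<^sup>2)" "integrable lborel (\<lambda>x. (norm (Du x))\<^sup>2)"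
    "integrable lborel (\<lambda>x. (u x)\<^sup>2 * (norm (Du x))\<^sup>2)"
    "integrable lborel (\<lambda>x. (1 + 2 * (u x)\<^sup>2) * (norm (Du x))\<^sup>2)"
proof -
  show *: "u \<in> borel_measurable borel" "Du \<in> borel_measurable borel" "weak_grad u Du"
    "integrable lborel (\<lambda>x. (u x)\<^sup>2)" "integrable lborel (\<lambda>x. (norm (Du x))\<^sup>2)"
    "integrable lborel (\<lambda>x. (u x)\<^sup>2 * (norm (Du x))\<^sup>2)"
    using assms by (auto simp: finite_energy_def)
  have "integrable lborel (\<lambda>x. (norm (Du x))\<^sup>2 + 2 * ((u x)\<^sup>2 * (norm (Du x))\<^sup>2))" using * by simp
  then show "integrable lborel (\<lambda>x. (1 + 2 * (u x)\<^sup>2) * (norm (Du x))\<^sup>2)" by (simp add: algebra_simps)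
qed

definition mass :: "(real^'n \<Rightarrow> real) \<Rightarrow> real" where "mass u = (\<integral>x. (u x)\<^sup>2 \<partial>lborel)"

definition kinetic :: "(real^'n \<Rightarrow> real) \<Rightarrow> (real^'n \<Rightarrow> real^'n) \<Rightarrow> real" where
  "kinetic u Du = 1/2 * (\<integral>x. (1 + 2 * (u x)\<^sup>2) * (norm (Du x))\<^sup>2 \<partial>lborel)"

lemma mass_nonneg: "0 \<le> mass u" by (simp add: mass_def)

lemma kinetic_nonneg: "0 \<le> kinetic u Du" by (simp add: kinetic_def integral_nonneg_AE)

lemma kinetic_bounds:
  assumes "finite_energy u Du"
  shows "(\<integral>x. (norm (Du x))\<^sup>2 \<partial>lborel) \<le> 2 * kinetic u Du"
    "(\<integral>x. (u x)\<^sup>2 * (norm (Du x))\<^sup>2 \<partial>lborel) \<le> kinetic u Du"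
proof -
  note * = finite_energyD[OF assms]
  have e: "2 * kinetic u Du = (\<integral>x. (norm (Du x))\<^sup>2 \<partial>lborel) + 2 * (\<integral>x. (u x)\<^sup>2 * (norm (Du x))\<^sup>2 \<partial>lborel)"
  proof -
    have "2 * kinetic u Du = (\<integral>x. (norm (Du x))\<^sup>2 + 2 * ((u x)\<^sup>2 * (norm (Du x))\<^sup>2) \<partial>lborel)"
      by (simp add: kinetic_def algebra_simps)
    then show ?thesis using * by simp
  qed
  have "0 \<le> (\<integral>x. (norm (Du x))\<^sup>2 \<partial>lborel)" "0 \<le> (\<integral>x. (u x)\<^sup>2 * (norm (Du x))\<^sup>2 \<partial>lborel)"
    by (auto intro!: integral_nonneg_AE)
  then show "(\<integral>x. (norm (Du x))\<^sup>2 \<partial>lborel) \<le> 2 * kinetic u Du"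
    "(\<integral>x. (u x)\<^sup>2 * (norm (Du x))\<^sup>2 \<partial>lborel) \<le> kinetic u Du" using e by linarith+
qed

lemma diff_bound_mono: "diff_bound K f \<Longrightarrow> K \<le> K' \<Longrightarrow> diff_bound K' f"
  unfolding diff_bound_def by (meson order_trans ennreal_leI mult_left_mono zero_le_power2)

lemma square_powr: "(s\<^sup>2) powr a = \<bar>s\<bar> powr (2 * a)" for s a :: real
proof (cases "s = 0")
  case False
  then have "s\<^sup>2 = \<bar>s\<bar> powr 2" by simp
  then show ?thesis by (simp only: powr_powr)
qed simp

text \<open>The Gagliardo-Nirenberg inequality for w = u^2: the exponent 2 + 2/N turns into 4 + 4/N,
  the L^1 norm of w is the mass, and the mass enters the constant only through its upper bound
  \<open>m\<close>.\<close>

lemma finite_energy_power_bound: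
  fixes m :: real assumes m: "0 < m"
  shows "\<exists>c\<ge>0. \<forall>(u :: real^'n \<Rightarrow> real) Du. finite_energy u Du \<and> mass u \<le> m \<longrightarrow>
    integrable lborel (\<lambda>x. \<bar>u x\<bar> powr (4 + 4 / real CARD('n))) \<and>
    (\<integral>x. \<bar>u x\<bar> powr (4 + 4 / real CARD('n)) \<partial>lborel) \<le> c * (\<integral>x. (u x)\<^sup>2 * (norm (Du x))\<^sup>2 \<partial>lborel)"
proof -
  let ?N = "real CARD('n)"
  define C0 where "C0 = 1 / 4 + 2 powr (2 + 2 / ?N) * ?N * (4 * (?N + 2)) powr (2 / ?N) / (1 - 2 powr (- 2 / ?N))"
  define D where "D = \<bar>C0\<bar> * m powr (2 / ?N)"
  have D: "D \<ge> 0" by (simp add: D_def)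
  show ?thesis
  proof (intro exI[of _ "4 * D"] conjI allI impI)
    fix u :: "real^'n \<Rightarrow> real" and Du assume as: "finite_energy u Du \<and> mass u \<le> m"
    then have fe: "finite_energy u Du" and mu: "mass u \<le> m" by auto
    note [measurable] = finite_energyD(1,2)[OF fe]
    note i = finite_energyD(4,5,6)[OF fe]
    define I where "I = (\<integral>x. (u x)\<^sup>2 * (norm (Du x))\<^sup>2 \<partial>lborel)"
    have I: "I \<ge> 0" by (simp add: I_def)
    have e: "((u x)\<^sup>2) powr (2 + 2 / ?N) = \<bar>u x\<bar> powr (4 + 4 / ?N)" for x
      unfolding square_powr by (simp add: algebra_simps)
    \<comment> \<open>The slack k keeps the constant in the difference bound positive, as
      \<open>gagliardo_nirenberg\<close> requires, also when u^2 |Du|^2 has integral 0. It is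
      removed at the end.\<close>
    have b: "(\<integral>\<^sup>+x. ennreal (\<bar>u x\<bar> powr (4 + 4 / ?N)) \<partial>lborel) \<le> ennreal (D * (4 * I + k))" if k: "k > 0" for k
    proof -
      have "(\<integral>\<^sup>+x. ennreal (((u x)\<^sup>2) powr (2 + 2 / ?N)) \<partial>lborel) \<le> ennreal (C0 * (m powr (2 / ?N) * (4 * I + k)))"
        unfolding C0_def
      proof (rule gagliardo_nirenberg)
        show "diff_bound (4 * I + k) (\<lambda>x. (u x)\<^sup>2)"
          by (rule diff_bound_mono[OF diff_bound_weak_grad_square[OF finite_energyD(3)[OF fe] _ _ i]]) (use k in \<open>auto simp: I_def\<close>)
        have "(\<integral>\<^sup>+x. ennreal ((u x)\<^sup>2) \<partial>lborel) = ennreal (mass u)"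
          unfolding mass_def by (rule nn_integral_eq_integral[OF i(1)]) simp
        then show "(\<integral>\<^sup>+x. ennreal ((u x)\<^sup>2) \<partial>lborel) \<le> ennreal m" using mu by (simp add: ennreal_leI)
      qed (use I k m in auto)
      also have "\<dots> \<le> ennreal (D * (4 * I + k))"
        unfolding D_def mult.assoc using I k by (intro ennreal_leI mult_right_mono) auto
      finally show ?thesis unfolding e .
    qed
    show int: "integrable lborel (\<lambda>x. \<bar>u x\<bar> powr (4 + 4 / ?N))"
      by (rule integrableI_bounded) (use b[of 1] in \<open>auto intro: le_less_trans\<close>)
    show "(\<integral>x. \<bar>u x\<bar> powr (4 + 4 / ?N) \<partial>lborel) \<le> 4 * D * (\<integral>x. (u x)\<^sup>2 * (norm (Du x))\<^sup>2 \<partial>lborel)"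
    proof (rule field_le_epsilon)
      fix e :: real assume e: "e > 0"
      define k where "k = e / (D + 1)"
      have k: "k > 0" using e D by (simp add: k_def)
      have "D * k \<le> (D + 1) * k" using k by simp
      also have "\<dots> = e" using D by (simp add: k_def)
      finally have Dk: "D * k \<le> e" .
      have "ennreal (\<integral>x. \<bar>u x\<bar> powr (4 + 4 / ?N) \<partial>lborel) \<le> ennreal (D * (4 * I + k))"
        using b[OF k] by (subst nn_integral_eq_integral[OF int, symmetric]) auto
      then have "(\<integral>x. \<bar>u x\<bar> powr (4 + 4 / ?N) \<partial>lborel) \<le> D * (4 * I + k)"
        using D I k by (subst (asm) ennreal_le_iff) auto
      then show "(\<integral>x. \<bar>u x\<bar> powr (4 + 4 / ?N) \<partial>lborel) \<le> 4 * D * (\<integral>x. (u x)\<^sup>2 * (norm (Du x))\<^sup>2 \<partial>lborel) + e"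
        using Dk by (simp add: I_def distrib_left)
    qed
  qed (use D in auto)
qed

text \<open>A dilation leaves the values of u unchanged, so the weight 1 + 2 u^2 is merely
  transported and the whole kinetic energy scales by t^(N - 2), against t^N for the mass.\<close>

lemma finite_energy_dilate:
  fixes u :: "real^'n \<Rightarrow> real" and t :: real
  assumes fe: "finite_energy u Du" and t: "t > 0"
  shows "finite_energy (\<lambda>x. u ((1/t) *\<^sub>R x)) (\<lambda>x. (1/t) *\<^sub>R Du ((1/t) *\<^sub>R x))"
    and "mass (\<lambda>x. u ((1/t) *\<^sub>R x)) = t ^ CARD('n) * mass u"
    and "kinetic (\<lambda>x. u ((1/t) *\<^sub>R x)) (\<lambda>x. (1/t) *\<^sub>R Du ((1/t) *\<^sub>R x)) = t ^ CARD('n) / t\<^sup>2 * kinetic u Du"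
proof -
  note [measurable] = finite_energyD(1,2)[OF fe]
  note i = finite_energyD(4,5,6)[OF fe]
  have sc: "(\<integral>x. f ((1/t) *\<^sub>R x) \<partial>lborel) = t ^ CARD('n) * (\<integral>x. f x \<partial>lborel)"
    if [measurable]: "f \<in> borel_measurable borel" for f :: "real^'n \<Rightarrow> real"
    using integral_lborel_affine[of "\<lambda>x. f ((1/t) *\<^sub>R x)" t 0] t by simp
  have ii: "integrable lborel (\<lambda>x. f ((1/t) *\<^sub>R x))" if "f \<in> borel_measurable borel" "integrable lborel f" for f :: "real^'n \<Rightarrow> real"
    using integrable_lborel_affine[OF that(1), of "1/t" 0] that(2) t by simp
  have w: "weak_grad (\<lambda>x. u ((1/t) *\<^sub>R x)) (\<lambda>x. (1/t) *\<^sub>R Du ((1/t) *\<^sub>R x))"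
    unfolding weak_grad_def
  proof (intro allI impI)
    fix \<phi> :: "real^'n \<Rightarrow> real" and j assume tf: "test_fun \<phi>"
    note [measurable] = test_fun_borel[OF tf] test_fun_borel[OF test_fun_pderiv[OF tf]]
    define \<psi> where "\<psi> x = \<phi> (t *\<^sub>R x)" for x
    have tp: "test_fun \<psi>" using test_fun_affine[OF tf, of t 1 0] t by (simp add: \<psi>_def[abs_def])
    have pd: "pderiv_i \<psi> j x = t * pderiv_i \<phi> j (t *\<^sub>R x)" for x
      using pderiv_i_affine[of \<phi> t x 0 j] smooth_fun_differentiable[OF test_fun_smooth[OF tf]] by (simp add: \<psi>_def[abs_def])
    have "(\<integral>x. u ((1/t) *\<^sub>R x) * pderiv_i \<phi> j x \<partial>lborel) = t ^ CARD('n) * (\<integral>x. u x * pderiv_i \<phi> j (t *\<^sub>R x) \<partial>lborel)"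
      using sc[of "\<lambda>x. u x * pderiv_i \<phi> j (t *\<^sub>R x)"] t by simp
    also have "(\<integral>x. u x * pderiv_i \<phi> j (t *\<^sub>R x) \<partial>lborel) = (\<integral>x. (1/t) * (u x * pderiv_i \<psi> j x) \<partial>lborel)"
      using t by (simp add: pd)
    also have "\<dots> = (1/t) * (\<integral>x. u x * pderiv_i \<psi> j x \<partial>lborel)" by (rule integral_mult_right_zero)
    also have "(\<integral>x. u x * pderiv_i \<psi> j x \<partial>lborel) = - (\<integral>x. Du x $ j * \<psi> x \<partial>lborel)"
      using finite_energyD(3)[OF fe] tp unfolding weak_grad_def by blast
    also have "t ^ CARD('n) * ((1/t) * - (\<integral>x. Du x $ j * \<psi> x \<partial>lborel)) = - (t ^ CARD('n) * (\<integral>x. (1/t) * (Du x $ j * \<psi> x) \<partial>lborel))"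
      by simp
    also have "t ^ CARD('n) * (\<integral>x. (1/t) * (Du x $ j * \<psi> x) \<partial>lborel) = (\<integral>x. (1/t) * (Du ((1/t) *\<^sub>R x) $ j * \<phi> x) \<partial>lborel)"
      using sc[of "\<lambda>x. (1/t) * (Du x $ j * \<psi> x)"] t unfolding \<psi>_def by simp
    finally show "(\<integral>x. u ((1/t) *\<^sub>R x) * pderiv_i \<phi> j x \<partial>lborel) = - (\<integral>x. ((1/t) *\<^sub>R Du ((1/t) *\<^sub>R x)) $ j * \<phi> x \<partial>lborel)"
      by (simp add: mult.assoc)
  qed
  show "finite_energy (\<lambda>x. u ((1/t) *\<^sub>R x)) (\<lambda>x. (1/t) *\<^sub>R Du ((1/t) *\<^sub>R x))"
    unfolding finite_energy_def
  proof (intro conjI w)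
    show "integrable lborel (\<lambda>x. (u ((1/t) *\<^sub>R x))\<^sup>2)" by (rule ii[OF _ i(1)]) measurable
    have "integrable lborel (\<lambda>x. (1/t)\<^sup>2 * (norm (Du ((1/t) *\<^sub>R x)))\<^sup>2)"
      by (intro integrable_mult_right ii[OF _ i(2)]) measurable
    then show "integrable lborel (\<lambda>x. (norm ((1/t) *\<^sub>R Du ((1/t) *\<^sub>R x)))\<^sup>2)"
      by (simp only: norm_scaleR power_mult_distrib power2_abs)
    have "integrable lborel (\<lambda>x. (1/t)\<^sup>2 * ((u ((1/t) *\<^sub>R x))\<^sup>2 * (norm (Du ((1/t) *\<^sub>R x)))\<^sup>2))"
      by (intro integrable_mult_right ii[OF _ i(3)]) measurable
    then show "integrable lborel (\<lambda>x. (u ((1/t) *\<^sub>R x))\<^sup>2 * (norm ((1/t) *\<^sub>R Du ((1/t) *\<^sub>R x)))\<^sup>2)"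
      by (simp only: norm_scaleR power_mult_distrib power2_abs mult.left_commute)
  qed measurable
  show "mass (\<lambda>x. u ((1/t) *\<^sub>R x)) = t ^ CARD('n) * mass u"
    unfolding mass_def by (rule sc) measurable
  have "(\<integral>x. (1 + 2 * (u ((1/t) *\<^sub>R x))\<^sup>2) * (norm ((1/t) *\<^sub>R Du ((1/t) *\<^sub>R x)))\<^sup>2 \<partial>lborel) =
    (\<integral>x. (1/t)\<^sup>2 * ((1 + 2 * (u ((1/t) *\<^sub>R x))\<^sup>2) * (norm (Du ((1/t) *\<^sub>R x)))\<^sup>2) \<partial>lborel)"
    by (simp only: norm_scaleR power_mult_distrib power2_abs mult.left_commute)
  also have "\<dots> = (1/t)\<^sup>2 * (\<integral>x. (1 + 2 * (u ((1/t) *\<^sub>R x))\<^sup>2) * (norm (Du ((1/t) *\<^sub>R x)))\<^sup>2 \<partial>lborel)"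
    by (rule integral_mult_right_zero)
  also have "(\<integral>x. (1 + 2 * (u ((1/t) *\<^sub>R x))\<^sup>2) * (norm (Du ((1/t) *\<^sub>R x)))\<^sup>2 \<partial>lborel) = t ^ CARD('n) * (\<integral>x. (1 + 2 * (u x)\<^sup>2) * (norm (Du x))\<^sup>2 \<partial>lborel)"
    by (rule sc) measurable
  finally show "kinetic (\<lambda>x. u ((1/t) *\<^sub>R x)) (\<lambda>x. (1/t) *\<^sub>R Du ((1/t) *\<^sub>R x)) = t ^ CARD('n) / t\<^sup>2 * kinetic u Du"
    using t by (simp add: kinetic_def power_divide mult_ac)
qed

lemma integral_dilate:
  fixes f :: "real^'n \<Rightarrow> real" and t :: real
  assumes [measurable]: "f \<in> borel_measurable borel" and t: "t > 0"
  shows "(\<integral>x. f ((1/t) *\<^sub>R x) \<partial>lborel) = t ^ CARD('n) * (\<integral>x. f x \<partial>lborel)"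
  using integral_lborel_affine[of "\<lambda>x. f ((1/t) *\<^sub>R x)" t 0] t by simp

section \<open>Growth of the nonlinearity, coercivity and comparison of masses\<close>

locale nonlinearity =
  fixes g :: "real \<Rightarrow> real" and p :: real
  assumes g_cont: "continuous_on UNIV g" and p4: "4 < p"
    and g_zero: "((\<lambda>s. g s / s) \<longlongrightarrow> 0) (at 0)"
    and g_infinity: "((\<lambda>s. \<bar>g s\<bar> / \<bar>s\<bar> powr (p - 1)) \<longlongrightarrow> 0) at_infinity"
begin

lemma g_isCont: "isCont g s" using g_cont by (simp add: continuous_on_eq_continuous_at)

lemma g_borel [measurable]: "g \<in> borel_measurable borel" using g_cont by (rule borel_measurable_continuous_onI)

lemma g_0: "g 0 = 0"
proof -
  have "((\<lambda>s. g s / s * s) \<longlongrightarrow> 0 * 0) (at 0)" by (intro tendsto_intros g_zero)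
  then have "(g \<longlongrightarrow> 0 * 0) (at 0)" by (rule Lim_transform_eventually) (auto simp: eventually_at_filter)
  then have "(g \<longlongrightarrow> 0) (at 0)" by simp
  moreover have "(g \<longlongrightarrow> g 0) (at 0)" using g_isCont[of 0] by (simp add: isCont_def)
  ultimately show ?thesis using tendsto_unique[of "at (0::real)"] by auto
qed

lemma g_small: assumes "e > 0" obtains d where "d > 0" "\<And>s. \<bar>s\<bar> \<le> d \<Longrightarrow> \<bar>g s\<bar> \<le> e * \<bar>s\<bar>"
proof -
  obtain d where d: "d > 0" "\<And>s. s \<noteq> 0 \<Longrightarrow> \<bar>s\<bar> < d \<Longrightarrow> \<bar>g s / s\<bar> < e"
    using g_zero[unfolded tendsto_iff, rule_format, OF assms] unfolding eventually_at by (auto simp: dist_real_def)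
  show ?thesis
  proof (rule that[of "d / 2"])
    fix s assume s: "\<bar>s\<bar> \<le> d / 2"
    show "\<bar>g s\<bar> \<le> e * \<bar>s\<bar>"
    proof (cases "s = 0")
      case False
      then have "\<bar>g s\<bar> / \<bar>s\<bar> < e" using d(2)[of s] s d(1) by (simp add: abs_divide)
      then show ?thesis using False by (simp add: divide_less_eq)
    qed (simp add: g_0)
  qed (use d in simp)
qed

text \<open>Near 0 the function is at most |s|, far out at most e |s|^(p - 1); on the remaining
  range |s| lies between d and r, and a bound M of |g| there is absorbed as (M / d) |s|. The
  coefficient at infinity is arbitrarily small, which coercivity relies on.\<close>

lemma g_bound:
  assumes e: "e > 0"
  obtains C where "C \<ge> 0" "\<And>s. \<bar>g s\<bar> \<le> C * \<bar>s\<bar> + e * \<bar>s\<bar> powr (p - 1)"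
proof -
  obtain d where d: "d > 0" "\<And>s. \<bar>s\<bar> \<le> d \<Longrightarrow> \<bar>g s\<bar> \<le> 1 * \<bar>s\<bar>" using g_small[of 1] by auto
  obtain R where R: "\<And>s. R \<le> \<bar>s\<bar> \<Longrightarrow> \<bar>g s\<bar> / \<bar>s\<bar> powr (p - 1) < e"
    using g_infinity[unfolded tendsto_iff, rule_format, OF e] unfolding eventually_at_infinity by auto
  define r where "r = max R d"
  have "compact (g ` {-r..r})" by (intro compact_continuous_image continuous_on_subset[OF g_cont]) auto
  then obtain M where M: "M > 0" "\<And>y. y \<in> g ` {-r..r} \<Longrightarrow> norm y \<le> M"
    using compact_imp_bounded bounded_pos by metis
  show ?thesis
  proof (rule that[of "1 + M / d"])
    show "1 + M / d \<ge> 0" using M d by simp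
    fix s
    have nn: "0 \<le> e * \<bar>s\<bar> powr (p - 1)" "0 \<le> M / d * \<bar>s\<bar>" using e M d by auto
    consider "\<bar>s\<bar> \<le> d" | "d < \<bar>s\<bar>" "\<bar>s\<bar> \<le> r" | "r < \<bar>s\<bar>" by linarith
    then show "\<bar>g s\<bar> \<le> (1 + M / d) * \<bar>s\<bar> + e * \<bar>s\<bar> powr (p - 1)"
    proof cases
      case 1 then show ?thesis using d(2)[of s] nn by (simp add: distrib_right)
    next
      case 2
      then have "s \<in> {-r..r}" by auto
      then have "\<bar>g s\<bar> \<le> M" using M(2)[of "g s"] by simp
      also have "M = M / d * d" using d by simp
      also have "\<dots> \<le> M / d * \<bar>s\<bar>" using 2 M d by (intro mult_left_mono) auto
      finally show ?thesis using nn by (simp add: distrib_right)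
    next
      case 3
      then have "\<bar>g s\<bar> / \<bar>s\<bar> powr (p - 1) < e" "s \<noteq> 0" using R[of s] d(1) by (auto simp: r_def)
      then have "\<bar>g s\<bar> \<le> e * \<bar>s\<bar> powr (p - 1)" by (simp add: divide_less_eq)
      then show ?thesis using nn by (simp add: distrib_right)
    qed
  qed
qed

definition "G = prim g"

lemma G_0 [simp]: "G 0 = 0" by (simp add: G_def prim_def zero_ereal_def)

lemma G_deriv: "(G has_real_derivative g s) (at s)"
proof -
  define a where "a = - \<bar>s\<bar> - 1" define b where "b = \<bar>s\<bar> + 1"
  have "((\<lambda>u. LBINT y=0..u. g y) has_vector_derivative g s) (at s within {a..b})"
    unfolding zero_ereal_def by (rule interval_integral_FTC2) (auto simp: a_def b_def intro: continuous_on_subset[OF g_cont])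
  then have "(G has_vector_derivative g s) (at s within {a..b})" by (simp add: G_def prim_def[abs_def])
  moreover have "at s within {a..b} = at s" by (rule at_within_interior) (simp add: a_def b_def, linarith)
  ultimately show ?thesis by (simp add: has_real_derivative_iff_has_vector_derivative)
qed

lemma G_cont: "continuous_on UNIV G"
  using G_deriv DERIV_isCont by (auto intro!: continuous_at_imp_continuous_on)

lemma G_borel [measurable]: "G \<in> borel_measurable borel" using G_cont by (rule borel_measurable_continuous_onI)

lemma G_mvt: "\<exists>z. \<bar>z\<bar> \<le> \<bar>a\<bar> + \<bar>b\<bar> \<and> G (a + b) - G a = b * g z"
proof -
  consider "b > 0" | "b < 0" | "b = 0" by linarith
  then show ?thesis
  proof cases
    case 1
    then obtain z where "a < z" "z < a + b" "G (a + b) - G a = (a + b - a) * g z"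
      using MVT2[of a "a + b" G g] G_deriv by auto
    then show ?thesis by (intro exI[of _ z]) auto
  next
    case 2
    then obtain z where "a + b < z" "z < a" "G a - G (a + b) = (a - (a + b)) * g z"
      using MVT2[of "a + b" a G g] G_deriv by auto
    then show ?thesis by (intro exI[of _ z]) auto
  next
    case 3
    show ?thesis by (rule exI[of _ a]) (simp add: 3)
  qed
qed

lemma G_bound:
  assumes e: "e > 0"
  obtains C where "C \<ge> 0" "\<And>s. \<bar>G s\<bar> \<le> C * s\<^sup>2 + e * \<bar>s\<bar> powr p"
proof -
  obtain C where C: "C \<ge> 0" "\<And>s. \<bar>g s\<bar> \<le> C * \<bar>s\<bar> + e * \<bar>s\<bar> powr (p - 1)" using g_bound[OF e] by blast
  show ?thesis
  proof (rule that[OF C(1)])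
    fix s
    obtain z where z: "\<bar>z\<bar> \<le> \<bar>s\<bar>" "G s = s * g z" using G_mvt[of 0 s] by auto
    have "\<bar>G s\<bar> = \<bar>s\<bar> * \<bar>g z\<bar>" by (simp add: z abs_mult)
    also have "\<dots> \<le> \<bar>s\<bar> * (C * \<bar>z\<bar> + e * \<bar>z\<bar> powr (p - 1))" by (intro mult_left_mono C) auto
    also have "\<dots> \<le> \<bar>s\<bar> * (C * \<bar>s\<bar> + e * \<bar>s\<bar> powr (p - 1))"
      using z C e p4 by (intro mult_left_mono add_mono powr_mono2) auto
    also have "\<dots> = C * s\<^sup>2 + e * (\<bar>s\<bar> * \<bar>s\<bar> powr (p - 1))" by (simp add: algebra_simps power2_eq_square)
    also have "\<bar>s\<bar> * \<bar>s\<bar> powr (p - 1) = \<bar>s\<bar> powr p" by (cases "s = 0") (simp_all add: powr_diff)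
    finally show "\<bar>G s\<bar> \<le> C * s\<^sup>2 + e * \<bar>s\<bar> powr p" .
  qed
qed

text \<open>The quadratic and the critical term both carry the small factor e; what is left is a
  constant supported on |s| > l. A negative energy therefore forces the level set of u at height l
  to have measure bounded below.\<close>

lemma G_upper:
  assumes e: "e > 0"
  obtains l C where "l > 0" "C \<ge> 0" "\<And>s. G s \<le> e * s\<^sup>2 + e * \<bar>s\<bar> powr p + C * indicator {s. l < \<bar>s\<bar>} s"
proof -
  obtain d where d: "d > 0" "\<And>s. \<bar>s\<bar> \<le> d \<Longrightarrow> \<bar>g s\<bar> \<le> e * \<bar>s\<bar>" using g_small[OF e] by blast
  have e2: "e / 2 > 0" using e by simp
  obtain C where C: "C \<ge> 0" "\<And>s. \<bar>G s\<bar> \<le> C * s\<^sup>2 + e / 2 * \<bar>s\<bar> powr p" using G_bound[OF e2] by blast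
  \<comment> \<open>For |s| > r one has |s|^(p - 2) \<ge> |s| \<ge> 2 C / e, so C s^2 is absorbed by
    half of the critical term; for smaller |s| it is at most C r^2.\<close>
  define r where "r = max 1 (2 * C / e)"
  have r: "r \<ge> 1" "2 * C / e \<le> r" by (auto simp: r_def)
  show ?thesis
  proof (rule that[OF d(1), of "C * r\<^sup>2"])
    show "C * r\<^sup>2 \<ge> 0" using C by simp
    fix s
    have nn: "0 \<le> e * \<bar>s\<bar> powr p" "0 \<le> e * s\<^sup>2" using e by auto
    show "G s \<le> e * s\<^sup>2 + e * \<bar>s\<bar> powr p + C * r\<^sup>2 * indicator {s. d < \<bar>s\<bar>} s"
    proof (cases "\<bar>s\<bar> \<le> d")
      case True
      obtain z where z: "\<bar>z\<bar> \<le> \<bar>s\<bar>" "G s = s * g z" using G_mvt[of 0 s] by auto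
      have "G s \<le> \<bar>s\<bar> * \<bar>g z\<bar>" unfolding z by (metis abs_ge_self abs_mult)
      also have "\<dots> \<le> \<bar>s\<bar> * (e * \<bar>z\<bar>)" using z True by (intro mult_left_mono d) auto
      also have "\<dots> \<le> \<bar>s\<bar> * (e * \<bar>s\<bar>)" using z e by (intro mult_left_mono) auto
      also have "\<dots> = e * s\<^sup>2" by (simp add: power2_eq_square)
      finally show ?thesis using nn True by simp
    next
      case False
      have "C * s\<^sup>2 \<le> e / 2 * \<bar>s\<bar> powr p + C * r\<^sup>2"
      proof (cases "\<bar>s\<bar> \<le> r")
        case True
        then have "s\<^sup>2 \<le> r\<^sup>2" using r by (simp add: abs_le_square_iff[symmetric])
        then have "C * s\<^sup>2 \<le> C * r\<^sup>2" using C by (intro mult_left_mono)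
        then show ?thesis using nn by simp
      next
        case False
        then have s1: "\<bar>s\<bar> \<ge> 1" "2 * C / e \<le> \<bar>s\<bar>" using r by auto
        have "2 * C \<le> e * \<bar>s\<bar>" using s1 e by (simp add: divide_le_eq mult.commute)
        also have "\<dots> = e * \<bar>s\<bar> powr 1" using s1 by simp
        also have "\<dots> \<le> e * \<bar>s\<bar> powr (p - 2)" using s1 p4 e by (intro mult_left_mono powr_mono) auto
        finally have "C \<le> e / 2 * \<bar>s\<bar> powr (p - 2)" by simp
        then have "C * s\<^sup>2 \<le> e / 2 * \<bar>s\<bar> powr (p - 2) * s\<^sup>2" by (rule mult_right_mono) simp
        also have "\<dots> = e / 2 * \<bar>s\<bar> powr p"
        proof -
          have "\<bar>s\<bar> powr p = \<bar>s\<bar> powr (p - 2) * \<bar>s\<bar> powr 2" by (simp only: powr_add[symmetric]) simp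
          then show ?thesis using s1 by simp
        qed
        finally show ?thesis using C by (simp add: add_increasing2)
      qed
      then show ?thesis using C(2)[of s] nn False by simp
    qed
  qed
qed

definition potential :: "(real^'n \<Rightarrow> real) \<Rightarrow> real" where "potential u = (\<integral>x. G (u x) \<partial>lborel)"

definition total_energy :: "(real^'n \<Rightarrow> real) \<Rightarrow> (real^'n \<Rightarrow> real^'n) \<Rightarrow> real" where
  "total_energy u Du = kinetic u Du - potential u"

end

text \<open>The argument of type \<open>'n itself\<close> carries no value; it fixes the dimension
  to which the exponent is tied.\<close>

locale critical_nonlinearity = nonlinearity g p for g p +
  fixes dim :: "'n::finite itself"
  assumes p_eq: "p = 4 + 4 / real CARD('n)"
begin

lemma power_bound:
  assumes "0 < m"
  obtains c where "c \<ge> 0" "\<And>(u :: real^'n \<Rightarrow> real) Du. finite_energy u Du \<Longrightarrow> mass u \<le> m \<Longrightarrow>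
    (\<integral>x. \<bar>u x\<bar> powr p \<partial>lborel) \<le> c * (\<integral>x. (u x)\<^sup>2 * (norm (Du x))\<^sup>2 \<partial>lborel)"
  using finite_energy_power_bound[OF assms, where 'n='n] unfolding p_eq by blast

lemma power_integrable:
  assumes "finite_energy (u :: real^'n \<Rightarrow> real) Du" shows "integrable lborel (\<lambda>x. \<bar>u x\<bar> powr p)"
proof -
  have "0 < mass u + 1" "mass u \<le> mass u + 1" using mass_nonneg[of u] by auto
  then show ?thesis using finite_energy_power_bound[where 'n='n] assms unfolding p_eq by blast
qed

lemma G_integrable:
  assumes fe: "finite_energy (u :: real^'n \<Rightarrow> real) Du" shows "integrable lborel (\<lambda>x. G (u x))"
proof -
  note [measurable] = finite_energyD(1)[OF fe]
  obtain C where C: "C \<ge> 0" "\<And>s. \<bar>G s\<bar> \<le> C * s\<^sup>2 + 1 * \<bar>s\<bar> powr p" using G_bound[of 1] by auto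
  show ?thesis
  proof (rule Bochner_Integration.integrable_bound)
    show "integrable lborel (\<lambda>x. C * (u x)\<^sup>2 + 1 * \<bar>u x\<bar> powr p)"
      using finite_energyD(4)[OF fe] power_integrable[OF fe] by simp
    show "AE x in lborel. norm (G (u x)) \<le> norm (C * (u x)\<^sup>2 + 1 * \<bar>u x\<bar> powr p)"
      using C by (auto intro!: AE_I2 simp: abs_of_nonneg intro: order_trans[OF _ abs_ge_self])
  qed measurable
qed

lemma coercive:
  assumes m: "0 < m"
  obtains C where "C \<ge> 0" "\<And>(u :: real^'n \<Rightarrow> real) Du. finite_energy u Du \<Longrightarrow> mass u \<le> m \<Longrightarrow>
    kinetic u Du / 2 - C \<le> total_energy u Du"
proof -
  obtain c where c: "c \<ge> 0" "\<And>(u :: real^'n \<Rightarrow> real) Du. finite_energy u Du \<Longrightarrow> mass u \<le> m \<Longrightarrow>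
    (\<integral>x. \<bar>u x\<bar> powr p \<partial>lborel) \<le> c * (\<integral>x. (u x)\<^sup>2 * (norm (Du x))\<^sup>2 \<partial>lborel)"
    using power_bound[OF m] by blast
  \<comment> \<open>With this e the critical part of the potential is at most half the kinetic
    energy; c + 1 also covers c = 0.\<close>
  define e where "e = 1 / (2 * (c + 1))"
  have e: "e > 0" using c by (simp add: e_def)
  have ec: "e * c \<le> 1 / 2"
  proof -
    have "e * c \<le> e * (c + 1)" using e by simp
    also have "\<dots> = 1 / 2" using c unfolding e_def by (auto simp: divide_simps)
    finally show ?thesis .
  qed
  obtain C where C: "C \<ge> 0" "\<And>s. \<bar>G s\<bar> \<le> C * s\<^sup>2 + e * \<bar>s\<bar> powr p" using G_bound[OF e] by blast
  show ?thesis
  proof (rule that[of "C * m"])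
    show "C * m \<ge> 0" using C m by simp
    fix u :: "real^'n \<Rightarrow> real" and Du assume fe: "finite_energy u Du" and mu: "mass u \<le> m"
    note i = finite_energyD(4)[OF fe] power_integrable[OF fe]
    have "potential u \<le> (\<integral>x. C * (u x)\<^sup>2 + e * \<bar>u x\<bar> powr p \<partial>lborel)"
      unfolding potential_def using G_integrable[OF fe] i C(2)
      by (intro integral_mono) (auto intro: order_trans[OF abs_ge_self])
    also have "\<dots> = C * mass u + e * (\<integral>x. \<bar>u x\<bar> powr p \<partial>lborel)" using i by (simp add: mass_def)
    also have "\<dots> \<le> C * m + e * (c * kinetic u Du)"
      using C mu e c order_trans[OF c(2)[OF fe mu] mult_left_mono[OF kinetic_bounds(2)[OF fe] c(1)]]
      by (intro add_mono mult_left_mono) auto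
    also have "e * (c * kinetic u Du) \<le> 1 / 2 * kinetic u Du"
      unfolding mult.assoc[symmetric] by (rule mult_right_mono[OF ec kinetic_nonneg])
    finally show "kinetic u Du / 2 - C * m \<le> total_energy u Du" by (simp add: total_energy_def)
  qed
qed

lemma total_energy_dilate:
  assumes fe: "finite_energy (u :: real^'n \<Rightarrow> real) Du" and t: "t > 0"
  shows "total_energy (\<lambda>x. u ((1/t) *\<^sub>R x)) (\<lambda>x. (1/t) *\<^sub>R Du ((1/t) *\<^sub>R x)) =
    t ^ CARD('n) * (kinetic u Du / t\<^sup>2 - potential u)"
proof -
  note [measurable] = finite_energyD(1)[OF fe]
  have "potential (\<lambda>x. u ((1/t) *\<^sub>R x)) = t ^ CARD('n) * potential u"
    unfolding potential_def by (rule integral_dilate[OF _ t]) measurable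
  then show ?thesis unfolding total_energy_def finite_energy_dilate(3)[OF fe t] by (simp add: right_diff_distrib)
qed

text \<open>The factor satisfies t^N = m / mass v, so the dilate of v has mass m and is an
  admissible competitor.\<close>

lemma energy_lower_dilate:
  assumes m: "0 < m" and lb: "\<And>(u :: real^'n \<Rightarrow> real) Du. finite_energy u Du \<Longrightarrow> mass u = m \<Longrightarrow> e \<le> total_energy u Du"
    and fe: "finite_energy (v :: real^'n \<Rightarrow> real) Dv" and mv: "mass v > 0"
  defines "t \<equiv> root CARD('n) (m / mass v)"
  shows "t > 0" "e \<le> m / mass v * (kinetic v Dv / t\<^sup>2 - potential v)"
proof -
  show t: "t > 0" unfolding t_def using m mv by (simp add: real_root_gt_zero)
  have tN: "t ^ CARD('n) = m / mass v" unfolding t_def using m mv by (simp add: real_root_pow_pos2)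
  show "e \<le> m / mass v * (kinetic v Dv / t\<^sup>2 - potential v)"
    unfolding tN[symmetric] total_energy_dilate[OF fe t, symmetric]
    using m mv by (intro lb finite_energy_dilate(1)[OF fe t]) (simp add: finite_energy_dilate(2)[OF fe t] tN)
qed

lemma mass_eq_0_potential:
  assumes fe: "finite_energy (v :: real^'n \<Rightarrow> real) Dv" and "mass v = 0" shows "potential v = 0"
proof -
  note [measurable] = finite_energyD(1)[OF fe]
  have "AE x in lborel. (v x)\<^sup>2 = 0"
    using assms(2) integral_nonneg_eq_0_iff_AE[OF finite_energyD(4)[OF fe]] by (simp add: mass_def)
  then have "AE x in lborel. G (v x) = 0" by eventually_elim simp
  then have "potential v = (\<integral>x. 0 \<partial>(lborel :: (real^'n) measure))" unfolding potential_def by (intro integral_cong_AE) auto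
  then show ?thesis by simp
qed

text \<open>If mass v \<le> m, the dilation factor to mass m is at least 1 and can only decrease the
  kinetic part relative to the potential. The energy per unit mass of v is thus at least e / m. A
  function of mass 0 has zero potential and is treated apart.\<close>

lemma energy_lower_sub:
  assumes m: "0 < m" and lb: "\<And>(u :: real^'n \<Rightarrow> real) Du. finite_energy u Du \<Longrightarrow> mass u = m \<Longrightarrow> e \<le> total_energy u Du"
    and fe: "finite_energy (v :: real^'n \<Rightarrow> real) Dv" and mv: "mass v \<le> m"
  shows "mass v / m * e \<le> total_energy v Dv"
proof (cases "mass v = 0")
  case True
  then show ?thesis using mass_eq_0_potential[OF fe True] kinetic_nonneg[of v Dv] by (simp add: total_energy_def)
next
  case False
  then have mp: "mass v > 0" using mass_nonneg[of v] by simp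
  define t where "t = root CARD('n) (m / mass v)"
  note * = energy_lower_dilate[OF m lb fe mp, folded t_def]
  have "1 \<le> t" unfolding t_def using m mp mv by simp
  then have "1 \<le> t\<^sup>2" by simp
  then have "kinetic v Dv / t\<^sup>2 \<le> kinetic v Dv" using kinetic_nonneg[of v Dv] by (simp add: divide_le_eq mult_left_mono[of 1 _ "kinetic v Dv", simplified])
  then have "m / mass v * (kinetic v Dv / t\<^sup>2 - potential v) \<le> m / mass v * total_energy v Dv"
    unfolding total_energy_def using m mp by (intro mult_left_mono) auto
  then have "e \<le> m / mass v * total_energy v Dv" using *(2) by simp
  then show ?thesis using m mp by (simp add: field_simps)
qed

end

section \<open>Cut-off and concentration\<close>

lemma finite_energy_translate:
  fixes u :: "real^'n \<Rightarrow> real"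
  assumes fe: "finite_energy u Du"
  shows "finite_energy (\<lambda>x. u (x + d)) (\<lambda>x. Du (x + d))"
    and "mass (\<lambda>x. u (x + d)) = mass u"
    and "kinetic (\<lambda>x. u (x + d)) (\<lambda>x. Du (x + d)) = kinetic u Du"
proof -
  note [measurable] = finite_energyD(1,2)[OF fe]
  note i = finite_energyD(4,5,6)[OF fe]
  have w: "weak_grad (\<lambda>x. u (x + d)) (\<lambda>x. Du (x + d))"
    unfolding weak_grad_def
  proof (intro allI impI)
    fix \<phi> :: "real^'n \<Rightarrow> real" and j assume tf: "test_fun \<phi>"
    note [measurable] = test_fun_borel[OF tf] test_fun_borel[OF test_fun_pderiv[OF tf]]
    have pd: "pderiv_i (\<lambda>x. \<phi> (x + - d)) j x = pderiv_i \<phi> j (x + - d)" for x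
      using pderiv_i_affine[of \<phi> 1 x "- d" j] smooth_fun_differentiable[OF test_fun_smooth[OF tf]] by simp
    have "(\<integral>x. u (x + d) * pderiv_i \<phi> j x \<partial>lborel) = (\<integral>x. u x * pderiv_i \<phi> j (x + - d) \<partial>lborel)"
      using integral_lborel_shift[of "\<lambda>x. u x * pderiv_i \<phi> j (x + - d)" d] by simp
    also have "\<dots> = - (\<integral>x. Du x $ j * \<phi> (x + - d) \<partial>lborel)"
      using finite_energyD(3)[OF fe] test_fun_translate[OF tf, of "- d"] unfolding weak_grad_def pd[symmetric] by blast
    also have "(\<integral>x. Du x $ j * \<phi> (x + - d) \<partial>lborel) = (\<integral>x. Du (x + d) $ j * \<phi> x \<partial>lborel)"
      using integral_lborel_shift[of "\<lambda>x. Du x $ j * \<phi> (x + - d)" d] by simp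
    finally show "(\<integral>x. u (x + d) * pderiv_i \<phi> j x \<partial>lborel) = - (\<integral>x. Du (x + d) $ j * \<phi> x \<partial>lborel)" .
  qed
  have ii: "integrable lborel (\<lambda>x. f (x + d))" if "f \<in> borel_measurable borel" "integrable lborel f" for f :: "real^'n \<Rightarrow> real"
    using integrable_lborel_shift[OF that(1), of d] that(2) by simp
  show "finite_energy (\<lambda>x. u (x + d)) (\<lambda>x. Du (x + d))"
    unfolding finite_energy_def
  proof (intro conjI w)
    show "integrable lborel (\<lambda>x. (u (x + d))\<^sup>2)" by (rule ii[OF _ i(1)]) measurable
    show "integrable lborel (\<lambda>x. (norm (Du (x + d)))\<^sup>2)" by (rule ii[OF _ i(2)]) measurable
    show "integrable lborel (\<lambda>x. (u (x + d))\<^sup>2 * (norm (Du (x + d)))\<^sup>2)" by (rule ii[OF _ i(3)]) measurable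
  qed measurable
  show "mass (\<lambda>x. u (x + d)) = mass u"
    unfolding mass_def by (rule integral_lborel_shift) measurable
  have "(\<integral>x. (1 + 2 * (u (x + d))\<^sup>2) * (norm (Du (x + d)))\<^sup>2 \<partial>lborel) = (\<integral>x. (1 + 2 * (u x)\<^sup>2) * (norm (Du x))\<^sup>2 \<partial>lborel)"
    by (rule integral_lborel_shift) measurable
  then show "kinetic (\<lambda>x. u (x + d)) (\<lambda>x. Du (x + d)) = kinetic u Du" by (simp add: kinetic_def)
qed

text \<open>The weak gradient of u is tested with \<phi> \<eta>, again a test function because
  \<phi> has compact support; the product rule for smooth functions does the rest.\<close>

lemma weak_grad_mult_smooth:
  fixes u :: "real^'n \<Rightarrow> real"
  assumes fe: "weak_grad u Du" and [measurable]: "u \<in> borel_measurable borel" "Du \<in> borel_measurable borel"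
    and i: "integrable lborel (\<lambda>x. (u x)\<^sup>2)" "integrable lborel (\<lambda>x. (norm (Du x))\<^sup>2)"
    and s: "smooth_fun \<eta>"
  shows "weak_grad (\<lambda>x. \<eta> x * u x) (\<lambda>x. \<eta> x *\<^sub>R Du x + u x *\<^sub>R grad \<eta> x)"
  unfolding weak_grad_def
proof (intro allI impI)
  fix \<phi> :: "real^'n \<Rightarrow> real" and j assume t: "test_fun \<phi>"
  have t1: "test_fun (\<lambda>x. \<phi> x * \<eta> x)" by (rule test_fun_mult[OF t s])
  have t2: "test_fun (\<lambda>x. pderiv_i \<phi> j x * \<eta> x)" by (rule test_fun_mult[OF test_fun_pderiv[OF t] s])
  have t3: "test_fun (\<lambda>x. \<phi> x * pderiv_i \<eta> j x)" by (rule test_fun_mult[OF t smooth_fun_pderiv_i[OF s]])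
  have Di: "integrable lborel (\<lambda>x. (Du x $ j)\<^sup>2)"
    by (rule Bochner_Integration.integrable_bound[OF i(2)]) 
       (auto intro!: AE_I2 simp: abs_le_square_iff[symmetric] component_le_norm_cart)
  have i1: "integrable lborel (\<lambda>x. u x * (pderiv_i \<phi> j x * \<eta> x))"
    using test_fun_borel[OF t2] by (intro integrable_mult_of_squares i test_fun_square_integrable t2) auto
  have i2: "integrable lborel (\<lambda>x. u x * (\<phi> x * pderiv_i \<eta> j x))"
    using test_fun_borel[OF t3] by (intro integrable_mult_of_squares i test_fun_square_integrable t3) auto
  have i3: "integrable lborel (\<lambda>x. Du x $ j * (\<phi> x * \<eta> x))"
    using test_fun_borel[OF t1] by (intro integrable_mult_of_squares Di test_fun_square_integrable t1) auto
  have p: "pderiv_i (\<lambda>x. \<phi> x * \<eta> x) j x = pderiv_i \<phi> j x * \<eta> x + \<phi> x * pderiv_i \<eta> j x" for x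
    by (intro pderiv_i_mult smooth_fun_differentiable test_fun_smooth t s)
  have "(\<integral>x. u x * pderiv_i (\<lambda>x. \<phi> x * \<eta> x) j x \<partial>lborel) = - (\<integral>x. Du x $ j * (\<phi> x * \<eta> x) \<partial>lborel)"
    using fe t1 unfolding weak_grad_def by blast
  then have "(\<integral>x. u x * (pderiv_i \<phi> j x * \<eta> x) \<partial>lborel) + (\<integral>x. u x * (\<phi> x * pderiv_i \<eta> j x) \<partial>lborel) = - (\<integral>x. Du x $ j * (\<phi> x * \<eta> x) \<partial>lborel)"
    unfolding p distrib_left using i1 i2 by simp
  then have "(\<integral>x. u x * (pderiv_i \<phi> j x * \<eta> x) \<partial>lborel) = - ((\<integral>x. Du x $ j * (\<phi> x * \<eta> x) \<partial>lborel) + (\<integral>x. u x * (\<phi> x * pderiv_i \<eta> j x) \<partial>lborel))"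
    by simp
  also have "(\<integral>x. Du x $ j * (\<phi> x * \<eta> x) \<partial>lborel) + (\<integral>x. u x * (\<phi> x * pderiv_i \<eta> j x) \<partial>lborel) =
    (\<integral>x. Du x $ j * (\<phi> x * \<eta> x) + u x * (\<phi> x * pderiv_i \<eta> j x) \<partial>lborel)"
    using i2 i3 by simp
  also have "\<dots> = (\<integral>x. (\<eta> x *\<^sub>R Du x + u x *\<^sub>R grad \<eta> x) $ j * \<phi> x \<partial>lborel)"
    by (intro Bochner_Integration.integral_cong refl) (simp add: grad_def algebra_simps)
  finally show "(\<integral>x. \<eta> x * u x * pderiv_i \<phi> j x \<partial>lborel) = - (\<integral>x. (\<eta> x *\<^sub>R Du x + u x *\<^sub>R grad \<eta> x) $ j * \<phi> x \<partial>lborel)"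
    by (simp add: mult_ac)
qed

text \<open>The cut-off is 1 - \<theta>(x / R), whose gradient is O(1 / R). The error in the kinetic
  energy is of the same order, with one constant for all u. The fourth power of u enters because the
  weight 1 + 2 u^2 meets the term u^2 |D\<eta>|^2.\<close>

lemma cutoff_outer:
  "\<exists>C\<ge>0. \<forall>R\<ge>1. \<forall>(u :: real^'n \<Rightarrow> real) Du. finite_energy u Du \<and> integrable lborel (\<lambda>x. (u x)^4) \<longrightarrow>
    (\<exists>v Dv. finite_energy v Dv \<and> (\<forall>x. \<bar>v x\<bar> \<le> \<bar>u x\<bar>) \<and> (\<forall>x. x \<notin> Q (2 * R) \<longrightarrow> v x = u x) \<and> (\<forall>x\<in>Q R. v x = 0) \<and>
      kinetic v Dv \<le> 1/2 * (\<integral>x. (1 - indicator (Q R) x) * ((1 + 2 * (u x)\<^sup>2) * (norm (Du x))\<^sup>2) \<partial>lborel)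
        + C / R * (\<integral>x. (1 + 2 * (u x)\<^sup>2) * ((norm (Du x))\<^sup>2 + (u x)\<^sup>2) \<partial>lborel))"
proof -
  obtain \<theta> :: "real^'n \<Rightarrow> real" where th: "test_fun \<theta>" "\<And>x. 0 \<le> \<theta> x" "\<And>x. \<theta> x \<le> 1"
    "\<And>x. x \<in> Q 1 \<Longrightarrow> \<theta> x = 1" "\<And>x. x \<notin> Q 2 \<Longrightarrow> \<theta> x = 0" using ex_cutoff by metis
  obtain R0 B where B: "B > 0" "\<And>x. norm (grad \<theta> x) \<le> B * indicator (cball 0 R0) x"
    using test_fun_grad_bound[OF th(1)] by metis
  have Bg: "norm (grad \<theta> x) \<le> B" for x using B(2)[of x] B(1) by (cases "x \<in> cball 0 R0") auto
  show ?thesis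
  proof (intro exI[of _ "B * (1 + B) / 2"] conjI allI impI)
    fix R :: real and u :: "real^'n \<Rightarrow> real" and Du
    assume R: "1 \<le> R" and as: "finite_energy u Du \<and> integrable lborel (\<lambda>x. (u x)^4)"
    then have fe: "finite_energy u Du" and u4: "integrable lborel (\<lambda>x. (u x)^4)" by auto
    note [measurable] = finite_energyD(1,2)[OF fe]
    note i = finite_energyD(4,5,6)[OF fe]
    define \<eta> where "\<eta> x = 1 + (-1) * \<theta> ((1/R) *\<^sub>R x + 0)" for x
    have s: "smooth_fun \<eta>" unfolding \<eta>_def
      by (intro smooth_fun_add smooth_fun_const smooth_fun_affine test_fun_smooth th)
    have ev: "\<eta> x = 1 - \<theta> ((1/R) *\<^sub>R x)" for x by (simp add: \<eta>_def)
    have e01: "0 \<le> \<eta> x" "\<eta> x \<le> 1" for x using th(2,3)[of "(1/R) *\<^sub>R x"] by (auto simp: ev)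
    have sc: "(1/R) *\<^sub>R x \<in> Q a \<longleftrightarrow> x \<in> Q (a * R)" for x :: "real^'n" and a
      using R by (simp add: Q_def abs_mult divide_le_eq abs_divide)
    have ein: "\<eta> x = 0" if "x \<in> Q R" for x using th(4)[of "(1/R) *\<^sub>R x"] that sc[of x 1] by (simp add: ev)
    have eout: "\<eta> x = 1" if "x \<notin> Q (2 * R)" for x using th(5)[of "(1/R) *\<^sub>R x"] that sc[of x 2] by (simp add: ev)
    have gr: "grad \<eta> x = (- (1/R)) *\<^sub>R grad \<theta> ((1/R) *\<^sub>R x)" for x
    proof -
      have d: "\<theta> differentiable (at y)" for y using smooth_fun_differentiable[OF test_fun_smooth[OF th(1)]] .
      have "pderiv_i \<eta> j x = - (1/R) * pderiv_i \<theta> j ((1/R) *\<^sub>R x)" for j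
      proof -
        have d': "(\<lambda>x. \<theta> ((1/R) *\<^sub>R x + 0)) differentiable (at x)" by (rule differentiable_affine[OF d])
        have "pderiv_i \<eta> j x = pderiv_i (\<lambda>x. 1) j x + pderiv_i (\<lambda>x. (-1) * \<theta> ((1/R) *\<^sub>R x + 0)) j x"
          unfolding \<eta>_def[abs_def] by (rule pderiv_i_add) (intro differentiable_const differentiable_mult d')+
        also have "pderiv_i (\<lambda>x. (-1) * \<theta> ((1/R) *\<^sub>R x + 0)) j x = pderiv_i (\<lambda>x. - 1) j x * \<theta> ((1/R) *\<^sub>R x + 0) + (-1) * pderiv_i (\<lambda>x. \<theta> ((1/R) *\<^sub>R x + 0)) j x"
          by (rule pderiv_i_mult[OF differentiable_const d'])
        also have "pderiv_i (\<lambda>x. \<theta> ((1/R) *\<^sub>R x + 0)) j x = (1/R) * pderiv_i \<theta> j ((1/R) *\<^sub>R x + 0)"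
          by (rule pderiv_i_affine[OF d])
        finally show ?thesis by simp
      qed
      then show ?thesis by (simp add: grad_def vec_eq_iff)
    qed
    define \<delta> where "\<delta> = B / R"
    have dl: "0 < \<delta>" "\<delta> \<le> B" using B(1) R by (auto simp: \<delta>_def divide_le_eq)
    have gb: "norm (grad \<eta> x) \<le> \<delta>" for x
      unfolding gr \<delta>_def using Bg[of "(1/R) *\<^sub>R x"] R by (simp add: divide_right_mono)
    note [measurable] = grad_borel[OF s] borel_measurable_continuous_onI[OF smooth_fun_continuous[OF s]]
    define v where "v x = \<eta> x * u x" for x
    define Dv where "Dv x = \<eta> x *\<^sub>R Du x + u x *\<^sub>R grad \<eta> x" for x
    have [measurable]: "v \<in> borel_measurable borel" "Dv \<in> borel_measurable borel" unfolding v_def Dv_def by measurable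
    have vu: "\<bar>v x\<bar> \<le> \<bar>u x\<bar>" for x using e01[of x] by (simp add: v_def abs_mult mult_left_le_one_le)
    have vu2: "(v x)\<^sup>2 \<le> (u x)\<^sup>2" for x using vu[of x] by (simp add: abs_le_square_iff)
    have Dvb: "norm (Dv x) \<le> norm (Du x) + \<delta> * \<bar>u x\<bar>" for x
    proof -
      have "norm (Dv x) \<le> \<bar>\<eta> x\<bar> * norm (Du x) + \<bar>u x\<bar> * norm (grad \<eta> x)"
        unfolding Dv_def by (rule order_trans[OF norm_triangle_ineq]) simp
      also have "\<dots> \<le> 1 * norm (Du x) + \<bar>u x\<bar> * \<delta>" using e01[of x] gb[of x] by (intro add_mono mult_mono) auto
      finally show ?thesis by (simp add: mult.commute)
    qed
    \<comment> \<open>Here \<delta> = B / R \<le> B is used once, to trade \<delta>^2 for \<delta>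
      B. The resulting factor \<delta> (1 + B), halved in the kinetic energy, is the constant B (1 +
      B) / 2 divided by R.\<close>
    have sq: "(a + \<delta> * b)\<^sup>2 \<le> a\<^sup>2 + \<delta> * (1 + B) * (a\<^sup>2 + b\<^sup>2)" if "0 \<le> a" "0 \<le> b" for a b
    proof -
      have 1: "2 * (a * b) \<le> a\<^sup>2 + b\<^sup>2" using sum_squares_bound[of a b] by (simp add: mult.assoc)
      have "(a + \<delta> * b)\<^sup>2 = a\<^sup>2 + \<delta> * (2 * (a * b)) + \<delta> * (\<delta> * b\<^sup>2)" by (simp add: power2_eq_square algebra_simps)
      also have "\<dots> \<le> a\<^sup>2 + \<delta> * (a\<^sup>2 + b\<^sup>2) + \<delta> * (B * (a\<^sup>2 + b\<^sup>2))"
        using 1 dl by (intro add_mono mult_left_mono mult_mono) auto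
      finally show ?thesis by (simp add: algebra_simps)
    qed
    have pt: "(norm (Dv x))\<^sup>2 \<le> (norm (Du x))\<^sup>2 + \<delta> * (1 + B) * ((norm (Du x))\<^sup>2 + (u x)\<^sup>2)" for x
      using order_trans[OF power_mono[OF Dvb[of x] norm_ge_zero] sq[of "norm (Du x)" "\<bar>u x\<bar>"]] by simp
    define W where "W x = (1 + 2 * (u x)\<^sup>2) * ((norm (Du x))\<^sup>2 + (u x)\<^sup>2)" for x
    have W0: "0 \<le> W x" for x by (simp add: W_def)
    have Wi: "integrable lborel W"
    proof -
      have "integrable lborel (\<lambda>x. (norm (Du x))\<^sup>2 + (u x)\<^sup>2 + 2 * ((u x)\<^sup>2 * (norm (Du x))\<^sup>2) + 2 * (u x)^4)"
        using i u4 by simp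
      then show ?thesis unfolding W_def[abs_def] by (simp add: algebra_simps power4_eq_xxxx power2_eq_square)
    qed
    define c where "c = 1 + \<delta> * (1 + B)"
    have c: "c \<ge> 1" using dl B by (simp add: c_def)
    have pt2: "(1 + 2 * (v x)\<^sup>2) * (norm (Dv x))\<^sup>2 \<le> c * W x" for x
    proof -
      have "(norm (Dv x))\<^sup>2 \<le> c * ((norm (Du x))\<^sup>2 + (u x)\<^sup>2)"
      proof -
        have "(norm (Dv x))\<^sup>2 \<le> ((norm (Du x))\<^sup>2 + (u x)\<^sup>2) + \<delta> * (1 + B) * ((norm (Du x))\<^sup>2 + (u x)\<^sup>2)"
          using pt[of x] zero_le_power2[of "u x"] by linarith
        then show ?thesis unfolding c_def by (simp only: distrib_right mult_1_left)
      qed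
      then have "(1 + 2 * (v x)\<^sup>2) * (norm (Dv x))\<^sup>2 \<le> (1 + 2 * (u x)\<^sup>2) * (c * ((norm (Du x))\<^sup>2 + (u x)\<^sup>2))"
        using vu2[of x] by (intro mult_mono) auto
      then show ?thesis by (simp add: W_def mult_ac)
    qed
    have i7: "integrable lborel (\<lambda>x. (1 + 2 * (v x)\<^sup>2) * (norm (Dv x))\<^sup>2)"
    proof (rule Bochner_Integration.integrable_bound)
      show "integrable lborel (\<lambda>x. c * W x)" using Wi by simp
      show "AE x in lborel. norm ((1 + 2 * (v x)\<^sup>2) * (norm (Dv x))\<^sup>2) \<le> norm (c * W x)"
        unfolding real_norm_def by (rule AE_I2, rule order_trans[OF _ abs_ge_self], subst abs_of_nonneg, simp, rule pt2)
    qed measurable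
    have fv: "finite_energy v Dv"
      unfolding finite_energy_def
    proof (intro conjI)
      show "weak_grad v Dv" unfolding v_def[abs_def] Dv_def[abs_def]
        by (rule weak_grad_mult_smooth[OF finite_energyD(3)[OF fe] _ _ i(1,2) s]) measurable
      show "integrable lborel (\<lambda>x. (v x)\<^sup>2)"
        by (rule Bochner_Integration.integrable_bound[OF i(1)]) (auto intro!: AE_I2 simp: vu2)
      show "integrable lborel (\<lambda>x. (norm (Dv x))\<^sup>2)"
        by (rule Bochner_Integration.integrable_bound[OF i7]) (auto intro!: AE_I2 simp: distrib_right)
      show "integrable lborel (\<lambda>x. (v x)\<^sup>2 * (norm (Dv x))\<^sup>2)"
        by (rule Bochner_Integration.integrable_bound[OF i7]) (auto intro!: AE_I2 simp: distrib_right mult.assoc)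
    qed measurable
    have pt3: "(1 + 2 * (v x)\<^sup>2) * (norm (Dv x))\<^sup>2 \<le>
      (1 - indicator (Q R) x) * ((1 + 2 * (u x)\<^sup>2) * (norm (Du x))\<^sup>2) + \<delta> * (1 + B) * W x" for x
    proof (cases "x \<in> Q R")
      case True
      \<comment> \<open>Inside the cube \<open>v\<close> vanishes, but the formula for
        \<open>Dv\<close> retains u D\<eta>; that term is charged to the error.\<close>
      have z: "v x = 0" "Dv x = u x *\<^sub>R grad \<eta> x" using ein[OF True] by (auto simp: v_def Dv_def)
      have "(norm (Dv x))\<^sup>2 \<le> (\<bar>u x\<bar> * \<delta>)\<^sup>2" unfolding z using gb[of x] by (intro power_mono) (auto intro: mult_left_mono)
      also have "\<dots> = \<delta> * (\<delta> * (u x)\<^sup>2)" by (simp add: power_mult_distrib power2_eq_square)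
      also have "\<dots> \<le> \<delta> * ((1 + B) * W x)"
        using dl B by (intro mult_left_mono mult_mono) (auto simp: W_def algebra_simps)
      finally show ?thesis using True z by (simp add: mult.assoc)
    next
      case False
      have "(1 + 2 * (v x)\<^sup>2) * (norm (Dv x))\<^sup>2 \<le> (1 + 2 * (u x)\<^sup>2) * ((norm (Du x))\<^sup>2 + \<delta> * (1 + B) * ((norm (Du x))\<^sup>2 + (u x)\<^sup>2))"
        using vu2[of x] pt[of x] by (intro mult_mono) auto
      also have "\<dots> = (1 + 2 * (u x)\<^sup>2) * (norm (Du x))\<^sup>2 + \<delta> * (1 + B) * W x" unfolding W_def by (simp add: distrib_left mult_ac)
      finally show ?thesis using False by simp
    qed
    have io: "integrable lborel (\<lambda>x. (1 - indicator (Q R) x) * ((1 + 2 * (u x)\<^sup>2) * (norm (Du x))\<^sup>2))"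
      by (rule Bochner_Integration.integrable_bound[OF finite_energyD(7)[OF fe]]) (auto intro!: AE_I2 simp: indicator_def)
    have "(\<integral>x. (1 + 2 * (v x)\<^sup>2) * (norm (Dv x))\<^sup>2 \<partial>lborel) \<le>
      (\<integral>x. (1 - indicator (Q R) x) * ((1 + 2 * (u x)\<^sup>2) * (norm (Du x))\<^sup>2) + \<delta> * (1 + B) * W x \<partial>lborel)"
      by (rule integral_mono[OF i7 _ pt3]) (use io Wi in simp)
    also have "\<dots> = (\<integral>x. (1 - indicator (Q R) x) * ((1 + 2 * (u x)\<^sup>2) * (norm (Du x))\<^sup>2) \<partial>lborel) + \<delta> * (1 + B) * (\<integral>x. W x \<partial>lborel)"
      using io Wi by simp
    finally have "kinetic v Dv \<le> 1/2 * ((\<integral>x. (1 - indicator (Q R) x) * ((1 + 2 * (u x)\<^sup>2) * (norm (Du x))\<^sup>2) \<partial>lborel) + \<delta> * (1 + B) * (\<integral>x. W x \<partial>lborel))"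
      by (simp add: kinetic_def)
    also have "\<dots> = 1/2 * (\<integral>x. (1 - indicator (Q R) x) * ((1 + 2 * (u x)\<^sup>2) * (norm (Du x))\<^sup>2) \<partial>lborel)
        + B * (1 + B) / 2 / R * (\<integral>x. (1 + 2 * (u x)\<^sup>2) * ((norm (Du x))\<^sup>2 + (u x)\<^sup>2) \<partial>lborel)"
    proof -
      have "1/2 * (A + B / R * (1 + B) * I) = 1/2 * A + B * (1 + B) / 2 / R * I" for A I :: real
        by (simp add: algebra_simps add_divide_distrib)
      then show ?thesis unfolding \<delta>_def W_def .
    qed
    finally show "\<exists>v Dv. finite_energy v Dv \<and> (\<forall>x. \<bar>v x\<bar> \<le> \<bar>u x\<bar>) \<and> (\<forall>x. x \<notin> Q (2 * R) \<longrightarrow> v x = u x) \<and> (\<forall>x\<in>Q R. v x = 0) \<and>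
      kinetic v Dv \<le> 1/2 * (\<integral>x. (1 - indicator (Q R) x) * ((1 + 2 * (u x)\<^sup>2) * (norm (Du x))\<^sup>2) \<partial>lborel)
        + B * (1 + B) / 2 / R * (\<integral>x. (1 + 2 * (u x)\<^sup>2) * ((norm (Du x))\<^sup>2 + (u x)\<^sup>2) \<partial>lborel)"
      using fv vu ein eout by (intro exI[of _ v] exI[of _ Dv]) (auto simp: v_def)
  qed (use B in auto)
qed

definition local_mass :: "real \<Rightarrow> (real^'n \<Rightarrow> real) \<Rightarrow> real" where
  "local_mass R u = (\<integral>x. indicator (Q R) x * (u x)\<^sup>2 \<partial>lborel)"

lemma integrable_Q_mult:
  fixes f :: "real^'n \<Rightarrow> real"
  assumes "integrable lborel f" shows "integrable lborel (\<lambda>x. indicator (Q R) x * f x)"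
  using integrable_mult_indicator[OF _ assms, of "Q R"] by simp

text \<open>From |u^2 - v^2| \<le> (1 + 1/d) (u - v)^2 + d v^2: \<open>d\<close> makes the second
  term small in terms of the mass of v, and the local L^2 convergence then handles the
  first.\<close>

lemma local_mass_tendsto:
  fixes u :: "nat \<Rightarrow> real^'n \<Rightarrow> real"
  assumes [measurable]: "\<And>n. u n \<in> borel_measurable borel" "v \<in> borel_measurable borel"
    and u2: "\<And>n. integrable lborel (\<lambda>x. (u n x)\<^sup>2)" and v2: "integrable lborel (\<lambda>x. (v x)\<^sup>2)"
    and conv: "\<And>e. e > 0 \<Longrightarrow> \<exists>n0. \<forall>n\<ge>n0. (\<integral>\<^sup>+x. indicator (Q R) x * ennreal ((u n x - v x)\<^sup>2) \<partial>lborel) \<le> ennreal e"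
  shows "(\<lambda>n. local_mass R (u n)) \<longlonglongrightarrow> local_mass R v"
proof (rule LIMSEQ_I)
  fix r :: real assume r: "r > 0"
  define m where "m = mass v + 1"
  have m: "m > 0" "mass v < m" using mass_nonneg[of v] by (auto simp: m_def)
  define d where "d = r / (2 * m)"
  have d: "d > 0" using r m by (simp add: d_def)
  define e where "e = r / (2 * (1 + 1 / d))"
  have pos: "1 + 1 / d > 0" using d by (simp add: add_pos_pos)
  have e: "e > 0" using r pos by (simp add: e_def)
  obtain n0 where n0: "\<And>n. n \<ge> n0 \<Longrightarrow> (\<integral>\<^sup>+x. indicator (Q R) x * ennreal ((u n x - v x)\<^sup>2) \<partial>lborel) \<le> ennreal e"
    using conv[OF e] by blast
  have duv: "integrable lborel (\<lambda>x. (u n x - v x)\<^sup>2)" for n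
  proof -
    have m: "u n \<in> borel_measurable lborel" "v \<in> borel_measurable lborel" by simp_all
    have e: "(u n x - v x)\<^sup>2 = (u n x)\<^sup>2 + (v x)\<^sup>2 - 2 * (u n x * v x)" for x
      by (simp add: power2_eq_square algebra_simps)
    show ?thesis unfolding e
      by (intro Bochner_Integration.integrable_diff Bochner_Integration.integrable_add integrable_mult_right u2 v2
          integrable_mult_of_squares[OF m u2 v2])
  qed
  show "\<exists>n0. \<forall>n\<ge>n0. norm (local_mass R (u n) - local_mass R v) < r"
  proof (intro exI[of _ n0] allI impI)
    fix n assume n: "n \<ge> n0"
    have I: "(\<integral>x. indicator (Q R) x * (u n x - v x)\<^sup>2 \<partial>lborel) \<le> e"
    proof -
      have "ennreal (\<integral>x. indicator (Q R) x * (u n x - v x)\<^sup>2 \<partial>lborel) = (\<integral>\<^sup>+x. ennreal (indicator (Q R) x * (u n x - v x)\<^sup>2) \<partial>lborel)"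
        by (rule nn_integral_eq_integral[symmetric]) (use integrable_Q_mult[OF duv] in auto)
      also have "\<dots> = (\<integral>\<^sup>+x. indicator (Q R) x * ennreal ((u n x - v x)\<^sup>2) \<partial>lborel)"
        by (intro nn_integral_cong) (auto simp: indicator_def)
      also have "\<dots> \<le> ennreal e" by (rule n0[OF n])
      finally show ?thesis using e by (simp add: ennreal_le_iff)
    qed
    have dif: "local_mass R (u n) - local_mass R v = (\<integral>x. indicator (Q R) x * (u n x)\<^sup>2 - indicator (Q R) x * (v x)\<^sup>2 \<partial>lborel)"
      unfolding local_mass_def using integrable_Q_mult[OF u2] integrable_Q_mult[OF v2] by simp
    have "norm (local_mass R (u n) - local_mass R v) \<le> (\<integral>x. norm (indicator (Q R) x * (u n x)\<^sup>2 - indicator (Q R) x * (v x)\<^sup>2) \<partial>lborel)"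
      unfolding dif by (rule integral_norm_bound)
    also have "\<dots> \<le> (\<integral>x. (1 + 1 / d) * (indicator (Q R) x * (u n x - v x)\<^sup>2) + d * (v x)\<^sup>2 \<partial>lborel)"
    proof (rule integral_mono)
      show "integrable lborel (\<lambda>x. norm (indicator (Q R) x * (u n x)\<^sup>2 - indicator (Q R) x * (v x)\<^sup>2))"
        by (intro integrable_norm Bochner_Integration.integrable_diff integrable_Q_mult u2 v2)
      show "integrable lborel (\<lambda>x. (1 + 1 / d) * (indicator (Q R) x * (u n x - v x)\<^sup>2) + d * (v x)\<^sup>2)"
        by (intro Bochner_Integration.integrable_add integrable_mult_right integrable_Q_mult duv v2)
      fix x
      have "\<bar>(u n x)\<^sup>2 - (v x)\<^sup>2\<bar> \<le> (1 + 1 / d) * (u n x - v x)\<^sup>2 + d * (v x)\<^sup>2"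
      proof -
        define a where "a = u n x - v x" define b where "b = v x"
        have e: "(u n x)\<^sup>2 - (v x)\<^sup>2 = a\<^sup>2 + 2 * (a * b)" by (simp add: a_def b_def power2_eq_square algebra_simps)
        have "2 * (\<bar>a\<bar> * (d * \<bar>b\<bar>)) \<le> \<bar>a\<bar>\<^sup>2 + (d * \<bar>b\<bar>)\<^sup>2"
          using sum_squares_bound[of "\<bar>a\<bar>" "d * \<bar>b\<bar>"] by (simp add: mult.assoc)
        then have "d * (2 * \<bar>a * b\<bar>) \<le> d * (1 / d * a\<^sup>2 + d * b\<^sup>2)"
          using d by (simp add: distrib_left power_mult_distrib abs_mult mult_ac power2_eq_square)
        then have "2 * \<bar>a * b\<bar> \<le> 1 / d * a\<^sup>2 + d * b\<^sup>2" using d by (simp only: mult_le_cancel_left_pos)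
        moreover have "\<bar>a\<^sup>2 + 2 * (a * b)\<bar> \<le> a\<^sup>2 + 2 * \<bar>a * b\<bar>" using zero_le_power2[of a] by linarith
        ultimately have "\<bar>a\<^sup>2 + 2 * (a * b)\<bar> \<le> (1 + 1 / d) * a\<^sup>2 + d * b\<^sup>2" by (simp add: distrib_right)
        then show ?thesis unfolding e by (simp only: a_def b_def)
      qed
      then show "norm (indicator (Q R) x * (u n x)\<^sup>2 - indicator (Q R) x * (v x)\<^sup>2) \<le> (1 + 1 / d) * (indicator (Q R) x * (u n x - v x)\<^sup>2) + d * (v x)\<^sup>2"
        using d by (auto simp: indicator_def)
    qed
    also have "\<dots> = (1 + 1 / d) * (\<integral>x. indicator (Q R) x * (u n x - v x)\<^sup>2 \<partial>lborel) + d * mass v"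
      using integrable_Q_mult[OF duv] v2 by (simp add: mass_def)
    also have "\<dots> < (1 + 1 / d) * e + d * m"
      using I pos d m by (intro add_le_less_mono mult_left_mono mult_strict_left_mono) auto
    also have "(1 + 1 / d) * e = r / 2"
    proof -
      have "k * (r / (2 * k)) = r / 2" if "k > 0" for k :: real using that by simp
      from this[OF pos] show ?thesis unfolding e_def .
    qed
    also have "d * m = r / 2" unfolding d_def using m by simp
    finally show "norm (local_mass R (u n) - local_mass R v) < r" by simp
  qed
qed

context critical_nonlinearity
begin

text \<open>As p > 4, one has s^4 \<le> s^2 for |s| \<le> 1 and s^4 \<le> |s|^p otherwise. This
  supplies the integrability demanded by the cut-off.\<close>

lemma quartic_bound:
  assumes fe: "finite_energy (u :: real^'n \<Rightarrow> real) Du"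
  shows "integrable lborel (\<lambda>x. (u x)^4)" "(\<integral>x. (u x)^4 \<partial>lborel) \<le> mass u + (\<integral>x. \<bar>u x\<bar> powr p \<partial>lborel)"
proof -
  note [measurable] = finite_energyD(1)[OF fe]
  have b: "s^4 \<le> s\<^sup>2 + \<bar>s\<bar> powr p" for s :: real
  proof (cases "\<bar>s\<bar> \<le> 1")
    case True
    then have "s\<^sup>2 \<le> 1" by (simp add: abs_square_le_1)
    then have "s\<^sup>2 * s\<^sup>2 \<le> s\<^sup>2 * 1" by (intro mult_left_mono) auto
    then show ?thesis by (simp add: power4_eq_xxxx power2_eq_square add_increasing2 mult.assoc)
  next
    case False
    then have "\<bar>s\<bar>^4 = \<bar>s\<bar> powr 4" by simp
    also have "\<dots> \<le> \<bar>s\<bar> powr p" using False p4 by (intro powr_mono) auto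
    finally show ?thesis by (simp add: add_increasing)
  qed
  have i: "integrable lborel (\<lambda>x. (u x)\<^sup>2 + \<bar>u x\<bar> powr p)"
    using finite_energyD(4)[OF fe] power_integrable[OF fe] by simp
  show q: "integrable lborel (\<lambda>x. (u x)^4)"
    by (rule Bochner_Integration.integrable_bound[OF i]) (use b in \<open>auto intro!: AE_I2 intro: order_trans[OF _ abs_ge_self]\<close>)
  have "(\<integral>x. (u x)^4 \<partial>lborel) \<le> (\<integral>x. (u x)\<^sup>2 + \<bar>u x\<bar> powr p \<partial>lborel)" by (rule integral_mono[OF q i b])
  then show "(\<integral>x. (u x)^4 \<partial>lborel) \<le> mass u + (\<integral>x. \<bar>u x\<bar> powr p \<partial>lborel)"
    using finite_energyD(4)[OF fe] power_integrable[OF fe] by (simp add: mass_def)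
qed

lemma weight_bound:
  assumes fe: "finite_energy (u :: real^'n \<Rightarrow> real) Du"
  shows "(\<integral>x. (1 + 2 * (u x)\<^sup>2) * ((norm (Du x))\<^sup>2 + (u x)\<^sup>2) \<partial>lborel) \<le>
    2 * kinetic u Du + 3 * mass u + 2 * (\<integral>x. \<bar>u x\<bar> powr p \<partial>lborel)"
proof -
  have e: "(1 + 2 * (u x)\<^sup>2) * ((norm (Du x))\<^sup>2 + (u x)\<^sup>2) = (1 + 2 * (u x)\<^sup>2) * (norm (Du x))\<^sup>2 + ((u x)\<^sup>2 + 2 * (u x)^4)" for x
    by (simp add: algebra_simps power4_eq_xxxx power2_eq_square)
  have "(\<integral>x. (1 + 2 * (u x)\<^sup>2) * ((norm (Du x))\<^sup>2 + (u x)\<^sup>2) \<partial>lborel) = 2 * kinetic u Du + (mass u + 2 * (\<integral>x. (u x)^4 \<partial>lborel))"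
    unfolding e using finite_energyD(4,7)[OF fe] quartic_bound(1)[OF fe] by (simp add: kinetic_def mass_def)
  then show ?thesis using quartic_bound(2)[OF fe] by simp
qed

text \<open>The cut-off of \<open>u\<close> to the outside of \<open>Q R\<close> has mass at most \<open>m - local_mass R u\<close>, so its energy is bounded below by the dilation estimate; what remains is a bound for the energy inside.\<close>

lemma inner_energy_bound:
  "\<exists>C\<ge>0. \<forall>R m e0 ep Ce. \<forall>(u :: real^'n \<Rightarrow> real) Du. 1 \<le> R \<and> 0 < m \<and> e0 < 0 \<and> finite_energy u Du \<and> mass u = m \<and>
    (\<forall>(v :: real^'n \<Rightarrow> real) Dv. finite_energy v Dv \<and> mass v = m \<longrightarrow> e0 \<le> total_energy v Dv) \<and>
    0 < ep \<and> 0 \<le> Ce \<and> (\<forall>s. \<bar>G s\<bar> \<le> Ce * s\<^sup>2 + ep * \<bar>s\<bar> powr p) \<longrightarrow>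
    1/2 * (\<integral>x. indicator (Q R) x * ((1 + 2 * (u x)\<^sup>2) * (norm (Du x))\<^sup>2) \<partial>lborel) \<le>
      total_energy u Du - (1 - local_mass R u / m) * e0 + (\<integral>x. indicator (Q R) x * G (u x) \<partial>lborel)
      + 2 * (Ce * (local_mass (2 * R) u - local_mass R u) + ep * (\<integral>x. \<bar>u x\<bar> powr p \<partial>lborel))
      + C / R * (2 * kinetic u Du + 3 * m + 2 * (\<integral>x. \<bar>u x\<bar> powr p \<partial>lborel))"
proof -
  obtain C where C: "C \<ge> 0" and cut: "\<And>R u Du. R \<ge> 1 \<Longrightarrow> finite_energy (u :: real^'n \<Rightarrow> real) Du \<Longrightarrow> integrable lborel (\<lambda>x. (u x)^4) \<Longrightarrow>
    \<exists>v Dv. finite_energy v Dv \<and> (\<forall>x. \<bar>v x\<bar> \<le> \<bar>u x\<bar>) \<and> (\<forall>x. x \<notin> Q (2 * R) \<longrightarrow> v x = u x) \<and> (\<forall>x\<in>Q R. v x = 0) \<and>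
      kinetic v Dv \<le> 1/2 * (\<integral>x. (1 - indicator (Q R) x) * ((1 + 2 * (u x)\<^sup>2) * (norm (Du x))\<^sup>2) \<partial>lborel)
        + C / R * (\<integral>x. (1 + 2 * (u x)\<^sup>2) * ((norm (Du x))\<^sup>2 + (u x)\<^sup>2) \<partial>lborel)"
    using cutoff_outer[where 'n='n] by blast
  show ?thesis
  proof (intro exI[of _ C] conjI allI impI C, elim conjE)
    fix R m e0 ep Ce :: real and u :: "real^'n \<Rightarrow> real" and Du
    assume R: "1 \<le> R" and m: "0 < m" and e0: "e0 < 0" and fe: "finite_energy u Du" and mu: "mass u = m"
      and lb: "\<forall>(v :: real^'n \<Rightarrow> real) Dv. finite_energy v Dv \<and> mass v = m \<longrightarrow> e0 \<le> total_energy v Dv"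
      and ep: "0 < ep" and Ce: "0 \<le> Ce" and Gb: "\<forall>s. \<bar>G s\<bar> \<le> Ce * s\<^sup>2 + ep * \<bar>s\<bar> powr p"
    note [measurable] = finite_energyD(1,2)[OF fe]
    obtain v Dv where fv: "finite_energy v Dv" and vu: "\<And>x. \<bar>v x\<bar> \<le> \<bar>u x\<bar>" and vo: "\<And>x. x \<notin> Q (2 * R) \<Longrightarrow> v x = u x"
      and vi: "\<And>x. x \<in> Q R \<Longrightarrow> v x = 0" and kv: "kinetic v Dv \<le> 1/2 * (\<integral>x. (1 - indicator (Q R) x) * ((1 + 2 * (u x)\<^sup>2) * (norm (Du x))\<^sup>2) \<partial>lborel)
        + C / R * (\<integral>x. (1 + 2 * (u x)\<^sup>2) * ((norm (Du x))\<^sup>2 + (u x)\<^sup>2) \<partial>lborel)"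
      using cut[OF R fe quartic_bound(1)[OF fe]] by blast
    note [measurable] = finite_energyD(1,2)[OF fv]
    define P where "P = (\<integral>x. \<bar>u x\<bar> powr p \<partial>lborel)"
    have vu2: "(v x)\<^sup>2 \<le> (u x)\<^sup>2" for x using vu[of x] by (simp add: abs_le_square_iff)
    have vup: "\<bar>v x\<bar> powr p \<le> \<bar>u x\<bar> powr p" for x using vu[of x] p4 by (intro powr_mono2) auto
    note iu = finite_energyD(4,7)[OF fe] and iv = finite_energyD(4,7)[OF fv]
    have sub: "(Q R :: (real^'n) set) \<subseteq> Q (2 * R)" using R unfolding Q_def by (auto intro: order_trans)
    have mv: "mass v \<le> m - local_mass R u"
    proof -
      have "mass v \<le> (\<integral>x. (u x)\<^sup>2 - indicator (Q R) x * (u x)\<^sup>2 \<partial>lborel)"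
        unfolding mass_def
        by (rule integral_mono) (use iu iv integrable_Q_mult[OF iu(1)] vu2 vi in \<open>auto simp: indicator_def\<close>)
      also have "\<dots> = m - local_mass R u"
        unfolding mu[symmetric] local_mass_def mass_def using iu(1) integrable_Q_mult[OF iu(1)] by simp
      finally show ?thesis .
    qed
    have lm: "0 \<le> local_mass R u" unfolding local_mass_def by (auto intro!: integral_nonneg_AE)
    have Ev: "(1 - local_mass R u / m) * e0 \<le> total_energy v Dv"
    proof -
      have "mass v / m * e0 \<le> total_energy v Dv"
        by (rule energy_lower_sub[OF m _ fv]) (use lb mv lm in auto)
      \<comment> \<open>Since e0 < 0, the upper bound for the mass of \<open>v\<close> turns into a
        lower bound here.\<close>
      moreover have "(1 - local_mass R u / m) * e0 \<le> mass v / m * e0"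
        using mv m e0 by (intro mult_right_mono_neg) (auto simp: field_simps)
      ultimately show ?thesis by linarith
    qed
    have iG: "integrable lborel (\<lambda>x. G (u x))" "integrable lborel (\<lambda>x. G (v x))" using G_integrable fe fv by auto
    have ip: "integrable lborel (\<lambda>x. \<bar>u x\<bar> powr p)" by (rule power_integrable[OF fe])
    \<comment> \<open>The potentials of u and v differ by the inner part over \<open>Q R\<close> and
      by the values on the shell between \<open>Q R\<close> and \<open>Q (2 * R)\<close>. There both
      G(u) and G(v) obey the growth bound in terms of u, because |v| \<le> |u|; hence the factor
      2.\<close>
    have Gv: "potential u - (\<integral>x. indicator (Q R) x * G (u x) \<partial>lborel) - 2 * (Ce * (local_mass (2 * R) u - local_mass R u) + ep * P) \<le> potential v"
    proof -
      have "(\<integral>x. G (u x) - indicator (Q R) x * G (u x) - (2 * Ce * (indicator (Q (2 * R)) x * (u x)\<^sup>2 - indicator (Q R) x * (u x)\<^sup>2) + 2 * ep * \<bar>u x\<bar> powr p) \<partial>lborel) \<le> potential v"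
        unfolding potential_def
      proof (rule integral_mono)
        show "integrable lborel (\<lambda>x. G (u x) - indicator (Q R) x * G (u x) - (2 * Ce * (indicator (Q (2 * R)) x * (u x)\<^sup>2 - indicator (Q R) x * (u x)\<^sup>2) + 2 * ep * \<bar>u x\<bar> powr p))"
          by (intro Bochner_Integration.integrable_diff Bochner_Integration.integrable_add integrable_mult_right integrable_Q_mult iG iu ip)
        fix x :: "real^'n"
        have pp: "0 \<le> ep * \<bar>u x\<bar> powr p" using ep by simp
        consider "x \<in> Q R" | "x \<notin> Q (2 * R)" | "x \<notin> Q R" "x \<in> Q (2 * R)" by blast
        then show "G (u x) - indicator (Q R) x * G (u x) - (2 * Ce * (indicator (Q (2 * R)) x * (u x)\<^sup>2 - indicator (Q R) x * (u x)\<^sup>2) + 2 * ep * \<bar>u x\<bar> powr p) \<le> G (v x)"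
        proof cases
          case 1
          then have "x \<in> Q (2 * R)" using sub by blast
          then show ?thesis using 1 vi pp by simp
        next
          case 2
          then have "x \<notin> Q R" using sub by blast
          then show ?thesis using 2 vo pp by simp
        next
          case 3
          have a: "\<bar>G (u x)\<bar> \<le> Ce * (u x)\<^sup>2 + ep * \<bar>u x\<bar> powr p" using Gb by blast
          have "\<bar>G (v x)\<bar> \<le> Ce * (v x)\<^sup>2 + ep * \<bar>v x\<bar> powr p" using Gb by blast
          also have "\<dots> \<le> Ce * (u x)\<^sup>2 + ep * \<bar>u x\<bar> powr p"
            using Ce ep by (intro add_mono mult_left_mono vu2 vup) auto
          finally show ?thesis using a 3 by simp
        qed
      qed (rule iG)
      moreover have "(\<integral>x. G (u x) - indicator (Q R) x * G (u x) - (2 * Ce * (indicator (Q (2 * R)) x * (u x)\<^sup>2 - indicator (Q R) x * (u x)\<^sup>2) + 2 * ep * \<bar>u x\<bar> powr p) \<partial>lborel)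
        = potential u - (\<integral>x. indicator (Q R) x * G (u x) \<partial>lborel) - (2 * Ce * (local_mass (2 * R) u - local_mass R u) + 2 * ep * P)"
        unfolding potential_def local_mass_def P_def using iG integrable_Q_mult[OF iG(1)] integrable_Q_mult[OF iu(1)] ip by simp
      ultimately show ?thesis by (simp add: algebra_simps)
    qed
    have io: "integrable lborel (\<lambda>x. indicator (Q R) x * ((1 + 2 * (u x)\<^sup>2) * (norm (Du x))\<^sup>2))" by (rule integrable_Q_mult[OF iu(2)])
    have "(\<integral>x. (1 - indicator (Q R) x) * ((1 + 2 * (u x)\<^sup>2) * (norm (Du x))\<^sup>2) \<partial>lborel) =
      (\<integral>x. (1 + 2 * (u x)\<^sup>2) * (norm (Du x))\<^sup>2 - indicator (Q R) x * ((1 + 2 * (u x)\<^sup>2) * (norm (Du x))\<^sup>2) \<partial>lborel)"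
      by (simp only: left_diff_distrib mult_1_left)
    also have "\<dots> = 2 * kinetic u Du - (\<integral>x. indicator (Q R) x * ((1 + 2 * (u x)\<^sup>2) * (norm (Du x))\<^sup>2) \<partial>lborel)"
      using io iu(2) by (simp add: kinetic_def)
    finally have k1: "1/2 * (\<integral>x. indicator (Q R) x * ((1 + 2 * (u x)\<^sup>2) * (norm (Du x))\<^sup>2) \<partial>lborel) =
      kinetic u Du - 1/2 * (\<integral>x. (1 - indicator (Q R) x) * ((1 + 2 * (u x)\<^sup>2) * (norm (Du x))\<^sup>2) \<partial>lborel)" by linarith
    have "C / R * (\<integral>x. (1 + 2 * (u x)\<^sup>2) * ((norm (Du x))\<^sup>2 + (u x)\<^sup>2) \<partial>lborel) \<le> C / R * (2 * kinetic u Du + 3 * m + 2 * P)"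
      using weight_bound[OF fe] C R by (intro mult_left_mono) (auto simp: mu P_def)
    then show "1/2 * (\<integral>x. indicator (Q R) x * ((1 + 2 * (u x)\<^sup>2) * (norm (Du x))\<^sup>2) \<partial>lborel) \<le>
      total_energy u Du - (1 - local_mass R u / m) * e0 + (\<integral>x. indicator (Q R) x * G (u x) \<partial>lborel)
      + 2 * (Ce * (local_mass (2 * R) u - local_mass R u) + ep * (\<integral>x. \<bar>u x\<bar> powr p \<partial>lborel))
      + C / R * (2 * kinetic u Du + 3 * m + 2 * (\<integral>x. \<bar>u x\<bar> powr p \<partial>lborel))"
      using k1 kv Ev Gv unfolding total_energy_def P_def[symmetric] by linarith
  qed
qed

section \<open>Energy of the local limit\<close>

text \<open>Under critical growth the local potentials are only upper semicontinuous up to the error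
  ep P: Fatou's lemma is applied to the nonnegative function Ce t^2 + ep |t|^p - G(t), whose
  quadratic part converges with the local masses. The proof is by contradiction along a subsequence
  violating the claim.\<close>

lemma local_potential_limsup:
  fixes u :: "nat \<Rightarrow> real^'n \<Rightarrow> real"
  assumes fe: "\<And>n. finite_energy (u n) (Du n)" and fg: "finite_energy v Dv"
    and ae: "AE x in lborel. (\<lambda>n. u n x) \<longlonglongrightarrow> v x"
    and lm: "(\<lambda>n. local_mass R (u n)) \<longlonglongrightarrow> local_mass R v"
    and P: "\<And>n. (\<integral>x. \<bar>u n x\<bar> powr p \<partial>lborel) \<le> P"
    and ep: "0 < ep" and Ce: "0 \<le> Ce" and Gb: "\<And>s. \<bar>G s\<bar> \<le> Ce * s\<^sup>2 + ep * \<bar>s\<bar> powr p" and r: "r > 0"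
  shows "\<forall>\<^sub>F n in sequentially. (\<integral>x. indicator (Q R) x * G (u n x) \<partial>lborel) \<le> (\<integral>x. indicator (Q R) x * G (v x) \<partial>lborel) + ep * P + r"
proof (rule ccontr)
  assume asm: "\<not> ?thesis"
  obtain s :: "nat \<Rightarrow> nat" where s: "strict_mono s"
    and sn: "\<forall>n. \<not> (\<integral>x. indicator (Q R) x * G (u (s n) x) \<partial>lborel) \<le> (\<integral>x. indicator (Q R) x * G (v x) \<partial>lborel) + ep * P + r"
    using not_eventually_sequentiallyD[OF asm] by (elim exE conjE)
  have big: "(\<integral>x. indicator (Q R) x * G (v x) \<partial>lborel) + ep * P + r < (\<integral>x. indicator (Q R) x * G (u (s n) x) \<partial>lborel)" for n
    using sn by (simp only: not_le)
  define h where "h t = Ce * t\<^sup>2 + ep * \<bar>t\<bar> powr p - G t" for t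
  have h0: "h t \<ge> 0" for t using Gb[of t] by (simp add: h_def abs_le_iff)
  have hc: "isCont h t" for t
  proof -
    have "isCont G t" using G_deriv DERIV_isCont by blast
    then show ?thesis unfolding h_def using p4 by (intro continuous_intros) auto
  qed
  have [measurable]: "h \<in> borel_measurable borel" unfolding h_def by measurable
  have hi: "integrable lborel (\<lambda>x. indicator (Q R) x * h (w x))"
    and he: "(\<integral>x. indicator (Q R) x * h (w x) \<partial>lborel) = Ce * local_mass R w + ep * (\<integral>x. indicator (Q R) x * \<bar>w x\<bar> powr p \<partial>lborel) - (\<integral>x. indicator (Q R) x * G (w x) \<partial>lborel)"
    if fw: "finite_energy w Dw" for w :: "real^'n \<Rightarrow> real" and Dw
  proof -
    have i: "integrable lborel (\<lambda>x. indicator (Q R) x * (w x)\<^sup>2)" "integrable lborel (\<lambda>x. indicator (Q R) x * \<bar>w x\<bar> powr p)"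
      "integrable lborel (\<lambda>x. indicator (Q R) x * G (w x))"
      by (intro integrable_Q_mult finite_energyD(4)[OF fw] power_integrable[OF fw] G_integrable[OF fw])+
    have e: "indicator (Q R) x * h (w x) = Ce * (indicator (Q R) x * (w x)\<^sup>2) + ep * (indicator (Q R) x * \<bar>w x\<bar> powr p) - indicator (Q R) x * G (w x)" for x
      by (simp add: h_def algebra_simps)
    show "integrable lborel (\<lambda>x. indicator (Q R) x * h (w x))" unfolding e using i by simp
    show "(\<integral>x. indicator (Q R) x * h (w x) \<partial>lborel) = Ce * local_mass R w + ep * (\<integral>x. indicator (Q R) x * \<bar>w x\<bar> powr p \<partial>lborel) - (\<integral>x. indicator (Q R) x * G (w x) \<partial>lborel)"
      unfolding e local_mass_def using i by simp
  qed
  \<comment> \<open>Along the bad subsequence the integrals of h are eventually at most B, the ep P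
    of the assumption absorbing the critical term. Dropping the critical term for v shows that the
    integral of h(v) exceeds B by at least r / 2, against Fatou's lemma.\<close>
  define B where "B = Ce * local_mass R v + r / 2 - (\<integral>x. indicator (Q R) x * G (v x) \<partial>lborel) - r"
  have "(\<lambda>n. Ce * local_mass R (u (s n))) \<longlonglongrightarrow> Ce * local_mass R v"
    by (intro tendsto_intros LIMSEQ_subseq_LIMSEQ[OF lm s, unfolded o_def])
  then have ev: "\<forall>\<^sub>F n in sequentially. Ce * local_mass R (u (s n)) < Ce * local_mass R v + r / 2"
    using r by (intro order_tendstoD(2)) auto
  have evB: "\<forall>\<^sub>F k in sequentially. (\<integral>x. indicator (Q R) x * h (u (s k) x) \<partial>lborel) \<le> B"
    using ev
  proof eventually_elim
    case (elim k)
    have "(\<integral>x. indicator (Q R) x * \<bar>u (s k) x\<bar> powr p \<partial>lborel) \<le> (\<integral>x. \<bar>u (s k) x\<bar> powr p \<partial>lborel)"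
      by (rule integral_mono) (use integrable_Q_mult[OF power_integrable[OF fe]] power_integrable[OF fe] in \<open>auto simp: indicator_def\<close>)
    also note P
    finally have "ep * (\<integral>x. indicator (Q R) x * \<bar>u (s k) x\<bar> powr p \<partial>lborel) \<le> ep * P" using ep by simp
    then show ?case
      unfolding he[OF fe] B_def using elim big[of k] by linarith
  qed
  have hn: "(\<integral>x. indicator (Q R) x * h (w x) \<partial>lborel) \<ge> 0" for w :: "real^'n \<Rightarrow> real"
    by (auto intro!: integral_nonneg_AE simp: h0)
  obtain k0 where "(\<integral>x. indicator (Q R) x * h (u (s k0) x) \<partial>lborel) \<le> B"
    using eventually_happens'[OF sequentially_bot evB] by blast
  then have B0: "0 \<le> B" using order_trans[OF hn] by blast
  have "(\<integral>\<^sup>+x. ennreal (indicator (Q R) x * h (v x)) \<partial>lborel) \<le> ennreal B"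
  proof (rule nn_fatou_le[where f="\<lambda>n x. indicator (Q R) x * h (u (s n) x)"])
    show "(\<lambda>x. indicator (Q R) x * h (u (s k) x)) \<in> borel_measurable lborel" for k
      using finite_energyD(1)[OF fe[of "s k"]] by measurable
    show "AE x in lborel. (\<lambda>k. indicator (Q R) x * h (u (s k) x)) \<longlonglongrightarrow> indicator (Q R) x * h (v x)"
      using ae
    proof eventually_elim
      case (elim x)
      have "(\<lambda>k. u (s k) x) \<longlonglongrightarrow> v x" using LIMSEQ_subseq_LIMSEQ[OF elim s] by (simp add: o_def)
      then show ?case by (intro tendsto_intros isCont_tendsto_compose[OF hc])
    qed
    show "\<forall>\<^sub>F k in sequentially. (\<integral>\<^sup>+x. ennreal (indicator (Q R) x * h (u (s k) x)) \<partial>lborel) \<le> ennreal B"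
      using evB
    proof eventually_elim
      case (elim k)
      have "(\<integral>\<^sup>+x. ennreal (indicator (Q R) x * h (u (s k) x)) \<partial>lborel) = ennreal (\<integral>x. indicator (Q R) x * h (u (s k) x) \<partial>lborel)"
        by (rule nn_integral_eq_integral[OF hi[OF fe]]) (simp add: h0)
      then show ?case using elim by (simp add: ennreal_leI)
    qed
  qed
  moreover have "(\<integral>\<^sup>+x. ennreal (indicator (Q R) x * h (v x)) \<partial>lborel) = ennreal (\<integral>x. indicator (Q R) x * h (v x) \<partial>lborel)"
    by (rule nn_integral_eq_integral[OF hi[OF fg]]) (simp add: h0)
  moreover have "(\<integral>x. indicator (Q R) x * h (v x) \<partial>lborel) > B"
  proof -
    have "0 \<le> (\<integral>x. indicator (Q R) x * \<bar>v x\<bar> powr p \<partial>lborel)" by (auto intro!: integral_nonneg_AE)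
    then have "0 \<le> ep * (\<integral>x. indicator (Q R) x * \<bar>v x\<bar> powr p \<partial>lborel)" using ep by simp
    then show ?thesis unfolding he[OF fg] B_def using r by linarith
  qed
  ultimately show False using B0 by (simp add: ennreal_le_iff)
qed

lemma local_integral_tendsto:
  fixes f :: "real^'n \<Rightarrow> real"
  assumes f: "integrable lborel f" and c: "c \<ge> 1"
  shows "(\<lambda>n. \<integral>x. indicator (Q (c * real n)) x * f x \<partial>lborel) \<longlonglongrightarrow> (\<integral>x. f x \<partial>lborel)"
proof (rule integral_dominated_convergence[where w="\<lambda>x. norm (f x)"])
  show "AE x in lborel. (\<lambda>n. indicator (Q (c * real n)) x * f x) \<longlonglongrightarrow> f x"
  proof (rule AE_I2)
    fix x :: "real^'n"
    obtain n0 where n0: "x \<in> Q (real n0)" using UN_Q by blast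
    have "x \<in> Q (c * real n)" if "n \<ge> n0" for n
    proof -
      have "real n0 \<le> 1 * real n" using that by simp
      also have "\<dots> \<le> c * real n" using c by (intro mult_right_mono) auto
      finally show ?thesis using n0 unfolding Q_def by (auto intro: order_trans)
    qed
    then have "\<forall>\<^sub>F n in sequentially. indicator (Q (c * real n)) x * f x = f x"
      unfolding eventually_sequentially by (intro exI[of _ n0]) simp
    then show "(\<lambda>n. indicator (Q (c * real n)) x * f x) \<longlonglongrightarrow> f x" by (rule tendsto_eventually)
  qed
qed (use f in \<open>auto simp: indicator_def\<close>)

lemma potential_translate:
  assumes fe: "finite_energy (u :: real^'n \<Rightarrow> real) Du"
  shows "potential (\<lambda>x. u (x + d)) = potential u"
  unfolding potential_def using finite_energyD(1)[OF fe] by (intro integral_lborel_shift) measurable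

text \<open>The order of the limits matters. At fixed R and ep, n tends to infinity in
  \<open>inner_energy_bound\<close>, by lower semicontinuity of the inner kinetic energy and
  convergence of the local masses. Then R tends to infinity, which removes the mass in the shell,
  where the large constant Ce sits, and the cut-off error T / R. Only then does ep tend to
  0.\<close>

lemma limit_energy_bound:
  fixes u :: "nat \<Rightarrow> real^'n \<Rightarrow> real"
  assumes fe: "\<And>n. finite_energy (u n) (Du n)" and mu: "\<And>n. mass (u n) = m" and m: "0 < m"
    and lb: "\<And>(v :: real^'n \<Rightarrow> real) Dv. finite_energy v Dv \<Longrightarrow> mass v = m \<Longrightarrow> e0 \<le> total_energy v Dv" and e0: "e0 < 0"
    and E: "(\<lambda>n. total_energy (u n) (Du n)) \<longlonglongrightarrow> e0"
    and K: "\<And>n. kinetic (u n) (Du n) \<le> K" and P: "\<And>n. (\<integral>x. \<bar>u n x\<bar> powr p \<partial>lborel) \<le> P"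
    and fg: "finite_energy v Dv" and ae: "AE x in lborel. (\<lambda>n. u n x) \<longlonglongrightarrow> v x"
    and conv: "\<And>R e. e > 0 \<Longrightarrow> \<exists>n0. \<forall>n\<ge>n0. (\<integral>\<^sup>+x. indicator (Q R) x * ennreal ((u n x - v x)\<^sup>2) \<partial>lborel) \<le> ennreal e"
    and lsc: "\<And>R B k. (\<And>n. n \<ge> k \<Longrightarrow> (\<integral>\<^sup>+x. ennreal (indicator (Q R) x * ((1 + 2 * (u n x)\<^sup>2) * (norm (Du n x))\<^sup>2)) \<partial>lborel) \<le> ennreal B) \<Longrightarrow>
       (\<integral>\<^sup>+x. ennreal (indicator (Q R) x * ((1 + 2 * (v x)\<^sup>2) * (norm (Dv x))\<^sup>2)) \<partial>lborel) \<le> ennreal B"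
  shows "total_energy v Dv \<le> e0 / m * mass v"
proof -
  have P0: "0 \<le> P" using order_trans[OF integral_nonneg_AE P[of 0]] by simp
  have K0: "0 \<le> K" using order_trans[OF kinetic_nonneg K[of 0]] .
  obtain C where C: "C \<ge> 0" and raw: "\<forall>R m e0 ep Ce. \<forall>(u :: real^'n \<Rightarrow> real) Du. 1 \<le> R \<and> 0 < m \<and> e0 < 0 \<and> finite_energy u Du \<and> mass u = m \<and>
    (\<forall>(v :: real^'n \<Rightarrow> real) Dv. finite_energy v Dv \<and> mass v = m \<longrightarrow> e0 \<le> total_energy v Dv) \<and>
    0 < ep \<and> 0 \<le> Ce \<and> (\<forall>s. \<bar>G s\<bar> \<le> Ce * s\<^sup>2 + ep * \<bar>s\<bar> powr p) \<longrightarrow>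
    1/2 * (\<integral>x. indicator (Q R) x * ((1 + 2 * (u x)\<^sup>2) * (norm (Du x))\<^sup>2) \<partial>lborel) \<le>
      total_energy u Du - (1 - local_mass R u / m) * e0 + (\<integral>x. indicator (Q R) x * G (u x) \<partial>lborel)
      + 2 * (Ce * (local_mass (2 * R) u - local_mass R u) + ep * (\<integral>x. \<bar>u x\<bar> powr p \<partial>lborel))
      + C / R * (2 * kinetic u Du + 3 * m + 2 * (\<integral>x. \<bar>u x\<bar> powr p \<partial>lborel))"
    using inner_energy_bound by blast
  note inner = raw[rule_format, of _ m, OF conjI[OF _ conjI[OF m conjI[OF _ conjI[OF _ conjI[OF _ conjI[OF _ conjI[OF _ conjI]]]]]]]]
  define T where "T = C * (2 * K + 3 * m + 2 * P)"
  note ug = finite_energyD(1)[OF fe] finite_energyD(1)[OF fg] finite_energyD(4)[OF fe] finite_energyD(4)[OF fg]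
  have lm: "(\<lambda>n. local_mass R (u n)) \<longlonglongrightarrow> local_mass R v" for R
    by (rule local_mass_tendsto[OF ug conv])
  let ?k = "\<lambda>x. (1 + 2 * (v x)\<^sup>2) * (norm (Dv x))\<^sup>2"
  have ik: "integrable lborel ?k" by (rule finite_energyD(7)[OF fg])
  have fin: "kinetic v Dv \<le> potential v + e0 / m * mass v + 3 * (ep * P)"
    if ep: "ep > 0" for ep
  proof -
    obtain Ce where Ce: "Ce \<ge> 0" "\<And>s. \<bar>G s\<bar> \<le> Ce * s\<^sup>2 + ep * \<bar>s\<bar> powr p" using G_bound[OF ep] by blast
    \<comment> \<open>Of the three terms ep P, two come from the shell estimate of
      \<open>inner_energy_bound\<close> and one from \<open>local_potential_limsup\<close>. The
      energy limit contributes e0 - (1 - M/m) e0 = (M/m) e0 with M the local mass of v.\<close>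
    have loc: "1/2 * (\<integral>x. indicator (Q R) x * ?k x \<partial>lborel) \<le> e0 / m * local_mass R v + (\<integral>x. indicator (Q R) x * G (v x) \<partial>lborel)
       + 2 * (Ce * (local_mass (2 * R) v - local_mass R v)) + 3 * (ep * P) + T / R" if R: "R \<ge> 1" for R
    proof (rule field_le_epsilon)
      fix r :: real assume r: "r > 0"
      define X where "X n = total_energy (u n) (Du n) - (1 - local_mass R (u n) / m) * e0 + 2 * (Ce * (local_mass (2 * R) (u n) - local_mass R (u n)))" for n
      have "X \<longlonglongrightarrow> e0 - (1 - local_mass R v / m) * e0 + 2 * (Ce * (local_mass (2 * R) v - local_mass R v))"
        unfolding X_def using m by (intro tendsto_intros E lm) auto
      then have ev1: "\<forall>\<^sub>F n in sequentially. X n < e0 - (1 - local_mass R v / m) * e0 + 2 * (Ce * (local_mass (2 * R) v - local_mass R v)) + r / 2"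
        using r by (intro order_tendstoD(2)) auto
      have r2: "r / 2 > 0" using r by simp
      define D where "D = 2 * (e0 / m * local_mass R v + (\<integral>x. indicator (Q R) x * G (v x) \<partial>lborel)
       + 2 * (Ce * (local_mass (2 * R) v - local_mass R v)) + 3 * (ep * P) + T / R + r)"
      have ev: "\<forall>\<^sub>F n in sequentially. (\<integral>x. indicator (Q R) x * ((1 + 2 * (u n x)\<^sup>2) * (norm (Du n x))\<^sup>2) \<partial>lborel) \<le> D"
        using ev1 local_potential_limsup[OF fe fg ae lm P ep Ce r2, of R]
      proof eventually_elim
        case (elim n)
        have i: "1/2 * (\<integral>x. indicator (Q R) x * ((1 + 2 * (u n x)\<^sup>2) * (norm (Du n x))\<^sup>2) \<partial>lborel) \<le>
          total_energy (u n) (Du n) - (1 - local_mass R (u n) / m) * e0 + (\<integral>x. indicator (Q R) x * G (u n x) \<partial>lborel)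
          + 2 * (Ce * (local_mass (2 * R) (u n) - local_mass R (u n)) + ep * (\<integral>x. \<bar>u n x\<bar> powr p \<partial>lborel))
          + C / R * (2 * kinetic (u n) (Du n) + 3 * m + 2 * (\<integral>x. \<bar>u n x\<bar> powr p \<partial>lborel))"
          by (rule inner[OF R e0 fe mu _ ep Ce(1)]) (use lb Ce(2) in auto)
        have a: "ep * (\<integral>x. \<bar>u n x\<bar> powr p \<partial>lborel) \<le> ep * P" using P ep by simp
        have b: "C / R * (2 * kinetic (u n) (Du n) + 3 * m + 2 * (\<integral>x. \<bar>u n x\<bar> powr p \<partial>lborel)) \<le> T / R"
        proof -
          have "C / R * (2 * kinetic (u n) (Du n) + 3 * m + 2 * (\<integral>x. \<bar>u n x\<bar> powr p \<partial>lborel)) \<le> C / R * (2 * K + 3 * m + 2 * P)"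
            using K[of n] P[of n] C R by (intro mult_left_mono) auto
          then show ?thesis by (simp add: T_def)
        qed
        have c: "e0 - (1 - local_mass R v / m) * e0 = e0 / m * local_mass R v" by (simp add: algebra_simps)
        show ?case using i a b elim c unfolding D_def X_def distrib_left by linarith
      qed
      then obtain n0 where n0: "\<And>n. n \<ge> n0 \<Longrightarrow> (\<integral>x. indicator (Q R) x * ((1 + 2 * (u n x)\<^sup>2) * (norm (Du n x))\<^sup>2) \<partial>lborel) \<le> D"
        unfolding eventually_sequentially by blast
      have D0: "0 \<le> D" by (rule order_trans[OF _ n0[OF order_refl]]) (auto intro!: integral_nonneg_AE)
      have "(\<integral>\<^sup>+x. ennreal (indicator (Q R) x * ?k x) \<partial>lborel) \<le> ennreal D"
      proof (rule lsc)
        fix n assume "n \<ge> n0"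
        have "(\<integral>\<^sup>+x. ennreal (indicator (Q R) x * ((1 + 2 * (u n x)\<^sup>2) * (norm (Du n x))\<^sup>2)) \<partial>lborel) =
          ennreal (\<integral>x. indicator (Q R) x * ((1 + 2 * (u n x)\<^sup>2) * (norm (Du n x))\<^sup>2) \<partial>lborel)"
          by (rule nn_integral_eq_integral[OF integrable_Q_mult[OF finite_energyD(7)[OF fe]]]) auto
        then show "(\<integral>\<^sup>+x. ennreal (indicator (Q R) x * ((1 + 2 * (u n x)\<^sup>2) * (norm (Du n x))\<^sup>2)) \<partial>lborel) \<le> ennreal D"
          using n0[OF \<open>n \<ge> n0\<close>] by (simp add: ennreal_leI)
      qed
      moreover have "(\<integral>\<^sup>+x. ennreal (indicator (Q R) x * ?k x) \<partial>lborel) = ennreal (\<integral>x. indicator (Q R) x * ?k x \<partial>lborel)"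
        by (rule nn_integral_eq_integral[OF integrable_Q_mult[OF ik]]) auto
      ultimately have kD: "(\<integral>x. indicator (Q R) x * ?k x \<partial>lborel) \<le> D" using D0 by (simp add: ennreal_le_iff)
      have half: "1/2 * a \<le> b" if "a \<le> 2 * b" for a b :: real using that by simp
      show "1/2 * (\<integral>x. indicator (Q R) x * ?k x \<partial>lborel) \<le> e0 / m * local_mass R v + (\<integral>x. indicator (Q R) x * G (v x) \<partial>lborel)
       + 2 * (Ce * (local_mass (2 * R) v - local_mass R v)) + 3 * (ep * P) + T / R + r" by (rule half[OF kD[unfolded D_def]])
    qed
    have c1: "(\<lambda>n. local_mass (1 * real n) v) \<longlonglongrightarrow> mass v" "(\<lambda>n. local_mass (2 * real n) v) \<longlonglongrightarrow> mass v"
      unfolding local_mass_def mass_def by (rule local_integral_tendsto[OF finite_energyD(4)[OF fg]]; simp)+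
    have c2: "(\<lambda>n. \<integral>x. indicator (Q (1 * real n)) x * G (v x) \<partial>lborel) \<longlonglongrightarrow> potential v"
      unfolding potential_def by (rule local_integral_tendsto[OF G_integrable[OF fg]]) simp
    have c3: "(\<lambda>n. \<integral>x. indicator (Q (1 * real n)) x * ?k x \<partial>lborel) \<longlonglongrightarrow> (\<integral>x. ?k x \<partial>lborel)"
      by (rule local_integral_tendsto[OF ik]) simp
    have c4: "(\<lambda>n. T / real n) \<longlonglongrightarrow> 0" by (rule lim_const_over_n)
    have "1/2 * (\<integral>x. ?k x \<partial>lborel) \<le> e0 / m * mass v + potential v + 2 * (Ce * (mass v - mass v)) + 3 * (ep * P) + 0"
    proof (rule tendsto_le[OF sequentially_bot])
      show "(\<lambda>n. 1/2 * (\<integral>x. indicator (Q (1 * real n)) x * ?k x \<partial>lborel)) \<longlonglongrightarrow> 1/2 * (\<integral>x. ?k x \<partial>lborel)"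
        by (intro tendsto_mult tendsto_const c3)
      show "(\<lambda>n. e0 / m * local_mass (1 * real n) v + (\<integral>x. indicator (Q (1 * real n)) x * G (v x) \<partial>lborel)
       + 2 * (Ce * (local_mass (2 * real n) v - local_mass (1 * real n) v)) + 3 * (ep * P) + T / real n) \<longlonglongrightarrow>
        e0 / m * mass v + potential v + 2 * (Ce * (mass v - mass v)) + 3 * (ep * P) + 0"
        by (intro tendsto_add tendsto_mult tendsto_diff tendsto_const c1 c2 c4)
      show "\<forall>\<^sub>F n in sequentially. 1/2 * (\<integral>x. indicator (Q (1 * real n)) x * ?k x \<partial>lborel) \<le> e0 / m * local_mass (1 * real n) v + (\<integral>x. indicator (Q (1 * real n)) x * G (v x) \<partial>lborel)
       + 2 * (Ce * (local_mass (2 * real n) v - local_mass (1 * real n) v)) + 3 * (ep * P) + T / real n"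
        unfolding eventually_sequentially mult_1_left by (intro exI[of _ 1] allI impI loc) simp
    qed
    then show ?thesis by (simp add: kinetic_def)
  qed
  have "kinetic v Dv \<le> potential v + e0 / m * mass v"
  proof (rule field_le_epsilon)
    fix r :: real assume r: "r > 0"
    define ep where "ep = r / (3 * (P + 1))"
    have ep: "ep > 0" using r P0 by (simp add: ep_def)
    have "3 * (ep * P) \<le> 3 * (ep * (P + 1))" using ep by simp
    also have "\<dots> = r"
    proof -
      have "3 * (r / (3 * k) * k) = r" if "k > 0" for k using that by simp
      from this[of "P + 1"] show ?thesis unfolding ep_def using P0 by simp
    qed
    finally show "kinetic v Dv \<le> potential v + e0 / m * mass v + r" using fin[OF ep] by linarith
  qed
  then show ?thesis by (simp add: total_energy_def)
qed

section \<open>Attainment of the infimum\<close>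

text \<open>If mass v < m, the dilation to mass m has factor t > 1. Comparing the dilate with e0
  gives kinetic \<le> kinetic / t^2, so the kinetic energy is 0. Then v has difference bound 0 and
  vanishes almost everywhere, against its positive mass.\<close>

lemma attained_of_energy_bound:
  assumes m: "0 < m" and e0: "e0 < 0"
    and lb: "\<And>(v :: real^'n \<Rightarrow> real) Dv. finite_energy v Dv \<Longrightarrow> mass v = m \<Longrightarrow> e0 \<le> total_energy v Dv"
    and fe: "finite_energy (v :: real^'n \<Rightarrow> real) Dv" and mv: "0 < mass v" "mass v \<le> m"
    and E: "total_energy v Dv \<le> e0 / m * mass v"
  shows "mass v = m"
proof (rule ccontr)
  assume "mass v \<noteq> m"
  then have lt: "mass v < m" using mv by simp
  define t where "t = root CARD('n) (m / mass v)"
  note * = energy_lower_dilate[OF m lb fe mv(1), folded t_def]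
  have t1: "1 < t" unfolding t_def using lt mv by simp
  have mp: "m / mass v > 0" using m mv by simp
  have "m / mass v * (total_energy v Dv) \<le> m / mass v * (e0 / m * mass v)"
    using E mp by (intro mult_left_mono) auto
  also have "\<dots> = e0" using m mv by simp
  also have "\<dots> \<le> m / mass v * (kinetic v Dv / t\<^sup>2 - potential v)" by (rule *(2))
  finally have "total_energy v Dv \<le> kinetic v Dv / t\<^sup>2 - potential v" using mp by (simp only: mult_le_cancel_left_pos)
  then have k: "kinetic v Dv \<le> kinetic v Dv / t\<^sup>2" by (simp add: total_energy_def)
  have "kinetic v Dv = 0"
  proof (rule ccontr)
    assume "kinetic v Dv \<noteq> 0"
    then have "kinetic v Dv > 0" using kinetic_nonneg[of v Dv] by simp
    moreover have "t\<^sup>2 > 1" using t1 by (simp add: one_less_power)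
    ultimately have "kinetic v Dv / t\<^sup>2 < kinetic v Dv" by (simp add: divide_less_eq)
    then show False using k by simp
  qed
  then have "(\<integral>x. (norm (Dv x))\<^sup>2 \<partial>lborel) \<le> 0" using kinetic_bounds(1)[OF fe] by simp
  then have "diff_bound 0 v"
    using diff_bound_mono[OF diff_bound_weak_grad[OF finite_energyD(3,1,2,4,5)[OF fe]]] by blast
  then have "AE x in lborel. v x = 0" using diff_bound_zero_AE[OF finite_energyD(1)[OF fe] _ finite_energyD(4)[OF fe]] by blast
  then have "mass v = (\<integral>x. 0 \<partial>(lborel :: (real^'n) measure))"
    unfolding mass_def using finite_energyD(1)[OF fe] by (intro integral_cong_AE) auto
  then show False using mv by simp
qed

text \<open>A potential of at least -e0 cannot come from the small terms of \<open>G_upper\<close>,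
  so the level set above l has measure at least \<delta>. For r small enough, depending only on the
  given bounds, \<open>nonvanishing_cube\<close> finds a cube of size r with a fixed amount of
  mass.\<close>

lemma nonvanishing:
  assumes m: "0 < m" and e0: "e0 < 0" and K0: "0 \<le> K" and P0: "0 \<le> P"
  shows "\<exists>r c. 0 < r \<and> 0 < c \<and> (\<forall>(u :: real^'n \<Rightarrow> real) Du. finite_energy u Du \<and> mass u = m \<and> total_energy u Du \<le> e0 \<and>
    kinetic u Du \<le> K \<and> (\<integral>x. \<bar>u x\<bar> powr p \<partial>lborel) \<le> P \<longrightarrow>
    (\<exists>x. ennreal c < (\<integral>\<^sup>+h. indicator (Q r) h * ennreal ((u (x + h))\<^sup>2) \<partial>lborel)))"
proof -
  \<comment> \<open>Chosen so that ep (m + P) = - e0 / 2: the small terms of \<open>G_upper\<close>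
    account for at most half of the required potential.\<close>
  define ep where "ep = - e0 / (2 * (m + P))"
  have mP: "m + P > 0" using m P0 by simp
  have ep: "ep > 0" using e0 mP by (simp add: ep_def divide_neg_pos)
  have epmP: "ep * (m + P) = - e0 / 2" unfolding ep_def using mP by (simp add: field_simps)
  obtain l C where l: "l > 0" and C: "C \<ge> 0" and Gu: "\<And>s. G s \<le> ep * s\<^sup>2 + ep * \<bar>s\<bar> powr p + C * indicator {s. l < \<bar>s\<bar>} s"
    using G_upper[OF ep] by blast
  define \<delta> where "\<delta> = - e0 / (2 * (C + 1))"
  have del: "\<delta> > 0" using e0 C by (simp add: \<delta>_def divide_neg_pos)
  \<comment> \<open>Solves the strict inequality demanded by \<open>nonvanishing_cube\<close> with
    Dirichlet bound 2 K; the summand 1 in 2 K + 1 keeps the denominator positive when K = 0.\<close>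
  define r where "r = sqrt (l\<^sup>2 / 4 * \<delta> / (2 * CARD('n) * (2 * K + 1)))"
  have rpos: "l\<^sup>2 / 4 * \<delta> / (2 * CARD('n) * (2 * K + 1)) > 0" using l del K0 by simp
  have r: "r > 0" unfolding r_def using rpos by (simp only: real_sqrt_gt_zero)
  have r2: "CARD('n) * r\<^sup>2 * (2 * K) < l\<^sup>2 / 4 * \<delta>"
  proof -
    have req: "r\<^sup>2 = l\<^sup>2 / 4 * \<delta> / (2 * CARD('n) * (2 * K + 1))" unfolding r_def using rpos by (intro real_sqrt_pow2) simp
    have kp: "2 * CARD('n) * (2 * K + 1) \<noteq> 0" using K0 by simp
    have "r\<^sup>2 * (2 * CARD('n) * (2 * K + 1)) = l\<^sup>2 / 4 * \<delta>" using req nonzero_eq_divide_eq[OF kp] by blast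
    moreover have "CARD('n) * r\<^sup>2 * (2 * K) < r\<^sup>2 * (2 * CARD('n) * (2 * K + 1))"
    proof -
      have "r\<^sup>2 * (2 * CARD('n) * (2 * K + 1)) = CARD('n) * r\<^sup>2 * (2 * K) + CARD('n) * r\<^sup>2 * (2 * K + 2)" by (simp add: algebra_simps)
      moreover have "0 < CARD('n) * r\<^sup>2 * (2 * K + 2)" using r K0 by simp
      ultimately show ?thesis by linarith
    qed
    ultimately show ?thesis by (rule ord_less_eq_trans[rotated])
  qed
  show ?thesis
  proof (rule exI[of _ r], rule exI[of _ "(2 * r) ^ CARD('n) * (l\<^sup>2 / 4)"], intro conjI allI impI)
    fix u :: "real^'n \<Rightarrow> real" and Du
    assume "finite_energy u Du \<and> mass u = m \<and> total_energy u Du \<le> e0 \<and>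
      kinetic u Du \<le> K \<and> (\<integral>x. \<bar>u x\<bar> powr p \<partial>lborel) \<le> P"
    then have fe: "finite_energy u Du" and mu: "mass u = m" and E: "total_energy u Du \<le> e0"
      and kK: "kinetic u Du \<le> K" and pP: "(\<integral>x. \<bar>u x\<bar> powr p \<partial>lborel) \<le> P" by - (elim conjE, assumption)+
    note [measurable] = finite_energyD(1,2)[OF fe]
    let ?A = "{x. l < \<bar>u x\<bar>}"
    have iA: "integrable lborel (indicator ?A :: _ \<Rightarrow> real)"
    proof (rule Bochner_Integration.integrable_bound)
      show "integrable lborel (\<lambda>x. (1 / l\<^sup>2) * (u x)\<^sup>2)" using finite_energyD(4)[OF fe] by simp
      show "AE x in lborel. norm (indicator ?A x :: real) \<le> norm ((1 / l\<^sup>2) * (u x)\<^sup>2)"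
      proof (rule AE_I2)
        fix x
        have "l\<^sup>2 \<le> (u x)\<^sup>2" if "l < \<bar>u x\<bar>" using that l by (simp add: abs_le_square_iff[symmetric])
        then show "norm (indicator ?A x :: real) \<le> norm ((1 / l\<^sup>2) * (u x)\<^sup>2)" using l by (auto simp: indicator_def field_simps)
      qed
    qed measurable
    have i: "integrable lborel (\<lambda>x. (u x)\<^sup>2)" "integrable lborel (\<lambda>x. \<bar>u x\<bar> powr p)"
      using finite_energyD(4)[OF fe] power_integrable[OF fe] by auto
    have iA': "integrable lborel (\<lambda>x. C * indicator {s. l < \<bar>s\<bar>} (u x) :: real)"
      using integrable_mult_right[OF iA, of C] by (simp add: indicator_def)
    have "potential u \<le> (\<integral>x. ep * (u x)\<^sup>2 + ep * \<bar>u x\<bar> powr p + C * indicator {s. l < \<bar>s\<bar>} (u x) \<partial>lborel)"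
      unfolding potential_def by (rule integral_mono[OF G_integrable[OF fe] _ Gu]) (use i iA' in simp)
    also have "\<dots> = ep * mass u + ep * (\<integral>x. \<bar>u x\<bar> powr p \<partial>lborel) + (\<integral>x. C * indicator {s. l < \<bar>s\<bar>} (u x) \<partial>lborel)"
      using i iA' by (simp add: mass_def)
    also have "(\<integral>x. C * indicator {s. l < \<bar>s\<bar>} (u x) \<partial>lborel) = C * (\<integral>x. indicator ?A x \<partial>lborel)"
      by (simp add: indicator_def)
    also have "(\<integral>x. indicator ?A x \<partial>lborel) = measure lborel ?A" by simp
    finally have pot: "potential u \<le> ep * m + ep * P + C * measure lborel ?A"
      using mult_left_mono[OF pP less_imp_le[OF ep]] mu by simp
    have "- e0 \<le> potential u" using E kinetic_nonneg[of u Du] by (simp add: total_energy_def)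
    then have CA: "- e0 / 2 \<le> C * measure lborel ?A" using pot epmP by (simp add: distrib_left)
    have "C * measure lborel ?A \<le> (C + 1) * measure lborel ?A" by (intro mult_right_mono) auto
    then have "- e0 / 2 \<le> (C + 1) * measure lborel ?A" using CA by linarith
    then have dm: "\<delta> \<le> measure lborel ?A" unfolding \<delta>_def using C by (simp add: divide_le_eq field_simps)
    have emA: "emeasure lborel ?A = ennreal (measure lborel ?A)"
      using iA by (intro emeasure_eq_ennreal_measure) (auto simp: integrable_indicator_iff)
    have "ennreal (CARD('n) * r\<^sup>2 * (2 * K)) < ennreal (l\<^sup>2 / 4 * \<delta>)" using r2 l del by (intro ennreal_lessI) auto
    also have "\<dots> \<le> ennreal (l\<^sup>2 / 4) * emeasure lborel ?A"
      unfolding emA using dm del by (subst ennreal_mult) (auto intro!: mult_left_mono ennreal_leI)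
    finally have lev: "ennreal (CARD('n) * r\<^sup>2 * (2 * K)) < ennreal (l\<^sup>2 / 4) * emeasure lborel ?A" .
    have d: "diff_bound (2 * K) u"
      using order_trans[OF kinetic_bounds(1)[OF fe], of "2 * K"] kK
      by (intro diff_bound_mono[OF diff_bound_weak_grad[OF finite_energyD(3,1,2,4,5)[OF fe]]]) auto
    have K2: "0 \<le> 2 * K" using K0 by simp
    show "\<exists>x. ennreal ((2 * r) ^ CARD('n) * (l\<^sup>2 / 4)) < (\<integral>\<^sup>+h. indicator (Q r) h * ennreal ((u (x + h))\<^sup>2) \<partial>lborel)"
      using nonvanishing_cube[OF finite_energyD(1)[OF fe] d K2 r l lev] by blast
  qed (use r l in auto)
qed

theorem minimiser_exists:
  assumes m: "0 < m" and neg: "\<exists>(u :: real^'n \<Rightarrow> real) Du. finite_energy u Du \<and> mass u = m \<and> total_energy u Du < 0"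
  shows "\<exists>(u :: real^'n \<Rightarrow> real) Du. finite_energy u Du \<and> mass u = m \<and>
    (\<forall>(v :: real^'n \<Rightarrow> real) Dv. finite_energy v Dv \<and> mass v = m \<longrightarrow> total_energy u Du \<le> total_energy v Dv)"
proof -
  define S where "S = {total_energy u Du | (u :: real^'n \<Rightarrow> real) Du. finite_energy u Du \<and> mass u = m}"
  obtain C where C: "C \<ge> 0" and coer: "\<And>(u :: real^'n \<Rightarrow> real) Du. finite_energy u Du \<Longrightarrow> mass u \<le> m \<Longrightarrow> kinetic u Du / 2 - C \<le> total_energy u Du"
    using coercive[OF m] by blast
  obtain c where c: "c \<ge> 0" and pow: "\<And>(u :: real^'n \<Rightarrow> real) Du. finite_energy u Du \<Longrightarrow> mass u \<le> m \<Longrightarrow>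
    (\<integral>x. \<bar>u x\<bar> powr p \<partial>lborel) \<le> c * (\<integral>x. (u x)\<^sup>2 * (norm (Du x))\<^sup>2 \<partial>lborel)"
    using power_bound[OF m] by blast
  have low: "- C \<le> s" if sS: "s \<in> S" for s
  proof -
    obtain u :: "real^'n \<Rightarrow> real" and Du where u: "s = total_energy u Du" "finite_energy u Du" "mass u = m" using sS unfolding S_def by blast
    show ?thesis using coer[OF u(2)] u kinetic_nonneg[of u Du] by simp
  qed
  then have bdd: "bdd_below S" by (rule bdd_belowI)
  have ne: "S \<noteq> {}" using neg unfolding S_def by blast
  define e0 where "e0 = Inf S"
  have lb: "e0 \<le> total_energy v Dv" if "finite_energy v Dv" "mass v = m" for v :: "real^'n \<Rightarrow> real" and Dv
    unfolding e0_def by (rule cInf_lower[OF _ bdd]) (use that in \<open>auto simp: S_def\<close>)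
  have e0: "e0 < 0"
  proof -
    obtain u :: "real^'n \<Rightarrow> real" and Du where u: "finite_energy u Du" "mass u = m" "total_energy u Du < 0" using neg by blast
    then show ?thesis using lb[OF u(1,2)] by linarith
  qed
  \<comment> \<open>The tolerance is a multiple of - e0 / 2, so every member of the minimising
    sequence has energy at most e0 / 2. This uniform negativity is what \<open>nonvanishing\<close>
    needs.\<close>
  have "\<exists>(u :: real^'n \<Rightarrow> real) Du. finite_energy u Du \<and> mass u = m \<and> total_energy u Du < e0 + (- e0 / 2) * inverse (real (Suc n))" for n
  proof -
    have "Inf S < e0 + (- e0 / 2) * inverse (real (Suc n))" unfolding e0_def[symmetric] using e0 by (simp add: mult_neg_pos zero_less_mult_iff)
    then obtain s where "s \<in> S" "s < e0 + (- e0 / 2) * inverse (real (Suc n))" using cInf_lessD[OF ne] by blast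
    then show ?thesis unfolding S_def by blast
  qed
  then obtain u0 :: "nat \<Rightarrow> real^'n \<Rightarrow> real" and Du0 where u0: "\<And>n. finite_energy (u0 n) (Du0 n)" "\<And>n. mass (u0 n) = m"
    "\<And>n. total_energy (u0 n) (Du0 n) < e0 + (- e0 / 2) * inverse (real (Suc n))" by metis
  have half: "total_energy (u0 n) (Du0 n) \<le> e0 / 2" for n
  proof -
    have "(- e0 / 2) * inverse (real (Suc n)) \<le> (- e0 / 2) * 1" using e0 by (intro mult_left_mono) (auto simp: inverse_le_1_iff)
    then show ?thesis using u0(3)[of n] by linarith
  qed
  \<comment> \<open>Coercivity reads kinetic / 2 - C \<le> energy, and the energies are
    negative.\<close>
  define K where "K = 2 * C"
  define P where "P = c * K"
  have KP: "0 \<le> K" "0 \<le> P" using C c by (auto simp: K_def P_def)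
  have kK: "kinetic (u0 n) (Du0 n) \<le> K" for n
    using coer[OF u0(1), of n] u0(2)[of n] half[of n] e0 by (simp add: K_def)
  have pP: "(\<integral>x. \<bar>u0 n x\<bar> powr p \<partial>lborel) \<le> P" for n
    unfolding P_def using order_trans[OF pow[OF u0(1)] mult_left_mono[OF order_trans[OF kinetic_bounds(2)[OF u0(1)] kK] c]] u0(2) by simp
  have e2: "e0 / 2 < 0" using e0 by simp
  obtain r c0 where r: "0 < r" "0 < c0" and nv: "\<And>n. \<exists>x. ennreal c0 < (\<integral>\<^sup>+h. indicator (Q r) h * ennreal ((u0 n (x + h))\<^sup>2) \<partial>lborel)"
  proof -
    obtain r c where rc: "0 < r" "0 < c" "\<forall>(u :: real^'n \<Rightarrow> real) Du. finite_energy u Du \<and> mass u = m \<and> total_energy u Du \<le> e0 / 2 \<and>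
      kinetic u Du \<le> K \<and> (\<integral>x. \<bar>u x\<bar> powr p \<partial>lborel) \<le> P \<longrightarrow>
      (\<exists>x. ennreal c < (\<integral>\<^sup>+h. indicator (Q r) h * ennreal ((u (x + h))\<^sup>2) \<partial>lborel))"
      using nonvanishing[OF m e2 KP] by (elim exE conjE)
    show ?thesis
    proof (rule that[OF rc(1,2)])
      show "\<exists>x. ennreal c < (\<integral>\<^sup>+h. indicator (Q r) h * ennreal ((u0 n (x + h))\<^sup>2) \<partial>lborel)" for n
        by (rule rc(3)[THEN spec, THEN spec, THEN mp, OF conjI[OF u0(1)[of n] conjI[OF u0(2)[of n] conjI[OF half[of n] conjI[OF kK[of n] pP[of n]]]]]])
    qed
  qed
  then obtain y where y: "\<And>n. ennreal c0 < (\<integral>\<^sup>+h. indicator (Q r) h * ennreal ((u0 n (y n + h))\<^sup>2) \<partial>lborel)" by metis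
  \<comment> \<open>Recentred at the cubes that carry mass, so that the mass cannot leave
    \<open>Q r\<close>.\<close>
  define u1 where "u1 n x = u0 n (x + y n)" for n x
  define Du1 where "Du1 n x = Du0 n (x + y n)" for n x
  have u1: "finite_energy (u1 n) (Du1 n)" "mass (u1 n) = m" "kinetic (u1 n) (Du1 n) = kinetic (u0 n) (Du0 n)"
    "total_energy (u1 n) (Du1 n) = total_energy (u0 n) (Du0 n)" for n
    using finite_energy_translate[OF u0(1), of n "y n"] potential_translate[OF u0(1), of n "y n"] u0(2)
    by (simp_all add: u1_def[abs_def] Du1_def[abs_def] total_energy_def)
  have p1: "(\<integral>x. \<bar>u1 n x\<bar> powr p \<partial>lborel) \<le> P" for n
  proof -
    note [measurable] = finite_energyD(1)[OF u0(1)]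
    have "(\<integral>x. \<bar>u1 n x\<bar> powr p \<partial>lborel) = (\<integral>x. \<bar>u0 n x\<bar> powr p \<partial>lborel)"
      unfolding u1_def by (rule integral_lborel_shift[of "\<lambda>x. \<bar>u0 n x\<bar> powr p" "y n"]) measurable
    then show ?thesis using pP[of n] by simp
  qed
  have D2K: "(\<integral>x. (norm (Du1 n x))\<^sup>2 \<partial>lborel) \<le> 2 * K" for n
    using kinetic_bounds(1)[OF u1(1), of n] kK[of n] unfolding u1(3) by simp
  have uD2K: "(\<integral>x. (u1 n x)\<^sup>2 * (norm (Du1 n x))\<^sup>2 \<partial>lborel) \<le> K" for n
    using kinetic_bounds(2)[OF u1(1), of n] kK[of n] unfolding u1(3) by simp
  have dif: "diff_bound (2 * K) (u1 n)" for n
    by (rule diff_bound_mono[OF diff_bound_weak_grad[OF finite_energyD(3,1,2,4,5)[OF u1(1)]] D2K])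
  have mass1: "(\<integral>x. (u1 n x)\<^sup>2 \<partial>lborel) \<le> m" for n using u1(2)[of n] by (simp add: mass_def)
  have K2: "0 \<le> 2 * K" using KP by simp
  obtain q v where q: "strict_mono q" and vb: "v \<in> borel_measurable borel" and ae: "AE x in lborel. (\<lambda>n. u1 (q n) x) \<longlonglongrightarrow> v x"
    and conv: "\<And>R e. e > 0 \<Longrightarrow> \<exists>n0. \<forall>n\<ge>n0. (\<integral>\<^sup>+x. indicator (Q R) x * ennreal ((u1 (q n) x - v x)\<^sup>2) \<partial>lborel) \<le> ennreal e"
  proof (rule rellich[OF finite_energyD(1)[OF u1(1)] finite_energyD(4)[OF u1(1)] mass1 dif K2])
    fix r g assume *: "strict_mono r" "g \<in> borel_measurable borel" "AE x in lborel. (\<lambda>n. u1 (r n) x) \<longlonglongrightarrow> g x"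
      "\<And>R e. e > 0 \<Longrightarrow> \<exists>n0. \<forall>n\<ge>n0. (\<integral>\<^sup>+x. indicator (Q R) x * ennreal ((u1 (r n) x - g x)\<^sup>2) \<partial>lborel) \<le> ennreal e"
    show ?thesis by (rule that[OF *])
  qed
  define w where "w n = u1 (q n)" for n
  define Dw where "Dw n = Du1 (q n)" for n
  have wf: "finite_energy (w n) (Dw n)" "mass (w n) = m" for n using u1 by (auto simp: w_def Dw_def)
  note [measurable] = finite_energyD(1,2)[OF wf(1)] vb
  have vfat: "(\<integral>\<^sup>+x. ennreal ((v x)\<^sup>2) \<partial>lborel) \<le> ennreal m"
  proof (rule nn_fatou_le[where f="\<lambda>n x. (w n x)\<^sup>2"])
    show "AE x in lborel. (\<lambda>k. (w k x)\<^sup>2) \<longlonglongrightarrow> (v x)\<^sup>2" using ae unfolding w_def by eventually_elim (intro tendsto_intros)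
    have "(\<integral>\<^sup>+x. ennreal ((w k x)\<^sup>2) \<partial>lborel) = ennreal m" for k
      using nn_integral_eq_integral[OF finite_energyD(4)[OF wf(1)]] wf(2)[of k] by (simp add: mass_def)
    then show "\<forall>\<^sub>F k in sequentially. (\<integral>\<^sup>+x. ennreal ((w k x)\<^sup>2) \<partial>lborel) \<le> ennreal m" by simp
  qed measurable
  have v2: "integrable lborel (\<lambda>x. (v x)\<^sup>2)"
    by (rule integrableI_bounded) (use vfat in \<open>auto intro: le_less_trans\<close>)
  have mvm: "mass v \<le> m" unfolding mass_def using vfat m by (simp add: nn_integral_eq_integral[OF v2] ennreal_le_iff)
  define CC where "CC = m + 2 * K"
  have wC: "(\<integral>x. (w n x)\<^sup>2 \<partial>lborel) \<le> CC" "(\<integral>x. (norm (Dw n x))\<^sup>2 \<partial>lborel) \<le> CC" "(\<integral>x. (w n x)\<^sup>2 * (norm (Dw n x))\<^sup>2 \<partial>lborel) \<le> CC" for n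
    using mass1[of "q n"] D2K[of "q n"] uD2K[of "q n"] m KP by (auto simp: CC_def w_def Dw_def)
  obtain Dv where Dv: "Dv \<in> borel_measurable borel" "weak_grad v Dv" "integrable lborel (\<lambda>x. (norm (Dv x))\<^sup>2)"
    "integrable lborel (\<lambda>x. (v x)\<^sup>2 * (norm (Dv x))\<^sup>2)"
    and lsc: "\<And>R B k. (\<And>n. n \<ge> k \<Longrightarrow> (\<integral>\<^sup>+x. ennreal (indicator (Q R) x * ((1 + 2 * (w n x)\<^sup>2) * (norm (Dw n x))\<^sup>2)) \<partial>lborel) \<le> ennreal B) \<Longrightarrow>
       (\<integral>\<^sup>+x. ennreal (indicator (Q R) x * ((1 + 2 * (v x)\<^sup>2) * (norm (Dv x))\<^sup>2)) \<partial>lborel) \<le> ennreal B"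
  proof (rule weak_limit[OF finite_energyD(1,2)[OF wf(1)] vb finite_energyD(3,4)[OF wf(1)] wC(1) finite_energyD(5)[OF wf(1)] wC(2) finite_energyD(6)[OF wf(1)] wC(3) v2])
    show "\<exists>n0. \<forall>n\<ge>n0. (\<integral>\<^sup>+x. indicator (Q R) x * ennreal ((w n x - v x)\<^sup>2) \<partial>lborel) \<le> ennreal e" if "e > 0" for R e
      using conv[of e R] \<open>e > 0\<close> unfolding w_def by simp
  next
    fix D assume *: "D \<in> borel_measurable borel" "weak_grad v D" "integrable lborel (\<lambda>x. (norm (D x))\<^sup>2)"
      "integrable lborel (\<lambda>x. (v x)\<^sup>2 * (norm (D x))\<^sup>2)"
      "\<And>R B k. (\<And>n. n \<ge> k \<Longrightarrow> (\<integral>\<^sup>+x. ennreal (indicator (Q R) x * ((1 + 2 * (w n x)\<^sup>2) * (norm (Dw n x))\<^sup>2)) \<partial>lborel) \<le> ennreal B) \<Longrightarrow>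
       (\<integral>\<^sup>+x. ennreal (indicator (Q R) x * ((1 + 2 * (v x)\<^sup>2) * (norm (D x))\<^sup>2)) \<partial>lborel) \<le> ennreal B"
    show ?thesis by (rule that[OF *])
  qed
  have fv: "finite_energy v Dv" using Dv v2 vb by (simp add: finite_energy_def)
  \<comment> \<open>If v vanished, L^2 convergence on \<open>Q r\<close> would bring the mass there
    down to \<open>c0\<close>, while it exceeds \<open>c0\<close> along the recentred
    sequence.\<close>
  have mv0: "mass v > 0"
  proof (rule ccontr)
    assume "\<not> mass v > 0"
    then have "mass v = 0" using mass_nonneg[of v] by simp
    then have "AE x in lborel. (v x)\<^sup>2 = 0" using integral_nonneg_eq_0_iff_AE[OF v2] by (simp add: mass_def)
    then have vz: "AE x in lborel. v x = 0" by eventually_elim simp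
    obtain n0 where "\<forall>n\<ge>n0. (\<integral>\<^sup>+x. indicator (Q r) x * ennreal ((u1 (q n) x - v x)\<^sup>2) \<partial>lborel) \<le> ennreal c0"
      using conv[OF r(2)] by blast
    then have "(\<integral>\<^sup>+x. indicator (Q r) x * ennreal ((u1 (q n0) x - v x)\<^sup>2) \<partial>lborel) \<le> ennreal c0" by blast
    moreover have "(\<integral>\<^sup>+x. indicator (Q r) x * ennreal ((u1 (q n0) x - v x)\<^sup>2) \<partial>lborel) = (\<integral>\<^sup>+x. indicator (Q r) x * ennreal ((u1 (q n0) x)\<^sup>2) \<partial>lborel)"
      using vz by (intro nn_integral_cong_AE, eventually_elim) simp
    ultimately show False using y[of "q n0"] by (simp add: u1_def add.commute not_le[symmetric])
  qed
  have Elim: "(\<lambda>n. total_energy (w n) (Dw n)) \<longlonglongrightarrow> e0"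
  proof -
    have "(\<lambda>n. total_energy (u1 n) (Du1 n)) \<longlonglongrightarrow> e0"
    proof (rule tendsto_sandwich)
      show "\<forall>\<^sub>F n in sequentially. e0 \<le> total_energy (u1 n) (Du1 n)" using lb[OF u1(1,2)] by simp
      show "\<forall>\<^sub>F n in sequentially. total_energy (u1 n) (Du1 n) \<le> e0 + (- e0 / 2) * inverse (real (Suc n))"
        unfolding u1(4) using u0(3) by (simp add: less_imp_le)
      have "(\<lambda>n. e0 + (- e0 / 2) * inverse (real (Suc n))) \<longlonglongrightarrow> e0 + (- e0 / 2) * 0"
        by (intro tendsto_add tendsto_mult tendsto_const LIMSEQ_inverse_real_of_nat)
      then show "(\<lambda>n. e0 + (- e0 / 2) * inverse (real (Suc n))) \<longlonglongrightarrow> e0" by (simp only: mult_zero_right add_0_right)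
    qed (rule tendsto_const)
    from LIMSEQ_subseq_LIMSEQ[OF this q] show ?thesis by (simp add: o_def w_def Dw_def)
  qed
  have le: "total_energy v Dv \<le> e0 / m * mass v"
  proof (rule limit_energy_bound[OF wf m lb e0 Elim _ _ fv _ _ lsc])
    show "kinetic (w n) (Dw n) \<le> K" for n using kK u1(3) by (simp add: w_def Dw_def)
    show "(\<integral>x. \<bar>w n x\<bar> powr p \<partial>lborel) \<le> P" for n using p1 by (simp add: w_def)
    show "AE x in lborel. (\<lambda>n. w n x) \<longlonglongrightarrow> v x" using ae by (simp add: w_def)
    show "\<exists>n0. \<forall>n\<ge>n0. (\<integral>\<^sup>+x. indicator (Q R) x * ennreal ((w n x - v x)\<^sup>2) \<partial>lborel) \<le> ennreal e" if "e > 0" for R e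
      using conv[of e R] that unfolding w_def by simp
  qed
  have mv: "mass v = m" by (rule attained_of_energy_bound[OF m e0 lb fv mv0 mvm le])
  have le0: "total_energy v Dv \<le> e0" using le m mv by simp
  show ?thesis
  proof (rule exI[of _ v], rule exI[of _ Dv], intro conjI allI impI)
    show "total_energy v Dv \<le> total_energy v' Dv'" if as: "finite_energy v' Dv' \<and> mass v' = m" for v' :: "real^'n \<Rightarrow> real" and Dv'
      by (rule order_trans[OF le0 lb[OF conjunct1[OF as] conjunct2[OF as]]])
  qed (rule fv mv)+
qed

end

section \<open>First variation\<close>

lemma integrable_compact_bound:
  fixes f :: "real^'n \<Rightarrow> real"
  assumes "f \<in> borel_measurable borel" "\<And>x. \<bar>f x\<bar> \<le> B * indicator (cball 0 R) x"
  shows "integrable lborel f"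
proof (rule Bochner_Integration.integrable_bound)
  show "integrable lborel (\<lambda>x. B * indicator (cball (0::real^'n) R) x)"
    using emeasure_bounded_finite[OF bounded_cball, of "0::real^'n" R] by simp
  show "AE x in lborel. norm (f x) \<le> norm (B * indicator (cball 0 R) x)"
    using assms(2) by (intro AE_I2) (auto intro: order_trans[OF _ abs_ge_self])
qed (use assms in simp)

text \<open>Difference quotients of \<psi> have integral 0 by translation invariance, and they
  converge boundedly within a ball of radius R + 1 to the partial derivative.\<close>

lemma integral_pderiv_test_fun:
  fixes \<psi> :: "real^'n \<Rightarrow> real"
  assumes t: "test_fun \<psi>" shows "(\<integral>x. pderiv_i \<psi> i x \<partial>lborel) = 0"
proof -
  note s = test_fun_smooth[OF t]
  note [measurable] = test_fun_borel[OF t] test_fun_borel[OF test_fun_pderiv[OF t]]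
  obtain R B where RB: "R > 0" "B > 0" "\<And>x. \<bar>\<psi> x\<bar> \<le> B * indicator (cball 0 R) x"
    "\<And>x. norm (grad \<psi> x) \<le> B * indicator (cball 0 R) x" using test_fun_grad_bound[OF t] by metis
  let ?e = "axis i 1 :: real^'n"
  have ip: "integrable lborel \<psi>" by (rule integrable_compact_bound[OF _ RB(3)]) measurable
  define f where "f n x = real (Suc n) * (\<psi> (x + (1 / real (Suc n)) *\<^sub>R ?e) - \<psi> x)" for n :: nat and x
  have [measurable]: "f n \<in> borel_measurable borel" for n unfolding f_def by measurable
  have gi: "?e \<bullet> grad \<psi> x = pderiv_i \<psi> i x" for x by (simp add: inner_axis' grad_def)
  have lim: "(\<lambda>n. f n x) \<longlonglongrightarrow> pderiv_i \<psi> i x" for x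
  proof -
    have "((\<lambda>h. (\<psi> (x + (0 + h) *\<^sub>R ?e) - \<psi> (x + 0 *\<^sub>R ?e)) / h) \<longlongrightarrow> ?e \<bullet> grad \<psi> (x + 0 *\<^sub>R ?e)) (at 0)"
      using grad_line_derivative[OF s, of x ?e 0] unfolding DERIV_def .
    then have "((\<lambda>h. (\<psi> (x + h *\<^sub>R ?e) - \<psi> x) / h) \<longlongrightarrow> pderiv_i \<psi> i x) (at 0)" by (simp add: gi)
    then have "(\<lambda>n. (\<psi> (x + (1 / real (Suc n)) *\<^sub>R ?e) - \<psi> x) / (1 / real (Suc n))) \<longlonglongrightarrow> pderiv_i \<psi> i x"
    proof (rule filterlim_compose)
      show "filterlim (\<lambda>n. 1 / real (Suc n)) (at 0) sequentially"
        using LIMSEQ_inverse_real_of_nat by (simp add: filterlim_at inverse_eq_divide)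
    qed
    then show ?thesis unfolding f_def by (simp add: mult.commute)
  qed
  have bnd: "\<bar>f n x\<bar> \<le> B * indicator (cball 0 (R + 1)) x" for n x
  proof -
    have "\<exists>z. 0 < z \<and> z < 1 / real (Suc n) \<and> \<psi> (x + (1 / real (Suc n)) *\<^sub>R ?e) - \<psi> (x + 0 *\<^sub>R ?e) = (1 / real (Suc n) - 0) * (?e \<bullet> grad \<psi> (x + z *\<^sub>R ?e))"
      by (rule MVT2) (use grad_line_derivative[OF s] in auto)
    then obtain z where z: "0 < z" "z < 1 / real (Suc n)" "\<psi> (x + (1 / real (Suc n)) *\<^sub>R ?e) - \<psi> x = (1 / real (Suc n)) * (?e \<bullet> grad \<psi> (x + z *\<^sub>R ?e))" by auto
    have "f n x = ?e \<bullet> grad \<psi> (x + z *\<^sub>R ?e)" unfolding f_def z(3) by simp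
    also have "\<bar>\<dots>\<bar> \<le> norm ?e * norm (grad \<psi> (x + z *\<^sub>R ?e))" by (rule Cauchy_Schwarz_ineq2)
    also have "\<dots> \<le> B * indicator (cball 0 R) (x + z *\<^sub>R ?e)" using RB(4)[of "x + z *\<^sub>R ?e"] by simp
    also have "\<dots> \<le> B * indicator (cball 0 (R + 1)) x"
    proof (cases "norm (x + z *\<^sub>R ?e) \<le> R")
      case True
      have "z \<le> 1" using z(2) by (rule less_imp_le[OF less_le_trans]) simp
      then have "norm (z *\<^sub>R ?e) \<le> 1" using z(1) by simp
      then have "norm x \<le> R + 1" using True norm_triangle_ineq4[of "x + z *\<^sub>R ?e" "z *\<^sub>R ?e"] by simp
      then show ?thesis using RB(2) by (simp add: indicator_def)
    qed (use RB(2) in \<open>simp add: indicator_def\<close>)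
    finally show ?thesis .
  qed
  have "(\<lambda>n. \<integral>x. f n x \<partial>lborel) \<longlonglongrightarrow> (\<integral>x. pderiv_i \<psi> i x \<partial>lborel)"
  proof (rule integral_dominated_convergence[where w="\<lambda>x. B * indicator (cball 0 (R + 1)) x"])
    show "integrable lborel (\<lambda>x. B * indicator (cball (0::real^'n) (R + 1)) x)"
      using emeasure_bounded_finite[OF bounded_cball, of "0::real^'n" "R + 1"] by simp
  qed (use lim bnd in auto)
  moreover have "(\<integral>x. f n x \<partial>lborel) = 0" for n
    unfolding f_def using ip integrable_lborel_shift[of \<psi> "(1 / real (Suc n)) *\<^sub>R ?e"] integral_lborel_shift[of \<psi> "(1 / real (Suc n)) *\<^sub>R ?e"] by simp
  ultimately show ?thesis by (simp add: LIMSEQ_const_iff)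
qed

lemma weak_grad_test_fun:
  fixes \<phi> :: "real^'n \<Rightarrow> real"
  assumes t: "test_fun \<phi>" shows "weak_grad \<phi> (grad \<phi>)"
  unfolding weak_grad_def
proof (intro allI impI)
  fix \<psi> :: "real^'n \<Rightarrow> real" and i assume t': "test_fun \<psi>"
  note [measurable] = test_fun_borel[OF t] test_fun_borel[OF test_fun_pderiv[OF t]] test_fun_borel[OF t'] test_fun_borel[OF test_fun_pderiv[OF t']]
  note d = smooth_fun_differentiable[OF test_fun_smooth[OF t]] smooth_fun_differentiable[OF test_fun_smooth[OF t']]
  have i: "integrable lborel (\<lambda>x. pderiv_i \<phi> i x * \<psi> x)" "integrable lborel (\<lambda>x. \<phi> x * pderiv_i \<psi> i x)"
    by (intro integrable_mult_of_squares test_fun_square_integrable test_fun_pderiv t t'; measurable)+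
  have "0 = (\<integral>x. pderiv_i (\<lambda>x. \<phi> x * \<psi> x) i x \<partial>lborel)"
    using integral_pderiv_test_fun[OF test_fun_mult[OF t test_fun_smooth[OF t']]] by simp
  also have "\<dots> = (\<integral>x. pderiv_i \<phi> i x * \<psi> x + \<phi> x * pderiv_i \<psi> i x \<partial>lborel)"
    by (intro Bochner_Integration.integral_cong refl pderiv_i_mult d)
  also have "\<dots> = (\<integral>x. pderiv_i \<phi> i x * \<psi> x \<partial>lborel) + (\<integral>x. \<phi> x * pderiv_i \<psi> i x \<partial>lborel)" using i by simp
  finally show "(\<integral>x. \<phi> x * pderiv_i \<psi> i x \<partial>lborel) = - (\<integral>x. grad \<phi> x $ i * \<psi> x \<partial>lborel)"
    by (simp add: grad_def)
qed

lemma finite_energy_add_test_fun: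
  fixes u :: "real^'n \<Rightarrow> real" and t :: real
  assumes fe: "finite_energy u Du" and tf: "test_fun \<phi>"
  shows "finite_energy (\<lambda>x. u x + t * \<phi> x) (\<lambda>x. Du x + t *\<^sub>R grad \<phi> x)"
proof -
  note [measurable] = finite_energyD(1,2)[OF fe] test_fun_borel[OF tf] test_fun_borel[OF test_fun_pderiv[OF tf]] grad_borel[OF test_fun_smooth[OF tf]]
  note i = finite_energyD(4,5,6)[OF fe]
  obtain R B where RB: "R > 0" "B > 0" "\<And>x. \<bar>\<phi> x\<bar> \<le> B * indicator (cball 0 R) x"
    "\<And>x. norm (grad \<phi> x) \<le> B * indicator (cball 0 R) x" using test_fun_grad_bound[OF tf] by metis
  have B1: "\<bar>\<phi> x\<bar> \<le> B" "norm (grad \<phi> x) \<le> B" for x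
    using RB(2) RB(3,4)[of x] by (cases "x \<in> cball 0 R"; simp)+
  have ig: "integrable lborel (\<lambda>x. (norm (grad \<phi> x))\<^sup>2)"
  proof (rule integrable_compact_bound)
    fix x show "\<bar>(norm (grad \<phi> x))\<^sup>2\<bar> \<le> B\<^sup>2 * indicator (cball 0 R) x"
      using power_mono[OF RB(4)[of x] norm_ge_zero, of 2] by (cases "x \<in> cball 0 R") auto
  qed measurable
  have ip: "integrable lborel (\<lambda>x. (\<phi> x)\<^sup>2)" by (rule test_fun_square_integrable[OF tf])
  have sq: "(a + t * b)\<^sup>2 \<le> 2 * a\<^sup>2 + 2 * t\<^sup>2 * b\<^sup>2" for a b :: real
    using zero_le_power2[of "a - t * b"] by (simp add: power2_eq_square algebra_simps)
  have nsq: "(norm (Du x + t *\<^sub>R grad \<phi> x))\<^sup>2 \<le> 2 * (norm (Du x))\<^sup>2 + 2 * t\<^sup>2 * (norm (grad \<phi> x))\<^sup>2" for x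
  proof -
    have "norm (Du x + t *\<^sub>R grad \<phi> x) \<le> norm (Du x) + \<bar>t\<bar> * norm (grad \<phi> x)"
      using norm_triangle_ineq[of "Du x" "t *\<^sub>R grad \<phi> x"] by simp
    then have "(norm (Du x + t *\<^sub>R grad \<phi> x))\<^sup>2 \<le> (norm (Du x) + \<bar>t\<bar> * norm (grad \<phi> x))\<^sup>2" by (rule power_mono) simp
    also have "\<dots> \<le> 2 * (norm (Du x))\<^sup>2 + 2 * \<bar>t\<bar>\<^sup>2 * (norm (grad \<phi> x))\<^sup>2"
      using zero_le_power2[of "norm (Du x) - \<bar>t\<bar> * norm (grad \<phi> x)"] by (simp add: power2_eq_square algebra_simps)
    finally show ?thesis by simp
  qed
  have w: "weak_grad (\<lambda>x. u x + t * \<phi> x) (\<lambda>x. Du x + t *\<^sub>R grad \<phi> x)"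
    unfolding weak_grad_def
  proof (intro allI impI)
    fix \<psi> :: "real^'n \<Rightarrow> real" and j assume t': "test_fun \<psi>"
    note [measurable] = test_fun_borel[OF t'] test_fun_borel[OF test_fun_pderiv[OF t']]
    have Dj: "integrable lborel (\<lambda>x. (Du x $ j)\<^sup>2)"
      by (rule Bochner_Integration.integrable_bound[OF i(2)])
         (auto intro!: AE_I2 simp: abs_le_square_iff[symmetric] component_le_norm_cart)
    have I: "integrable lborel (\<lambda>x. u x * pderiv_i \<psi> j x)" "integrable lborel (\<lambda>x. \<phi> x * pderiv_i \<psi> j x)"
      "integrable lborel (\<lambda>x. Du x $ j * \<psi> x)" "integrable lborel (\<lambda>x. pderiv_i \<phi> j x * \<psi> x)"
      by (intro integrable_mult_of_squares i Dj test_fun_square_integrable test_fun_pderiv tf t'; measurable)+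
    have "(\<integral>x. (u x + t * \<phi> x) * pderiv_i \<psi> j x \<partial>lborel) = (\<integral>x. u x * pderiv_i \<psi> j x + t * (\<phi> x * pderiv_i \<psi> j x) \<partial>lborel)"
      by (simp add: algebra_simps)
    also have "\<dots> = (\<integral>x. u x * pderiv_i \<psi> j x \<partial>lborel) + t * (\<integral>x. \<phi> x * pderiv_i \<psi> j x \<partial>lborel)" using I by simp
    also have "\<dots> = - ((\<integral>x. Du x $ j * \<psi> x \<partial>lborel) + t * (\<integral>x. pderiv_i \<phi> j x * \<psi> x \<partial>lborel))"
      using finite_energyD(3)[OF fe] weak_grad_test_fun[OF tf] t' unfolding weak_grad_def by (simp add: grad_def)
    also have "(\<integral>x. Du x $ j * \<psi> x \<partial>lborel) + t * (\<integral>x. pderiv_i \<phi> j x * \<psi> x \<partial>lborel) = (\<integral>x. Du x $ j * \<psi> x + t * (pderiv_i \<phi> j x * \<psi> x) \<partial>lborel)"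
      using I by simp
    also have "\<dots> = (\<integral>x. (Du x + t *\<^sub>R grad \<phi> x) $ j * \<psi> x \<partial>lborel)" by (simp add: grad_def algebra_simps)
    finally show "(\<integral>x. (u x + t * \<phi> x) * pderiv_i \<psi> j x \<partial>lborel) = - (\<integral>x. (Du x + t *\<^sub>R grad \<phi> x) $ j * \<psi> x \<partial>lborel)" .
  qed
  show ?thesis
    unfolding finite_energy_def
  proof (intro conjI w)
    have "integrable lborel (\<lambda>x. 2 * (u x)\<^sup>2 + 2 * t\<^sup>2 * (\<phi> x)\<^sup>2)" using i ip by simp
    then show "integrable lborel (\<lambda>x. (u x + t * \<phi> x)\<^sup>2)"
      by (rule Bochner_Integration.integrable_bound) (auto intro!: AE_I2 simp: sq)
    have "integrable lborel (\<lambda>x. 2 * (norm (Du x))\<^sup>2 + 2 * t\<^sup>2 * (norm (grad \<phi> x))\<^sup>2)" using i ig by simp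
    then show "integrable lborel (\<lambda>x. (norm (Du x + t *\<^sub>R grad \<phi> x))\<^sup>2)"
      by (rule Bochner_Integration.integrable_bound) (auto intro!: AE_I2 simp: nsq)
    have I4: "integrable lborel (\<lambda>x. 4 * ((u x)\<^sup>2 * (norm (Du x))\<^sup>2) + 4 * t\<^sup>2 * B\<^sup>2 * (u x)\<^sup>2 + 4 * t\<^sup>2 * B\<^sup>2 * (norm (Du x))\<^sup>2 + 4 * t\<^sup>2 * t\<^sup>2 * B\<^sup>2 * (norm (grad \<phi> x))\<^sup>2)"
      using i ig by simp
    show "integrable lborel (\<lambda>x. (u x + t * \<phi> x)\<^sup>2 * (norm (Du x + t *\<^sub>R grad \<phi> x))\<^sup>2)"
    proof (rule Bochner_Integration.integrable_bound[OF I4])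
      show "AE x in lborel. norm ((u x + t * \<phi> x)\<^sup>2 * (norm (Du x + t *\<^sub>R grad \<phi> x))\<^sup>2) \<le> norm (4 * ((u x)\<^sup>2 * (norm (Du x))\<^sup>2) + 4 * t\<^sup>2 * B\<^sup>2 * (u x)\<^sup>2 + 4 * t\<^sup>2 * B\<^sup>2 * (norm (Du x))\<^sup>2 + 4 * t\<^sup>2 * t\<^sup>2 * B\<^sup>2 * (norm (grad \<phi> x))\<^sup>2)"
      proof (rule AE_I2)
        fix x
        define a b c e where "a = (u x)\<^sup>2" and "b = (\<phi> x)\<^sup>2" and "c = (norm (Du x))\<^sup>2" and "e = (norm (grad \<phi> x))\<^sup>2"
        have nn: "0 \<le> a" "0 \<le> b" "0 \<le> c" "0 \<le> e" by (auto simp: a_def b_def c_def e_def)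
        have bB: "b \<le> B\<^sup>2" "e \<le> B\<^sup>2" using power_mono[OF B1(1)[of x], of 2] power_mono[OF B1(2)[of x], of 2] by (auto simp: b_def e_def)
        have "(u x + t * \<phi> x)\<^sup>2 * (norm (Du x + t *\<^sub>R grad \<phi> x))\<^sup>2 \<le> (2 * a + 2 * t\<^sup>2 * b) * (2 * c + 2 * t\<^sup>2 * e)"
          unfolding a_def b_def c_def e_def by (intro mult_mono sq nsq) auto
        also have "\<dots> = 4 * (a * c) + 4 * t\<^sup>2 * e * a + 4 * t\<^sup>2 * b * c + 4 * t\<^sup>2 * t\<^sup>2 * b * e" by (simp add: algebra_simps)
        also have "\<dots> \<le> 4 * (a * c) + 4 * t\<^sup>2 * B\<^sup>2 * a + 4 * t\<^sup>2 * B\<^sup>2 * c + 4 * t\<^sup>2 * t\<^sup>2 * B\<^sup>2 * e"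
          using nn bB by (intro add_mono mult_right_mono mult_left_mono) auto
        finally show "norm ((u x + t * \<phi> x)\<^sup>2 * (norm (Du x + t *\<^sub>R grad \<phi> x))\<^sup>2) \<le> norm (4 * ((u x)\<^sup>2 * (norm (Du x))\<^sup>2) + 4 * t\<^sup>2 * B\<^sup>2 * (u x)\<^sup>2 + 4 * t\<^sup>2 * B\<^sup>2 * (norm (Du x))\<^sup>2 + 4 * t\<^sup>2 * t\<^sup>2 * B\<^sup>2 * (norm (grad \<phi> x))\<^sup>2)"
          unfolding a_def b_def c_def e_def by (simp add: abs_of_nonneg)
      qed
    qed measurable
  qed measurable
qed

lemma finite_energy_test_fun:
  assumes "test_fun (\<phi> :: real^'n \<Rightarrow> real)" shows "finite_energy (\<lambda>x. t * \<phi> x) (\<lambda>x. t *\<^sub>R grad \<phi> x)"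
proof -
  have "finite_energy (\<lambda>x::real^'n. 0) (\<lambda>x. 0)" by (simp add: finite_energy_def weak_grad_def)
  from finite_energy_add_test_fun[OF this assms, of t] show ?thesis by simp
qed

lemma mass_add:
  fixes u \<phi> :: "real^'n \<Rightarrow> real"
  assumes fe: "finite_energy u Du" and tf: "test_fun \<phi>"
  shows "mass (\<lambda>x. u x + t * \<phi> x) = mass u + 2 * t * (\<integral>x. u x * \<phi> x \<partial>lborel) + t\<^sup>2 * mass \<phi>"
    and "integrable lborel (\<lambda>x. u x * \<phi> x)"
proof -
  note [measurable] = finite_energyD(1,2)[OF fe] test_fun_borel[OF tf]
  note i = finite_energyD(4)[OF fe] test_fun_square_integrable[OF tf]
  show I: "integrable lborel (\<lambda>x. u x * \<phi> x)" by (intro integrable_mult_of_squares i; measurable)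
  have e: "(u x + t * \<phi> x)\<^sup>2 = (u x)\<^sup>2 + 2 * t * (u x * \<phi> x) + t\<^sup>2 * (\<phi> x)\<^sup>2" for x by (simp add: power2_eq_square algebra_simps)
  show "mass (\<lambda>x. u x + t * \<phi> x) = mass u + 2 * t * (\<integral>x. u x * \<phi> x \<partial>lborel) + t\<^sup>2 * mass \<phi>"
    unfolding mass_def e using i I by simp
qed

text \<open>The integrand is a polynomial of degree 4 in t, so no differentiation under the integral
  sign occurs. Only the linear coefficient is identified; of the others just the existence matters
  for the derivative at 0.\<close>

lemma kinetic_add:
  fixes u \<phi> :: "real^'n \<Rightarrow> real"
  assumes fe: "finite_energy u Du" and tf: "test_fun \<phi>"
  shows "integrable lborel (\<lambda>x. (1 + 2 * (u x)\<^sup>2) * (Du x \<bullet> grad \<phi> x) + 2 * u x * (norm (Du x))\<^sup>2 * \<phi> x)" (is "integrable lborel ?A")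
    and "\<exists>a2 a3 a4. \<forall>t. kinetic (\<lambda>x. u x + t * \<phi> x) (\<lambda>x. Du x + t *\<^sub>R grad \<phi> x) =
      kinetic u Du + t * (\<integral>x. (1 + 2 * (u x)\<^sup>2) * (Du x \<bullet> grad \<phi> x) + 2 * u x * (norm (Du x))\<^sup>2 * \<phi> x \<partial>lborel) + t\<^sup>2 * a2 + t^3 * a3 + t^4 * a4"
proof -
  note [measurable] = finite_energyD(1,2)[OF fe] test_fun_borel[OF tf] test_fun_borel[OF test_fun_pderiv[OF tf]] grad_borel[OF test_fun_smooth[OF tf]]
  note i = finite_energyD(4,5,6)[OF fe]
  obtain R B where RB: "R > 0" "B > 0" "\<And>x. \<bar>\<phi> x\<bar> \<le> B * indicator (cball 0 R) x"
    "\<And>x. norm (grad \<phi> x) \<le> B * indicator (cball 0 R) x" using test_fun_grad_bound[OF tf] by metis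
  have B1: "\<bar>\<phi> x\<bar> \<le> B" "norm (grad \<phi> x) \<le> B" for x
    using RB(2) RB(3,4)[of x] by (cases "x \<in> cball 0 R"; simp)+
  let ?i = "indicator (cball 0 R) :: real^'n \<Rightarrow> real"
  define a where "a x = \<bar>u x\<bar>" for x
  define c where "c x = norm (Du x)" for x
  have ii: "integrable lborel ?i" using emeasure_bounded_finite[OF bounded_cball, of "0::real^'n" R] by simp
  \<comment> \<open>A single integrable majorant: every coefficient of the expansion involving
    \<phi> is bounded by a multiple of \<open>W\<close>, mixed products being reduced by y \<le> 1 +
    y^2.\<close>
  define W where "W x = ?i x + (a x)\<^sup>2 + (c x)\<^sup>2 + (a x)\<^sup>2 * (c x)\<^sup>2" for x
  have Wi: "integrable lborel W" unfolding W_def a_def c_def using ii i by simp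
  have W0: "0 \<le> W x" for x by (simp add: W_def)
  have I: "integrable lborel f" if [measurable]: "f \<in> borel_measurable borel" and b: "\<And>x. \<bar>f x\<bar> \<le> k * W x" for f :: "real^'n \<Rightarrow> real" and k
  proof (rule Bochner_Integration.integrable_bound)
    show "integrable lborel (\<lambda>x. k * W x)" using Wi by simp
    show "AE x in lborel. norm (f x) \<le> norm (k * W x)"
      using b by (intro AE_I2) (auto intro: order_trans[OF _ abs_ge_self])
  qed measurable
  have q1: "y \<le> 1 + y\<^sup>2" for y :: real proof (cases "y \<le> 1")
    case False
    then show ?thesis using self_le_power[of y 2] by simp
  qed (simp add: add_increasing2)
  have aw: "a x * ?i x \<le> W x" "c x * ?i x \<le> W x" "?i x \<le> W x" "(a x)\<^sup>2 \<le> W x" "(c x)\<^sup>2 \<le> W x" "a x * (c x)\<^sup>2 \<le> W x"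
    "a x * c x \<le> W x" "(a x)\<^sup>2 * c x \<le> W x" for x
  proof -
    have nn: "0 \<le> a x" "0 \<le> c x" by (auto simp: a_def c_def)
    have n2: "0 \<le> (a x)\<^sup>2" "0 \<le> (c x)\<^sup>2" "0 \<le> (a x)\<^sup>2 * (c x)\<^sup>2" "0 \<le> ?i x" by auto
    show "?i x \<le> W x" "(a x)\<^sup>2 \<le> W x" "(c x)\<^sup>2 \<le> W x" unfolding W_def using n2 by linarith+
    have iq: "y * ?i x \<le> ?i x + y\<^sup>2" for y
    proof (cases "x \<in> cball 0 R")
      case True
      then have "?i x = 1" by (rule indicator_simps)
      then show ?thesis using q1[of y] by (simp only: mult_1_right)
    next
      case False
      then have "?i x = 0" by (rule indicator_simps)
      then show ?thesis by (simp only: mult_zero_right add_0_left zero_le_power2)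
    qed
    show "a x * ?i x \<le> W x" "c x * ?i x \<le> W x" unfolding W_def using n2 iq[of "a x"] iq[of "c x"] by linarith+
    have "a x * (c x)\<^sup>2 \<le> (1 + (a x)\<^sup>2) * (c x)\<^sup>2" by (intro mult_right_mono q1) auto
    then show "a x * (c x)\<^sup>2 \<le> W x" unfolding W_def distrib_right mult_1_left using n2 by linarith
    have "(a x)\<^sup>2 * c x \<le> (a x)\<^sup>2 * (1 + (c x)\<^sup>2)" by (intro mult_left_mono q1) auto
    then show "(a x)\<^sup>2 * c x \<le> W x" unfolding W_def distrib_left mult_1_right using n2 by linarith
    have "2 * (a x * c x) \<le> (a x)\<^sup>2 + (c x)\<^sup>2" using sum_squares_bound[of "a x" "c x"] by (simp add: mult.assoc)
    moreover have "0 \<le> a x * c x" using nn by simp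
    ultimately have "a x * c x \<le> (a x)\<^sup>2 + (c x)\<^sup>2" by linarith
    then show "a x * c x \<le> W x" unfolding W_def using n2 by linarith
  qed
  have cs: "\<bar>Du x \<bullet> grad \<phi> x\<bar> \<le> B * (c x * ?i x)" for x
  proof -
    have "\<bar>Du x \<bullet> grad \<phi> x\<bar> \<le> norm (Du x) * norm (grad \<phi> x)" by (rule Cauchy_Schwarz_ineq2)
    also have "\<dots> \<le> norm (Du x) * (B * ?i x)" by (intro mult_left_mono RB) auto
    finally show ?thesis by (simp add: c_def mult_ac)
  qed
  have ile: "?i x \<le> 1" for x by (simp add: indicator_def)
  have cs': "\<bar>Du x \<bullet> grad \<phi> x\<bar> \<le> B * c x" for x
    using order_trans[OF cs[of x] mult_left_mono[OF mult_left_mono[OF ile]]] RB(2) by (simp add: c_def)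
  have g2: "(norm (grad \<phi> x))\<^sup>2 \<le> B\<^sup>2 * ?i x" for x
    using power_mono[OF RB(4)[of x] norm_ge_zero, of 2] by (cases "x \<in> cball 0 R") auto
  have g2': "(norm (grad \<phi> x))\<^sup>2 \<le> B\<^sup>2" for x using power_mono[OF B1(2)[of x] norm_ge_zero, of 2] .
  have p2: "(\<phi> x)\<^sup>2 \<le> B\<^sup>2" for x using power_mono[OF B1(1)[of x], of 2] by simp
  have Bp: "0 \<le> B" "0 \<le> B\<^sup>2" using RB by auto
  have t1: "integrable lborel (\<lambda>x. Du x \<bullet> grad \<phi> x)"
    by (rule I[of _ B], measurable) (rule order_trans[OF cs mult_left_mono[OF aw(2) Bp(1)]])
  have t2: "integrable lborel (\<lambda>x. (u x)\<^sup>2 * (Du x \<bullet> grad \<phi> x))"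
  proof (rule I[of _ B])
    fix x
    have "\<bar>(u x)\<^sup>2 * (Du x \<bullet> grad \<phi> x)\<bar> \<le> (a x)\<^sup>2 * (B * c x)" unfolding abs_mult a_def by (intro mult_mono cs') auto
    also have "\<dots> = B * ((a x)\<^sup>2 * c x)" by simp
    also have "\<dots> \<le> B * W x" by (intro mult_left_mono aw Bp)
    finally show "\<bar>(u x)\<^sup>2 * (Du x \<bullet> grad \<phi> x)\<bar> \<le> B * W x" .
  qed measurable
  have t3: "integrable lborel (\<lambda>x. u x * (norm (Du x))\<^sup>2 * \<phi> x)"
  proof (rule I[of _ B])
    fix x
    have "\<bar>u x * (norm (Du x))\<^sup>2 * \<phi> x\<bar> \<le> a x * (c x)\<^sup>2 * B" unfolding abs_mult a_def c_def by (intro mult_mono B1) auto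
    also have "\<dots> = B * (a x * (c x)\<^sup>2)" by simp
    also have "\<dots> \<le> B * W x" by (intro mult_left_mono aw Bp)
    finally show "\<bar>u x * (norm (Du x))\<^sup>2 * \<phi> x\<bar> \<le> B * W x" .
  qed measurable
  have t4: "integrable lborel (\<lambda>x. (norm (grad \<phi> x))\<^sup>2)"
    by (rule I[of _ "B\<^sup>2"], measurable) (use order_trans[OF g2 mult_left_mono[OF aw(3) Bp(2)]] in simp)
  have t5: "integrable lborel (\<lambda>x. (u x)\<^sup>2 * (norm (grad \<phi> x))\<^sup>2)"
  proof (rule I[of _ "B\<^sup>2"])
    fix x
    have "\<bar>(u x)\<^sup>2 * (norm (grad \<phi> x))\<^sup>2\<bar> \<le> (a x)\<^sup>2 * B\<^sup>2" unfolding abs_mult a_def using g2' by (intro mult_mono) auto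
    also have "\<dots> \<le> W x * B\<^sup>2" by (intro mult_right_mono aw Bp)
    finally show "\<bar>(u x)\<^sup>2 * (norm (grad \<phi> x))\<^sup>2\<bar> \<le> B\<^sup>2 * W x" by (simp add: mult.commute)
  qed measurable
  have t6: "integrable lborel (\<lambda>x. u x * \<phi> x * (Du x \<bullet> grad \<phi> x))"
  proof (rule I[of _ "B * B"])
    fix x
    have "\<bar>u x * \<phi> x * (Du x \<bullet> grad \<phi> x)\<bar> \<le> a x * B * (B * c x)" unfolding abs_mult a_def using Bp by (intro mult_mono B1 cs') auto
    also have "\<dots> = B * B * (a x * c x)" by simp
    also have "\<dots> \<le> B * B * W x" using Bp by (intro mult_left_mono aw) auto
    finally show "\<bar>u x * \<phi> x * (Du x \<bullet> grad \<phi> x)\<bar> \<le> B * B * W x" .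
  qed measurable
  have t7: "integrable lborel (\<lambda>x. (\<phi> x)\<^sup>2 * (norm (Du x))\<^sup>2)"
  proof (rule I[of _ "B\<^sup>2"])
    fix x
    have "\<bar>(\<phi> x)\<^sup>2 * (norm (Du x))\<^sup>2\<bar> \<le> B\<^sup>2 * (c x)\<^sup>2" unfolding abs_mult c_def using p2 by (intro mult_mono) auto
    also have "\<dots> \<le> B\<^sup>2 * W x" by (intro mult_left_mono aw Bp)
    finally show "\<bar>(\<phi> x)\<^sup>2 * (norm (Du x))\<^sup>2\<bar> \<le> B\<^sup>2 * W x" .
  qed measurable
  have t8: "integrable lborel (\<lambda>x. u x * \<phi> x * (norm (grad \<phi> x))\<^sup>2)"
  proof (rule I[of _ "B * B\<^sup>2"])
    fix x
    have "\<bar>u x * \<phi> x * (norm (grad \<phi> x))\<^sup>2\<bar> \<le> a x * B * (B\<^sup>2 * ?i x)" unfolding abs_mult a_def using Bp g2 by (intro mult_mono B1) auto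
    also have "\<dots> = B * B\<^sup>2 * (a x * ?i x)" by simp
    also have "\<dots> \<le> B * B\<^sup>2 * W x" using Bp by (intro mult_left_mono aw) auto
    finally show "\<bar>u x * \<phi> x * (norm (grad \<phi> x))\<^sup>2\<bar> \<le> B * B\<^sup>2 * W x" .
  qed measurable
  have t9: "integrable lborel (\<lambda>x. (\<phi> x)\<^sup>2 * (Du x \<bullet> grad \<phi> x))"
  proof (rule I[of _ "B\<^sup>2 * B"])
    fix x
    have "\<bar>(\<phi> x)\<^sup>2 * (Du x \<bullet> grad \<phi> x)\<bar> \<le> B\<^sup>2 * (B * (c x * ?i x))" unfolding abs_mult using Bp p2 by (intro mult_mono cs) auto
    also have "\<dots> = B\<^sup>2 * B * (c x * ?i x)" by simp
    also have "\<dots> \<le> B\<^sup>2 * B * W x" using Bp by (intro mult_left_mono aw) auto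
    finally show "\<bar>(\<phi> x)\<^sup>2 * (Du x \<bullet> grad \<phi> x)\<bar> \<le> B\<^sup>2 * B * W x" .
  qed measurable
  have t10: "integrable lborel (\<lambda>x. (\<phi> x)\<^sup>2 * (norm (grad \<phi> x))\<^sup>2)"
  proof (rule I[of _ "B\<^sup>2 * B\<^sup>2"])
    fix x
    have "\<bar>(\<phi> x)\<^sup>2 * (norm (grad \<phi> x))\<^sup>2\<bar> \<le> B\<^sup>2 * (B\<^sup>2 * ?i x)" unfolding abs_mult using Bp p2 g2 by (intro mult_mono) auto
    also have "\<dots> = B\<^sup>2 * B\<^sup>2 * ?i x" by simp
    also have "\<dots> \<le> B\<^sup>2 * B\<^sup>2 * W x" using Bp by (intro mult_left_mono aw) auto
    finally show "\<bar>(\<phi> x)\<^sup>2 * (norm (grad \<phi> x))\<^sup>2\<bar> \<le> B\<^sup>2 * B\<^sup>2 * W x" .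
  qed measurable
  have eA: "?A x = (Du x \<bullet> grad \<phi> x) + 2 * ((u x)\<^sup>2 * (Du x \<bullet> grad \<phi> x)) + 2 * (u x * (norm (Du x))\<^sup>2 * \<phi> x)" for x
    by (simp add: algebra_simps)
  show iA: "integrable lborel ?A" unfolding eA using t1 t2 t3 by simp
  define f2 where "f2 x = (norm (grad \<phi> x))\<^sup>2 + 2 * ((u x)\<^sup>2 * (norm (grad \<phi> x))\<^sup>2) + 8 * (u x * \<phi> x * (Du x \<bullet> grad \<phi> x)) + 2 * ((\<phi> x)\<^sup>2 * (norm (Du x))\<^sup>2)" for x
  define f3 where "f3 x = 4 * (u x * \<phi> x * (norm (grad \<phi> x))\<^sup>2) + 4 * ((\<phi> x)\<^sup>2 * (Du x \<bullet> grad \<phi> x))" for x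
  define f4 where "f4 x = 2 * ((\<phi> x)\<^sup>2 * (norm (grad \<phi> x))\<^sup>2)" for x
  have i2: "integrable lborel f2" "integrable lborel f3" "integrable lborel f4"
    unfolding f2_def f3_def f4_def using t4 t5 t6 t7 t8 t9 t10 by simp_all
  have expand: "(1 + 2 * (u x + t * \<phi> x)\<^sup>2) * (norm (Du x + t *\<^sub>R grad \<phi> x))\<^sup>2 =
     (1 + 2 * (u x)\<^sup>2) * (norm (Du x))\<^sup>2 + 2 * t * ?A x + t\<^sup>2 * f2 x + t^3 * f3 x + t^4 * f4 x" for x t
  proof -
    have n: "(norm (Du x + t *\<^sub>R grad \<phi> x))\<^sup>2 = (norm (Du x))\<^sup>2 + 2 * t * (Du x \<bullet> grad \<phi> x) + t\<^sup>2 * (norm (grad \<phi> x))\<^sup>2"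
      unfolding power2_norm_eq_inner by (simp add: inner_simps inner_commute power2_eq_square algebra_simps)
    show ?thesis unfolding n f2_def f3_def f4_def
      by (simp add: power2_eq_square power3_eq_cube power4_eq_xxxx algebra_simps)
  qed
  have k: "kinetic (\<lambda>x. u x + t * \<phi> x) (\<lambda>x. Du x + t *\<^sub>R grad \<phi> x) =
      kinetic u Du + t * (\<integral>x. ?A x \<partial>lborel) + t\<^sup>2 * (1/2 * (\<integral>x. f2 x \<partial>lborel)) + t^3 * (1/2 * (\<integral>x. f3 x \<partial>lborel)) + t^4 * (1/2 * (\<integral>x. f4 x \<partial>lborel))" for t
  proof -
    have "(\<integral>x. (1 + 2 * (u x)\<^sup>2) * (norm (Du x))\<^sup>2 + 2 * t * ?A x + t\<^sup>2 * f2 x + t^3 * f3 x + t^4 * f4 x \<partial>lborel) =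
      (\<integral>x. (1 + 2 * (u x)\<^sup>2) * (norm (Du x))\<^sup>2 \<partial>lborel) + 2 * t * (\<integral>x. ?A x \<partial>lborel) + t\<^sup>2 * (\<integral>x. f2 x \<partial>lborel) + t^3 * (\<integral>x. f3 x \<partial>lborel) + t^4 * (\<integral>x. f4 x \<partial>lborel)"
      using finite_energyD(7)[OF fe] iA i2
      by (simp only: Bochner_Integration.integral_add Bochner_Integration.integrable_add integrable_mult_right integral_mult_right_zero)
    then show ?thesis unfolding kinetic_def expand by (simp only: distrib_left mult.assoc)
  qed
  show "\<exists>a2 a3 a4. \<forall>t. kinetic (\<lambda>x. u x + t * \<phi> x) (\<lambda>x. Du x + t *\<^sub>R grad \<phi> x) =
      kinetic u Du + t * (\<integral>x. ?A x \<partial>lborel) + t\<^sup>2 * a2 + t^3 * a3 + t^4 * a4"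
    using k by blast
qed

lemma deriv_quotient_LIMSEQ:
  assumes "(f has_real_derivative d) (at 0)"
  shows "(\<lambda>n. (f (inverse (real (Suc n))) - f 0) / inverse (real (Suc n))) \<longlonglongrightarrow> d"
proof -
  have d: "((\<lambda>h. (f h - f 0) / h) \<longlongrightarrow> d) (at 0)" using assms by (simp add: DERIV_def)
  have "filterlim (\<lambda>n. inverse (real (Suc n))) (at 0) sequentially"
    by (rule filterlim_atI[OF LIMSEQ_inverse_real_of_nat]) simp
  from filterlim_compose[OF d this] show ?thesis .
qed

lemma powr_le_one_add: "0 \<le> y \<Longrightarrow> 0 \<le> a \<Longrightarrow> a \<le> b \<Longrightarrow> y powr a \<le> 1 + y powr b" for y a b :: real
proof (cases "y \<le> 1")
  case True
  assume "0 \<le> y" "0 \<le> a"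
  then have "y powr a \<le> 1" using True by (simp add: powr_le1)
  then show ?thesis by (simp add: add_increasing2)
next
  case False
  assume "a \<le> b"
  then have "y powr a \<le> y powr b" using False by (intro powr_mono) auto
  then show ?thesis by simp
qed

lemma powr_add_le: "0 \<le> a \<Longrightarrow> 0 \<le> b \<Longrightarrow> 0 \<le> r \<Longrightarrow> (a + b) powr r \<le> (2 * a) powr r + (2 * b) powr r" for a b r :: real
proof (cases "a \<le> b")
  case True
  assume *: "0 \<le> a" "0 \<le> b" "0 \<le> r"
  then have "(a + b) powr r \<le> (2 * b) powr r" using True by (intro powr_mono2) auto
  then show ?thesis by (simp add: add_increasing)
next
  case False
  assume *: "0 \<le> a" "0 \<le> b" "0 \<le> r"
  then have "(a + b) powr r \<le> (2 * a) powr r" using False by (intro powr_mono2) auto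
  then show ?thesis by (simp add: add_increasing2)
qed

lemma test_fun_uminus:
  assumes "test_fun (\<phi> :: real^'n \<Rightarrow> real)" shows "test_fun (\<lambda>x. - \<phi> x)" "grad (\<lambda>x. - \<phi> x) x = - grad \<phi> x"
proof -
  show "test_fun (\<lambda>x. - \<phi> x)" using test_fun_affine[OF assms, of 1 "-1" 0] by simp
  have "pderiv_i (\<lambda>x. (- 1) * \<phi> x) i x = - pderiv_i \<phi> i x" for i
    using pderiv_i_mult[OF differentiable_const smooth_fun_differentiable[OF test_fun_smooth[OF assms]], of "- 1" i x] by simp
  then show "grad (\<lambda>x. - \<phi> x) x = - grad \<phi> x" by (simp add: grad_def vec_eq_iff)
qed

context critical_nonlinearity
begin

text \<open>The difference quotient of G is \<phi> g(z) with |z| \<le> |u| + B by the mean value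
  theorem. The growth of g then gives a majorant for dominated convergence. The limit is taken along
  1 / (n + 1), which suffices for comparing one-sided quotients.\<close>

lemma potential_add:
  fixes u \<phi> :: "real^'n \<Rightarrow> real"
  assumes fe: "finite_energy u Du" and tf: "test_fun \<phi>"
  shows "integrable lborel (\<lambda>x. g (u x) * \<phi> x)"
    and "(\<lambda>n. (potential (\<lambda>x. u x + inverse (real (Suc n)) * \<phi> x) - potential u) / inverse (real (Suc n))) \<longlonglongrightarrow>
      (\<integral>x. g (u x) * \<phi> x \<partial>lborel)"
proof -
  note [measurable] = finite_energyD(1)[OF fe] test_fun_borel[OF tf]
  obtain R B where RB: "R > 0" "B > 0" "\<And>x. \<bar>\<phi> x\<bar> \<le> B * indicator (cball 0 R) x" using test_fun_grad_bound[OF tf] by metis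
  have B1: "\<bar>\<phi> x\<bar> \<le> B" for x using RB(2) RB(3)[of x] by (cases "x \<in> cball 0 R") auto
  obtain C where C: "C \<ge> 0" "\<And>s. \<bar>g s\<bar> \<le> C * \<bar>s\<bar> + 1 * \<bar>s\<bar> powr (p - 1)" using g_bound[of 1] by auto
  define T where "T n = inverse (real (Suc n))" for n
  have T: "0 < T n" "T n \<le> 1" for n by (auto simp: T_def inverse_le_1_iff)
  \<comment> \<open>Both powers in the growth bound are at most 1 + y^p with y = |u| + B, and y^p is
    split as (2 |u|)^p + (2 B)^p. The constant parts are confined to the support of \<phi>.\<close>
  define w where "w x = B * ((C + 1) * (1 + (2 * B) powr p)) * indicator (cball 0 R) x + B * (C + 1) * 2 powr p * \<bar>u x\<bar> powr p" for x
  have wi: "integrable lborel w" unfolding w_def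
    using power_integrable[OF fe] emeasure_bounded_finite[OF bounded_cball, of "0::real^'n" R] by simp
  have gw: "\<bar>\<phi> x\<bar> * \<bar>g z\<bar> \<le> w x" if z: "\<bar>z\<bar> \<le> \<bar>u x\<bar> + B" for x z
  proof (cases "x \<in> cball 0 R")
    case True
    let ?y = "\<bar>u x\<bar> + B"
    have "\<bar>g z\<bar> \<le> C * \<bar>z\<bar> powr 1 + \<bar>z\<bar> powr (p - 1)" using C(2)[of z] by simp
    also have "\<dots> \<le> C * ?y powr 1 + ?y powr (p - 1)"
      using z C RB p4 by (intro add_mono mult_left_mono powr_mono2) auto
    also have "\<dots> \<le> C * (1 + ?y powr p) + (1 + ?y powr p)"
      using RB C p4 by (intro add_mono mult_left_mono powr_le_one_add) auto
    also have "\<dots> = (C + 1) * (1 + ?y powr p)" by (simp add: algebra_simps)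
    also have "\<dots> \<le> (C + 1) * (1 + ((2 * \<bar>u x\<bar>) powr p + (2 * B) powr p))"
      using RB C p4 by (intro mult_left_mono add_left_mono powr_add_le) auto
    also have "(2 * \<bar>u x\<bar>) powr p = 2 powr p * \<bar>u x\<bar> powr p" by (simp add: powr_mult)
    finally have *: "\<bar>g z\<bar> \<le> (C + 1) * (1 + (2 powr p * \<bar>u x\<bar> powr p + (2 * B) powr p))" .
    have "\<bar>\<phi> x\<bar> * \<bar>g z\<bar> \<le> B * ((C + 1) * (1 + (2 powr p * \<bar>u x\<bar> powr p + (2 * B) powr p)))"
      using RB by (intro mult_mono * B1) auto
    also have "\<dots> = w x" using True by (simp add: w_def algebra_simps)
    finally show ?thesis .
  next
    case False
    then show ?thesis using RB(2) RB(3)[of x] C by (simp add: w_def)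
  qed
  have gb: "\<bar>g (u x) * \<phi> x\<bar> \<le> w x" for x using gw[of "u x" x] RB by (simp add: abs_mult mult.commute)
  show "integrable lborel (\<lambda>x. g (u x) * \<phi> x)"
  proof (rule Bochner_Integration.integrable_bound[OF wi])
    show "AE x in lborel. norm (g (u x) * \<phi> x) \<le> norm (w x)"
      using gb by (intro AE_I2) (auto intro: order_trans[OF _ abs_ge_self])
  qed measurable
  define s where "s n x = (G (u x + T n * \<phi> x) - G (u x)) / T n" for n x
  have "(\<lambda>n. \<integral>x. s n x \<partial>lborel) \<longlonglongrightarrow> (\<integral>x. g (u x) * \<phi> x \<partial>lborel)"
  proof (rule integral_dominated_convergence[OF _ _ wi])
    show "AE x in lborel. (\<lambda>n. s n x) \<longlonglongrightarrow> g (u x) * \<phi> x"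
    proof (rule AE_I2)
      fix x
      have "((\<lambda>t. G (u x + t * \<phi> x)) has_real_derivative g (u x + 0 * \<phi> x) * \<phi> x) (at 0)"
        by (rule DERIV_chain2[OF G_deriv]) (auto intro!: derivative_eq_intros)
      from deriv_quotient_LIMSEQ[OF this] show "(\<lambda>n. s n x) \<longlonglongrightarrow> g (u x) * \<phi> x" by (simp add: s_def T_def)
    qed
    show "AE x in lborel. norm (s n x) \<le> w x" for n
    proof (rule AE_I2)
      fix x
      obtain z where z: "\<bar>z\<bar> \<le> \<bar>u x\<bar> + \<bar>T n * \<phi> x\<bar>" "G (u x + T n * \<phi> x) - G (u x) = T n * \<phi> x * g z" using G_mvt by blast
      have "\<bar>T n * \<phi> x\<bar> \<le> 1 * B" unfolding abs_mult using T[of n] by (intro mult_mono B1) auto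
      then have "\<bar>\<phi> x\<bar> * \<bar>g z\<bar> \<le> w x" using z(1) by (intro gw) simp
      moreover have "s n x = \<phi> x * g z" using z(2) T(1)[of n] by (simp add: s_def)
      ultimately show "norm (s n x) \<le> w x" by (simp add: abs_mult)
    qed
    show "s n \<in> borel_measurable lborel" for n unfolding s_def by measurable
  qed measurable
  moreover have "(\<integral>x. s n x \<partial>lborel) = (potential (\<lambda>x. u x + T n * \<phi> x) - potential u) / T n" for n
  proof -
    have "(\<integral>x. s n x \<partial>lborel) = (\<integral>x. G (u x + T n * \<phi> x) - G (u x) \<partial>lborel) / T n"
      unfolding s_def by (rule integral_divide_zero)
    also have "(\<integral>x. G (u x + T n * \<phi> x) - G (u x) \<partial>lborel) = potential (\<lambda>x. u x + T n * \<phi> x) - potential u"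
      unfolding potential_def by (rule Bochner_Integration.integral_diff[OF G_integrable[OF finite_energy_add_test_fun[OF fe tf]] G_integrable[OF fe]])
    finally show ?thesis .
  qed
  ultimately show "(\<lambda>n. (potential (\<lambda>x. u x + inverse (real (Suc n)) * \<phi> x) - potential u) / inverse (real (Suc n))) \<longlonglongrightarrow>
      (\<integral>x. g (u x) * \<phi> x \<partial>lborel)" by (simp only: T_def)
qed

text \<open>The comparison with the dilate of mass m, multiplied by mass v / m and with t^(-2)
  written as a power of that ratio. In this form it bounds the potential from above by quantities
  differentiable in a parameter, with equality when v is a minimiser of mass m and e its
  energy.\<close>

lemma energy_lower_scaled:
  assumes m: "0 < m" and lb: "\<And>(u :: real^'n \<Rightarrow> real) Du. finite_energy u Du \<Longrightarrow> mass u = m \<Longrightarrow> e \<le> total_energy u Du"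
    and fe: "finite_energy (v :: real^'n \<Rightarrow> real) Dv" and mv: "mass v > 0"
  shows "e * (mass v / m) + potential v \<le> kinetic v Dv * (mass v / m) powr (2 / real CARD('n))"
proof -
  define t where "t = root CARD('n) (m / mass v)"
  note * = energy_lower_dilate[OF m lb fe mv, folded t_def]
  have "t = (m / mass v) powr (1 / real CARD('n))"
    unfolding t_def using m mv by (simp add: root_powr_inverse)
  then have "t\<^sup>2 = ((m / mass v) powr (1 / real CARD('n))) powr 2" using m mv by simp
  also have "\<dots> = (m / mass v) powr (2 / real CARD('n))" by (simp add: powr_powr)
  also have "\<dots> = 1 / (mass v / m) powr (2 / real CARD('n))" using m mv by (simp add: powr_divide)
  finally have t2: "kinetic v Dv / t\<^sup>2 = kinetic v Dv * (mass v / m) powr (2 / real CARD('n))" by simp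
  have "e * (mass v / m) \<le> (m / mass v * (kinetic v Dv / t\<^sup>2 - potential v)) * (mass v / m)"
    using *(2) m mv by (intro mult_right_mono) auto
  also have "\<dots> = kinetic v Dv / t\<^sup>2 - potential v" using m mv by simp
  finally show ?thesis unfolding t2 by linarith
qed

text \<open>u + t \<phi> has the wrong mass; \<open>energy_lower_scaled\<close> compares its dilate
  with u. The resulting upper bound for the potential of u + t \<phi> is attained at t = 0, so the
  right difference quotients obey the same inequality in the limit. The multiplier arises from
  differentiating the mass ratio.\<close>

lemma first_variation_nonneg:
  fixes u \<phi> :: "real^'n \<Rightarrow> real"
  assumes m: "0 < m" and fe: "finite_energy u Du" and mu: "mass u = m"
    and lb: "\<And>(v :: real^'n \<Rightarrow> real) Dv. finite_energy v Dv \<Longrightarrow> mass v = m \<Longrightarrow> total_energy u Du \<le> total_energy v Dv"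
    and tf: "test_fun \<phi>"
  defines "N \<equiv> real CARD('n)"
  shows "(\<integral>x. g (u x) * \<phi> x \<partial>lborel) \<le>
    (\<integral>x. (1 + 2 * (u x)\<^sup>2) * (Du x \<bullet> grad \<phi> x) + 2 * u x * (norm (Du x))\<^sup>2 * \<phi> x \<partial>lborel)
    + 2 * (2 / N * kinetic u Du - total_energy u Du) / m * (\<integral>x. u x * \<phi> x \<partial>lborel)"
proof -
  let ?v = "\<lambda>t x. u x + t * \<phi> x" and ?Dv = "\<lambda>t x. Du x + t *\<^sub>R grad \<phi> x"
  define A where "A = (\<integral>x. (1 + 2 * (u x)\<^sup>2) * (Du x \<bullet> grad \<phi> x) + 2 * u x * (norm (Du x))\<^sup>2 * \<phi> x \<partial>lborel)"
  define b where "b = (\<integral>x. u x * \<phi> x \<partial>lborel)"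
  define e where "e = total_energy u Du"
  define T where "T n = inverse (real (Suc n))" for n
  obtain a2 a3 a4 where k: "\<And>t. kinetic (?v t) (?Dv t) = kinetic u Du + t * A + t\<^sup>2 * a2 + t^3 * a3 + t^4 * a4"
    using kinetic_add(2)[OF fe tf] unfolding A_def by blast
  have M: "mass (?v t) = m + 2 * t * b + t\<^sup>2 * mass \<phi>" for t using mass_add(1)[OF fe tf, of t] mu by (simp add: b_def)
  define k' where "k' t = kinetic u Du + t * A + t\<^sup>2 * a2 + t^3 * a3 + t^4 * a4" for t
  define M' where "M' t = (m + 2 * t * b + t\<^sup>2 * mass \<phi>) / m" for t
  \<comment> \<open>The upper bound for the potential of u + t \<phi>. Its derivative at 0 combines
    A with (2/N) kinetic - e times 2 b / m, the derivative of the mass ratio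
    \<open>M'\<close>.\<close>
  define K where "K t = k' t * M' t powr (2 / N) - e * M' t" for t
  have M0: "M' 0 = 1" using m by (simp add: M'_def)
  have dk: "(k' has_real_derivative A) (at 0)" unfolding k'_def by (auto intro!: derivative_eq_intros)
  have dM: "(M' has_real_derivative 2 * b / m) (at 0)" unfolding M'_def using m by (auto intro!: derivative_eq_intros)
  have dP: "((\<lambda>t. M' t powr (2 / N)) has_real_derivative (2 / N * 1 powr (2 / N - 1)) * (2 * b / m)) (at 0)"
    by (rule DERIV_chain2[OF _ dM]) (use has_real_derivative_powr[of 1 "2 / N"] M0 in simp)
  have "(K has_real_derivative A * M' 0 powr (2 / N) + (2 / N * 1 powr (2 / N - 1)) * (2 * b / m) * k' 0 - e * (2 * b / m)) (at 0)"
    unfolding K_def by (rule DERIV_diff[OF DERIV_mult[OF dk dP] DERIV_cmult[OF dM]])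
  then have dK: "(K has_real_derivative A + 2 * (2 / N * kinetic u Du - e) / m * b) (at 0)"
    using m by (simp add: M0 k'_def diff_divide_distrib algebra_simps)
  have K0: "K 0 = potential u" by (simp add: K_def M0 k'_def e_def total_energy_def)
  have Tl: "T \<longlonglongrightarrow> 0" unfolding T_def by (rule LIMSEQ_inverse_real_of_nat)
  have "(\<lambda>n. M' (T n)) \<longlonglongrightarrow> M' 0"
    by (rule isCont_tendsto_compose[OF DERIV_isCont[OF dM] Tl])
  then have "\<forall>\<^sub>F n in sequentially. 0 < M' (T n)" by (rule order_tendstoD) (simp add: M0)
  then have ev: "\<forall>\<^sub>F n in sequentially. (potential (?v (T n)) - potential u) / T n \<le> (K (T n) - K 0) / T n"
  proof eventually_elim
    case (elim n)
    have Mm: "mass (?v (T n)) / m = M' (T n)" by (simp add: M M'_def)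
    have "mass (?v (T n)) > 0" using elim m by (simp add: Mm[symmetric] zero_less_divide_iff)
    from energy_lower_scaled[OF m lb finite_energy_add_test_fun[OF fe tf] this]
    have "e * M' (T n) + potential (?v (T n)) \<le> k' (T n) * M' (T n) powr (2 / N)"
      unfolding Mm k k'_def N_def e_def .
    then have "potential (?v (T n)) \<le> K (T n)" by (simp add: K_def)
    then show ?case unfolding K0 by (intro divide_right_mono) (auto simp: T_def)
  qed
  have "(\<integral>x. g (u x) * \<phi> x \<partial>lborel) \<le> A + 2 * (2 / N * kinetic u Du - e) / m * b"
    by (rule tendsto_le[OF _ deriv_quotient_LIMSEQ[OF dK, folded T_def] potential_add(2)[OF fe tf, folded T_def] ev]) simp
  then show ?thesis by (simp only: A_def b_def e_def)
qed

text \<open>The inequality of the first variation is linear in \<phi>, so replacing \<phi> by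
  -\<phi> gives equality. The multiplier depends on u alone, through its kinetic and total
  energy.\<close>

lemma euler_lagrange:
  fixes u :: "real^'n \<Rightarrow> real"
  assumes m: "0 < m" and fe: "finite_energy u Du" and mu: "mass u = m"
    and lb: "\<And>(v :: real^'n \<Rightarrow> real) Dv. finite_energy v Dv \<Longrightarrow> mass v = m \<Longrightarrow> total_energy u Du \<le> total_energy v Dv"
  obtains \<mu> where "\<And>\<phi>. test_fun \<phi> \<Longrightarrow> integrable lborel (\<lambda>x. (1 + 2 * (u x)\<^sup>2) * (Du x \<bullet> grad \<phi> x)
                   + 2 * u x * (norm (Du x))\<^sup>2 * \<phi> x + \<mu> * u x * \<phi> x - g (u x) * \<phi> x)"
    "\<And>\<phi>. test_fun \<phi> \<Longrightarrow> (\<integral>x. (1 + 2 * (u x)\<^sup>2) * (Du x \<bullet> grad \<phi> x)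
                   + 2 * u x * (norm (Du x))\<^sup>2 * \<phi> x + \<mu> * u x * \<phi> x - g (u x) * \<phi> x \<partial>lborel) = 0"
proof -
  define \<mu> where "\<mu> = 2 * (2 / real CARD('n) * kinetic u Du - total_energy u Du) / m"
  define A where "A \<phi> x = (1 + 2 * (u x)\<^sup>2) * (Du x \<bullet> grad \<phi> x) + 2 * u x * (norm (Du x))\<^sup>2 * \<phi> x" for \<phi> x
  have i: "integrable lborel (A \<phi>)" "integrable lborel (\<lambda>x. u x * \<phi> x)" "integrable lborel (\<lambda>x. g (u x) * \<phi> x)" if "test_fun \<phi>" for \<phi>
    unfolding A_def using kinetic_add(1)[OF fe that] mass_add(2)[OF fe that] potential_add(1)[OF fe that] by auto
  have ge: "(\<integral>x. g (u x) * \<phi> x \<partial>lborel) \<le> (\<integral>x. A \<phi> x \<partial>lborel) + \<mu> * (\<integral>x. u x * \<phi> x \<partial>lborel)" if "test_fun \<phi>" for \<phi>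
    using first_variation_nonneg[OF m fe mu lb that] unfolding A_def \<mu>_def .
  have eq: "(\<integral>x. g (u x) * \<phi> x \<partial>lborel) = (\<integral>x. A \<phi> x \<partial>lborel) + \<mu> * (\<integral>x. u x * \<phi> x \<partial>lborel)" if tf: "test_fun \<phi>" for \<phi>
  proof (rule antisym[OF ge[OF tf]])
    have "A (\<lambda>x. - \<phi> x) x = - A \<phi> x" for x unfolding A_def by (simp add: test_fun_uminus(2)[OF tf] algebra_simps)
    then show "(\<integral>x. A \<phi> x \<partial>lborel) + \<mu> * (\<integral>x. u x * \<phi> x \<partial>lborel) \<le> (\<integral>x. g (u x) * \<phi> x \<partial>lborel)"
      using ge[OF test_fun_uminus(1)[OF tf]] by simp
  qed
  have F: "(1 + 2 * (u x)\<^sup>2) * (Du x \<bullet> grad \<phi> x) + 2 * u x * (norm (Du x))\<^sup>2 * \<phi> x + \<mu> * u x * \<phi> x - g (u x) * \<phi> x =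
    A \<phi> x + \<mu> * (u x * \<phi> x) - g (u x) * \<phi> x" for \<phi> x by (simp add: A_def)
  show ?thesis
  proof (rule that[of \<mu>], goal_cases)
    case (1 \<phi>)
    show ?case unfolding F using i[OF 1] by simp
  next
    case (2 \<phi>)
    show ?case unfolding F using i[OF 2] eq[OF 2] by simp
  qed
qed

end

section \<open>Negative energy and representatives\<close>

text \<open>The bumps approximate the indicator of the unit box, whose volume is 1; a function F
  with F 0 = 0 sees only the value F 1 in the limit.\<close>

lemma bump_integral_tendsto:
  obtains \<phi> :: "nat \<Rightarrow> real^'n \<Rightarrow> real" where "\<And>k. test_fun (\<phi> k)" "\<And>k x. 0 \<le> \<phi> k x" "\<And>k x. \<phi> k x \<le> 1"
    "\<And>F :: real \<Rightarrow> real. continuous_on UNIV F \<Longrightarrow> F 0 = 0 \<Longrightarrow> (\<lambda>k. \<integral>x. F (\<phi> k x) \<partial>lborel) \<longlonglongrightarrow> F 1"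
proof (rule ex_bump_seq[of "0 :: real^'n" One])
  fix \<phi> :: "nat \<Rightarrow> real^'n \<Rightarrow> real"
  assume tf: "\<And>k. test_fun (\<phi> k)" and p0: "\<And>k x. 0 \<le> \<phi> k x" and p1: "\<And>k x. \<phi> k x \<le> indicator (box 0 One) x"
    and lim: "\<And>x. (\<lambda>k. \<phi> k x) \<longlonglongrightarrow> indicator (box 0 One) x"
  have one: "\<phi> k x \<le> 1" for k x by (rule order_trans[OF p1]) (simp add: indicator_def)
  have e1: "emeasure lborel (box (0 :: real^'n) One) = 1" by (simp add: emeasure_lborel_box)
  have m1: "measure lborel (box (0 :: real^'n) One) = 1" using e1 by (simp add: measure_def)
  show thesis
  proof (rule that[OF tf p0 one])
    fix F :: "real \<Rightarrow> real" assume F: "continuous_on UNIV F" and F0: "F 0 = 0"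
    have [measurable]: "F \<in> borel_measurable borel" using F by (rule borel_measurable_continuous_onI)
    note [measurable] = test_fun_borel[OF tf]
    have "compact (F ` {0..1})" by (intro compact_continuous_image continuous_on_subset[OF F]) auto
    then obtain B where B: "B > 0" "\<And>y. y \<in> F ` {0..1} \<Longrightarrow> norm y \<le> B" using compact_imp_bounded bounded_pos by metis
    have "(\<lambda>k. \<integral>x. F (\<phi> k x) \<partial>lborel) \<longlonglongrightarrow> (\<integral>x. F (indicator (box (0 :: real^'n) One) x) \<partial>lborel)"
    proof (rule integral_dominated_convergence)
      show "integrable lborel (\<lambda>x. B * indicator (box (0 :: real^'n) One) x)" using e1 by simp
      show "AE x in lborel. (\<lambda>k. F (\<phi> k x)) \<longlonglongrightarrow> F (indicator (box 0 One) x)"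
        by (rule AE_I2, rule isCont_tendsto_compose[OF _ lim]) (use F in \<open>simp add: continuous_on_eq_continuous_at\<close>)
      show "AE x in lborel. norm (F (\<phi> k x)) \<le> B * indicator (box 0 One) x" for k
      proof (rule AE_I2)
        fix x
        show "norm (F (\<phi> k x)) \<le> B * indicator (box 0 One) x"
        proof (cases "x \<in> box 0 One")
          case True
          have "norm (F (\<phi> k x)) \<le> B" using p0[of k x] one[of k x] by (intro B) auto
          then show ?thesis using True by simp
        next
          case False
          then have "\<phi> k x = 0" using p0[of k x] p1[of k x] by simp
          then show ?thesis using F0 False by simp
        qed
      qed
    qed measurable
    also have "(\<integral>x. F (indicator (box (0 :: real^'n) One) x) \<partial>lborel) = (\<integral>x. F 1 * indicator (box (0 :: real^'n) One) x \<partial>lborel)"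
      by (intro Bochner_Integration.integral_cong) (auto simp: indicator_def F0)
    also have "\<dots> = F 1" using m1 by simp
    finally show "(\<lambda>k. \<integral>x. F (\<phi> k x) \<partial>lborel) \<longlonglongrightarrow> F 1" .
  qed
qed

context critical_nonlinearity
begin

text \<open>A bump of height near s0 on the unit box has positive potential. Dilation by t
  multiplies the potential by t^N but the kinetic energy only by t^(N - 2), so the energy is
  negative once t^2 exceeds their ratio X.\<close>

lemma negative_energy_large_mass:
  assumes s0: "G s0 > 0"
  shows "\<exists>m1\<ge>0. \<forall>m>m1. \<exists>(u :: real^'n \<Rightarrow> real) Du. finite_energy u Du \<and> mass u = m \<and> total_energy u Du < 0"
proof -
  obtain \<phi> :: "nat \<Rightarrow> real^'n \<Rightarrow> real" where tf: "\<And>k. test_fun (\<phi> k)"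
    and lim: "\<And>F :: real \<Rightarrow> real. continuous_on UNIV F \<Longrightarrow> F 0 = 0 \<Longrightarrow> (\<lambda>k. \<integral>x. F (\<phi> k x) \<partial>lborel) \<longlonglongrightarrow> F 1"
    using bump_integral_tendsto by metis
  have "continuous_on UNIV (\<lambda>s. G (s0 * s))" by (rule continuous_on_compose2[OF G_cont]) (auto intro!: continuous_intros)
  then have "(\<lambda>k. \<integral>x. G (s0 * \<phi> k x) \<partial>lborel) \<longlonglongrightarrow> G (s0 * 1)" by (rule lim) simp
  then have "\<forall>\<^sub>F k in sequentially. 0 < (\<integral>x. G (s0 * \<phi> k x) \<partial>lborel)" by (rule order_tendstoD) (use s0 in simp)
  then obtain k where k: "0 < (\<integral>x. G (s0 * \<phi> k x) \<partial>lborel)" unfolding eventually_sequentially by blast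
  define u where "u x = s0 * \<phi> k x" for x
  define Du where "Du x = s0 *\<^sub>R grad (\<phi> k) x" for x
  have fe: "finite_energy u Du" unfolding u_def Du_def by (rule finite_energy_test_fun[OF tf])
  have pot: "potential u > 0" using k by (simp add: potential_def u_def)
  have mp: "mass u > 0" using mass_eq_0_potential[OF fe] pot mass_nonneg[of u] by (cases "mass u = 0") auto
  define X where "X = kinetic u Du / potential u"
  have X: "X \<ge> 0" using pot kinetic_nonneg[of u Du] by (simp add: X_def)
  show ?thesis
  \<comment> \<open>This is the mass of the dilate by the factor X + 1. A larger mass corresponds to
    t > X + 1 \<ge> 1, hence t^2 \<ge> t > X.\<close>
  proof (intro exI[of _ "(X + 1) ^ CARD('n) * mass u"] conjI allI impI)
    show "(X + 1) ^ CARD('n) * mass u \<ge> 0" using X mp by simp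
    fix m assume m: "(X + 1) ^ CARD('n) * mass u < m"
    define t where "t = root CARD('n) (m / mass u)"
    have m0: "0 < m" by (rule le_less_trans[OF _ m]) (use X mp in simp)
    have tN: "t ^ CARD('n) = m / mass u" unfolding t_def using m0 mp by (simp add: real_root_pow_pos2)
    have t0: "0 \<le> t" unfolding t_def using m0 mp by (simp add: real_root_ge_zero)
    have "(X + 1) ^ CARD('n) < t ^ CARD('n)" unfolding tN using m mp by (simp add: less_divide_eq)
    then have t: "X + 1 < t" by (rule power_less_imp_less_base[OF _ t0])
    have tp: "t > 0" "1 \<le> t" using t X by auto
    have "X < t" using t by simp
    also have "t \<le> t\<^sup>2" using tp by (simp add: self_le_power)
    finally have "kinetic u Du < potential u * t\<^sup>2" using pot by (simp add: X_def divide_less_eq mult.commute)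
    then have neg: "kinetic u Du / t\<^sup>2 - potential u < 0" using tp by (simp add: divide_less_eq)
    show "\<exists>(u :: real^'n \<Rightarrow> real) Du. finite_energy u Du \<and> mass u = m \<and> total_energy u Du < 0"
    proof (rule exI, rule exI, intro conjI)
      show "finite_energy (\<lambda>x. u ((1/t) *\<^sub>R x)) (\<lambda>x. (1/t) *\<^sub>R Du ((1/t) *\<^sub>R x))" by (rule finite_energy_dilate(1)[OF fe tp(1)])
      show "mass (\<lambda>x. u ((1/t) *\<^sub>R x)) = m" unfolding finite_energy_dilate(2)[OF fe tp(1)] tN using mp by simp
      show "total_energy (\<lambda>x. u ((1/t) *\<^sub>R x)) (\<lambda>x. (1/t) *\<^sub>R Du ((1/t) *\<^sub>R x)) < 0"
        unfolding total_energy_dilate[OF fe tp(1)] using neg tp by (simp add: mult_pos_neg)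
    qed
  qed
qed

text \<open>The hypothesis with threshold C q says that g dominates the derivative of C s^q for
  small s > 0; the mean value theorem integrates this. Positive s are enough for nonnegative
  bumps.\<close>

lemma G_lower_near_0:
  assumes q: "q > 0" and lim: "filterlim (\<lambda>s. g s / (\<bar>s\<bar> powr (q - 2) * s)) at_top (at 0)"
  obtains d where "d > 0" "\<And>s. 0 \<le> s \<Longrightarrow> s \<le> d \<Longrightarrow> C * s powr q \<le> G s"
proof -
  have "\<forall>\<^sub>F s in at 0. C * q \<le> g s / (\<bar>s\<bar> powr (q - 2) * s)" using lim by (simp add: filterlim_at_top)
  then obtain d where d: "d > 0" "\<And>s. s \<noteq> 0 \<Longrightarrow> \<bar>s\<bar> < d \<Longrightarrow> C * q \<le> g s / (\<bar>s\<bar> powr (q - 2) * s)"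
    unfolding eventually_at by (auto simp: dist_real_def)
  have gl: "C * (q * s powr (q - 1)) \<le> g s" if s: "0 < s" "s < d" for s
  proof -
    have "s powr (q - 1) = s powr (q - 2) * s powr 1" by (simp only: powr_add[symmetric]) simp
    then have "\<bar>s\<bar> powr (q - 2) * s = s powr (q - 1)" using s by simp
    then show ?thesis using d(2)[of s] s by (simp add: le_divide_eq mult_ac)
  qed
  show ?thesis
  proof (rule that[of "d / 2"])
    fix s assume s: "0 \<le> s" "s \<le> d / 2"
    show "C * s powr q \<le> G s"
    proof (cases "s = 0")
      case False
      let ?H = "\<lambda>s. G s - C * s powr q"
      have dH: "(?H has_real_derivative g z - C * (q * z powr (q - 1))) (at z)" if "0 < z" for z
        by (rule DERIV_diff[OF G_deriv DERIV_cmult[OF has_real_derivative_powr[OF that]]])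
      have "\<exists>l z. 0 < z \<and> z < s \<and> DERIV ?H z :> l \<and> ?H s - ?H 0 = (s - 0) * l"
      proof (rule MVT)
        show "continuous_on {0..s} ?H" using q
          by (intro continuous_intros continuous_on_subset[OF G_cont] continuous_on_powr') auto
        show "?H differentiable at z" if "0 < z" for z using dH[OF that] by (auto simp: real_differentiable_def)
      qed (use s False in auto)
      then obtain l z where z: "0 < z" "z < s" "DERIV ?H z :> l" "?H s - ?H 0 = (s - 0) * l" by blast
      have "l = g z - C * (q * z powr (q - 1))" by (rule DERIV_unique[OF z(3) dH[OF z(1)]])
      then have "0 \<le> l" using gl[of z] z s d(1) by simp
      then have "0 \<le> (s - 0) * l" using s by simp
      then show ?thesis unfolding z(4)[symmetric] by simp
    qed simp
  qed (use d in simp)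
qed

text \<open>A profile u of mass m is flattened to r u and then dilated with t^N = 1 / r^2, which
  restores the mass. For q = 2 + 4/N both the kinetic term and the integral of (r u)^q scale like
  r^2 / t^2, so their ratio is independent of r. Superlinearity at 0 supplies an arbitrarily large
  coefficient in front of the latter and decides the sign.\<close>

lemma negative_energy_any_mass:
  fixes m :: real
  defines "q \<equiv> 2 + 4 / real CARD('n)"
  assumes lim: "filterlim (\<lambda>s. g s / (\<bar>s\<bar> powr (q - 2) * s)) at_top (at 0)" and m: "0 < m"
  shows "\<exists>(u :: real^'n \<Rightarrow> real) Du. finite_energy u Du \<and> mass u = m \<and> total_energy u Du < 0"
proof -
  let ?N = "real CARD('n)"
  have q: "q > 0" by (simp add: q_def add_pos_nonneg)
  obtain \<phi> :: "nat \<Rightarrow> real^'n \<Rightarrow> real" where tf: "\<And>k. test_fun (\<phi> k)" and p0: "\<And>k x. 0 \<le> \<phi> k x" and p1: "\<And>k x. \<phi> k x \<le> 1"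
    and F: "\<And>F :: real \<Rightarrow> real. continuous_on UNIV F \<Longrightarrow> F 0 = 0 \<Longrightarrow> (\<lambda>k. \<integral>x. F (\<phi> k x) \<partial>lborel) \<longlonglongrightarrow> F 1"
    using bump_integral_tendsto by metis
  have "(\<lambda>k. mass (\<phi> k)) \<longlonglongrightarrow> 1\<^sup>2" unfolding mass_def by (rule F[of "\<lambda>s. s\<^sup>2"]) (auto intro!: continuous_intros)
  then have "\<forall>\<^sub>F k in sequentially. 0 < mass (\<phi> k)" by (rule order_tendstoD) simp
  then obtain k where k: "0 < mass (\<phi> k)" unfolding eventually_sequentially by blast
  define a where "a = sqrt (m / mass (\<phi> k))"
  have a: "a > 0" using k m by (simp add: a_def)
  define u where "u x = a * \<phi> k x" for x
  define Du where "Du x = a *\<^sub>R grad (\<phi> k) x" for x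
  have mass_scale: "mass (\<lambda>x. c * v x) = c\<^sup>2 * mass v" for c and v :: "real^'n \<Rightarrow> real"
    unfolding mass_def by (simp add: power_mult_distrib)
  have mu: "mass u = m" unfolding u_def mass_scale using k m by (simp add: a_def)
  note [measurable] = test_fun_borel[OF tf]
  have um [measurable]: "u \<in> borel_measurable borel" unfolding u_def by measurable
  have u0: "0 \<le> u x" "u x \<le> a" for x using p0[of k x] p1[of k x] a by (auto simp: u_def mult_left_le)
  obtain R B where RB: "R > 0" "B > 0" "\<And>x. \<bar>\<phi> k x\<bar> \<le> B * indicator (cball 0 R) x" using test_fun_grad_bound[OF tf] by metis
  have iq: "integrable lborel (\<lambda>x. u x powr q)"
  proof (rule integrable_compact_bound[of _ "a powr q" R])
    fix x
    show "\<bar>u x powr q\<bar> \<le> a powr q * indicator (cball 0 R) x"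
    proof (cases "x \<in> cball 0 R")
      case True
      then show ?thesis using u0[of x] q by (simp add: powr_mono2)
    next
      case False
      then have "u x = 0" using RB(3)[of x] by (simp add: u_def)
      then show ?thesis by simp
    qed
  qed measurable
  define Z where "Z = (\<integral>x. u x powr q \<partial>lborel)"
  have Z: "Z > 0"
  proof (rule ccontr)
    assume "\<not> Z > 0"
    moreover have "Z \<ge> 0" unfolding Z_def by (intro integral_nonneg_AE) auto
    ultimately have "Z = 0" by simp
    then have "AE x in lborel. u x powr q = 0" unfolding Z_def by (subst (asm) integral_nonneg_eq_0_iff_AE[OF iq]) auto
    then have "AE x in lborel. (u x)\<^sup>2 = 0" by eventually_elim simp
    then have "mass u = (\<integral>x. 0 \<partial>(lborel :: (real^'n) measure))" unfolding mass_def by (intro integral_cong_AE) auto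
    then show False using mu m by simp
  qed
  define K where "K = kinetic u Du"
  have K: "K \<ge> 0" by (simp add: K_def kinetic_nonneg)
  \<comment> \<open>The coefficient in the lower bound of G near 0 that makes the potential exceed
    the kinetic term, at any amplitude where the bound is valid.\<close>
  define C where "C = (K + 1) / Z"
  have CZ: "C * Z = K + 1" using Z by (simp add: C_def)
  obtain d where d: "d > 0" "\<And>s. 0 \<le> s \<Longrightarrow> s \<le> d \<Longrightarrow> C * s powr q \<le> G s" using G_lower_near_0[OF q lim] by blast
  \<comment> \<open>The amplitude r a stays within the range \<open>d\<close> of the lower bound for
    G, and r \<le> 1 keeps the weight 1 + 2 w^2 below 1 + 2 u^2.\<close>
  define r where "r = min 1 (d / a)"
  have r: "0 < r" "r \<le> 1" using d a by (auto simp: r_def)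
  have rd: "r * a \<le> d" using a by (simp add: r_def min_mult_distrib_right min.coboundedI2)
  define w where "w x = (r * a) * \<phi> k x" for x
  define Dw where "Dw x = (r * a) *\<^sub>R grad (\<phi> k) x" for x
  have wu: "w x = r * u x" "Dw x = r *\<^sub>R Du x" for x by (auto simp: w_def Dw_def u_def Du_def)
  have few: "finite_energy w Dw" unfolding w_def Dw_def by (rule finite_energy_test_fun[OF tf])
  have feu: "finite_energy u Du" unfolding u_def Du_def by (rule finite_energy_test_fun[OF tf])
  have kw: "kinetic w Dw \<le> r\<^sup>2 * K"
  proof -
    have "(\<integral>x. (1 + 2 * (w x)\<^sup>2) * (norm (Dw x))\<^sup>2 \<partial>lborel) \<le> (\<integral>x. r\<^sup>2 * ((1 + 2 * (u x)\<^sup>2) * (norm (Du x))\<^sup>2) \<partial>lborel)"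
    proof (rule integral_mono[OF finite_energyD(7)[OF few]])
      show "integrable lborel (\<lambda>x. r\<^sup>2 * ((1 + 2 * (u x)\<^sup>2) * (norm (Du x))\<^sup>2))" using finite_energyD(7)[OF feu] by simp
      fix x
      have "(w x)\<^sup>2 \<le> (u x)\<^sup>2" unfolding wu using r u0[of x] by (intro power_mono) (auto simp: mult_left_le_one_le)
      then have "(1 + 2 * (w x)\<^sup>2) * (norm (Dw x))\<^sup>2 \<le> (1 + 2 * (u x)\<^sup>2) * (norm (Dw x))\<^sup>2" by (intro mult_right_mono) auto
      moreover have "(norm (Dw x))\<^sup>2 = r\<^sup>2 * (norm (Du x))\<^sup>2" unfolding wu by (simp add: power_mult_distrib)
      then have "(1 + 2 * (u x)\<^sup>2) * (norm (Dw x))\<^sup>2 = r\<^sup>2 * ((1 + 2 * (u x)\<^sup>2) * (norm (Du x))\<^sup>2)" by (simp only: mult.left_commute)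
      ultimately show "(1 + 2 * (w x)\<^sup>2) * (norm (Dw x))\<^sup>2 \<le> r\<^sup>2 * ((1 + 2 * (u x)\<^sup>2) * (norm (Du x))\<^sup>2)" by (rule ord_le_eq_trans)
    qed
    then show ?thesis unfolding K_def kinetic_def by simp
  qed
  define t where "t = r powr (- 2 / ?N)"
  have t: "t > 0" using r by (simp add: t_def)
  have tN: "t ^ CARD('n) = 1 / r\<^sup>2"
  proof -
    have "t ^ CARD('n) = t powr ?N" using t by (simp add: powr_realpow)
    also have "\<dots> = r powr (- 2)" unfolding t_def by (simp add: powr_powr)
    also have "\<dots> = 1 / r\<^sup>2" using r by (simp add: powr_minus_divide)
    finally show ?thesis .
  qed
  \<comment> \<open>The point where q = 2 + 4/N enters: t^2 = r^(-4/N), so r^q is exactly r^2 /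
    t^2.\<close>
  have rq: "r powr q = r\<^sup>2 / t\<^sup>2"
  proof -
    have "t\<^sup>2 = t powr 2" using t by simp
    also have "\<dots> = r powr (- (4 / ?N))" unfolding t_def by (simp add: powr_powr)
    finally have "t\<^sup>2 = 1 / r powr (4 / ?N)" by (simp only: powr_minus_divide)
    then show ?thesis using r by (simp add: q_def powr_add)
  qed
  have pw: "r\<^sup>2 / t\<^sup>2 * (K + 1) \<le> potential w"
  proof -
    have "r\<^sup>2 / t\<^sup>2 * (K + 1) = C * r powr q * Z" unfolding rq CZ[symmetric] by simp
    also have "\<dots> = (\<integral>x. C * r powr q * u x powr q \<partial>lborel)" unfolding Z_def by simp
    also have "\<dots> \<le> potential w" unfolding potential_def
    proof (rule integral_mono[OF _ G_integrable[OF few]])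
      show "integrable lborel (\<lambda>x. C * r powr q * u x powr q)" using iq by simp
      fix x
      have ra: "r * u x \<le> r * a" using u0[of x] r by (intro mult_left_mono) auto
      have "C * (r * u x) powr q \<le> G (r * u x)" using order_trans[OF ra rd] u0[of x] r by (intro d) auto
      then show "C * r powr q * u x powr q \<le> G (w x)" using u0[of x] r by (simp add: wu powr_mult mult.assoc)
    qed
    finally show ?thesis .
  qed
  have neg: "kinetic w Dw / t\<^sup>2 - potential w < 0"
  proof -
    have "kinetic w Dw / t\<^sup>2 \<le> r\<^sup>2 * K / t\<^sup>2" using kw by (intro divide_right_mono) auto
    also have "\<dots> < r\<^sup>2 / t\<^sup>2 * (K + 1)" using r t by (simp add: divide_simps)
    finally show ?thesis using pw by linarith
  qed
  show ?thesis
  proof (rule exI, rule exI, intro conjI)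
    show "finite_energy (\<lambda>x. w ((1/t) *\<^sub>R x)) (\<lambda>x. (1/t) *\<^sub>R Dw ((1/t) *\<^sub>R x))" by (rule finite_energy_dilate(1)[OF few t])
    have "mass w = r\<^sup>2 * m" using mass_scale[of r u] mu by (simp add: wu(1)[abs_def])
    then show "mass (\<lambda>x. w ((1/t) *\<^sub>R x)) = m" unfolding finite_energy_dilate(2)[OF few t] tN using r by simp
    show "total_energy (\<lambda>x. w ((1/t) *\<^sub>R x)) (\<lambda>x. (1/t) *\<^sub>R Dw ((1/t) *\<^sub>R x)) < 0"
      unfolding total_energy_dilate[OF few t] using neg t by (simp add: mult_pos_neg)
  qed
qed

end

section \<open>Passage between Lebesgue measurable functions and Borel representatives\<close>

lemma lebesgue_lborel_transfer:
  fixes f f' :: "'a::euclidean_space \<Rightarrow> real"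
  assumes f: "f \<in> borel_measurable lebesgue" and f': "f' \<in> borel_measurable borel" and ae: "AE x in lborel. f x = f' x"
  shows "integrable lebesgue f \<longleftrightarrow> integrable lborel f'" "integral\<^sup>L lebesgue f = integral\<^sup>L lborel f'"
proof -
  have m: "f' \<in> borel_measurable lborel" using f' by simp
  have l: "f' \<in> borel_measurable lebesgue" by (rule measurable_completion[OF m])
  show "integrable lebesgue f \<longleftrightarrow> integrable lborel f'"
    using integrable_cong_AE[OF f l AE_completion[OF ae]] integrable_completion[OF m] by simp
  show "integral\<^sup>L lebesgue f = integral\<^sup>L lborel f'"
    using integral_cong_AE[OF f l AE_completion[OF ae]] integral_completion[OF m] by simp
qed

lemma lebesgue_lborel_borel:
  fixes f :: "'a::euclidean_space \<Rightarrow> real"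
  assumes f: "f \<in> borel_measurable borel"
  shows "integrable lebesgue f \<longleftrightarrow> integrable lborel f" "integral\<^sup>L lebesgue f = integral\<^sup>L lborel f"
  using f by (intro lebesgue_lborel_transfer measurable_completion AE_I2; simp)+

lemma finite_energy_Sm:
  assumes fe: "finite_energy u Du" shows "(u, Du) \<in> Sm (mass u)"
proof -
  note [measurable] = finite_energyD(1,2)[OF fe]
  have m: "u \<in> borel_measurable lebesgue" "Du \<in> borel_measurable lebesgue"
    by (rule measurable_completion, simp)+
  have w: "integral\<^sup>L lebesgue (\<lambda>x. u x * pderiv_i \<phi> i x) = - integral\<^sup>L lebesgue (\<lambda>x. Du x $ i * \<phi> x)" if t: "test_fun \<phi>" for \<phi> i
  proof -
    note [measurable] = test_fun_borel[OF t] test_fun_borel[OF test_fun_pderiv[OF t]]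
    have "(\<integral>x. u x * pderiv_i \<phi> i x \<partial>lborel) = - (\<integral>x. Du x $ i * \<phi> x \<partial>lborel)"
      using finite_energyD(3)[OF fe] t unfolding weak_grad_def by blast
    then show ?thesis by (subst (1 2) lebesgue_lborel_borel(2)) measurable
  qed
  show ?thesis unfolding Sm_def H1_weak_def
    using m w finite_energyD(4,5,6)[OF fe] by (simp add: lebesgue_lborel_borel mass_def)
qed

context critical_nonlinearity
begin

lemma energy_eq_total_energy:
  assumes fe: "finite_energy (u :: real^'n \<Rightarrow> real) Du" shows "energy g u Du = total_energy u Du"
proof -
  note [measurable] = finite_energyD(1,2)[OF fe]
  show ?thesis unfolding energy_def total_energy_def kinetic_def potential_def G_def[symmetric]
    by (simp add: lebesgue_lborel_borel(2))
qed

text \<open>Minimality has to be tested against every Lebesgue measurable pair in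
  \<open>Sm m\<close>. Such a pair agrees almost everywhere with a Borel pair, the gradient being
  replaced coordinate by coordinate, and all integrals involved are unchanged.\<close>

lemma Sm_representative:
  assumes S: "(w :: real^'n \<Rightarrow> real, Dw) \<in> Sm m"
  obtains u :: "real^'n \<Rightarrow> real" and Du where "finite_energy u Du" "mass u = m" "total_energy u Du = energy g w Dw"
proof -
  have w: "w \<in> borel_measurable lebesgue" "integrable lebesgue (\<lambda>x. (w x)\<^sup>2)" "Dw \<in> borel_measurable lebesgue"
    "integrable lebesgue (\<lambda>x. (norm (Dw x))\<^sup>2)" "integrable lebesgue (\<lambda>x. (w x)\<^sup>2 * (norm (Dw x))\<^sup>2)"
    "integral\<^sup>L lebesgue (\<lambda>x. (w x)\<^sup>2) = m"
    and wg: "\<And>\<phi> i. test_fun \<phi> \<Longrightarrow> integral\<^sup>L lebesgue (\<lambda>x. w x * pderiv_i \<phi> i x) = - integral\<^sup>L lebesgue (\<lambda>x. Dw x $ i * \<phi> x)"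
    using S by (auto simp: Sm_def H1_weak_def)
  note [measurable] = w(1,3)
  obtain u where um': "u \<in> borel_measurable lborel" and uw: "AE x in lborel. w x = u x"
    using completion_ex_borel_measurable_real[OF w(1)] by blast
  have um [measurable]: "u \<in> borel_measurable borel" using um' by simp
  have "\<exists>D'\<in>borel_measurable lborel. AE x in lborel. Dw x $ i = D' x" for i
    by (rule completion_ex_borel_measurable_real) measurable
  then obtain D' where D': "\<And>i. D' i \<in> borel_measurable lborel" "\<And>i. AE x in lborel. Dw x $ i = D' i x" by metis
  define Du where "Du x = (\<chi> i. D' i x)" for x
  have Dm [measurable]: "Du \<in> borel_measurable borel"
    unfolding borel_measurable_euclidean_space[of Du] using D'(1) by (auto simp: Basis_vec_def inner_axis Du_def)
  have "AE x in lborel. \<forall>i. Dw x $ i = D' i x" unfolding AE_all_countable by (rule allI) (rule D'(2))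
  then have Dae: "AE x in lborel. Dw x = Du x" by eventually_elim (simp add: Du_def vec_eq_iff)
  have ae: "AE x in lborel. w x = u x \<and> Dw x = Du x" using uw Dae by eventually_elim simp
  have T: "integrable lebesgue f \<longleftrightarrow> integrable lborel f'" "integral\<^sup>L lebesgue f = integral\<^sup>L lborel f'"
    if "f \<in> borel_measurable lebesgue" "f' \<in> borel_measurable borel" "\<And>x. w x = u x \<Longrightarrow> Dw x = Du x \<Longrightarrow> f x = f' x" for f f' :: "real^'n \<Rightarrow> real"
  proof -
    have "AE x in lborel. f x = f' x" using ae by eventually_elim (use that(3) in blast)
    from lebesgue_lborel_transfer[OF that(1,2) this]
    show "integrable lebesgue f \<longleftrightarrow> integrable lborel f'" "integral\<^sup>L lebesgue f = integral\<^sup>L lborel f'" by blast+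
  qed
  have c: "integrable lborel (\<lambda>x. (u x)\<^sup>2)" "integrable lborel (\<lambda>x. (norm (Du x))\<^sup>2)" "integrable lborel (\<lambda>x. (u x)\<^sup>2 * (norm (Du x))\<^sup>2)"
    using T(1)[of "\<lambda>x. (w x)\<^sup>2" "\<lambda>x. (u x)\<^sup>2"] T(1)[of "\<lambda>x. (norm (Dw x))\<^sup>2" "\<lambda>x. (norm (Du x))\<^sup>2"]
      T(1)[of "\<lambda>x. (w x)\<^sup>2 * (norm (Dw x))\<^sup>2" "\<lambda>x. (u x)\<^sup>2 * (norm (Du x))\<^sup>2"] w by simp_all
  have wgu: "weak_grad u Du" unfolding weak_grad_def
  proof (intro allI impI)
    fix \<phi> :: "real^'n \<Rightarrow> real" and i assume t: "test_fun \<phi>"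
    have b [measurable]: "\<phi> \<in> borel_measurable borel" "pderiv_i \<phi> i \<in> borel_measurable borel"
      using test_fun_borel[OF t] test_fun_borel[OF test_fun_pderiv[OF t]] by auto
    have [measurable]: "\<phi> \<in> borel_measurable lebesgue" "pderiv_i \<phi> i \<in> borel_measurable lebesgue"
      by (rule measurable_completion, simp)+
    show "(\<integral>x. u x * pderiv_i \<phi> i x \<partial>lborel) = - (\<integral>x. Du x $ i * \<phi> x \<partial>lborel)"
      using wg[OF t, of i] T(2)[of "\<lambda>x. w x * pderiv_i \<phi> i x" "\<lambda>x. u x * pderiv_i \<phi> i x"]
        T(2)[of "\<lambda>x. Dw x $ i * \<phi> x" "\<lambda>x. Du x $ i * \<phi> x"] by simp
  qed
  have fe: "finite_energy u Du" using c wgu um Dm by (simp add: finite_energy_def)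
  have mu: "mass u = m" unfolding mass_def w(6)[symmetric] by (rule T(2)[symmetric]; (measurable | simp))
  have "integral\<^sup>L lebesgue (\<lambda>x. (1 + 2 * (w x)\<^sup>2) * (norm (Dw x))\<^sup>2) = (\<integral>x. (1 + 2 * (u x)\<^sup>2) * (norm (Du x))\<^sup>2 \<partial>lborel)"
    by (rule T(2); (measurable | simp))
  moreover have "integral\<^sup>L lebesgue (\<lambda>x. G (w x)) = potential u"
    unfolding potential_def by (rule T(2); (measurable | simp))
  ultimately have "total_energy u Du = energy g w Dw"
    unfolding energy_def total_energy_def kinetic_def G_def[symmetric] by simp
  then show ?thesis using that fe mu by blast
qed

text \<open>Minimality over all of \<open>Sm m\<close> includes minimality among those members that
  solve the equation; the Euler-Lagrange equation places the minimiser itself among them.\<close>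

lemma ground_state_exists:
  assumes m: "0 < m" and neg: "\<exists>(u :: real^'n \<Rightarrow> real) Du. finite_energy u Du \<and> mass u = m \<and> total_energy u Du < 0"
  shows "\<exists>(u :: real^'n \<Rightarrow> real) Du. ground_state g m u Du"
proof -
  obtain u :: "real^'n \<Rightarrow> real" and Du where fe: "finite_energy u Du" and mu: "mass u = m"
    and lb: "\<forall>(v :: real^'n \<Rightarrow> real) Dv. finite_energy v Dv \<and> mass v = m \<longrightarrow> total_energy u Du \<le> total_energy v Dv"
    using minimiser_exists[OF m neg] by (elim exE conjE)
  note [measurable] = finite_energyD(1,2)[OF fe]
  have lb': "total_energy u Du \<le> total_energy v Dv" if "finite_energy v Dv" "mass v = m" for v :: "real^'n \<Rightarrow> real" and Dv
    by (rule lb[THEN spec, THEN spec, THEN mp, OF conjI[OF that]])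
  obtain \<mu> where EL: "\<And>\<phi>. test_fun \<phi> \<Longrightarrow> integrable lborel (\<lambda>x. (1 + 2 * (u x)\<^sup>2) * (Du x \<bullet> grad \<phi> x)
                   + 2 * u x * (norm (Du x))\<^sup>2 * \<phi> x + \<mu> * u x * \<phi> x - g (u x) * \<phi> x)"
    "\<And>\<phi>. test_fun \<phi> \<Longrightarrow> (\<integral>x. (1 + 2 * (u x)\<^sup>2) * (Du x \<bullet> grad \<phi> x)
                   + 2 * u x * (norm (Du x))\<^sup>2 * \<phi> x + \<mu> * u x * \<phi> x - g (u x) * \<phi> x \<partial>lborel) = 0"
  proof (rule euler_lagrange[OF m fe mu lb'])
    fix \<mu> assume *: "\<And>\<phi>. test_fun \<phi> \<Longrightarrow> integrable lborel (\<lambda>x. (1 + 2 * (u x)\<^sup>2) * (Du x \<bullet> grad \<phi> x)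
                   + 2 * u x * (norm (Du x))\<^sup>2 * \<phi> x + \<mu> * u x * \<phi> x - g (u x) * \<phi> x)"
      "\<And>\<phi>. test_fun \<phi> \<Longrightarrow> (\<integral>x. (1 + 2 * (u x)\<^sup>2) * (Du x \<bullet> grad \<phi> x)
                   + 2 * u x * (norm (Du x))\<^sup>2 * \<phi> x + \<mu> * u x * \<phi> x - g (u x) * \<phi> x \<partial>lborel) = 0"
    show ?thesis by (rule that[OF *])
  qed
  have S: "(u, Du) \<in> Sm m" using finite_energy_Sm[OF fe] mu by simp
  have "weak_sol g \<mu> u Du" unfolding weak_sol_def Let_def grad_def[symmetric]
  proof (intro allI impI)
    fix \<phi> :: "real^'n \<Rightarrow> real" assume t: "test_fun \<phi>"
    note [measurable] = test_fun_borel[OF t] grad_borel[OF test_fun_smooth[OF t]]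
    have b: "(\<lambda>x. (1 + 2 * (u x)\<^sup>2) * (Du x \<bullet> grad \<phi> x)
                   + 2 * u x * (norm (Du x))\<^sup>2 * \<phi> x + \<mu> * u x * \<phi> x - g (u x) * \<phi> x) \<in> borel_measurable borel" by measurable
    show "integrable lebesgue (\<lambda>x. (1 + 2 * (u x)\<^sup>2) * (Du x \<bullet> grad \<phi> x)
                   + 2 * u x * (norm (Du x))\<^sup>2 * \<phi> x + \<mu> * u x * \<phi> x - g (u x) * \<phi> x) \<and>
      integral\<^sup>L lebesgue (\<lambda>x. (1 + 2 * (u x)\<^sup>2) * (Du x \<bullet> grad \<phi> x)
                   + 2 * u x * (norm (Du x))\<^sup>2 * \<phi> x + \<mu> * u x * \<phi> x - g (u x) * \<phi> x) = 0"
      unfolding lebesgue_lborel_borel[OF b] by (rule conjI[OF EL(1)[OF t] EL(2)[OF t]])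
  qed
  then have sol: "solves_P g \<mu> m u Du" using S by (simp add: solves_P_def)
  have "energy g u Du \<le> energy g w Dw" if wS: "(w, Dw) \<in> Sm m" for w :: "real^'n \<Rightarrow> real" and Dw
  proof (rule Sm_representative[OF wS])
    fix v :: "real^'n \<Rightarrow> real" and Dv
    assume v: "finite_energy v Dv" "mass v = m" "total_energy v Dv = energy g w Dw"
    show ?thesis using lb'[OF v(1,2)] v(3) energy_eq_total_energy[OF fe] by simp
  qed
  then show ?thesis using S sol unfolding ground_state_def by blast
qed

end

theorem theorem1p4:
  fixes g :: "real \<Rightarrow> real"
  defines "N \<equiv> real CARD('n::finite)"
  defines "p \<equiv> 4 + 4 / N"
  defines "q \<equiv> 2 + 4 / N"
  assumes N2: "CARD('n) \<ge> 2"
    and g1: "continuous_on UNIV g"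
    and g2: "((\<lambda>s. g s / s) \<longlongrightarrow> 0) (at 0)"
    and g3: "((\<lambda>s. \<bar>g s\<bar> / \<bar>s\<bar> powr (p - 1)) \<longlongrightarrow> 0) at_infinity"
    and g4: "\<exists>s0>0. prim g s0 > 0"
  shows "(\<exists>m1\<ge>0. \<forall>m>m1. \<exists>(u :: real^'n \<Rightarrow> real) Du. ground_state g m u Du)
       \<and> (filterlim (\<lambda>s. g s / (\<bar>s\<bar> powr (q - 2) * s)) at_top (at 0) \<longrightarrow>
            (\<forall>m>0. \<exists>(u :: real^'n \<Rightarrow> real) Du. ground_state g m u Du))"
proof -
  interpret critical_nonlinearity g p "TYPE('n)"
    by unfold_locales (use g1 g2 g3 in \<open>simp_all add: p_def N_def\<close>)
  obtain s0 where "G s0 > 0" using g4 by (auto simp: G_def)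
  from negative_energy_large_mass[OF this] obtain m1 where m1: "m1 \<ge> 0"
    "\<forall>m>m1. \<exists>(u :: real^'n \<Rightarrow> real) Du. finite_energy u Du \<and> mass u = m \<and> total_energy u Du < 0" by (elim exE conjE)
  have "\<exists>(u :: real^'n \<Rightarrow> real) Du. ground_state g m u Du" if "m > m1" for m
    by (rule ground_state_exists[OF le_less_trans[OF m1(1) that] m1(2)[rule_format, OF that]])
  moreover have "\<exists>(u :: real^'n \<Rightarrow> real) Du. ground_state g m u Du"
    if "filterlim (\<lambda>s. g s / (\<bar>s\<bar> powr (q - 2) * s)) at_top (at 0)" "m > 0" for m
    by (rule ground_state_exists[OF that(2) negative_energy_any_mass[OF that(1)[unfolded q_def N_def] that(2)]])
  ultimately show ?thesis using m1(1) by blast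
qed

end
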